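(* Let $\ell\ge0$ and let $(X_i)_{i\ge1}$ be an $\mathbb{R}^d$-valued Markov chain with (arbitrary) initial law $\nu_1\in\mathcal{P}(\mathbb{R}^d)$ and transition kernel $P$ on $(\mathbb{R}^d,\mathcal{B}(\mathbb{R}^d))$. Set $\mu_N:=\frac1N\sum_{i=1}^N\delta_{X_i}$. Assume: (L1) there exist a measurable $V:\mathbb{R}^d\to\mathbb{R}_+$, $K\in\mathbb{R}_+$ and $\gamma\in(0,1)$ such that $PV(x)\le\gamma V(x)+K$ for all $x\in\mathbb{R}^d$; (L2') there exist $R>\frac{4K}{(1-\sqrt\gamma)^2}$ and $\rho\in(0,1]$ such that for all $x,y\in\mathbb{R}^d$ with $V(x)+V(y)\le R$, $\left(P(x,\cdot)\wedge P(y,\cdot)\right)(\mathbb{R}^d)\ge\rho$; (L3) $C_\ell:=\sup_{x\in\mathbb{R}^d}\frac{|x|^\ell}{1+V(x)}<\infty$. Let $\mu$ be the unique invariant probability measure of $P$ (which belongs to $\mathcal{P}_\ell(\mathbb{R}^d)$), and let $U:\mathcal{P}_\ell(\mathbb{R}^d)\to\mathbb{R}$. Assume there exists $r>0$ such that, with $B(\mu,r)$ the ball centered at $\mu$ with radius $r$ for the metric $W_\ell$: (a) $U$ admits a linear functional derivative $\frac{\delta U}{\delta m}(\tilde\mu,\cdot)$ at every $\tilde\mu\in B(\mu,r)$; (b) there is $C<\infty$ such that $\left|\frac{\delta U}{\delta m}(\tilde\mu,x)\right|\le C(1+|x|^{\ell/2})$ for all $(\tilde\mu,x)\in B(\mu,r)\times\mathbb{R}^d$;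 (c) $\sup_{x\in\mathbb{R}^d}\frac{\left|\frac{\delta U}{\delta m}(\tilde\mu,x)-\frac{\delta U}{\delta m}(\mu,x)\right|}{1+|x|^{\ell/2}}\to 0$ when $W_\ell(\tilde\mu,\mu)\to 0$; (d) there are $\alpha\in(\frac12,1]$ and $C<\infty$ such that for all $\mu_1,\mu_2\in B(\mu,r)$, $$\sup_{x\in\mathbb{R}^d}\frac{\left|\frac{\delta U}{\delta m}(\mu_2,x)-\frac{\delta U}{\delta m}(\mu_1,x)\right|}{1+|x|^{\ell/2}}\le C\left(\int_{\mathbb{R}^d}(1+|y|^{\frac{\ell}{2\alpha}})\,|\mu_2-\mu_1|(dy)\right)^\alpha.$$ Then, as $N\to\infty$, $$\sqrt N\left(U(\mu_N)-U(\mu)\right)\ \overset{d}{\Longrightarrow}\ \mathcal{N}\left(0,\ \mu\left(F^2(\mu,\cdot)\right)-\mu\left((PF)^2(\mu,\cdot)\right)\right),$$ where $F(\mu,\cdot)$ denotes the solution, unique up to an additive constant, of the Poisson equation $$F(\mu,x)-PF(\mu,x)=\frac{\delta U}{\delta m}(\mu,x)-\int_{\mathbb{R}^d}\frac{\delta U}{\delta m}(\mu,y)\mu(dy),\qquad x\in\mathbb{R}^d,$$ that is, up to an additive constant, $F(\mu,\cdot)=\sum_{n\in\mathbb{N}}\left(P^n\frac{\delta U}{\delta m}(\mu,\cdot)-\mu\left(\frac{\delta U}{\delta m}(\mu,\cdot)\right)\right)$.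
   Context: For $\ell\ge0$, $\mathcal{P}_\ell(\mathbb{R}^d)$ is the set of Borel probability measures $m$ on $\mathbb{R}^d$ with $\int|x|^\ell m(dx)<\infty$. The convention $|x|^0=1$ is used. For a signed measure $\tau$, $|\tau|$ is its total variation measure. For $\ell>0$, $W_\ell(\mu_1,\mu_2)=\inf_\rho\left(\int|x-y|^\ell\rho(dx,dy)\right)^{1/(\ell\vee1)}$, and for $\ell=0$, $W_0(\mu_1,\mu_2)=\inf_\rho\int(1\wedge|x-y|)\rho(dx,dy)$, the infima being over all couplings $\rho$ of $\mu_1$ and $\mu_2$. Linear functional derivative: $U:\mathcal{P}_\ell(\mathbb{R}^d)\to\mathbb{R}$ admits a linear functional derivative at $m\in\mathcal{P}_\ell(\mathbb{R}^d)$ if there is a measurable function $y\mapsto\frac{\delta U}{\delta m}(m,y)$ with $\sup_y\frac{|\frac{\delta U}{\delta m}(m,y)|}{1+|y|^\ell}<\infty$ such that for all $\nu\in\mathcal{P}_\ell(\mathbb{R}^d)$, $\frac{d}{d\epsilon}\big|_{\epsilon=0^+}U(m+\epsilon(\nu-m))=\int_{\mathbb{R}^d}\frac{\delta U}{\delta m}(m,y)(\nu-m)(dy)$. The hypotheses refer to a fixed choice of such functions $\frac{\delta U}{\delta m}(m,\cdot)$, $m\in B(\mu,r)$. Notation: $Pf(x)=\int f(y)P(x,dy)$, $P^n$ is the $n$-th iterate of $P$ ($P^0f=f$), $\mu(f)=\int f\,d\mu$, $PF(\mu,x)=\int F(\mu,y)P(x,dy)$, and $P(x,\cdot)\wedge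 P(y,\cdot)$ is the minimum (greatest lower bound) of the two measures. Known facts: under (L1) and (L2'), $P$ has a unique invariant probability measure $\mu$, and $\mu(V)\le\frac{K}{1-\gamma}$. If $f$ is measurable with $\sup_x\frac{f(x)^2}{1+V(x)}<\infty$, the series $\sum_{n\in\mathbb{N}}(P^nf-\mu(f))$ converges for the norm $\|\phi\|_{\sqrt V,1}=\sup_x\frac{|\phi(x)|}{1+\sqrt{V(x)}}$ and its sum $F$ solves the Poisson equation $F-PF=f-\mu(f)$; this applies to $f=\frac{\delta U}{\delta m}(\mu,\cdot)$ under the hypotheses. A Gaussian law with variance $0$ is understood as a Dirac mass.
   Formalization: The functional U is additionally assumed to be Borel measurable on P_ℓ(R^d) (for the σ-algebra generated by m ↦ m(A)); conditions (a)–(d) do not imply this, and without it U(μ_N) need not be a random variable, so its law is undefined. *)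

theory Defs
  imports "HOL-Probability.Probability"
begin

text \<open>The function $|x|^p$ with the convention $|x|^0 = 1$ also at \<open>x = 0\<close>; note that
  \<open>0 powr 0 = 0\<close> in HOL.\<close>

definition npow :: "real \<Rightarrow> 'a::euclidean_space \<Rightarrow> real" where
  "npow p x = (if p = 0 then 1 else norm x powr p)"

definition Pspace :: "real \<Rightarrow> 'a::euclidean_space measure set" where
  "Pspace l = {m \<in> space (prob_algebra borel). (\<integral>\<^sup>+x. ennreal (npow l x) \<partial>m) < \<infinity>}"

definition couplings ::
    "'a::euclidean_space measure \<Rightarrow> 'a measure \<Rightarrow> ('a \<times> 'a) measure set" where
  "couplings m1 m2 = {c \<in> space (prob_algebra (borel \<Otimes>\<^sub>M borel)).
     distr c borel fst = m1 \<and> distr c borel snd = m2}"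

text \<open>Only used for arguments in \<open>Pspace l\<close>; there the set of couplings is nonempty and all
  the integrals below are finite, so that Bochner integrals and a real infimum suffice.\<close>

definition Wdist :: "real \<Rightarrow> 'a::euclidean_space measure \<Rightarrow> 'a measure \<Rightarrow> real" where
  "Wdist l m1 m2 =
     (if l = 0 then INF c\<in>couplings m1 m2. \<integral>p. min 1 (norm (fst p - snd p)) \<partial>c
      else INF c\<in>couplings m1 m2.
             (\<integral>p. norm (fst p - snd p) powr l \<partial>c) powr (1 / max l 1))"

definition Wball :: "real \<Rightarrow> 'a::euclidean_space measure \<Rightarrow> real \<Rightarrow> 'a measure set" where
  "Wball l m r = {m' \<in> Pspace l. Wdist l m' m < r}"

text \<open>The measure $m + \epsilon(\nu - m)$, for \<open>0 \<le> e \<le> 1\<close>.\<close>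

definition mixture ::
    "real \<Rightarrow> 'a::euclidean_space measure \<Rightarrow> 'a measure \<Rightarrow> 'a measure" where
  "mixture e m nu = measure_of UNIV (sets borel)
     (\<lambda>A. ennreal (1 - e) * emeasure m A + ennreal e * emeasure nu A)"

definition has_lin_fun_deriv ::
    "real \<Rightarrow> ('a::euclidean_space measure \<Rightarrow> real) \<Rightarrow> 'a measure \<Rightarrow> ('a \<Rightarrow> real) \<Rightarrow> bool" where
  "has_lin_fun_deriv l U m g \<longleftrightarrow>
     g \<in> borel_measurable borel \<and>
     bdd_above (range (\<lambda>y. \<bar>g y\<bar> / (1 + npow l y))) \<and>
     (\<forall>nu\<in>Pspace l.
        ((\<lambda>e. U (mixture e m nu)) has_real_derivative
           (\<integral>y. g y \<partial>nu) - (\<integral>y. g y \<partial>m)) (at_right 0))"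

text \<open>The total variation measure $|m_2 - m_1|$ of the difference of two finite measures:
  the supremum of $\sum_i |(m_2 - m_1)(B_i)|$ over finite measurable partitions $(B_i)$.\<close>

definition tv_diff :: "'a::euclidean_space measure \<Rightarrow> 'a measure \<Rightarrow> 'a measure" where
  "tv_diff m2 m1 = measure_of UNIV (sets borel)
     (\<lambda>A. SUP \<B>\<in>{\<B>. finite \<B> \<and> disjoint \<B> \<and> \<B> \<subseteq> sets borel \<and> \<Union>\<B> = A}.
            \<Sum>B\<in>\<B>. ennreal \<bar>measure m2 B - measure m1 B\<bar>)"

definition markov_chain ::
    "'w measure \<Rightarrow> (nat \<Rightarrow> 'w \<Rightarrow> 'a::euclidean_space) \<Rightarrow> 'a measure \<Rightarrow> ('a \<Rightarrow> 'a measure) \<Rightarrow> bool"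
  where
  "markov_chain M X nu P \<longleftrightarrow>
     prob_space M \<and>
     (\<forall>i\<ge>1. X i \<in> borel_measurable M) \<and>
     distr M borel (X 1) = nu \<and>
     (\<forall>n\<ge>1. \<forall>A\<in>sets borel. AE \<omega> in M.
        real_cond_exp M
          (sigma (space M) (\<Union>i\<in>{1..n}. {X i -` B \<inter> space M |B. B \<in> sets borel}))
          (\<lambda>\<omega>. indicator A (X (Suc n) \<omega>)) \<omega>
        = measure (P (X n \<omega>)) A)"

text \<open>The empirical measure $\frac1N\sum_{i=1}^N\delta_{x_i}$.\<close>

definition empirical :: "nat \<Rightarrow> (nat \<Rightarrow> 'a::euclidean_space) \<Rightarrow> 'a measure" where
  "empirical N x = distr (uniform_count_measure {1..N}) borel x"

definition kernel_op :: "('a \<Rightarrow> 'a measure) \<Rightarrow> ('a \<Rightarrow> real) \<Rightarrow> 'a \<Rightarrow> real" where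
  "kernel_op P f x = (\<integral>y. f y \<partial>P x)"

text \<open>$\sup_x |f(x)| / (1 + \sqrt{V(x)})$, taken in \<open>ennreal\<close> so that it is \<open>\<infinity>\<close> (not a junk value) for
  unbounded quotients.\<close>

definition sqrtV_norm :: "('a \<Rightarrow> real) \<Rightarrow> ('a \<Rightarrow> real) \<Rightarrow> ennreal" where
  "sqrtV_norm V f = (SUP x. ennreal (\<bar>f x\<bar> / (1 + sqrt (V x))))"

definition poisson_solution ::
    "('a::euclidean_space \<Rightarrow> 'a measure) \<Rightarrow> ('a \<Rightarrow> real) \<Rightarrow> 'a measure \<Rightarrow> ('a \<Rightarrow> real) \<Rightarrow> ('a \<Rightarrow> real)
      \<Rightarrow> bool" where
  "poisson_solution P V mu f F \<longleftrightarrow>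
     F \<in> borel_measurable borel \<and> sqrtV_norm V F < \<infinity> \<and>
     (\<forall>x. F x - kernel_op P F x = f x - (\<integral>y. f y \<partial>mu))"

definition poisson_series_sums ::
    "('a \<Rightarrow> 'a measure) \<Rightarrow> ('a \<Rightarrow> real) \<Rightarrow> 'a measure \<Rightarrow> ('a \<Rightarrow> real) \<Rightarrow> ('a \<Rightarrow> real) \<Rightarrow> bool" where
  "poisson_series_sums P V mu f G \<longleftrightarrow>
     (\<lambda>n. sqrtV_norm V (\<lambda>x. (\<Sum>k<n. (kernel_op P ^^ k) f x - (\<integral>y. f y \<partial>mu)) - G x))
       \<longlonglongrightarrow> 0"

text \<open>The centred Gaussian law with variance \<open>v \<ge> 0\<close>; \<open>normal_density\<close> takes the standard
  deviation.\<close>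

definition centred_normal :: "real \<Rightarrow> real measure" where
  "centred_normal v =
     (if v = 0 then return borel 0 else density lborel (normal_density 0 (sqrt v)))"

end

theory Submission
  imports Defs "HOL-Real_Asymp.Real_Asymp"
begin

text \<open>Let \<open>\<mu>\<^sup>i\<close> be the mixture in which the fraction \<open>i / N\<close> of \<open>\<mu>\<close> has been replaced by the first \<open>i\<close> sample
  points, so that \<open>U (\<mu>\<^sub>N) - U (\<mu>)\<close> telescopes. By the mean value theorem along segments and the Hoelder
  condition, the \<open>i\<close>-th increment is \<open>1 / N\<close> times the derivative at \<open>\<mu>\<^sup>i\<close>, centred and evaluated at
  \<open>X\<^sub>i\<close>, up to \<open>O (N powr (- 1 - \<alpha>))\<close>, which is negligible because \<open>\<alpha> > 1 / 2\<close>. With the derivative frozen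
  at \<open>\<mu>\<close>, the Poisson equation turns the sum into a martingale, whose characteristic function is computed by
  a telescoping argument; the conditional variances average out by a second Poisson equation. The difference between the
  derivatives at \<open>\<mu>\<^sup>i\<close> and at \<open>\<mu>\<close> is a predictable function, small in the weighted norm while all
  \<open>\<mu>\<^sup>i\<close> stay near \<open>\<mu>\<close>; its Poisson solution gives a martingale with small variance and a
  boundary sum that is again controlled by the Hoelder condition. All \<open>\<mu>\<^sup>i\<close> stay near
  \<open>\<mu>\<close> with high probability, because a Wasserstein neighbourhood of \<open>\<mu>\<close> contains one defined by finitely many
  integrals, to which the ergodic theorem applies. Finally, an arbitrary initial law is reduced to one with
  integrable \<open>V\<close> by conditioning on \<open>V (X\<^sub>1) \<le> a\<close>. Geometric ergodicity is proved with the weighted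
  oscillation seminorm of Hairer and Mattingly, for the weights \<open>V\<close> and \<open>sqrt V\<close>.\<close>

section \<open>Kernels with a drift condition\<close>

text \<open>The two weights are forced by the growth hypotheses. The derivative grows like the power
  l / 2, hence like \<open>sqrt V\<close>, so its Poisson solution must be controlled at weight
  \<open>sqrt V\<close>; squares and conditional variances then live at weight \<open>V\<close>, the
  scale whose moments along the chain are bounded. The drift survives the square root by Jensen's
  inequality, and the threshold for R in (L2') is the one that this second drift condition demands.
  As only first moments of \<open>V\<close> are available, Taylor remainders are truncated with a
  minimum instead of being bounded by third moments. A second obstacle is that the functions in the
  remainder are random: the derivative is taken at a measure built from the past. They must be
  jointly measurable and known one step ahead, so each martingale increment uses the measure that
  already contains the current point, at the price of changing the Poisson solution at every step.
  Nearness to \<open>mu\<close> is therefore described by finitely many integrals: such sets are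
  convex, which keeps the mean value segments inside, and visibly adapted.\<close>

locale markov_kernel =
  fixes P :: "'a::euclidean_space \<Rightarrow> 'a measure"
  assumes kernel [measurable]: "P \<in> borel \<rightarrow>\<^sub>M prob_algebra borel"
begin

lemma kernel_subprob [measurable]: "P \<in> borel \<rightarrow>\<^sub>M subprob_algebra borel"
  by (rule measurable_prob_algebraD) (rule kernel)

lemma prob_space_kernel: "prob_space (P x)"
  and sets_kernel [simp, measurable_cong]: "sets (P x) = sets borel"
  using measurable_space[OF kernel, of x] by (auto simp: space_prob_algebra)

lemma space_kernel [simp]: "space (P x) = UNIV"
  using sets_eq_imp_space_eq[OF sets_kernel, of x] by simp

lemma kernel_UNIV [simp]: "measure (P x) UNIV = 1" "emeasure (P x) UNIV = 1"
  using prob_space.prob_space[OF prob_space_kernel] prob_space.emeasure_space_1[OF prob_space_kernel]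
  by simp_all

lemma kernel_op_measurable [measurable]:
  "f \<in> borel_measurable borel \<Longrightarrow> kernel_op P f \<in> borel_measurable borel"
  unfolding kernel_op_def[abs_def]
  by (rule measurable_compose[OF kernel_subprob integral_measurable_subprob_algebra])

text \<open>The parameter is stored in the space: the image of \<open>P (h x)\<close> under
  \<open>y \<mapsto> (x, y)\<close> depends measurably on x as a subprobability measure, and against
  it the integrand is one fixed function on the product.\<close>

lemma integral_kernel_measurable2:
  fixes f :: "'b \<Rightarrow> 'a \<Rightarrow> real"
  assumes f [measurable]: "(\<lambda>(x, y). f x y) \<in> borel_measurable (N \<Otimes>\<^sub>M borel)"
    and h [measurable]: "h \<in> N \<rightarrow>\<^sub>M borel"
  shows "(\<lambda>x. \<integral>y. f x y \<partial>P (h x)) \<in> borel_measurable N"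
proof -
  note measurable_distr2[measurable]
  have "(\<lambda>x. integral\<^sup>L (distr (P (h x)) (N \<Otimes>\<^sub>M borel) (\<lambda>y. (x, y))) (\<lambda>(x, y). f x y))
      \<in> borel_measurable N"
    by measurable
  moreover have "integral\<^sup>L (distr (P (h x)) (N \<Otimes>\<^sub>M borel) (\<lambda>y. (x, y))) (\<lambda>(x, y). f x y)
      = (\<integral>y. f x y \<partial>P (h x))" if "x \<in> space N" for x
    using that by (subst integral_distr) auto
  ultimately show ?thesis
    by (simp cong: measurable_cong)
qed

end

section \<open>Drift condition and integrability under the invariant measure\<close>

locale drift_kernel = markov_kernel P for P :: "'a::euclidean_space \<Rightarrow> 'a measure" +
  fixes W :: "'a \<Rightarrow> real" and K \<gamma> R \<rho> :: real and mu :: "'a measure"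
  assumes W_measurable [measurable]: "W \<in> borel_measurable borel"
    and W_nonneg: "0 \<le> W x"
    and K_nonneg: "0 \<le> K"
    and gamma: "0 < \<gamma>" "\<gamma> < 1"
    and drift: "(\<integral>\<^sup>+y. ennreal (W y) \<partial>P x) \<le> ennreal (\<gamma> * W x + K)"
    and R: "2 * K / (1 - \<gamma>) < R"
    and rho: "0 < \<rho>" "\<rho> \<le> 1"
    and minorization: "W x + W y \<le> R \<Longrightarrow> ennreal \<rho> \<le> emeasure (inf (P x) (P y)) UNIV"
    and mu: "mu \<in> space (prob_algebra borel)" "bind mu P = mu"
begin

lemma prob_space_mu: "prob_space mu" and sets_mu [simp, measurable_cong]: "sets mu = sets borel"
  using mu(1) by (auto simp: space_prob_algebra)

lemma space_mu [simp]: "space mu = UNIV"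
  using sets_eq_imp_space_eq[OF sets_mu] by simp

lemma mu_UNIV [simp]: "measure mu UNIV = 1" "emeasure mu UNIV = 1"
  using prob_space.prob_space[OF prob_space_mu] prob_space.emeasure_space_1[OF prob_space_mu]
  by simp_all

text \<open>The weighted supremum norm with weight \<open>1 + W\<close> is at most c. The constant
  is an argument because later estimates must be linear in it: a small difference of derivatives has
  to give a proportionally small Poisson solution.\<close>

definition wbdd :: "real \<Rightarrow> ('a \<Rightarrow> real) \<Rightarrow> bool" where
  "wbdd c f \<longleftrightarrow> f \<in> borel_measurable borel \<and> (\<forall>x. \<bar>f x\<bar> \<le> c * (1 + W x))"

lemma wbdd_measurable: "wbdd c f \<Longrightarrow> f \<in> borel_measurable borel"
  by (simp add: wbdd_def)

lemma wbdd_bound: "wbdd c f \<Longrightarrow> \<bar>f x\<bar> \<le> c * (1 + W x)"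
  by (simp add: wbdd_def)

lemma wbdd_nonneg:
  assumes "wbdd c f" shows "0 \<le> c"
proof -
  have "0 \<le> c * (1 + W 0)"
    using assms abs_ge_zero[of "f 0"] unfolding wbdd_def by (meson order_trans)
  then show ?thesis
    using W_nonneg[of 0] by (simp add: zero_le_mult_iff)
qed

lemma wbdd_add: "wbdd c f \<Longrightarrow> wbdd c' g \<Longrightarrow> wbdd (c + c') (\<lambda>x. f x + g x)"
  unfolding wbdd_def by (auto simp: distrib_right intro!: order_trans[OF abs_triangle_ineq] add_mono)

lemma wbdd_diff: "wbdd c f \<Longrightarrow> wbdd c' g \<Longrightarrow> wbdd (c + c') (\<lambda>x. f x - g x)"
  unfolding wbdd_def by (auto simp: distrib_right intro!: order_trans[OF abs_triangle_ineq4] add_mono)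

lemma wbdd_const: "wbdd \<bar>a\<bar> (\<lambda>_. a)"
  using W_nonneg by (auto simp: wbdd_def mult_le_cancel_left1)

lemma W_integrable: "integrable (P x) W"
  and W_integral_le: "(\<integral>y. W y \<partial>P x) \<le> \<gamma> * W x + K"
proof -
  have nn: "0 \<le> \<gamma> * W x + K"
    using W_nonneg[of x] K_nonneg gamma by simp
  show 1: "integrable (P x) W"
    using drift[of x] W_nonneg
    by (intro integrableI_bounded) (auto simp: le_less_trans[OF _ ennreal_less_top])
  show "(\<integral>y. W y \<partial>P x) \<le> \<gamma> * W x + K"
    using drift[of x] nn by (intro integral_real_bounded) auto
qed

lemma wbdd_integrable:
  assumes "wbdd c f" shows "integrable (P x) f"
proof -
  interpret prob_space "P x" by (rule prob_space_kernel)
  show ?thesis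
    by (rule Bochner_Integration.integrable_bound[where f="\<lambda>y. c * (1 + W y)"])
       (use assms W_nonneg W_integrable in
         \<open>auto simp: wbdd_def intro!: AE_I2 intro: order_trans[OF _ abs_ge_self]\<close>)
qed

lemma kernel_op_abs_le:
  assumes f: "f \<in> borel_measurable borel" and bd: "\<And>y. \<bar>f y\<bar> \<le> a + b * W y" and b: "0 \<le> b"
  shows "\<bar>kernel_op P f x\<bar> \<le> a + b * (\<gamma> * W x + K)"
proof -
  interpret prob_space "P x" by (rule prob_space_kernel)
  have int: "integrable (P x) (\<lambda>y. a + b * W y)"
    using W_integrable by simp
  have "integrable (P x) f"
    by (rule Bochner_Integration.integrable_bound[OF int])
       (use f in \<open>auto intro!: AE_I2 order_trans[OF bd abs_ge_self]\<close>)
  then have "\<bar>kernel_op P f x\<bar> \<le> (\<integral>y. a + b * W y \<partial>P x)"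
    unfolding kernel_op_def using int bd by (intro integral_abs_bound_integral) auto
  also have "\<dots> = a + b * (\<integral>y. W y \<partial>P x)"
    using W_integrable by simp
  also have "\<dots> \<le> a + b * (\<gamma> * W x + K)"
    using W_integral_le b by (intro add_left_mono mult_left_mono)
  finally show ?thesis .
qed

lemma wbdd_kernel_op:
  assumes "wbdd c f" shows "wbdd (c * (1 + K)) (kernel_op P f)"
proof -
  have c: "0 \<le> c" using assms by (rule wbdd_nonneg)
  have "\<bar>kernel_op P f x\<bar> \<le> c * (1 + K) * (1 + W x)" for x
  proof -
    have "\<bar>kernel_op P f x\<bar> \<le> c + c * (\<gamma> * W x + K)"
      using assms c by (intro kernel_op_abs_le) (auto simp: wbdd_def algebra_simps)
    also have "\<dots> \<le> c + c * (1 * W x + K) + c * (K * W x)"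
      using c W_nonneg[of x] gamma K_nonneg
      by (intro add_increasing2 add_left_mono mult_left_mono add_mono mult_right_mono) auto
    finally show ?thesis by (simp add: algebra_simps)
  qed
  then show ?thesis using assms by (simp add: wbdd_def kernel_op_measurable)
qed

text \<open>Each use of the drift inequality multiplies the coefficient of W by \<gamma> and adds
  one term of a geometric series, so the bound is uniform in n.\<close>

lemma iter_abs_le:
  assumes "wbdd c f"
  shows "(kernel_op P ^^ n) f \<in> borel_measurable borel"
    "\<bar>(kernel_op P ^^ n) f x\<bar> \<le> c * (1 + K / (1 - \<gamma>)) + c * \<gamma> ^ n * W x"
proof -
  have c: "0 \<le> c" using assms by (rule wbdd_nonneg)
  have *: "(kernel_op P ^^ n) f \<in> borel_measurable borel \<and>
    (\<forall>x. \<bar>(kernel_op P ^^ n) f x\<bar> \<le> c * (1 + K * (\<Sum>k<n. \<gamma> ^ k)) + c * \<gamma> ^ n * W x)"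
  proof (induction n)
    case 0 then show ?case using assms by (simp add: wbdd_def algebra_simps)
  next
    case (Suc n)
    have "\<bar>kernel_op P ((kernel_op P ^^ n) f) x\<bar> \<le> 
      c * (1 + K * (\<Sum>k<n. \<gamma> ^ k)) + c * \<gamma> ^ n * (\<gamma> * W x + K)" for x
      using Suc c gamma by (intro kernel_op_abs_le) auto
    with Suc show ?case by (simp add: algebra_simps kernel_op_measurable)
  qed
  have "(\<Sum>k<n. \<gamma> ^ k) = (1 - \<gamma> ^ n) / (1 - \<gamma>)"
    using gamma by (simp add: sum_gp_strict)
  also have "\<dots> \<le> 1 / (1 - \<gamma>)"
    using gamma by (intro divide_right_mono) auto
  finally have "K * (\<Sum>k<n. \<gamma> ^ k) \<le> K * (1 / (1 - \<gamma>))"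
    using K_nonneg by (rule mult_left_mono)
  then have "c * (1 + K * (\<Sum>k<n. \<gamma> ^ k)) \<le> c * (1 + K / (1 - \<gamma>))"
    using c by (intro mult_left_mono add_left_mono) auto
  then show "(kernel_op P ^^ n) f \<in> borel_measurable borel"
    "\<bar>(kernel_op P ^^ n) f x\<bar> \<le> c * (1 + K / (1 - \<gamma>)) + c * \<gamma> ^ n * W x"
    using * by (auto intro: order_trans)
qed

lemma wbdd_iter:
  assumes "wbdd c f" shows "wbdd (c * (1 + K / (1 - \<gamma>))) ((kernel_op P ^^ n) f)"
proof -
  have c: "0 \<le> c" using assms by (rule wbdd_nonneg)
  have "c * \<gamma> ^ n * W x \<le> c * (1 + K / (1 - \<gamma>)) * W x" for x
    using c W_nonneg[of x] gamma K_nonneg power_le_one[of \<gamma> n]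
    by (intro mult_right_mono mult_left_mono) (auto simp: add_increasing2)
  then have "\<bar>(kernel_op P ^^ n) f x\<bar> \<le> c * (1 + K / (1 - \<gamma>)) + c * (1 + K / (1 - \<gamma>)) * W x" for x
    using iter_abs_le(2)[OF assms, of n x] by (smt (verit, best))
  then show ?thesis
    using iter_abs_le(1)[OF assms] by (auto simp: wbdd_def distrib_left)
qed

lemma nn_integral_mu_kernel:
  assumes [measurable]: "f \<in> borel_measurable borel"
  shows "(\<integral>\<^sup>+x. (\<integral>\<^sup>+y. f y \<partial>P x) \<partial>mu) = (\<integral>\<^sup>+x. f x \<partial>mu)"
proof -
  have "(\<integral>\<^sup>+x. f x \<partial>bind mu P) = (\<integral>\<^sup>+x. (\<integral>\<^sup>+y. f y \<partial>P x) \<partial>mu)"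
    using assms by (intro nn_integral_bind[where B=borel]) auto
  then show ?thesis using mu(2) by simp
qed

text \<open>Integrability of W under \<open>mu\<close> is not yet known, so W is truncated at n. By
  invariance the integral does not change when the truncated function is replaced by its k-th
  iterate, and the drift bounds that iterate by \<open>min n (\<gamma> ^ k * W x + s k)\<close>;
  letting k tend to infinity removes W.\<close>

lemma nn_integral_mu_W_min_le:
  fixes n :: real
  assumes n: "0 \<le> n"
  shows "(\<integral>\<^sup>+x. ennreal (min (W x) n) \<partial>mu) \<le> ennreal (K / (1 - \<gamma>))"
proof -
  interpret mu: prob_space mu by (rule prob_space_mu)
  define T :: "('a \<Rightarrow> ennreal) \<Rightarrow> 'a \<Rightarrow> ennreal" where "T f x = (\<integral>\<^sup>+y. f y \<partial>P x)" for f x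
  define f where "f x = ennreal (min (W x) n)" for x
  define k0 where "k0 = K / (1 - \<gamma>)"
  define s where "s k = K * (\<Sum>j<k. \<gamma> ^ j)" for k :: nat
  have s: "0 \<le> s k" "s k \<le> k0" "s (Suc k) = \<gamma> ^ k * K + s k" for k
  proof -
    have "(\<Sum>k<k. \<gamma> ^ k) = (1 - \<gamma> ^ k) / (1 - \<gamma>)"
      using gamma by (simp add: sum_gp_strict)
    also have "\<dots> \<le> 1 / (1 - \<gamma>)"
      using gamma by (intro divide_right_mono) auto
    finally have "s k \<le> K * (1 / (1 - \<gamma>))"
      unfolding s_def using K_nonneg by (rule mult_left_mono)
    then show "s k \<le> k0" by (simp add: k0_def)
    show "0 \<le> s k"
      unfolding s_def using gamma K_nonneg by (intro mult_nonneg_nonneg sum_nonneg) auto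
    show "s (Suc k) = \<gamma> ^ k * K + s k"
      by (simp add: s_def algebra_simps)
  qed
  have iter: "(T ^^ k) f \<in> borel_measurable borel \<and> integral\<^sup>N mu ((T ^^ k) f) = integral\<^sup>N mu f \<and>
     (\<forall>x. (T ^^ k) f x \<le> ennreal (min n (\<gamma> ^ k * W x + s k)))" for k
  proof (induction k)
    case 0
    show ?case using n s by (auto simp: f_def s_def intro!: ennreal_leI)
  next
    case (Suc k)
    then have [measurable]: "(T ^^ k) f \<in> borel_measurable borel" by simp
    have "T ((T ^^ k) f) x \<le> ennreal (min n (\<gamma> ^ Suc k * W x + s (Suc k)))" for x
    proof -
      interpret prob_space "P x" by (rule prob_space_kernel)
      have "T ((T ^^ k) f) x \<le> (\<integral>\<^sup>+y. ennreal n \<partial>P x)"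
        unfolding T_def[of "(T ^^ k) f"] using Suc
          by (intro nn_integral_mono) (meson ennreal_leI min.cobounded1 order_trans)
      also have "\<dots> = ennreal n" by simp
      finally have 1: "T ((T ^^ k) f) x \<le> ennreal n" .
      have "T ((T ^^ k) f) x \<le> (\<integral>\<^sup>+y. ennreal (\<gamma> ^ k) * ennreal (W y) + ennreal (s k) \<partial>P x)"
        unfolding T_def[of "(T ^^ k) f"]
      proof (intro nn_integral_mono)
        fix y
        have "(T ^^ k) f y \<le> ennreal (\<gamma> ^ k * W y + s k)"
          using Suc by (meson ennreal_leI min.cobounded2 order_trans)
        then show "(T ^^ k) f y \<le> ennreal (\<gamma> ^ k) * ennreal (W y) + ennreal (s k)"
          using gamma W_nonneg s by (simp add: ennreal_mult)
      qed
      also have "\<dots> = ennreal (\<gamma> ^ k) * (\<integral>\<^sup>+y. ennreal (W y) \<partial>P x) + ennreal (s k)"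
        by (simp add: nn_integral_add nn_integral_cmult)
      also have "\<dots> \<le> ennreal (\<gamma> ^ k) * ennreal (\<gamma> * W x + K) + ennreal (s k)"
        by (intro add_mono mult_left_mono drift) auto
      also have "\<dots> = ennreal (\<gamma> ^ k * (\<gamma> * W x + K) + s k)"
        using gamma W_nonneg s K_nonneg by (simp add: ennreal_mult)
      finally have 2: "T ((T ^^ k) f) x \<le> ennreal (\<gamma> ^ k * (\<gamma> * W x + K) + s k)" .
      show ?thesis
        using 1 2 unfolding s(3) by (simp add: algebra_simps min_def)
    qed
    moreover have "integral\<^sup>N mu (T ((T ^^ k) f)) = integral\<^sup>N mu ((T ^^ k) f)"
      unfolding T_def[of "(T ^^ k) f"] using Suc by (intro nn_integral_mu_kernel) simp
    moreover have "T ((T ^^ k) f) \<in> borel_measurable borel"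
      unfolding T_def[of "(T ^^ k) f", abs_def] by measurable
    ultimately show ?case using Suc by simp
  qed
  have le: "(\<integral>\<^sup>+x. ennreal (min (W x) n) \<partial>mu) \<le> ennreal ((\<integral>x. min n (\<gamma> ^ k * W x) \<partial>mu) + k0)" for k
  proof -
    have int: "integrable mu (\<lambda>x. min n (\<gamma> ^ k * W x))"
      using n W_nonneg gamma by (intro mu.integrable_const_bound[where B=n]) auto
    have "integral\<^sup>N mu f \<le> (\<integral>\<^sup>+x. ennreal (min n (\<gamma> ^ k * W x) + k0) \<partial>mu)"
    proof (subst iter[THEN conjunct2, THEN conjunct1, of k, symmetric], intro nn_integral_mono)
      fix x
      have "min n (\<gamma> ^ k * W x + s k) \<le> min n (\<gamma> ^ k * W x) + k0"
        using s(1,2)[of k] by (auto simp: min_def)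
      then show "(T ^^ k) f x \<le> ennreal (min n (\<gamma> ^ k * W x) + k0)"
        using iter[of k] by (meson ennreal_leI order_trans)
    qed
    also have "\<dots> = ennreal (\<integral>x. min n (\<gamma> ^ k * W x) + k0 \<partial>mu)"
      using int n W_nonneg gamma K_nonneg by (intro nn_integral_eq_integral) (auto simp: k0_def)
    also have "\<dots> = ennreal ((\<integral>x. min n (\<gamma> ^ k * W x) \<partial>mu) + k0)"
      using int by simp
    finally show ?thesis by (simp add: f_def[abs_def])
  qed
  have "(\<lambda>k. \<integral>x. min n (\<gamma> ^ k * W x) \<partial>mu) \<longlonglongrightarrow> (\<integral>x. 0 \<partial>mu)"
  proof (rule integral_dominated_convergence[where w="\<lambda>_. n" and f="\<lambda>_. 0"
      and s="\<lambda>k x. min n (\<gamma> ^ k * W x)"])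
    have "(\<lambda>k. \<gamma> ^ k) \<longlonglongrightarrow> 0"
      using gamma by (intro LIMSEQ_realpow_zero) auto
    then have "(\<lambda>k. min n (\<gamma> ^ k * W x)) \<longlonglongrightarrow> min n (0 * W x)" for x
      by (intro tendsto_min tendsto_mult tendsto_const)
    then show "AE x in mu. (\<lambda>k. min n (\<gamma> ^ k * W x)) \<longlonglongrightarrow> 0"
      using n by (intro AE_I2) simp
    show "AE x in mu. norm (min n (\<gamma> ^ k * W x)) \<le> n" for k
      using n W_nonneg gamma by (intro AE_I2) (simp add: abs_le_iff min_def)
  qed auto
  then have "(\<lambda>k. ennreal ((\<integral>x. min n (\<gamma> ^ k * W x) \<partial>mu) + k0)) \<longlonglongrightarrow> ennreal (0 + k0)"
    by (intro tendsto_ennrealI tendsto_intros) simp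
  then show ?thesis
    using le by (intro LIMSEQ_le_const[where a="\<integral>\<^sup>+x. ennreal (min (W x) n) \<partial>mu"]) (auto simp: k0_def)
qed

lemma W_integrable_mu: "integrable mu W"
proof -
  have "(\<integral>\<^sup>+x. ennreal (W x) \<partial>mu) = (\<integral>\<^sup>+x. (SUP n. ennreal (min (W x) (real n))) \<partial>mu)"
  proof (intro nn_integral_cong)
    fix x
    obtain n where n: "W x \<le> real n" using real_arch_simple by blast
    show "ennreal (W x) = (SUP n. ennreal (min (W x) (real n)))"
      using n by (intro antisym SUP_least ennreal_leI SUP_upper2[of n]) auto
  qed
  also have "\<dots> = (SUP n. \<integral>\<^sup>+x. ennreal (min (W x) (real n)) \<partial>mu)"
    by (intro nn_integral_monotone_convergence_SUP)
       (auto simp: incseq_def le_fun_def intro!: ennreal_leI)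
  also have "\<dots> \<le> ennreal (K / (1 - \<gamma>))"
    by (intro SUP_least nn_integral_mu_W_min_le) auto
  finally show ?thesis
    using W_nonneg by (intro integrableI_bounded) (auto simp: le_less_trans[OF _ ennreal_less_top])
qed

lemma wbdd_integrable_mu:
  assumes "wbdd c f" shows "integrable mu f"
proof -
  interpret prob_space mu by (rule prob_space_mu)
  show ?thesis
    by (rule Bochner_Integration.integrable_bound[where f="\<lambda>y. c * (1 + W y)"])
       (use assms W_nonneg W_integrable_mu in
         \<open>auto simp: wbdd_def intro!: AE_I2 intro: order_trans[OF _ abs_ge_self]\<close>)
qed

lemma integral_mu_kernel_op:
  assumes "wbdd c f" shows "(\<integral>x. kernel_op P f x \<partial>mu) = (\<integral>x. f x \<partial>mu)"
proof -
  have *: "(\<integral>x. kernel_op P f x \<partial>mu) = (\<integral>x. f x \<partial>mu)" if f: "wbdd c f" "\<And>x. 0 \<le> f x" for f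
  proof -
    have [measurable]: "f \<in> borel_measurable borel" using f by (simp add: wbdd_def)
    have "ennreal (\<integral>x. kernel_op P f x \<partial>mu) = (\<integral>\<^sup>+x. ennreal (kernel_op P f x) \<partial>mu)"
      using f by (intro nn_integral_eq_integral[symmetric] wbdd_integrable_mu[OF wbdd_kernel_op])
        (auto simp: kernel_op_def)
    also have "\<dots> = (\<integral>\<^sup>+x. (\<integral>\<^sup>+y. ennreal (f y) \<partial>P x) \<partial>mu)"
      unfolding kernel_op_def using f wbdd_integrable[OF f(1)]
      by (intro nn_integral_cong nn_integral_eq_integral[symmetric]) auto
    also have "\<dots> = (\<integral>\<^sup>+x. ennreal (f x) \<partial>mu)"
      by (rule nn_integral_mu_kernel) simp
    also have "\<dots> = ennreal (\<integral>x. f x \<partial>mu)"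
      using f by (intro nn_integral_eq_integral wbdd_integrable_mu) auto
    finally show ?thesis using f by (simp add: kernel_op_def)
  qed
  have pos: "wbdd c (\<lambda>x. max 0 (f x))" "wbdd c (\<lambda>x. max 0 (- f x))"
    using assms W_nonneg wbdd_nonneg[OF assms] by (auto simp: wbdd_def max_def abs_le_iff)
  have eq: "f = (\<lambda>x. max 0 (f x) - max 0 (- f x))" by (auto simp: max_def)
  have "(\<integral>x. kernel_op P f x \<partial>mu) =
      (\<integral>x. kernel_op P (\<lambda>x. max 0 (f x)) x - kernel_op P (\<lambda>x. max 0 (- f x)) x \<partial>mu)"
    using pos[THEN wbdd_integrable] by (simp add: kernel_op_def flip: Bochner_Integration.integral_diff eq)
  also have "\<dots> = (\<integral>x. max 0 (f x) \<partial>mu) - (\<integral>x. max 0 (- f x) \<partial>mu)"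
    using pos[THEN wbdd_kernel_op, THEN wbdd_integrable_mu] *[OF pos(1)] *[OF pos(2)] by simp
  also have "\<dots> = (\<integral>x. max 0 (f x) - max 0 (- f x) \<partial>mu)"
    using pos[THEN wbdd_integrable_mu] by simp
  finally show ?thesis by (simp flip: eq)
qed

lemma integral_mu_iter:
  assumes "wbdd c f" shows "(\<integral>x. (kernel_op P ^^ n) f x \<partial>mu) = (\<integral>x. f x \<partial>mu)"
proof (induction n)
  case (Suc n)
  then show ?case using integral_mu_kernel_op[OF wbdd_iter[OF assms, of n]] by simp
qed simp

end

section \<open>Geometric ergodicity and the Poisson equation\<close>

lemma (in markov_kernel) integrable_const_kernel [simp]: "integrable (P x) (\<lambda>_. a :: real)"
  by (rule finite_measure.integrable_const[OF prob_space.finite_measure[OF prob_space_kernel]])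

lemma kernel_op_diff:
  "integrable (P x) f \<Longrightarrow> integrable (P x) g \<Longrightarrow>
    kernel_op P (\<lambda>y. f y - g y) x = kernel_op P f x - kernel_op P g x"
  by (simp add: kernel_op_def)

context drift_kernel
begin

lemma integrable_const_mu [simp]: "integrable mu (\<lambda>_. a :: real)"
  by (rule finite_measure.integrable_const[OF prob_space.finite_measure[OF prob_space_mu]])

text \<open>The lattice order on measures compares spaces first, then sigma-algebras, and only then
  values. The null measure on \<open>borel\<close> lies below both kernels, hence below their
  infimum, and this forces the infimum to carry the Borel sigma-algebra.\<close>

lemma inf_kernel:
  shows "sets (inf (P x) (P y)) = sets borel"
    and "nn_integral (inf (P x) (P y)) f \<le> nn_integral (P x) f"
    and "nn_integral (inf (P x) (P y)) f \<le> nn_integral (P y) f"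
proof -
  let ?I = "inf (P x) (P y)"
  have null: "null_measure borel \<le> P z" for z
    by (subst le_measure) auto
  then have 1: "null_measure borel \<le> ?I" by simp
  have 2: "?I \<le> P x" "?I \<le> P y" by simp_all
  have sp: "space ?I = UNIV"
    using 1 by (auto simp: le_measure_iff split: if_splits)
  show *: "sets ?I = sets borel"
    using 1 2(1) sp by (auto simp: le_measure_iff split: if_splits)
  show "nn_integral ?I f \<le> nn_integral (P x) f" "nn_integral ?I f \<le> nn_integral (P y) f"
    using * 2 by (intro nn_integral_mono_measure; simp)+
qed

text \<open>Both \<open>w - \<phi>\<close> and \<open>w + \<phi>\<close> are nonnegative, and they
  add up to at least \<open>2 * a\<close>. Restricting the first integral under \<open>P x\<close>
  and the second under \<open>P y\<close> to the common part of the two kernels, of mass at least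
  \<rho>, leaves at least \<open>2 * (\<rho> * a)\<close>; this is the gain over the trivial
  bound.\<close>

lemma integral_diff_le_of_minorization:
  assumes \<phi>: "wbdd c \<phi>" and w: "wbdd c' w" and le: "\<And>z. \<bar>\<phi> z\<bar> \<le> w z" "\<And>z. a \<le> w z"
    and small: "W x + W y \<le> R" and a: "0 \<le> a"
  shows "kernel_op P \<phi> x - kernel_op P \<phi> y \<le> kernel_op P w x + kernel_op P w y - 2 * (\<rho> * a)"
proof -
  let ?I = "inf (P x) (P y)"
  have [measurable]: "\<phi> \<in> borel_measurable borel" "w \<in> borel_measurable borel"
    using \<phi> w by (auto simp: wbdd_def)
  note int = wbdd_integrable[OF \<phi>] wbdd_integrable[OF w]
  have le': "0 \<le> w z - \<phi> z" "0 \<le> w z + \<phi> z" for z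
    using le(1)[of z] by auto
  have sp: "space ?I = UNIV" using sets_eq_imp_space_eq[OF inf_kernel(1), of x y] by simp
  have m [measurable_cong]: "sets ?I = sets borel" by (rule inf_kernel(1))
  have "ennreal (2 * (\<rho> * a)) = ennreal (2 * a) * ennreal \<rho>"
    using rho a by (simp add: ennreal_mult[symmetric] mult_ac)
  also have "\<dots> \<le> ennreal (2 * a) * emeasure ?I UNIV"
    using minorization[OF small] by (intro mult_left_mono) auto
  also have "\<dots> = (\<integral>\<^sup>+z. ennreal (2 * a) \<partial>?I)"
    using sp by simp
  also have "\<dots> \<le> (\<integral>\<^sup>+z. ennreal (w z - \<phi> z) + ennreal (w z + \<phi> z) \<partial>?I)"
  proof (intro nn_integral_mono)
    fix z
    show "ennreal (2 * a) \<le> ennreal (w z - \<phi> z) + ennreal (w z + \<phi> z)"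
      using le(1)[of z] le(2)[of z] by (simp add: ennreal_plus[symmetric] abs_le_iff)
  qed
  also have "\<dots> = (\<integral>\<^sup>+z. ennreal (w z - \<phi> z) \<partial>?I) + (\<integral>\<^sup>+z. ennreal (w z + \<phi> z) \<partial>?I)"
    by (intro nn_integral_add) auto
  also have "\<dots> \<le> (\<integral>\<^sup>+z. ennreal (w z - \<phi> z) \<partial>P x) + (\<integral>\<^sup>+z. ennreal (w z + \<phi> z) \<partial>P y)"
    by (intro add_mono inf_kernel)
  also have "\<dots> = ennreal (\<integral>z. w z - \<phi> z \<partial>P x) + ennreal (\<integral>z. w z + \<phi> z \<partial>P y)"
    using int le'(1,2) by (subst (1 2) nn_integral_eq_integral) auto
  also have "\<dots> = ennreal ((\<integral>z. w z - \<phi> z \<partial>P x) + (\<integral>z. w z + \<phi> z \<partial>P y))"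
    using le' by (intro ennreal_plus[symmetric] integral_nonneg_AE AE_I2) auto
  finally have "2 * (\<rho> * a) \<le> (\<integral>z. w z - \<phi> z \<partial>P x) + (\<integral>z. w z + \<phi> z \<partial>P y)"
    using le' by (subst (asm) ennreal_le_iff)
      (auto intro!: add_nonneg_nonneg integral_nonneg_AE AE_I2)
  also have "\<dots> = kernel_op P w x + kernel_op P w y - (kernel_op P \<phi> x - kernel_op P \<phi> y)"
    using int by (simp add: kernel_op_def)
  finally show ?thesis by simp
qed

text \<open>The oscillation seminorm of Hairer and Mattingly, for the distance
  \<open>2 + \<beta> * W x + \<beta> * W y\<close> between distinct points. No absolute value
  appears because the condition is symmetric in x and y.\<close>

definition osc_le :: "real \<Rightarrow> real \<Rightarrow> ('a \<Rightarrow> real) \<Rightarrow> bool" where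
  "osc_le \<beta> L \<phi> \<longleftrightarrow> (\<forall>x y. \<phi> x - \<phi> y \<le> L * (2 + \<beta> * W x + \<beta> * W y))"

text \<open>The oscillation seminorm is the weighted supremum norm modulo constants. Every lower
  barrier \<open>\<phi> x - L * (1 + \<beta> * W x)\<close> lies below every upper barrier, so the
  supremum of the lower ones is an admissible centre.\<close>

lemma osc_le_centre:
  assumes "osc_le \<beta> L \<phi>"
  obtains b where "\<And>x. \<bar>\<phi> x - b\<bar> \<le> L * (1 + \<beta> * W x)"
proof -
  define b where "b = (SUP x. \<phi> x - L * (1 + \<beta> * W x))"
  have le: "\<phi> x - L * (1 + \<beta> * W x) \<le> \<phi> y + L * (1 + \<beta> * W y)" for x y
    using assms unfolding osc_le_def by (smt (verit) distrib_left mult.right_neutral)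
  have 1: "b \<le> \<phi> y + L * (1 + \<beta> * W y)" for y
    unfolding b_def by (rule cSUP_least) (use le in auto)
  have 2: "\<phi> x - L * (1 + \<beta> * W x) \<le> b" for x
    unfolding b_def by (rule cSUP_upper) (use le in \<open>auto intro!: bdd_aboveI2\<close>)
  show ?thesis
    using 1 2 by (intro that[of b]) (smt (verit))
qed

text \<open>The weight \<open>1 + \<beta> W\<close> makes the oscillation seminorm contract: far out by the drift
  condition, and on \<open>W x + W y \<le> R\<close> by the minorization once \<open>\<beta> K \<le> \<rho> / 2\<close>.\<close>

lemma osc_contraction:
  obtains \<beta> \<kappa> where "0 < \<beta>" "0 < \<kappa>" "\<kappa> < 1"
    "\<And>\<phi> L. \<phi> \<in> borel_measurable borel \<Longrightarrow> 0 \<le> L \<Longrightarrow> osc_le \<beta> L \<phi> \<Longrightarrow> osc_le \<beta> (\<kappa> * L) (kernel_op P \<phi>)"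
proof -
  define \<beta> where "\<beta> = \<rho> / (2 * (K + 1))"
  have \<beta>: "0 < \<beta>" "\<beta> * K \<le> \<rho> / 2"
    using rho K_nonneg by (auto simp: \<beta>_def field_simps)
  have "0 \<le> 2 * K / (1 - \<gamma>)" using K_nonneg gamma by simp
  then have R0: "0 < R" using R by linarith
  have RK: "2 * K < (1 - \<gamma>) * R" using R gamma by (simp add: field_simps)
  \<comment> \<open>The contraction factor of the far region at its boundary
    \<open>W x + W y = R\<close>; it is below 1 exactly when
    \<open>2 * K < (1 - \<gamma>) * R\<close>. Beyond the boundary the excess contracts with factor
    \<gamma>, so the worst case is the boundary itself or \<gamma>.\<close>
  define \<kappa>2 where "\<kappa>2 = (2 + \<beta> * \<gamma> * R + 2 * \<beta> * K) / (2 + \<beta> * R)"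
  have pos: "0 < 2 + \<beta> * R" using \<beta> R0 by (simp add: add_pos_pos)
  have "\<beta> * (2 * K) < \<beta> * ((1 - \<gamma>) * R)" using RK \<beta> by simp
  then have k2: "\<kappa>2 < 1" using pos by (simp add: \<kappa>2_def field_simps)
  define \<kappa> where "\<kappa> = max \<kappa>2 (max (1 - \<rho> / 2) \<gamma>)"
  have \<kappa>: "0 < \<kappa>" "\<kappa> < 1" "\<gamma> \<le> \<kappa>" "\<kappa>2 \<le> \<kappa>" "1 - \<rho> / 2 \<le> \<kappa>"
    using k2 rho gamma by (auto simp: \<kappa>_def)
  have "osc_le \<beta> (\<kappa> * L) (kernel_op P \<phi>)"
    if m[measurable]: "\<phi> \<in> borel_measurable borel" and L: "0 \<le> L" and osc: "osc_le \<beta> L \<phi>" for \<phi> L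
    unfolding osc_le_def
  proof (intro allI)
    fix x y
    obtain b where b: "\<And>x. \<bar>\<phi> x - b\<bar> \<le> L * (1 + \<beta> * W x)"
      using osc_le_centre[OF osc] by metis
    \<comment> \<open>Oscillation does not see constants, so the function may be centred; it then
      lies between \<open>- w\<close> and \<open>w\<close>, which both cases use.\<close>
    define \<psi> where "\<psi> z = \<phi> z - b" for z
    define w where "w z = L * (1 + \<beta> * W z)" for z
    have wb: "wbdd (L * (1 + \<beta>)) w"
      unfolding wbdd_def
    proof (intro conjI allI)
      show "w \<in> borel_measurable borel" unfolding w_def[abs_def] by measurable
      fix x
      have "1 + \<beta> * W x \<le> (1 + \<beta>) * (1 + W x)" "0 \<le> 1 + \<beta> * W x"
        using W_nonneg[of x] \<beta> by (auto simp: algebra_simps)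
      with L show "\<bar>w x\<bar> \<le> L * (1 + \<beta>) * (1 + W x)"
        by (simp add: w_def abs_mult mult.assoc mult_left_mono)
    qed
    have \<psi>w: "\<bar>\<psi> z\<bar> \<le> w z" for z using b by (simp add: \<psi>_def w_def)
    have \<psi>b: "wbdd (L * (1 + \<beta>)) \<psi>"
      using wb \<psi>w m unfolding wbdd_def \<psi>_def[abs_def] by (auto intro: order_trans[OF _ order_trans[OF abs_ge_self]])
    have \<phi>b: "wbdd (L * (1 + \<beta>) + \<bar>b\<bar>) \<phi>"
      using wbdd_add[OF \<psi>b wbdd_const[of b]] by (simp add: \<psi>_def)
    have eq: "kernel_op P \<psi> z = kernel_op P \<phi> z - b" for z
      using wbdd_integrable[OF \<phi>b] by (simp add: kernel_op_def \<psi>_def)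
    have wle: "kernel_op P w z \<le> L * (1 + \<beta> * (\<gamma> * W z + K))" for z
      using W_integral_le[of z] W_integrable[of z] L \<beta>
      by (simp add: kernel_op_def w_def mult_left_mono)
    let ?s = "W x + W y"
    have s: "0 \<le> ?s" using W_nonneg by (simp add: add_nonneg_nonneg)
    have bs: "0 \<le> \<beta> * ?s" using \<beta> s by simp
    have "kernel_op P \<psi> x - kernel_op P \<psi> y \<le> L * (\<kappa> * (2 + \<beta> * ?s))"
    proof (cases "?s \<le> R")
      case True
      have "kernel_op P \<psi> x - kernel_op P \<psi> y \<le> kernel_op P w x + kernel_op P w y - 2 * (\<rho> * L)"
        using \<beta> W_nonneg L by (intro integral_diff_le_of_minorization[OF \<psi>b wb \<psi>w _ True])
           (auto simp: w_def mult_le_cancel_left1)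
      also have "\<dots> \<le> L * (2 - 2 * \<rho> + 2 * (\<beta> * K) + \<beta> * \<gamma> * ?s)"
        using wle[of x] wle[of y] by (simp add: algebra_simps)
      also have "\<dots> \<le> L * (\<kappa> * (2 + \<beta> * ?s))"
      proof (rule mult_left_mono[OF _ L])
        have "\<gamma> * (\<beta> * ?s) \<le> \<kappa> * (\<beta> * ?s)" using \<kappa> bs by (intro mult_right_mono) auto
        moreover have "2 - 2 * \<rho> + 2 * (\<beta> * K) \<le> \<kappa> * 2" using \<beta>(2) \<kappa>(5) rho by simp
        ultimately show "2 - 2 * \<rho> + 2 * (\<beta> * K) + \<beta> * \<gamma> * ?s \<le> \<kappa> * (2 + \<beta> * ?s)"
          by (simp add: algebra_simps)
      qed
      finally show ?thesis .
    next
      case False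
      have "\<bar>kernel_op P \<psi> z\<bar> \<le> kernel_op P w z" for z
        unfolding kernel_op_def using wbdd_integrable[OF \<psi>b] wbdd_integrable[OF wb] \<psi>w
        by (intro integral_abs_bound_integral) auto
      from this[of x] this[of y]
      have "kernel_op P \<psi> x - kernel_op P \<psi> y \<le> kernel_op P w x + kernel_op P w y" by linarith
      also have "\<dots> \<le> L * (2 + 2 * (\<beta> * K) + \<beta> * \<gamma> * ?s)"
        using wle[of x] wle[of y] by (simp add: algebra_simps)
      also have "\<dots> \<le> L * (\<kappa> * (2 + \<beta> * ?s))"
      proof (rule mult_left_mono[OF _ L])
        have "2 + 2 * (\<beta> * K) + \<beta> * \<gamma> * R = \<kappa>2 * (2 + \<beta> * R)"
          using pos by (simp add: \<kappa>2_def)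
        also have "\<dots> \<le> \<kappa> * (2 + \<beta> * R)" using \<kappa> pos by (intro mult_right_mono) auto
        finally have 1: "2 + 2 * (\<beta> * K) + \<beta> * \<gamma> * R \<le> \<kappa> * (2 + \<beta> * R)" .
        have "\<gamma> * (\<beta> * (?s - R)) \<le> \<kappa> * (\<beta> * (?s - R))"
          using \<kappa> \<beta> False by (intro mult_right_mono) auto
        with 1 show "2 + 2 * (\<beta> * K) + \<beta> * \<gamma> * ?s \<le> \<kappa> * (2 + \<beta> * ?s)"
          by (simp add: algebra_simps)
      qed
      finally show ?thesis .
    qed
    then show "kernel_op P \<phi> x - kernel_op P \<phi> y \<le> \<kappa> * L * (2 + \<beta> * W x + \<beta> * W y)"
      by (simp add: eq algebra_simps)
  qed
  then show ?thesis using that \<beta>(1) \<kappa>(1,2) by blast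
qed

text \<open>By invariance, the distance of the iterate at x from the mean of f is the integral over
  y of the difference of its values at x and y. The oscillation of the iterate decays by
  contraction, and W is integrable under \<open>mu\<close>.\<close>

theorem geometric_ergodicity:
  obtains A \<kappa> where "0 \<le> A" "0 < \<kappa>" "\<kappa> < 1"
    "\<And>f c n x. wbdd c f \<Longrightarrow> \<bar>(kernel_op P ^^ n) f x - (\<integral>y. f y \<partial>mu)\<bar> \<le> A * c * \<kappa> ^ n * (1 + W x)"
proof -
  obtain \<beta> \<kappa> where \<beta>: "0 < \<beta>" and \<kappa>: "0 < \<kappa>" "\<kappa> < 1"
    and contr: "\<And>\<phi> L. \<phi> \<in> borel_measurable borel \<Longrightarrow> 0 \<le> L \<Longrightarrow> osc_le \<beta> L \<phi> \<Longrightarrow> osc_le \<beta> (\<kappa> * L) (kernel_op P \<phi>)"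
    using osc_contraction by metis
  \<comment> \<open>Converts the weight \<open>1 + W\<close> of \<open>wbdd\<close> into the weight
    \<open>1 + \<beta> * W\<close> of the seminorm, where \<beta> may be below 1.\<close>
  define B where "B = max 1 (1 / \<beta>)"
  define mW where "mW = (\<integral>y. W y \<partial>mu)"
  have B: "1 \<le> B" "1 \<le> B * \<beta>" using \<beta> by (auto simp: B_def max_def field_simps)
  have mW: "0 \<le> mW" unfolding mW_def using W_nonneg by simp
  define A where "A = B * (2 + \<beta> + \<beta> * mW)"
  have A: "0 \<le> A" using B \<beta> mW by (simp add: A_def)
  have bound: "\<bar>(kernel_op P ^^ n) f x - (\<integral>y. f y \<partial>mu)\<bar> \<le> A * c * \<kappa> ^ n * (1 + W x)"
    if f: "wbdd c f" for f c n x
  proof -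
    have c: "0 \<le> c" using f by (rule wbdd_nonneg)
    let ?Pn = "(kernel_op P ^^ n) f"
    have osc0: "osc_le \<beta> (B * c) f"
      unfolding osc_le_def
    proof (intro allI)
      fix x y
      have "f x - f y \<le> \<bar>f x\<bar> + \<bar>f y\<bar>" by simp
      also have "\<dots> \<le> c * (1 + W x) + c * (1 + W y)"
        using f by (intro add_mono) (auto simp: wbdd_def)
      also have "\<dots> = c * (2 * 1 + 1 * W x + 1 * W y)" by (simp add: algebra_simps)
      also have "\<dots> \<le> c * (2 * B + (B * \<beta>) * W x + (B * \<beta>) * W y)"
        using c B W_nonneg by (intro mult_left_mono add_mono mult_right_mono) auto
      finally show "f x - f y \<le> B * c * (2 + \<beta> * W x + \<beta> * W y)" by (simp add: algebra_simps)
    qed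
    have osc: "osc_le \<beta> (\<kappa> ^ n * (B * c)) ?Pn"
    proof (induction n)
      case (Suc n)
      then show ?case
        using contr[OF iter_abs_le(1)[OF f], of "\<kappa> ^ n * (B * c)"] \<kappa> B c by (simp add: mult_ac)
    qed (use osc0 in simp)
    let ?L = "\<kappa> ^ n * (B * c)"
    have L: "0 \<le> ?L" using \<kappa> B c by simp
    have int: "integrable mu ?Pn" by (rule wbdd_integrable_mu[OF wbdd_iter[OF f]])
    have "\<bar>?Pn x - (\<integral>y. f y \<partial>mu)\<bar> = \<bar>\<integral>y. ?Pn x - ?Pn y \<partial>mu\<bar>"
      using int by (simp add: integral_mu_iter[OF f])
    also have "\<dots> \<le> (\<integral>y. ?L * (2 + \<beta> * W x + \<beta> * W y) \<partial>mu)"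
    proof (rule integral_abs_bound_integral)
      show "\<bar>?Pn x - ?Pn y\<bar> \<le> ?L * (2 + \<beta> * W x + \<beta> * W y)" for y
        using osc unfolding osc_le_def by (smt (verit))
      show "integrable mu (\<lambda>y. ?Pn x - ?Pn y)" "integrable mu (\<lambda>y. ?L * (2 + \<beta> * W x + \<beta> * W y))"
        using int W_integrable_mu by (simp_all add: Bochner_Integration.integrable_diff)
    qed
    also have "\<dots> = ?L * (2 + \<beta> * W x + \<beta> * mW)"
      using W_integrable_mu by (simp add: mW_def)
    also have "\<dots> \<le> ?L * ((2 + \<beta> + \<beta> * mW) * (1 + W x))"
      using \<beta> W_nonneg[of x] mW by (intro mult_left_mono L) (simp add: algebra_simps)
    finally show ?thesis by (simp add: A_def mult_ac)
  qed
  show ?thesis using that[OF A \<kappa>] bound by blast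
qed

section \<open>Solutions of the Poisson equation\<close>

definition poisson_sol :: "('a \<Rightarrow> real) \<Rightarrow> 'a \<Rightarrow> real" where
  "poisson_sol f x = (\<Sum>n. (kernel_op P ^^ n) f x - (\<integral>y. f y \<partial>mu))"

text \<open>The facts are stated together so that one D and one \<kappa> serve every right-hand
  side; this uniformity is what random right-hand sides require. The remainder estimate at
  \<open>n = 0\<close> is the norm bound, and the difference rule later compares the solutions at
  successive measures.\<close>

theorem poisson_sol:
  obtains D \<kappa> where "0 \<le> D" "0 < \<kappa>" "\<kappa> < 1"
    "\<And>f c. wbdd c f \<Longrightarrow> wbdd (D * c) (poisson_sol f)"
    "\<And>f c x. wbdd c f \<Longrightarrow>
       poisson_sol f x - kernel_op P (poisson_sol f) x = f x - (\<integral>y. f y \<partial>mu)"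
    "\<And>f c n x. wbdd c f \<Longrightarrow>
       \<bar>(\<Sum>k<n. (kernel_op P ^^ k) f x - (\<integral>y. f y \<partial>mu)) - poisson_sol f x\<bar> \<le> D * c * \<kappa> ^ n * (1 + W x)"
    "\<And>f g c c'. wbdd c f \<Longrightarrow> wbdd c' g \<Longrightarrow>
       poisson_sol (\<lambda>x. f x - g x) = (\<lambda>x. poisson_sol f x - poisson_sol g x)"
proof -
  obtain A \<kappa> where A: "0 \<le> A" and \<kappa>: "0 < \<kappa>" "\<kappa> < 1" and
    erg: "\<And>f c n x. wbdd c f \<Longrightarrow> \<bar>(kernel_op P ^^ n) f x - (\<integral>y. f y \<partial>mu)\<bar> \<le> A * c * \<kappa> ^ n * (1 + W x)"
    using geometric_ergodicity by metis
  define D where "D = A / (1 - \<kappa>)"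
  have D: "0 \<le> D" using A \<kappa> by (simp add: D_def)
  let ?t = "\<lambda>f n x. (kernel_op P ^^ n) f x - (\<integral>y. f y \<partial>mu)"
  have bound: "summable (\<lambda>n. A * c * \<kappa> ^ n * (1 + W x))" for c x
    using \<kappa> by (intro summable_mult2 summable_mult) simp
  have summ: "summable (\<lambda>n. ?t f n x)" if "wbdd c f" for f c x
    using erg[OF that, of _ x] by (intro summable_comparison_test'[OF bound[of c x]]) simp
  have rest: "\<bar>(\<Sum>k<n. ?t f k x) - poisson_sol f x\<bar> \<le> D * c * \<kappa> ^ n * (1 + W x)"
    if f: "wbdd c f" for f c n x
  proof -
    have "poisson_sol f x - (\<Sum>k<n. ?t f k x) = (\<Sum>k. ?t f (k + n) x)"
      using suminf_minus_initial_segment[OF summ[OF f, of x], of n] by (simp add: poisson_sol_def)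
    also have "\<bar>\<dots>\<bar> \<le> (\<Sum>k. A * c * \<kappa> ^ (k + n) * (1 + W x))"
    proof -
      have s: "summable (\<lambda>k. A * c * \<kappa> ^ (k + n) * (1 + W x))"
        using bound[of c x] by (subst summable_iff_shift)
      have t: "summable (\<lambda>k. \<bar>?t f (k + n) x\<bar>)"
        using erg[OF f, of _ x] by (intro summable_comparison_test'[OF s]) simp
      have "\<bar>\<Sum>k. ?t f (k + n) x\<bar> \<le> (\<Sum>k. \<bar>?t f (k + n) x\<bar>)"
        by (rule summable_rabs[OF t])
      also have "\<dots> \<le> (\<Sum>k. A * c * \<kappa> ^ (k + n) * (1 + W x))"
        using erg[OF f] by (intro suminf_le t s) simp
      finally show ?thesis .
    qed
    also have "\<dots> = (A * c * \<kappa> ^ n * (1 + W x)) * (\<Sum>k. \<kappa> ^ k)"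
      using \<kappa> by (subst suminf_mult[symmetric]) (auto simp: power_add mult_ac)
    also have "\<dots> = D * c * \<kappa> ^ n * (1 + W x)"
      using \<kappa> by (simp add: suminf_geometric D_def)
    finally show ?thesis by (simp add: abs_minus_commute)
  qed
  have wb: "wbdd (D * c) (poisson_sol f)" if f: "wbdd c f" for f c
  proof -
    have "poisson_sol f \<in> borel_measurable borel"
      unfolding poisson_sol_def[abs_def] using iter_abs_le(1)[OF f] by measurable
    then show ?thesis
      using rest[OF f, where n=0] by (auto simp: wbdd_def)
  qed
  have lim0: "(\<lambda>n. a * \<kappa> ^ n * b) \<longlonglongrightarrow> 0" for a b :: real
    using tendsto_mult[OF tendsto_mult[OF tendsto_const[of a] LIMSEQ_realpow_zero[of \<kappa>]] tendsto_const[of b]] \<kappa>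
    by simp
  have eq: "poisson_sol f x - kernel_op P (poisson_sol f) x = f x - (\<integral>y. f y \<partial>mu)"
    if f: "wbdd c f" for f c x
  proof -
    let ?S = "\<lambda>n x. \<Sum>k<n. ?t f k x"
    interpret prob_space "P x" by (rule prob_space_kernel)
    have int: "integrable (P x) ((kernel_op P ^^ n) f)" for n
      by (rule wbdd_integrable[OF wbdd_iter[OF f]])
    have intS: "integrable (P x) (?S n)" for n using int by auto
    \<comment> \<open>The kernel shifts the index in the partial sum by one, so the term of index 0
      is lost; both sides converge, and the equation follows in the limit.\<close>
    have PS: "kernel_op P (?S n) x = ?S (Suc n) x - (f x - (\<integral>y. f y \<partial>mu))" for n
    proof -
      have "kernel_op P (?S n) x = (\<Sum>k<n. ?t f (Suc k) x)"
        using int by (simp add: kernel_op_def)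
      then show ?thesis by (simp add: sum.lessThan_Suc_shift del: sum.lessThan_Suc)
    qed
    have S: "(\<lambda>n. ?S n x) \<longlonglongrightarrow> poisson_sol f x"
      unfolding poisson_sol_def by (rule summable_LIMSEQ[OF summ[OF f]])
    have 1: "(\<lambda>n. kernel_op P (?S n) x) \<longlonglongrightarrow> poisson_sol f x - (f x - (\<integral>y. f y \<partial>mu))"
      unfolding PS using S by (intro tendsto_diff tendsto_const) (rule LIMSEQ_Suc)
    have 2: "(\<lambda>n. kernel_op P (?S n) x) \<longlonglongrightarrow> kernel_op P (poisson_sol f) x"
    proof -
      have "\<bar>kernel_op P (?S n) x - kernel_op P (poisson_sol f) x\<bar> \<le> D * c * \<kappa> ^ n * (1 + (\<gamma> * W x + K))" for n
      proof -
        have "kernel_op P (?S n) x - kernel_op P (poisson_sol f) x = kernel_op P (\<lambda>y. ?S n y - poisson_sol f y) x"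
          using intS wbdd_integrable[OF wb[OF f]] by (simp add: kernel_op_def)
        also have "\<bar>\<dots>\<bar> \<le> D * c * \<kappa> ^ n + D * c * \<kappa> ^ n * (\<gamma> * W x + K)"
        proof (rule kernel_op_abs_le)
          show "(\<lambda>y. ?S n y - poisson_sol f y) \<in> borel_measurable borel"
            using wbdd_measurable[OF wb[OF f]] iter_abs_le(1)[OF f] by measurable
          show "\<bar>?S n y - poisson_sol f y\<bar> \<le> D * c * \<kappa> ^ n + D * c * \<kappa> ^ n * W y" for y
            using rest[OF f, of y n] by (simp add: algebra_simps)
          show "0 \<le> D * c * \<kappa> ^ n" using D \<kappa> wbdd_nonneg[OF f] by simp
        qed
        finally show ?thesis by (simp add: algebra_simps)
      qed
      then have "(\<lambda>n. kernel_op P (?S n) x - kernel_op P (poisson_sol f) x) \<longlonglongrightarrow> 0"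
        using lim0[of "D * c"] by (intro Lim_null_comparison[OF _ lim0]) (auto intro!: always_eventually)
      then show ?thesis by (simp add: LIM_zero_iff)
    qed
    show ?thesis using LIMSEQ_unique[OF 1 2] by simp
  qed
  have diff: "poisson_sol (\<lambda>x. f x - g x) = (\<lambda>x. poisson_sol f x - poisson_sol g x)"
    if f: "wbdd c f" and g: "wbdd c' g" for f g c c'
  proof
    fix x
    have "(kernel_op P ^^ n) (\<lambda>x. f x - g x) = (\<lambda>x. (kernel_op P ^^ n) f x - (kernel_op P ^^ n) g x)" for n
    proof (induction n)
      case (Suc n)
      show ?case
        using wbdd_integrable[OF wbdd_iter[OF f]] wbdd_integrable[OF wbdd_iter[OF g]]
        by (auto simp: Suc kernel_op_diff)
    qed simp
    then have "poisson_sol (\<lambda>x. f x - g x) x = (\<Sum>n. ?t f n x - ?t g n x)"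
      unfolding poisson_sol_def using wbdd_integrable_mu[OF f] wbdd_integrable_mu[OF g]
      by (intro arg_cong[where f=suminf] ext) simp
    then show "poisson_sol (\<lambda>x. f x - g x) x = poisson_sol f x - poisson_sol g x"
      using summ[OF f] summ[OF g] by (simp add: suminf_diff poisson_sol_def)
  qed
  show ?thesis
    using that[OF D \<kappa>] wb eq rest diff by blast
qed

text \<open>Serves for the difference of two Poisson solutions: all iterates of h equal h, and they
  also converge to its mean.\<close>

lemma harmonic_wbdd_const:
  assumes h: "wbdd c h" and harm: "\<And>x. kernel_op P h x = h x"
  shows "h x = (\<integral>y. h y \<partial>mu)"
proof -
  obtain A \<kappa> where \<kappa>: "0 < \<kappa>" "\<kappa> < 1" and
    erg: "\<And>n x. \<bar>(kernel_op P ^^ n) h x - (\<integral>y. h y \<partial>mu)\<bar> \<le> A * c * \<kappa> ^ n * (1 + W x)"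
    using geometric_ergodicity h by metis
  have "(kernel_op P ^^ n) h = h" for n
    using harm by (induction n) auto
  then have le: "\<bar>h x - (\<integral>y. h y \<partial>mu)\<bar> \<le> A * c * \<kappa> ^ n * (1 + W x)" for n
    using erg[of n x] by simp
  have "(\<lambda>n. A * c * \<kappa> ^ n * (1 + W x)) \<longlonglongrightarrow> A * c * 0 * (1 + W x)"
    using \<kappa> by (intro tendsto_intros LIMSEQ_realpow_zero) auto
  then have "\<bar>h x - (\<integral>y. h y \<partial>mu)\<bar> \<le> A * c * 0 * (1 + W x)"
    using le by (intro LIMSEQ_le_const) auto
  then show ?thesis by simp
qed

end

section \<open>Markov chains and martingale increments\<close>

text \<open>The Markov property is stated as an identity of measures on events of the past rather
  than through conditional expectations. In this form it passes directly to the law conditioned on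
  an event of \<open>F 0\<close>.\<close>

locale kernel_chain = markov_kernel P + prob_space M
  for P :: "'a::euclidean_space \<Rightarrow> 'a measure" and M :: "'w measure" +
  fixes F :: "nat \<Rightarrow> 'w measure" and Y :: "nat \<Rightarrow> 'w \<Rightarrow> 'a"
  assumes subalg: "subalgebra M (F n)"
    and filtration: "sets (F n) \<subseteq> sets (F (Suc n))"
    and adapted [measurable]: "Y n \<in> F n \<rightarrow>\<^sub>M borel"
    and transition: "A \<in> sets (F n) \<Longrightarrow> B \<in> sets borel \<Longrightarrow>
      emeasure M (A \<inter> {\<omega>\<in>space M. Y (Suc n) \<omega> \<in> B}) =
        (\<integral>\<^sup>+\<omega>. indicator A \<omega> * emeasure (P (Y n \<omega>)) B \<partial>M)"
begin

lemma space_F [simp]: "space (F n) = space M"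
  using subalg[of n] by (simp add: subalgebra_def)

lemma measurable_F_M: "f \<in> F n \<rightarrow>\<^sub>M N \<Longrightarrow> f \<in> M \<rightarrow>\<^sub>M N"
  by (rule measurable_from_subalg[OF subalg])

lemma sets_F_mono: "m \<le> n \<Longrightarrow> sets (F m) \<subseteq> sets (F n)"
  by (rule lift_Suc_mono_le[of "\<lambda>n. sets (F n)"]) (use filtration in auto)

lemma subalg_F: "m \<le> n \<Longrightarrow> subalgebra (F n) (F m)"
  using sets_F_mono by (simp add: subalgebra_def)

lemma measurable_F_mono: "f \<in> F m \<rightarrow>\<^sub>M N \<Longrightarrow> m \<le> n \<Longrightarrow> f \<in> F n \<rightarrow>\<^sub>M N"
  by (rule measurable_from_subalg[OF subalg_F])

lemma ident_F_M [measurable]: "(\<lambda>\<omega>. \<omega>) \<in> M \<rightarrow>\<^sub>M F n"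
  by (rule measurable_F_M[of "\<lambda>\<omega>. \<omega>" n]) (rule measurable_ident_sets[OF refl])

lemma ident_F [measurable]: "(\<lambda>\<omega>. \<omega>) \<in> F (Suc n) \<rightarrow>\<^sub>M F n"
  by (rule measurable_F_mono[of "\<lambda>\<omega>. \<omega>" n]) (auto intro: measurable_ident_sets[OF refl])

lemma Y_measurable [measurable]: "Y n \<in> M \<rightarrow>\<^sub>M borel"
  by (rule measurable_F_M[OF adapted])

lemma step_measurable_F:
  fixes g :: "'w \<Rightarrow> 'a \<Rightarrow> real"
  assumes g [measurable]: "(\<lambda>(\<omega>, y). g \<omega> y) \<in> borel_measurable (F n \<Otimes>\<^sub>M borel)"
  shows "(\<lambda>\<omega>. g \<omega> (Y (Suc n) \<omega>)) \<in> borel_measurable (F (Suc n))"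
    and "(\<lambda>\<omega>. \<integral>y. g \<omega> y \<partial>P (Y n \<omega>)) \<in> borel_measurable (F n)"
proof -
  have "(\<lambda>\<omega>. (\<omega>, Y (Suc n) \<omega>)) \<in> F (Suc n) \<rightarrow>\<^sub>M F n \<Otimes>\<^sub>M borel" by measurable
  from measurable_compose[OF this g]
  show "(\<lambda>\<omega>. g \<omega> (Y (Suc n) \<omega>)) \<in> borel_measurable (F (Suc n))" by simp
  show "(\<lambda>\<omega>. \<integral>y. g \<omega> y \<partial>P (Y n \<omega>)) \<in> borel_measurable (F n)"
    by (rule integral_kernel_measurable2[OF g adapted])
qed

text \<open>The pair of \<omega> and the next state is regarded as a point of the product of
  \<open>F n\<close> with the Borel sets, so that integrands may depend on the past in any
  measurable way. Its law and the law built from the kernel agree on rectangles by the transition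
  property, and rectangles generate.\<close>

lemma nn_integral_transition:
  assumes g [measurable]: "(\<lambda>(\<omega>, y). g \<omega> y) \<in> borel_measurable (F n \<Otimes>\<^sub>M borel)"
  shows "(\<integral>\<^sup>+\<omega>. g \<omega> (Y (Suc n) \<omega>) \<partial>M) = (\<integral>\<^sup>+\<omega>. (\<integral>\<^sup>+y. g \<omega> y \<partial>P (Y n \<omega>)) \<partial>M)"
proof -
  let ?S = "F n \<Otimes>\<^sub>M (borel :: 'a measure)"
  let ?D = "\<lambda>\<omega>. distr (P (Y n \<omega>)) ?S (\<lambda>y. (\<omega>, y))"
  define N1 where "N1 = distr M ?S (\<lambda>\<omega>. (\<omega>, Y (Suc n) \<omega>))"
  define N2 where "N2 = bind M ?D"
  note measurable_distr2[measurable]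
  have D [measurable]: "?D \<in> M \<rightarrow>\<^sub>M subprob_algebra ?S" by measurable
  have s1: "sets N1 = sets ?S" by (simp add: N1_def)
  have s2: "sets N2 = sets ?S" unfolding N2_def by (rule sets_bind[OF _ not_empty]) simp
  let ?E = "{a \<times> b |a b. a \<in> sets (F n) \<and> b \<in> sets (borel :: 'a measure)}"
  have "N1 = N2"
  proof (rule measure_eqI_generator_eq[where E = ?E and \<Omega> = "space M \<times> UNIV" and A = "\<lambda>_. space M \<times> UNIV"])
    show "Int_stable ?E" by (rule Int_stable_pair_measure_generator)
    show "?E \<subseteq> Pow (space M \<times> UNIV)"
      using sets.sets_into_space[of _ "F n"] by auto
    show "sets N1 = sigma_sets (space M \<times> UNIV) ?E" "sets N2 = sigma_sets (space M \<times> UNIV) ?E"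
      unfolding s1 s2 by (simp_all add: sets_pair_measure)
    show "range (\<lambda>_. space M \<times> UNIV) \<subseteq> ?E"
      using sets.top[of "F n"] by force
    show "(\<Union>i. space M \<times> UNIV) = space M \<times> UNIV" by simp
    interpret N1: prob_space N1
      unfolding N1_def by (rule prob_space_distr) measurable
    show "emeasure N1 (space M \<times> UNIV) \<noteq> \<infinity>" for i :: nat by simp
    fix X assume "X \<in> ?E"
    then obtain A B where X: "X = A \<times> B" and A: "A \<in> sets (F n)" and B [measurable]: "B \<in> sets (borel :: 'a measure)"
      by auto
    have AB [measurable]: "A \<times> B \<in> sets ?S" using A B by simp
    have AM: "A \<subseteq> space M" using sets.sets_into_space[OF A] by simp
    have "emeasure N1 X = emeasure M (A \<inter> {\<omega>\<in>space M. Y (Suc n) \<omega> \<in> B})"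
      unfolding N1_def X using AM by (subst emeasure_distr) (auto intro!: arg_cong[where f="emeasure M"])
    also have "\<dots> = (\<integral>\<^sup>+\<omega>. indicator A \<omega> * emeasure (P (Y n \<omega>)) B \<partial>M)"
      by (rule transition[OF A B])
    also have "\<dots> = (\<integral>\<^sup>+\<omega>. emeasure (?D \<omega>) (A \<times> B) \<partial>M)"
    proof (rule nn_integral_cong)
      fix \<omega> assume "\<omega> \<in> space M"
      then show "indicator A \<omega> * emeasure (P (Y n \<omega>)) B = emeasure (?D \<omega>) (A \<times> B)"
        by (subst emeasure_distr) (auto simp: indicator_def intro!: arg_cong[where f="emeasure _"])
    qed
    also have "\<dots> = emeasure N2 X"
      unfolding N2_def X by (rule emeasure_bind[OF not_empty D AB, symmetric])
    finally show "emeasure N1 X = emeasure N2 X" .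
  qed
  then have "(\<integral>\<^sup>+z. (\<lambda>(\<omega>, y). g \<omega> y) z \<partial>N1) = (\<integral>\<^sup>+z. (\<lambda>(\<omega>, y). g \<omega> y) z \<partial>N2)" by simp
  moreover have "(\<integral>\<^sup>+z. (\<lambda>(\<omega>, y). g \<omega> y) z \<partial>N1) = (\<integral>\<^sup>+\<omega>. g \<omega> (Y (Suc n) \<omega>) \<partial>M)"
    unfolding N1_def by (subst nn_integral_distr) auto
  moreover have "(\<integral>\<^sup>+z. (\<lambda>(\<omega>, y). g \<omega> y) z \<partial>N2) = (\<integral>\<^sup>+\<omega>. (\<integral>\<^sup>+y. g \<omega> y \<partial>P (Y n \<omega>)) \<partial>M)"
  proof -
    have "(\<integral>\<^sup>+z. (\<lambda>(\<omega>, y). g \<omega> y) z \<partial>N2) = (\<integral>\<^sup>+\<omega>. (\<integral>\<^sup>+z. (\<lambda>(\<omega>, y). g \<omega> y) z \<partial>?D \<omega>) \<partial>M)"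
      unfolding N2_def by (rule nn_integral_bind[OF g D])
    also have "\<dots> = (\<integral>\<^sup>+\<omega>. (\<integral>\<^sup>+y. g \<omega> y \<partial>P (Y n \<omega>)) \<partial>M)"
    proof (rule nn_integral_cong)
      fix \<omega> assume "\<omega> \<in> space M"
      then have pair: "(\<lambda>y. (\<omega>, y)) \<in> P (Y n \<omega>) \<rightarrow>\<^sub>M ?S" by simp
      have "(\<lambda>(\<omega>, y). g \<omega> y) \<in> borel_measurable (?D \<omega>)"
        using g by (simp only: measurable_distr_eq1)
      from nn_integral_distr[OF pair this]
      show "(\<integral>\<^sup>+z. (\<lambda>(\<omega>, y). g \<omega> y) z \<partial>?D \<omega>) = (\<integral>\<^sup>+y. g \<omega> y \<partial>P (Y n \<omega>))"
        by (simp only: prod.case)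
    qed
    finally show ?thesis .
  qed
  ultimately show ?thesis by simp
qed

lemma expectation_transition:
  fixes g :: "'w \<Rightarrow> 'a \<Rightarrow> real"
  assumes g [measurable]: "(\<lambda>(\<omega>, y). g \<omega> y) \<in> borel_measurable (F n \<Otimes>\<^sub>M borel)"
    and int: "integrable M (\<lambda>\<omega>. g \<omega> (Y (Suc n) \<omega>))"
    and intP: "\<And>\<omega>. \<omega> \<in> space M \<Longrightarrow> integrable (P (Y n \<omega>)) (g \<omega>)"
  shows "integrable M (\<lambda>\<omega>. \<integral>y. g \<omega> y \<partial>P (Y n \<omega>))"
    and "expectation (\<lambda>\<omega>. g \<omega> (Y (Suc n) \<omega>)) = expectation (\<lambda>\<omega>. \<integral>y. g \<omega> y \<partial>P (Y n \<omega>))"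
proof -
  have *: "integrable M (\<lambda>\<omega>. \<integral>y. h \<omega> y \<partial>P (Y n \<omega>)) \<and>
      expectation (\<lambda>\<omega>. h \<omega> (Y (Suc n) \<omega>)) = expectation (\<lambda>\<omega>. \<integral>y. h \<omega> y \<partial>P (Y n \<omega>))"
    if h [measurable]: "(\<lambda>(\<omega>, y). h \<omega> y) \<in> borel_measurable (F n \<Otimes>\<^sub>M borel)"
      and i: "integrable M (\<lambda>\<omega>. h \<omega> (Y (Suc n) \<omega>))"
      and ip: "\<And>\<omega>. \<omega> \<in> space M \<Longrightarrow> integrable (P (Y n \<omega>)) (h \<omega>)" and nn: "\<And>\<omega> y. 0 \<le> h \<omega> y"
    for h :: "'w \<Rightarrow> 'a \<Rightarrow> real"
  proof -
    have [measurable]: "(\<lambda>\<omega>. \<integral>y. h \<omega> y \<partial>P (Y n \<omega>)) \<in> borel_measurable M"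
      by (rule measurable_F_M[OF step_measurable_F(2)[OF h]])
    have "(\<integral>\<^sup>+\<omega>. ennreal (\<integral>y. h \<omega> y \<partial>P (Y n \<omega>)) \<partial>M) = (\<integral>\<^sup>+\<omega>. (\<integral>\<^sup>+y. ennreal (h \<omega> y) \<partial>P (Y n \<omega>)) \<partial>M)"
      using ip nn by (intro nn_integral_cong nn_integral_eq_integral[symmetric]) auto
    also have "\<dots> = (\<integral>\<^sup>+\<omega>. ennreal (h \<omega> (Y (Suc n) \<omega>)) \<partial>M)"
      by (rule nn_integral_transition[symmetric]) measurable
    also have "\<dots> = ennreal (expectation (\<lambda>\<omega>. h \<omega> (Y (Suc n) \<omega>)))"
      using i nn by (intro nn_integral_eq_integral) auto
    finally have e: "(\<integral>\<^sup>+\<omega>. ennreal (\<integral>y. h \<omega> y \<partial>P (Y n \<omega>)) \<partial>M) = ennreal (expectation (\<lambda>\<omega>. h \<omega> (Y (Suc n) \<omega>)))" .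
    have nn': "0 \<le> (\<integral>y. h \<omega> y \<partial>P (Y n \<omega>))" for \<omega>
      using nn by (intro integral_nonneg_AE AE_I2) auto
    have "integrable M (\<lambda>\<omega>. \<integral>y. h \<omega> y \<partial>P (Y n \<omega>))"
      using e nn' by (intro integrableI_nonneg) auto
    moreover have "expectation (\<lambda>\<omega>. \<integral>y. h \<omega> y \<partial>P (Y n \<omega>)) = expectation (\<lambda>\<omega>. h \<omega> (Y (Suc n) \<omega>))"
      using e nn' nn by (intro integral_eq_nn_integral[THEN trans]) (auto intro!: enn2real_ennreal integral_nonneg_AE)
    ultimately show ?thesis by simp
  qed
  define p where "p \<omega> y = max 0 (g \<omega> y)" for \<omega> y
  define q where "q \<omega> y = max 0 (- g \<omega> y)" for \<omega> y
  have pq: "g \<omega> y = p \<omega> y - q \<omega> y" for \<omega> y by (auto simp: p_def q_def)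
  have [measurable]: "(\<lambda>(\<omega>, y). p \<omega> y) \<in> borel_measurable (F n \<Otimes>\<^sub>M borel)"
    "(\<lambda>(\<omega>, y). q \<omega> y) \<in> borel_measurable (F n \<Otimes>\<^sub>M borel)"
    unfolding p_def q_def by measurable
  have i: "integrable M (\<lambda>\<omega>. p \<omega> (Y (Suc n) \<omega>))" "integrable M (\<lambda>\<omega>. q \<omega> (Y (Suc n) \<omega>))"
    unfolding p_def q_def using int by auto
  have ip: "integrable (P (Y n \<omega>)) (p \<omega>)" "integrable (P (Y n \<omega>)) (q \<omega>)" if "\<omega> \<in> space M" for \<omega>
    unfolding p_def[abs_def] q_def[abs_def] using intP[OF that] by auto
  have P: "integrable M (\<lambda>\<omega>. \<integral>y. p \<omega> y \<partial>P (Y n \<omega>))"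
      "expectation (\<lambda>\<omega>. p \<omega> (Y (Suc n) \<omega>)) = expectation (\<lambda>\<omega>. \<integral>y. p \<omega> y \<partial>P (Y n \<omega>))"
    and Q: "integrable M (\<lambda>\<omega>. \<integral>y. q \<omega> y \<partial>P (Y n \<omega>))"
      "expectation (\<lambda>\<omega>. q \<omega> (Y (Suc n) \<omega>)) = expectation (\<lambda>\<omega>. \<integral>y. q \<omega> y \<partial>P (Y n \<omega>))"
    using *[of p] *[of q] i ip by (auto simp: p_def q_def)
  have split: "(\<integral>y. g \<omega> y \<partial>P (Y n \<omega>)) = (\<integral>y. p \<omega> y \<partial>P (Y n \<omega>)) - (\<integral>y. q \<omega> y \<partial>P (Y n \<omega>))"
    if "\<omega> \<in> space M" for \<omega>
    unfolding pq using ip[OF that] by simp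
  have "integrable M (\<lambda>\<omega>. (\<integral>y. p \<omega> y \<partial>P (Y n \<omega>)) - (\<integral>y. q \<omega> y \<partial>P (Y n \<omega>)))"
    using P Q by simp
  then show "integrable M (\<lambda>\<omega>. \<integral>y. g \<omega> y \<partial>P (Y n \<omega>))"
    by (subst Bochner_Integration.integrable_cong[OF refl split]) auto
  have "expectation (\<lambda>\<omega>. g \<omega> (Y (Suc n) \<omega>)) =
      expectation (\<lambda>\<omega>. p \<omega> (Y (Suc n) \<omega>)) - expectation (\<lambda>\<omega>. q \<omega> (Y (Suc n) \<omega>))"
    unfolding pq using i by simp
  also have "\<dots> = expectation (\<lambda>\<omega>. (\<integral>y. p \<omega> y \<partial>P (Y n \<omega>)) - (\<integral>y. q \<omega> y \<partial>P (Y n \<omega>)))"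
    using P Q by simp
  also have "\<dots> = expectation (\<lambda>\<omega>. \<integral>y. g \<omega> y \<partial>P (Y n \<omega>))"
    by (intro Bochner_Integration.integral_cong[OF refl]) (simp add: split)
  finally show "expectation (\<lambda>\<omega>. g \<omega> (Y (Suc n) \<omega>)) = expectation (\<lambda>\<omega>. \<integral>y. g \<omega> y \<partial>P (Y n \<omega>))" .
qed

end

section \<open>The weights \<open>V\<close> and \<open>sqrt V\<close>\<close>

locale weak_harris_kernel = markov_kernel P for P :: "'a::euclidean_space \<Rightarrow> 'a measure" +
  fixes V :: "'a \<Rightarrow> real" and K \<gamma> R \<rho> :: real and mu :: "'a measure"
  assumes V_measurable [measurable]: "V \<in> borel_measurable borel"
    and V_nonneg: "0 \<le> V x"
    and K_nonneg: "0 \<le> K"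
    and gamma: "0 < \<gamma>" "\<gamma> < 1"
    and drift: "(\<integral>\<^sup>+y. ennreal (V y) \<partial>P x) \<le> ennreal (\<gamma> * V x + K)"
    and R: "4 * K / (1 - sqrt \<gamma>)\<^sup>2 < R"
    and rho: "0 < \<rho>" "\<rho> \<le> 1"
    and minorization: "V x + V y \<le> R \<Longrightarrow> ennreal \<rho> \<le> emeasure (inf (P x) (P y)) UNIV"
    and mu: "mu \<in> space (prob_algebra borel)" "bind mu P = mu"
begin

lemma sqrt_V_le: "2 * sqrt (V x) \<le> 1 + V x"
proof -
  have "0 \<le> (1 - sqrt (V x))\<^sup>2" by simp
  then show ?thesis using V_nonneg[of x] by (simp add: power2_eq_square algebra_simps)
qed

sublocale V: drift_kernel P V K \<gamma> R \<rho> mu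
proof
  have g: "0 < 1 - sqrt \<gamma>" "0 < sqrt \<gamma>" using gamma by auto
  \<comment> \<open>Hence the assumed threshold for R dominates
    \<open>2 * K / (1 - \<gamma>)\<close>, the one that weight \<open>V\<close> requires.\<close>
  have "(1 - sqrt \<gamma>)\<^sup>2 \<le> 2 * (1 - \<gamma>)"
  proof -
    have "2 * (1 - \<gamma>) - (1 - sqrt \<gamma>)\<^sup>2 = (1 - sqrt \<gamma>) * (1 + 3 * sqrt \<gamma>)"
      using gamma by (simp add: power2_eq_square algebra_simps)
    also have "\<dots> \<ge> 0" using g by simp
    finally show ?thesis by simp
  qed
  then have "2 * K / (1 - \<gamma>) \<le> 4 * K / (1 - sqrt \<gamma>)\<^sup>2"
    using g K_nonneg gamma mult_left_mono[of "(1 - sqrt \<gamma>)\<^sup>2" "2 * (1 - \<gamma>)" "2 * K"]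
    by (simp add: field_simps)
  then show "2 * K / (1 - \<gamma>) < R" using R by simp
qed (use V_nonneg K_nonneg gamma drift rho minorization mu in auto)

text \<open>Jensen's inequality bounds the square of the integral of \<open>sqrt V\<close> by that
  of \<open>V\<close>, and \<open>\<gamma> * V x + K\<close> is at most the square of
  \<open>sqrt \<gamma> * sqrt (V x) + sqrt K\<close>. The condition on R for the new constants, once
  squared, is exactly the assumed threshold, and the level set of \<open>sqrt V\<close> for
  \<open>sqrt R\<close> lies inside the one of \<open>V\<close> for R.\<close>

sublocale S: drift_kernel P "\<lambda>x. sqrt (V x)" "sqrt K" "sqrt \<gamma>" "sqrt R" \<rho> mu
proof
  have g: "0 < 1 - sqrt \<gamma>" "0 < sqrt \<gamma>" using gamma by auto
  have "sqrt (4 * K / (1 - sqrt \<gamma>)\<^sup>2) < sqrt R" using R by simp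
  then show "2 * sqrt K / (1 - sqrt \<gamma>) < sqrt R"
    using g by (simp add: real_sqrt_divide real_sqrt_mult)
  have "0 \<le> 4 * K / (1 - sqrt \<gamma>)\<^sup>2" using K_nonneg by simp
  then have R0: "0 \<le> R" using R by simp
  show "ennreal \<rho> \<le> emeasure (inf (P x) (P y)) UNIV" if "sqrt (V x) + sqrt (V y) \<le> sqrt R" for x y
  proof (rule minorization)
    have "V x + V y \<le> (sqrt (V x) + sqrt (V y))\<^sup>2"
      using V_nonneg by (simp add: power2_sum)
    also have "\<dots> \<le> (sqrt R)\<^sup>2" using that V_nonneg by (intro power_mono) auto
    finally show "V x + V y \<le> R" using R0 by simp
  qed
  show "(\<integral>\<^sup>+y. ennreal (sqrt (V y)) \<partial>P x) \<le> ennreal (sqrt \<gamma> * sqrt (V x) + sqrt K)" for x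
  proof -
    interpret prob_space "P x" by (rule prob_space_kernel)
    have sq: "\<bar>sqrt (V y)\<bar> \<le> \<bar>1 + V y\<bar>" for y
      using sqrt_V_le[of y] V_nonneg[of y] by simp
    have int: "integrable (P x) (\<lambda>y. sqrt (V y))"
      by (rule Bochner_Integration.integrable_bound[where f="\<lambda>y. 1 + V y"])
         (use V.W_integrable sq in \<open>auto intro!: AE_I2\<close>)
    have "(\<integral>y. sqrt (V y) \<partial>P x)\<^sup>2 \<le> (\<integral>y. (sqrt (V y))\<^sup>2 \<partial>P x)"
    proof -
      have i2: "integrable (P x) (\<lambda>y. (sqrt (V y))\<^sup>2)" using V.W_integrable V_nonneg by simp
      have "0 \<le> variance (\<lambda>y. sqrt (V y))" by simp
      also have "\<dots> = (\<integral>y. (sqrt (V y))\<^sup>2 \<partial>P x) - (\<integral>y. sqrt (V y) \<partial>P x)\<^sup>2"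
        using int i2 by (rule variance_eq)
      finally show ?thesis by simp
    qed
    also have "\<dots> \<le> \<gamma> * V x + K" using V.W_integral_le V_nonneg by simp
    also have "\<dots> \<le> (sqrt \<gamma> * sqrt (V x) + sqrt K)\<^sup>2"
      using gamma K_nonneg V_nonneg[of x] unfolding power2_sum power_mult_distrib by simp
    finally have sq2: "(\<integral>y. sqrt (V y) \<partial>P x)\<^sup>2 \<le> (sqrt \<gamma> * sqrt (V x) + sqrt K)\<^sup>2" .
    have "0 \<le> sqrt \<gamma> * sqrt (V x) + sqrt K"
      using gamma K_nonneg V_nonneg[of x] by simp
    with sq2 have "(\<integral>y. sqrt (V y) \<partial>P x) \<le> sqrt \<gamma> * sqrt (V x) + sqrt K"
      by (rule power2_le_imp_le)
    moreover have "(\<integral>\<^sup>+y. ennreal (sqrt (V y)) \<partial>P x) = ennreal (\<integral>y. sqrt (V y) \<partial>P x)"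
      using V_nonneg by (intro nn_integral_eq_integral int AE_I2) simp
    ultimately show ?thesis by (simp add: ennreal_leI)
  qed
qed (use V_nonneg K_nonneg gamma rho mu in auto)

lemma one_plus_sqrt_squared_le: "(1 + sqrt (V x))\<^sup>2 \<le> 2 * (1 + V x)"
  using V_nonneg[of x] sqrt_V_le[of x] by (simp add: power2_sum)

text \<open>First moments of \<open>V\<close> along the chain are bounded, so this is the source of
  all second moment bounds for functions at weight \<open>sqrt V\<close>.\<close>

lemma S_wbdd_power2:
  assumes "S.wbdd c f" shows "V.wbdd (2 * c\<^sup>2) (\<lambda>x. (f x)\<^sup>2)"
proof -
  have c: "0 \<le> c" using assms by (rule S.wbdd_nonneg)
  have "(f x)\<^sup>2 \<le> 2 * c\<^sup>2 * (1 + V x)" for x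
  proof -
    have "\<bar>f x\<bar>\<^sup>2 \<le> (c * (1 + sqrt (V x)))\<^sup>2"
      using assms by (intro power_mono) (auto simp: S.wbdd_def)
    also have "\<dots> = c\<^sup>2 * (1 + sqrt (V x))\<^sup>2" by (simp add: power_mult_distrib)
    also have "\<dots> \<le> c\<^sup>2 * (2 * (1 + V x))" by (intro mult_left_mono one_plus_sqrt_squared_le) auto
    finally show ?thesis by (simp add: algebra_simps)
  qed
  then show ?thesis using assms by (auto simp: V.wbdd_def S.wbdd_def)
qed

lemma S_wbdd_imp_V_wbdd:
  assumes "S.wbdd c f" shows "V.wbdd (2 * c) f"
proof -
  have c: "0 \<le> c" using assms by (rule S.wbdd_nonneg)
  have "\<bar>f x\<bar> \<le> 2 * c * (1 + V x)" for x
  proof -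
    have "1 + sqrt (V x) \<le> 2 * (1 + V x)" using sqrt_V_le[of x] V_nonneg[of x] by argo
    then have "c * (1 + sqrt (V x)) \<le> c * (2 * (1 + V x))" using c by (intro mult_left_mono)
    moreover have "\<bar>f x\<bar> \<le> c * (1 + sqrt (V x))" using assms by (simp add: S.wbdd_def)
    ultimately show ?thesis by (simp add: algebra_simps)
  qed
  then show ?thesis using assms by (auto simp: V.wbdd_def S.wbdd_def)
qed

end

section \<open>Moments, averages and martingale sums along the chain\<close>

locale ergodic_chain = weak_harris_kernel P V K \<gamma> R \<rho> mu + kernel_chain P M F Y
  for P :: "'a::euclidean_space \<Rightarrow> 'a measure" and V :: "'a \<Rightarrow> real" and K \<gamma> R \<rho> :: real
    and mu :: "'a measure" and M :: "'w measure" and F :: "nat \<Rightarrow> 'w measure"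
    and Y :: "nat \<Rightarrow> 'w \<Rightarrow> 'a" +
  assumes V_Y0: "integrable M (\<lambda>\<omega>. V (Y 0 \<omega>))"
begin

text \<open>A bound that the moment recursion preserves: \<open>v \<mapsto> \<gamma> * v + K\<close>
  maps every v below this value to a value below it.\<close>

definition vbar :: real where
  "vbar = expectation (\<lambda>\<omega>. V (Y 0 \<omega>)) + K / (1 - \<gamma>)"

lemma vbar_nonneg: "0 \<le> vbar"
  using V_nonneg K_nonneg gamma by (auto simp: vbar_def intro!: add_nonneg_nonneg integral_nonneg_AE)

lemma V_Y_integrable: "integrable M (\<lambda>\<omega>. V (Y n \<omega>))"
  and V_Y_le: "expectation (\<lambda>\<omega>. V (Y n \<omega>)) \<le> vbar"
proof -
  have "integrable M (\<lambda>\<omega>. V (Y n \<omega>)) \<and> expectation (\<lambda>\<omega>. V (Y n \<omega>)) \<le> vbar"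
  proof (induction n)
    case 0
    show ?case using V_Y0 K_nonneg gamma by (simp add: vbar_def)
  next
    case (Suc n)
    have nn: "0 \<le> expectation (\<lambda>\<omega>. V (Y n \<omega>))" using V_nonneg by simp
    have "(\<integral>\<^sup>+\<omega>. ennreal (V (Y (Suc n) \<omega>)) \<partial>M) = (\<integral>\<^sup>+\<omega>. (\<integral>\<^sup>+y. ennreal (V y) \<partial>P (Y n \<omega>)) \<partial>M)"
      by (rule nn_integral_transition) measurable
    also have "\<dots> \<le> (\<integral>\<^sup>+\<omega>. ennreal (\<gamma> * V (Y n \<omega>) + K) \<partial>M)"
      by (intro nn_integral_mono drift)
    also have "\<dots> = ennreal (\<integral>\<omega>. \<gamma> * V (Y n \<omega>) + K \<partial>M)"
      using Suc V_nonneg gamma K_nonneg by (intro nn_integral_eq_integral) auto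
    also have "\<dots> = ennreal (\<gamma> * expectation (\<lambda>\<omega>. V (Y n \<omega>)) + K)"
      using Suc by (simp add: prob_space)
    finally have le: "(\<integral>\<^sup>+\<omega>. ennreal (V (Y (Suc n) \<omega>)) \<partial>M) \<le> ennreal (\<gamma> * expectation (\<lambda>\<omega>. V (Y n \<omega>)) + K)" .
    have int: "integrable M (\<lambda>\<omega>. V (Y (Suc n) \<omega>))"
      using V_nonneg le by (intro integrableI_bounded) (auto simp: le_less_trans[OF _ ennreal_less_top])
    have "expectation (\<lambda>\<omega>. V (Y (Suc n) \<omega>)) \<le> \<gamma> * expectation (\<lambda>\<omega>. V (Y n \<omega>)) + K"
      using le nn gamma K_nonneg by (intro integral_real_bounded) auto
    also have "\<dots> \<le> \<gamma> * vbar + K"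
      using Suc gamma by (intro add_right_mono mult_left_mono) auto
    also have "\<dots> = \<gamma> * expectation (\<lambda>\<omega>. V (Y 0 \<omega>)) + K / (1 - \<gamma>)"
      using gamma by (simp add: vbar_def field_simps)
    also have "\<dots> \<le> vbar"
      using gamma V_nonneg unfolding vbar_def
      by (intro add_right_mono mult_left_le_one_le integral_nonneg_AE) auto
    finally show ?case using int by simp
  qed
  then show "integrable M (\<lambda>\<omega>. V (Y n \<omega>))" "expectation (\<lambda>\<omega>. V (Y n \<omega>)) \<le> vbar" by auto
qed

lemma wbdd_Y_integrable: "V.wbdd c f \<Longrightarrow> integrable M (\<lambda>\<omega>. f (Y n \<omega>))"
  and expectation_abs_wbdd_Y_le: "V.wbdd c f \<Longrightarrow> expectation (\<lambda>\<omega>. \<bar>f (Y n \<omega>)\<bar>) \<le> c * (1 + vbar)"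
proof -
  assume f: "V.wbdd c f"
  then have c: "0 \<le> c" by (rule V.wbdd_nonneg)
  have [measurable]: "f \<in> borel_measurable borel" using f by (rule V.wbdd_measurable)
  have int: "integrable M (\<lambda>\<omega>. c * (1 + V (Y n \<omega>)))" using V_Y_integrable by simp
  show 1: "integrable M (\<lambda>\<omega>. f (Y n \<omega>))"
    by (rule Bochner_Integration.integrable_bound[OF int])
       (use V.wbdd_bound[OF f] in \<open>auto intro!: AE_I2 intro: order_trans[OF _ abs_ge_self]\<close>)
  have "expectation (\<lambda>\<omega>. \<bar>f (Y n \<omega>)\<bar>) \<le> expectation (\<lambda>\<omega>. c * (1 + V (Y n \<omega>)))"
    using 1 int V.wbdd_bound[OF f] by (intro integral_mono) auto
  also have "\<dots> = c * (1 + expectation (\<lambda>\<omega>. V (Y n \<omega>)))"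
    using V_Y_integrable by (simp add: prob_space)
  also have "\<dots> \<le> c * (1 + vbar)" using c V_Y_le by (intro mult_left_mono add_left_mono)
  finally show "expectation (\<lambda>\<omega>. \<bar>f (Y n \<omega>)\<bar>) \<le> c * (1 + vbar)" .
qed

lemma expectation_iter:
  assumes f: "V.wbdd c f"
  shows "expectation (\<lambda>\<omega>. f (Y n \<omega>)) = expectation (\<lambda>\<omega>. (kernel_op P ^^ n) f (Y 0 \<omega>))"
  using f
proof (induction n arbitrary: f c)
  case (Suc n)
  have [measurable]: "f \<in> borel_measurable borel" using Suc.prems by (rule V.wbdd_measurable)
  have "expectation (\<lambda>\<omega>. f (Y (Suc n) \<omega>)) = expectation (\<lambda>\<omega>. kernel_op P f (Y n \<omega>))"
    unfolding kernel_op_def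
    by (rule expectation_transition(2)[where g="\<lambda>\<omega> y. f y"])
       (use wbdd_Y_integrable[OF Suc.prems] V.wbdd_integrable[OF Suc.prems] in simp_all)
  also have "\<dots> = expectation (\<lambda>\<omega>. (kernel_op P ^^ n) (kernel_op P f) (Y 0 \<omega>))"
    by (rule Suc.IH[OF V.wbdd_kernel_op[OF Suc.prems]])
  finally show ?case by (simp add: funpow_swap1)
qed simp

text \<open>The deviations from the mean under \<open>mu\<close> decay geometrically, so their sum
  is bounded independently of N and linearly in the norm c.\<close>

lemma sum_expectation_le:
  obtains B where "0 \<le> B" "\<And>f c N. V.wbdd c f \<Longrightarrow>
    (\<Sum>k<N. expectation (\<lambda>\<omega>. f (Y k \<omega>))) \<le> real N * (\<integral>x. f x \<partial>mu) + B * c"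
proof -
  obtain A \<kappa> where A: "0 \<le> A" and \<kappa>: "0 < \<kappa>" "\<kappa> < 1" and
    erg: "\<And>f c n x. V.wbdd c f \<Longrightarrow> \<bar>(kernel_op P ^^ n) f x - (\<integral>y. f y \<partial>mu)\<bar> \<le> A * c * \<kappa> ^ n * (1 + V x)"
    using V.geometric_ergodicity by metis
  define B where "B = A * (1 + vbar) / (1 - \<kappa>)"
  have B: "0 \<le> B" using A vbar_nonneg \<kappa> by (simp add: B_def)
  have "(\<Sum>k<N. expectation (\<lambda>\<omega>. f (Y k \<omega>))) \<le> real N * (\<integral>x. f x \<partial>mu) + B * c"
    if f: "V.wbdd c f" for f c N
  proof -
    have c: "0 \<le> c" using f by (rule V.wbdd_nonneg)
    have le: "expectation (\<lambda>\<omega>. f (Y k \<omega>)) \<le> (\<integral>x. f x \<partial>mu) + A * c * (1 + vbar) * \<kappa> ^ k" for k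
    proof -
      have "expectation (\<lambda>\<omega>. f (Y k \<omega>)) \<le> expectation (\<lambda>\<omega>. (\<integral>x. f x \<partial>mu) + A * c * \<kappa> ^ k * (1 + V (Y 0 \<omega>)))"
        unfolding expectation_iter[OF f]
      proof (rule integral_mono)
        show "integrable M (\<lambda>\<omega>. (kernel_op P ^^ k) f (Y 0 \<omega>))"
          by (rule wbdd_Y_integrable[OF V.wbdd_iter[OF f]])
        show "(kernel_op P ^^ k) f (Y 0 \<omega>) \<le> (\<integral>x. f x \<partial>mu) + A * c * \<kappa> ^ k * (1 + V (Y 0 \<omega>))" for \<omega>
          using erg[OF f, of k "Y 0 \<omega>"] by linarith
      qed (use V_Y_integrable in simp)
      also have "\<dots> = (\<integral>x. f x \<partial>mu) + A * c * \<kappa> ^ k * (1 + expectation (\<lambda>\<omega>. V (Y 0 \<omega>)))"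
        using V_Y_integrable by (simp add: prob_space)
      also have "\<dots> \<le> (\<integral>x. f x \<partial>mu) + A * c * \<kappa> ^ k * (1 + vbar)"
        using A c \<kappa> V_Y_le by (intro add_left_mono mult_left_mono) auto
      finally show ?thesis by (simp add: mult_ac)
    qed
    have "(\<Sum>k<N. expectation (\<lambda>\<omega>. f (Y k \<omega>))) \<le> (\<Sum>k<N. (\<integral>x. f x \<partial>mu) + A * c * (1 + vbar) * \<kappa> ^ k)"
      by (intro sum_mono le)
    also have "\<dots> = real N * (\<integral>x. f x \<partial>mu) + A * c * (1 + vbar) * (\<Sum>k<N. \<kappa> ^ k)"
      by (simp add: sum.distrib sum_distrib_left)
    also have "\<dots> \<le> real N * (\<integral>x. f x \<partial>mu) + A * c * (1 + vbar) * (1 / (1 - \<kappa>))"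
    proof (intro add_left_mono mult_left_mono)
      have "(\<Sum>k<N. \<kappa> ^ k) = (1 - \<kappa> ^ N) / (1 - \<kappa>)"
        using \<kappa> by (simp add: sum_gp_strict)
      also have "\<dots> \<le> 1 / (1 - \<kappa>)" using \<kappa> by (intro divide_right_mono) auto
      finally show "(\<Sum>k<N. \<kappa> ^ k) \<le> 1 / (1 - \<kappa>)" .
    qed (use A c vbar_nonneg in auto)
    finally show ?thesis by (simp add: B_def mult_ac)
  qed
  then show ?thesis using that B by blast
qed

lemma S_wbdd_power2_Y:
  assumes "S.wbdd c f"
  shows "integrable M (\<lambda>\<omega>. (f (Y n \<omega>))\<^sup>2)" "expectation (\<lambda>\<omega>. (f (Y n \<omega>))\<^sup>2) \<le> 2 * c\<^sup>2 * (1 + vbar)"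
  using wbdd_Y_integrable[OF S_wbdd_power2[OF assms]] expectation_abs_wbdd_Y_le[OF S_wbdd_power2[OF assms]]
  by auto

text \<open>The function \<open>g j\<close> may depend on the past through \<omega>; this covers
  both a fixed Poisson solution and the random ones of the remainder. The compensator is an integral
  against the kernel, so that it is defined for every \<omega> and not only almost surely.\<close>

definition mart_diff :: "(nat \<Rightarrow> 'w \<Rightarrow> 'a \<Rightarrow> real) \<Rightarrow> nat \<Rightarrow> 'w \<Rightarrow> real" where
  "mart_diff g j \<omega> = g j \<omega> (Y (Suc j) \<omega>) - (\<integral>y. g j \<omega> y \<partial>P (Y j \<omega>))"

lemma mart_diff_measurable:
  assumes "(\<lambda>(\<omega>, y). g j \<omega> y) \<in> borel_measurable (F j \<Otimes>\<^sub>M borel)"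
  shows "mart_diff g j \<in> borel_measurable (F (Suc j))"
  unfolding mart_diff_def[abs_def]
  using step_measurable_F[OF assms] by (intro borel_measurable_diff) (auto intro: measurable_F_mono)

lemma mart_diff_abs_le:
  assumes "S.wbdd c (g j \<omega>)"
  shows "\<bar>mart_diff g j \<omega>\<bar> \<le> c * (1 + sqrt (V (Y (Suc j) \<omega>))) + c * (1 + sqrt K) * (1 + sqrt (V (Y j \<omega>)))"
  using S.wbdd_bound[OF assms, of "Y (Suc j) \<omega>"] S.wbdd_bound[OF S.wbdd_kernel_op[OF assms], of "Y j \<omega>"]
  unfolding mart_diff_def kernel_op_def by linarith

text \<open>The factor 4 is 2 from the square of a sum times 2 from
  \<open>one_plus_sqrt_squared_le\<close>; the term with K belongs to the compensator.\<close>

definition mart_const :: real where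
  "mart_const = 4 * (1 + (1 + sqrt K)\<^sup>2) * (1 + vbar)"

lemma mart_const_nonneg: "0 \<le> mart_const"
  using vbar_nonneg by (simp add: mart_const_def)

lemma mart_diff_power2_le:
  assumes "S.wbdd c (g j \<omega>)"
  shows "(mart_diff g j \<omega>)\<^sup>2 \<le> 4 * c\<^sup>2 * (1 + V (Y (Suc j) \<omega>)) + 4 * c\<^sup>2 * (1 + sqrt K)\<^sup>2 * (1 + V (Y j \<omega>))"
proof -
  have sq: "(a + b)\<^sup>2 \<le> 2 * a\<^sup>2 + 2 * b\<^sup>2" for a b :: real
    using zero_le_power2[of "a - b"] by (simp add: power2_eq_square algebra_simps)
  have "\<bar>mart_diff g j \<omega>\<bar>\<^sup>2 \<le> (c * (1 + sqrt (V (Y (Suc j) \<omega>))) + c * (1 + sqrt K) * (1 + sqrt (V (Y j \<omega>))))\<^sup>2"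
    using mart_diff_abs_le[where g=g and j=j, OF assms] by (intro power_mono) auto
  also have "\<dots> \<le> 2 * (c * (1 + sqrt (V (Y (Suc j) \<omega>))))\<^sup>2 + 2 * (c * (1 + sqrt K) * (1 + sqrt (V (Y j \<omega>))))\<^sup>2"
    by (rule sq)
  also have "\<dots> = 2 * c\<^sup>2 * (1 + sqrt (V (Y (Suc j) \<omega>)))\<^sup>2 + 2 * c\<^sup>2 * (1 + sqrt K)\<^sup>2 * (1 + sqrt (V (Y j \<omega>)))\<^sup>2"
    by (simp add: power_mult_distrib)
  also have "\<dots> \<le> 2 * c\<^sup>2 * (2 * (1 + V (Y (Suc j) \<omega>))) + 2 * c\<^sup>2 * (1 + sqrt K)\<^sup>2 * (2 * (1 + V (Y j \<omega>)))"
    by (intro add_mono mult_left_mono one_plus_sqrt_squared_le) auto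
  also have "\<dots> = 4 * c\<^sup>2 * (1 + V (Y (Suc j) \<omega>)) + 4 * c\<^sup>2 * (1 + sqrt K)\<^sup>2 * (1 + V (Y j \<omega>))" by (simp add: algebra_simps)
  finally show ?thesis by simp
qed

lemma mart_diff_power2:
  assumes m: "(\<lambda>(\<omega>, y). g j \<omega> y) \<in> borel_measurable (F j \<Otimes>\<^sub>M borel)"
    and b: "\<And>\<omega>. \<omega> \<in> space M \<Longrightarrow> S.wbdd c (g j \<omega>)"
  shows "integrable M (\<lambda>\<omega>. (mart_diff g j \<omega>)\<^sup>2)"
    and "expectation (\<lambda>\<omega>. (mart_diff g j \<omega>)\<^sup>2) \<le> mart_const * c\<^sup>2"
proof -
  have [measurable]: "mart_diff g j \<in> borel_measurable M"
    by (rule measurable_F_M[OF mart_diff_measurable[where g=g and j=j, OF m]])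
  let ?b = "\<lambda>\<omega>. 4 * c\<^sup>2 * (1 + V (Y (Suc j) \<omega>)) + 4 * c\<^sup>2 * (1 + sqrt K)\<^sup>2 * (1 + V (Y j \<omega>))"
  have le: "(mart_diff g j \<omega>)\<^sup>2 \<le> ?b \<omega>" if "\<omega> \<in> space M" for \<omega>
    by (rule mart_diff_power2_le[where g=g and j=j, OF b[OF that]])
  have int: "integrable M ?b" using V_Y_integrable by simp
  show 1: "integrable M (\<lambda>\<omega>. (mart_diff g j \<omega>)\<^sup>2)"
    by (rule Bochner_Integration.integrable_bound[OF int])
       (use le in \<open>auto intro!: AE_I2 intro: order_trans[OF _ abs_ge_self]\<close>)
  have "expectation (\<lambda>\<omega>. (mart_diff g j \<omega>)\<^sup>2) \<le> expectation ?b"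
    using 1 int le by (intro integral_mono) auto
  also have "\<dots> = 4 * c\<^sup>2 * (1 + expectation (\<lambda>\<omega>. V (Y (Suc j) \<omega>))) + 4 * c\<^sup>2 * (1 + sqrt K)\<^sup>2 * (1 + expectation (\<lambda>\<omega>. V (Y j \<omega>)))"
    using V_Y_integrable by (simp add: prob_space)
  also have "\<dots> \<le> 4 * c\<^sup>2 * (1 + vbar) + 4 * c\<^sup>2 * (1 + sqrt K)\<^sup>2 * (1 + vbar)"
    using V_Y_le by (intro add_mono mult_left_mono add_left_mono) auto
  also have "\<dots> = mart_const * c\<^sup>2" by (simp add: mart_const_def algebra_simps)
  finally show "expectation (\<lambda>\<omega>. (mart_diff g j \<omega>)\<^sup>2) \<le> mart_const * c\<^sup>2" .
qed

lemma integrable_mult_square: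
  fixes f g :: "'w \<Rightarrow> real"
  assumes [measurable]: "f \<in> borel_measurable M" "g \<in> borel_measurable M"
    and "integrable M (\<lambda>\<omega>. (f \<omega>)\<^sup>2)" "integrable M (\<lambda>\<omega>. (g \<omega>)\<^sup>2)"
  shows "integrable M (\<lambda>\<omega>. f \<omega> * g \<omega>)"
proof (rule Bochner_Integration.integrable_bound)
  show "integrable M (\<lambda>\<omega>. (f \<omega>)\<^sup>2 + (g \<omega>)\<^sup>2)" using assms by simp
  have "\<bar>a * b\<bar> \<le> \<bar>a\<^sup>2 + b\<^sup>2\<bar>" for a b :: real
  proof -
    have "2 * \<bar>a * b\<bar> \<le> a\<^sup>2 + b\<^sup>2"
      using sum_squares_bound[of "\<bar>a\<bar>" "\<bar>b\<bar>"] by (simp add: abs_mult)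
    then show ?thesis by simp
  qed
  then show "AE \<omega> in M. norm (f \<omega> * g \<omega>) \<le> norm ((f \<omega>)\<^sup>2 + (g \<omega>)\<^sup>2)" by simp
qed simp

text \<open>Orthogonality of the increments: for a fixed past the integrand is Z times a function
  centred under \<open>P (Y j \<omega>)\<close>, so the inner integral vanishes. Square
  integrability of both factors makes the product integrable.\<close>

lemma expectation_mult_mart_diff:
  assumes m [measurable]: "(\<lambda>(\<omega>, y). g j \<omega> y) \<in> borel_measurable (F j \<Otimes>\<^sub>M borel)"
    and b: "\<And>\<omega>. \<omega> \<in> space M \<Longrightarrow> S.wbdd c (g j \<omega>)"
    and Z [measurable]: "Z \<in> borel_measurable (F j)"
    and Zint: "integrable M (\<lambda>\<omega>. (Z \<omega>)\<^sup>2)"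
  shows "integrable M (\<lambda>\<omega>. Z \<omega> * mart_diff g j \<omega>)" "expectation (\<lambda>\<omega>. Z \<omega> * mart_diff g j \<omega>) = 0"
proof -
  have [measurable]: "Z \<in> borel_measurable M" by (rule measurable_F_M[OF Z])
  have [measurable]: "mart_diff g j \<in> borel_measurable M"
    by (rule measurable_F_M[OF mart_diff_measurable[where g=g and j=j, OF m]])
  show i: "integrable M (\<lambda>\<omega>. Z \<omega> * mart_diff g j \<omega>)"
    using Zint mart_diff_power2[where g=g and j=j, OF m b] by (intro integrable_mult_square) auto
  let ?h = "\<lambda>\<omega>. \<integral>y. g j \<omega> y \<partial>P (Y j \<omega>)"
  let ?G = "\<lambda>\<omega> y. Z \<omega> * (g j \<omega> y - ?h \<omega>)"
  note step_measurable_F(2)[OF m, measurable]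
  have "expectation (\<lambda>\<omega>. ?G \<omega> (Y (Suc j) \<omega>)) = expectation (\<lambda>\<omega>. \<integral>y. ?G \<omega> y \<partial>P (Y j \<omega>))"
  proof (rule expectation_transition(2))
    show "(\<lambda>(\<omega>, y). ?G \<omega> y) \<in> borel_measurable (F j \<Otimes>\<^sub>M borel)" by measurable
    show "integrable M (\<lambda>\<omega>. ?G \<omega> (Y (Suc j) \<omega>))" using i by (simp add: mart_diff_def)
    show "integrable (P (Y j \<omega>)) (?G \<omega>)" if "\<omega> \<in> space M" for \<omega>
      using S.wbdd_integrable[OF b[OF that]] by simp
  qed
  also have "\<dots> = expectation (\<lambda>\<omega>. 0)"
    using S.wbdd_integrable[OF b] by (intro Bochner_Integration.integral_cong) auto
  finally show "expectation (\<lambda>\<omega>. Z \<omega> * mart_diff g j \<omega>) = 0" by (simp add: mart_diff_def)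
qed

lemma sum_mart_diff_measurable:
  assumes "\<And>j. j < n \<Longrightarrow> (\<lambda>(\<omega>, y). g j \<omega> y) \<in> borel_measurable (F j \<Otimes>\<^sub>M borel)"
  shows "(\<lambda>\<omega>. \<Sum>j<n. mart_diff g j \<omega>) \<in> borel_measurable (F n)"
  using assms by (intro borel_measurable_sum measurable_F_mono[OF mart_diff_measurable]) auto

lemma sum_mart_diff_power2:
  assumes m: "\<And>j. j < n \<Longrightarrow> (\<lambda>(\<omega>, y). g j \<omega> y) \<in> borel_measurable (F j \<Otimes>\<^sub>M borel)"
    and b: "\<And>j \<omega>. j < n \<Longrightarrow> \<omega> \<in> space M \<Longrightarrow> S.wbdd c (g j \<omega>)"
  shows "integrable M (\<lambda>\<omega>. (\<Sum>j<n. mart_diff g j \<omega>)\<^sup>2)"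
    and "expectation (\<lambda>\<omega>. (\<Sum>j<n. mart_diff g j \<omega>)\<^sup>2) \<le> real n * (mart_const * c\<^sup>2)"
proof -
  have "integrable M (\<lambda>\<omega>. (\<Sum>j<n. mart_diff g j \<omega>)\<^sup>2) \<and>
    expectation (\<lambda>\<omega>. (\<Sum>j<n. mart_diff g j \<omega>)\<^sup>2) \<le> real n * (mart_const * c\<^sup>2)"
    using m b
  proof (induction n)
    case (Suc n)
    let ?S = "\<lambda>\<omega>. \<Sum>j<n. mart_diff g j \<omega>"
    let ?m = "mart_diff g n"
    have IH: "integrable M (\<lambda>\<omega>. (?S \<omega>)\<^sup>2)" "expectation (\<lambda>\<omega>. (?S \<omega>)\<^sup>2) \<le> real n * (mart_const * c\<^sup>2)"
      using Suc by auto
    have S: "?S \<in> borel_measurable (F n)"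
      using Suc.prems(1) by (intro sum_mart_diff_measurable) auto
    note mm = Suc.prems(1)[OF lessI] and bb = Suc.prems(2)[OF lessI]
    note cross = expectation_mult_mart_diff[where g=g and j=n and Z="?S", OF mm bb S IH(1)]
    note sq = mart_diff_power2[where g=g and j=n, OF mm bb]
    have eq: "(\<Sum>j<Suc n. mart_diff g j \<omega>)\<^sup>2 = (?S \<omega>)\<^sup>2 + 2 * (?S \<omega> * ?m \<omega>) + (?m \<omega>)\<^sup>2" for \<omega>
      by (simp add: power2_sum)
    show ?case
      unfolding eq using IH cross sq by (simp add: algebra_simps)
  qed simp
  then show "integrable M (\<lambda>\<omega>. (\<Sum>j<n. mart_diff g j \<omega>)\<^sup>2)"
    "expectation (\<lambda>\<omega>. (\<Sum>j<n. mart_diff g j \<omega>)\<^sup>2) \<le> real n * (mart_const * c\<^sup>2)" by auto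
qed

lemma prob_abs_gt_le:
  assumes [measurable]: "Z \<in> borel_measurable M" and int: "integrable M (\<lambda>\<omega>. (Z \<omega>)\<^sup>2)" and a: "0 < a"
  shows "prob {\<omega>\<in>space M. a < \<bar>Z \<omega>\<bar>} \<le> expectation (\<lambda>\<omega>. (Z \<omega>)\<^sup>2) / a\<^sup>2"
proof -
  have "prob {\<omega>\<in>space M. a < \<bar>Z \<omega>\<bar>} \<le> prob {\<omega>\<in>space M. a\<^sup>2 \<le> (Z \<omega>)\<^sup>2}"
    using a by (intro finite_measure_mono) (auto simp: abs_le_square_iff[symmetric])
  also have "\<dots> \<le> expectation (\<lambda>\<omega>. (Z \<omega>)\<^sup>2) / a\<^sup>2"
    using a int by (intro integral_Markov_inequality_measure[where A="{}"]) auto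
  finally show ?thesis .
qed

text \<open>By the Poisson equation the sum is a martingale plus two boundary terms. Orthogonality
  makes the second moment of the martingale linear in n, and the boundary terms add a bounded
  amount.\<close>

lemma sum_centred_power2:
  assumes [measurable]: "\<phi> \<in> borel_measurable borel" and bd: "\<And>x. \<bar>\<phi> x\<bar> \<le> 1"
  obtains D where "0 \<le> D"
    "\<And>n. integrable M (\<lambda>\<omega>. (\<Sum>k<n. \<phi> (Y k \<omega>) - (\<integral>x. \<phi> x \<partial>mu))\<^sup>2)"
    "\<And>n. expectation (\<lambda>\<omega>. (\<Sum>k<n. \<phi> (Y k \<omega>) - (\<integral>x. \<phi> x \<partial>mu))\<^sup>2) \<le> D * (real n + 1)"
proof -
  have \<phi>: "S.wbdd 1 \<phi>"
    unfolding S.wbdd_def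
  proof (intro conjI allI)
    show "\<bar>\<phi> x\<bar> \<le> 1 * (1 + sqrt (V x))" for x
      by (rule order_trans[OF bd]) (simp add: V_nonneg)
  qed simp
  obtain D where D: "0 \<le> D" "S.wbdd (D * 1) (S.poisson_sol \<phi>)"
    and eq: "\<And>x. S.poisson_sol \<phi> x - kernel_op P (S.poisson_sol \<phi>) x = \<phi> x - (\<integral>y. \<phi> y \<partial>mu)"
    using S.poisson_sol \<phi> by metis
  let ?G = "S.poisson_sol \<phi>"
  have G: "S.wbdd D ?G" using D by simp
  have Gm [measurable]: "?G \<in> borel_measurable borel" using G by (rule S.wbdd_measurable)
  let ?g = "\<lambda>(j::nat) (\<omega>::'w) y. ?G y"
  have gm: "(\<lambda>(\<omega>, y). ?g j \<omega> y) \<in> borel_measurable (F j \<Otimes>\<^sub>M borel)" for j by measurable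
  have dec: "(\<Sum>k<n. \<phi> (Y k \<omega>) - (\<integral>x. \<phi> x \<partial>mu)) = (\<Sum>j<n. mart_diff ?g j \<omega>) + (?G (Y 0 \<omega>) - ?G (Y n \<omega>))" for n \<omega>
  proof -
    have "(\<Sum>k<n. \<phi> (Y k \<omega>) - (\<integral>x. \<phi> x \<partial>mu)) = (\<Sum>j<n. mart_diff ?g j \<omega> + (?G (Y j \<omega>) - ?G (Y (Suc j) \<omega>)))"
      by (intro sum.cong refl) (simp add: mart_diff_def eq[symmetric] kernel_op_def)
    then show ?thesis
      using sum_lessThan_telescope'[of "\<lambda>j. ?G (Y j \<omega>)" n] by (simp add: sum.distrib)
  qed
  define D' where "D' = 3 * (mart_const * D\<^sup>2) + 12 * D\<^sup>2 * (1 + vbar)"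
  have D': "0 \<le> D'" using mart_const_nonneg vbar_nonneg by (simp add: D'_def)
  let ?b = "\<lambda>n \<omega>. 3 * (\<Sum>j<n. mart_diff ?g j \<omega>)\<^sup>2 + 3 * (?G (Y 0 \<omega>))\<^sup>2 + 3 * (?G (Y n \<omega>))\<^sup>2"
  have sq3: "(a + (b - c))\<^sup>2 \<le> 3 * a\<^sup>2 + 3 * b\<^sup>2 + 3 * c\<^sup>2" for a b c :: real
    using zero_le_power2[of "a - b"] zero_le_power2[of "a + c"] zero_le_power2[of "b + c"]
    unfolding power2_eq_square by (simp only: algebra_simps)
  have le: "(\<Sum>k<n. \<phi> (Y k \<omega>) - (\<integral>x. \<phi> x \<partial>mu))\<^sup>2 \<le> ?b n \<omega>" for n \<omega>
    unfolding dec by (rule sq3)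
  note s2 = sum_mart_diff_power2[where g="?g" and c=D, OF gm G]
  have int: "integrable M (?b n)" for n using s2(1)[of n] S_wbdd_power2_Y(1)[OF G] by simp
  have 1: "integrable M (\<lambda>\<omega>. (\<Sum>k<n. \<phi> (Y k \<omega>) - (\<integral>x. \<phi> x \<partial>mu))\<^sup>2)" for n
    by (rule Bochner_Integration.integrable_bound[OF int[of n]])
       (use le in \<open>auto intro!: AE_I2 intro: order_trans[OF _ abs_ge_self]\<close>)
  have "expectation (\<lambda>\<omega>. (\<Sum>k<n. \<phi> (Y k \<omega>) - (\<integral>x. \<phi> x \<partial>mu))\<^sup>2) \<le> D' * (real n + 1)" for n
  proof -
    have "expectation (\<lambda>\<omega>. (\<Sum>k<n. \<phi> (Y k \<omega>) - (\<integral>x. \<phi> x \<partial>mu))\<^sup>2) \<le> expectation (?b n)"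
      using 1 int le by (intro integral_mono) auto
    also have "\<dots> = 3 * expectation (\<lambda>\<omega>. (\<Sum>j<n. mart_diff ?g j \<omega>)\<^sup>2) + 3 * expectation (\<lambda>\<omega>. (?G (Y 0 \<omega>))\<^sup>2) + 3 * expectation (\<lambda>\<omega>. (?G (Y n \<omega>))\<^sup>2)"
      using s2(1)[of n] S_wbdd_power2_Y(1)[OF G] by simp
    also have "\<dots> \<le> 3 * (real n * (mart_const * D\<^sup>2)) + 3 * (2 * D\<^sup>2 * (1 + vbar)) + 3 * (2 * D\<^sup>2 * (1 + vbar))"
      using s2(2)[of n] S_wbdd_power2_Y(2)[OF G] by (intro add_mono mult_left_mono) auto
    also have "\<dots> = real n * (3 * (mart_const * D\<^sup>2)) + 12 * D\<^sup>2 * (1 + vbar)" by (simp add: algebra_simps)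
    also have "\<dots> \<le> real n * D' + D'"
      using mart_const_nonneg vbar_nonneg by (intro add_mono mult_left_mono) (auto simp: D'_def)
    finally show ?thesis by (simp add: algebra_simps)
  qed
  then show ?thesis using that D' 1 by blast
qed

text \<open>The partial sums move by at most \<open>2\<close> per step, so their maximum is controlled on a grid with a
  bounded number of points; the second moments then suffice.\<close>

lemma max_sum_centred_tendsto:
  assumes \<phi> [measurable]: "\<phi> \<in> borel_measurable borel" and bd: "\<And>x. \<bar>\<phi> x\<bar> \<le> 1" and \<eta>: "0 < \<eta>"
  shows "(\<lambda>N. prob {\<omega>\<in>space M. \<exists>i\<le>N. \<eta> * real N < \<bar>\<Sum>k<i. \<phi> (Y k \<omega>) - (\<integral>x. \<phi> x \<partial>mu)\<bar>}) \<longlonglongrightarrow> 0"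
proof -
  interpret mu: prob_space mu by (rule V.prob_space_mu)
  let ?S = "\<lambda>i \<omega>. \<Sum>k<i. \<phi> (Y k \<omega>) - (\<integral>x. \<phi> x \<partial>mu)"
  obtain D where D: "0 \<le> D" and i2: "\<And>n. integrable M (\<lambda>\<omega>. (?S n \<omega>)\<^sup>2)"
    and e2: "\<And>n. expectation (\<lambda>\<omega>. (?S n \<omega>)\<^sup>2) \<le> D * (real n + 1)"
    using sum_centred_power2[OF \<phi> bd] by blast
  \<comment> \<open>Between neighbouring grid points the sum moves by at most
    \<open>2 * (N / m + 1)\<close>; with m and N both at least \<open>8 / \<eta>\<close> this is at
    most half of the level \<open>\<eta> * N\<close>.\<close>
  obtain m where m: "8 / \<eta> \<le> real m" using real_arch_simple by blast
  have "0 < 8 / \<eta>" using \<eta> by simp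
  then have m0: "0 < real m" using m by linarith
  have "\<bar>\<integral>x. \<phi> x \<partial>mu\<bar> \<le> (\<integral>x. 1 \<partial>mu)"
    using bd by (intro integral_abs_bound_integral mu.integrable_const_bound[where B=1]) auto
  then have mu1: "\<bar>\<integral>x. \<phi> x \<partial>mu\<bar> \<le> 1" by simp
  have step: "\<bar>?S (i + d) \<omega> - ?S i \<omega>\<bar> \<le> 2 * real d" for i d \<omega>
  proof (induction d)
    case (Suc d)
    have "\<bar>\<phi> (Y (i + d) \<omega>) - (\<integral>x. \<phi> x \<partial>mu)\<bar> \<le> 2"
      using bd[of "Y (i + d) \<omega>"] mu1 by linarith
    then show ?case using Suc by simp
  qed simp
  let ?b = "\<lambda>N. (real m + 1) * (D * (real m * (real N / real m + 1) + 1) / (\<eta> * real N / 2)\<^sup>2)"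
  have "prob {\<omega>\<in>space M. \<exists>i\<le>N. \<eta> * real N < \<bar>?S i \<omega>\<bar>} \<le> ?b N" if N: "8 / \<eta> \<le> real N" for N
  proof -
    have N0: "0 < real N" using N \<open>0 < 8 / \<eta>\<close> by linarith
    \<comment> \<open>Rounding up makes q positive and lets the points \<open>j * q\<close> with
      \<open>j \<le> m\<close> serve every \<open>i \<le> N\<close>.\<close>
    define q where "q = N div m + 1"
    have q: "real q \<le> real N / real m + 1" "0 < q"
      using of_nat_div_le_of_nat[of N m] by (auto simp: q_def)
    have "{\<omega>\<in>space M. \<exists>i\<le>N. \<eta> * real N < \<bar>?S i \<omega>\<bar>} \<subseteq> (\<Union>j\<in>{..m}. {\<omega>\<in>space M. \<eta> * real N / 2 < \<bar>?S (j * q) \<omega>\<bar>})"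
    proof safe
      fix \<omega> i assume \<omega>: "\<omega> \<in> space M" and i: "i \<le> N" and big: "\<eta> * real N < \<bar>?S i \<omega>\<bar>"
      have "i < Suc m * q"
      proof -
        have "N < m * (N div m + 1)"
          using m0 by (metis add.commute dividend_less_times_div mult.commute of_nat_0_less_iff plus_1_eq_Suc mult_Suc_right)
        then show ?thesis using i by (simp add: q_def)
      qed
      then have j: "i div q \<le> m" by (simp add: less_mult_imp_div_less flip: less_Suc_eq_le)
      have "\<bar>?S i \<omega> - ?S (i div q * q) \<omega>\<bar> \<le> 2 * real (i mod q)"
        using step[of \<omega> "i div q * q" "i mod q"] by simp
      also have "\<dots> \<le> 2 * (real N / real m + 1)"
      proof -
        have "real (i mod q) \<le> real q" using q(2) by (simp add: less_imp_le)
        then have "real (i mod q) \<le> real N / real m + 1" using q(1) by (rule order_trans)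
        then show ?thesis by (rule mult_left_mono) simp
      qed
      also have "\<dots> \<le> \<eta> * real N / 2"
      proof -
        have A: "real N / real m \<le> \<eta> * real N / 8" using m m0 \<eta> N0 by (simp add: field_simps)
        have B: "1 \<le> \<eta> * real N / 8" using N \<eta> by (simp add: field_simps)
        have "2 * (real N / real m + 1) \<le> 2 * (\<eta> * real N / 8 + \<eta> * real N / 8)"
          by (intro mult_left_mono add_mono A B) simp
        also have "\<dots> = \<eta> * real N / 2" by simp
        finally show ?thesis .
      qed
      finally have "\<eta> * real N / 2 < \<bar>?S (i div q * q) \<omega>\<bar>" using big by linarith
      then show "\<omega> \<in> (\<Union>j\<in>{..m}. {\<omega>\<in>space M. \<eta> * real N / 2 < \<bar>?S (j * q) \<omega>\<bar>})"
        using j \<omega> by blast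
    qed
    then have "prob {\<omega>\<in>space M. \<exists>i\<le>N. \<eta> * real N < \<bar>?S i \<omega>\<bar>} \<le> prob (\<Union>j\<in>{..m}. {\<omega>\<in>space M. \<eta> * real N / 2 < \<bar>?S (j * q) \<omega>\<bar>})"
      by (intro finite_measure_mono) auto
    also have "\<dots> \<le> (\<Sum>j\<in>{..m}. prob {\<omega>\<in>space M. \<eta> * real N / 2 < \<bar>?S (j * q) \<omega>\<bar>})"
      by (intro finite_measure_subadditive_finite) auto
    also have "\<dots> \<le> (\<Sum>j\<in>{..m}. D * (real m * (real N / real m + 1) + 1) / (\<eta> * real N / 2)\<^sup>2)"
    proof (rule sum_mono)
      fix j assume j: "j \<in> {..m}"
      have "prob {\<omega>\<in>space M. \<eta> * real N / 2 < \<bar>?S (j * q) \<omega>\<bar>} \<le> expectation (\<lambda>\<omega>. (?S (j * q) \<omega>)\<^sup>2) / (\<eta> * real N / 2)\<^sup>2"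
        using i2 \<eta> N0 by (intro prob_abs_gt_le) auto
      also have "\<dots> \<le> D * (real (j * q) + 1) / (\<eta> * real N / 2)\<^sup>2"
        by (intro divide_right_mono e2) auto
      also have "\<dots> \<le> D * (real m * (real N / real m + 1) + 1) / (\<eta> * real N / 2)\<^sup>2"
      proof (intro divide_right_mono mult_left_mono add_right_mono D)
        have "real j * real q \<le> real m * (real N / real m + 1)"
          using j q by (intro mult_mono) auto
        then show "real (j * q) \<le> real m * (real N / real m + 1)" by simp
      qed auto
      finally show "prob {\<omega>\<in>space M. \<eta> * real N / 2 < \<bar>?S (j * q) \<omega>\<bar>} \<le> D * (real m * (real N / real m + 1) + 1) / (\<eta> * real N / 2)\<^sup>2" .
    qed
    also have "\<dots> = ?b N" by simp
    finally show ?thesis .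
  qed
  note bnd = this
  have "\<forall>\<^sub>F N in sequentially. norm (prob {\<omega>\<in>space M. \<exists>i\<le>N. \<eta> * real N < \<bar>?S i \<omega>\<bar>}) \<le> ?b N"
    by (rule eventually_mono[OF eventually_ge_at_top[of "nat \<lceil>8 / \<eta>\<rceil>"]])
       (use bnd in \<open>simp add: nat_le_iff ceiling_le_iff\<close>)
  moreover have "?b \<longlonglongrightarrow> 0"
    using m0 \<eta> by real_asymp
  ultimately show ?thesis by (rule Lim_null_comparison)
qed

end

section \<open>Characteristic functions of the Poisson martingale\<close>

context ergodic_chain
begin

lemma integrable_bounded_mult:
  fixes Z :: "'w \<Rightarrow> complex" and X :: "'w \<Rightarrow> real"
  assumes [measurable]: "Z \<in> borel_measurable M" and bd: "\<And>\<omega>. norm (Z \<omega>) \<le> b" and X: "integrable M X"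
  shows "integrable M (\<lambda>\<omega>. Z \<omega> * of_real (X \<omega>))"
    and "norm (\<integral>\<omega>. Z \<omega> * of_real (X \<omega>) \<partial>M) \<le> b * (\<integral>\<omega>. \<bar>X \<omega>\<bar> \<partial>M)"
proof -
  have b: "0 \<le> b" using bd[of undefined] norm_ge_zero order_trans by blast
  have [measurable]: "X \<in> borel_measurable M" using X by simp
  have le: "norm (Z \<omega> * of_real (X \<omega>)) \<le> b * \<bar>X \<omega>\<bar>" for \<omega>
    using bd[of \<omega>] by (simp add: norm_mult mult_right_mono)
  have bX: "integrable M (\<lambda>\<omega>. b * \<bar>X \<omega>\<bar>)" using X by simp
  show i: "integrable M (\<lambda>\<omega>. Z \<omega> * of_real (X \<omega>))"
    by (rule Bochner_Integration.integrable_bound[OF bX]) (use le b in \<open>auto simp: abs_mult\<close>)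
  have "norm (\<integral>\<omega>. Z \<omega> * of_real (X \<omega>) \<partial>M) \<le> (\<integral>\<omega>. norm (Z \<omega> * of_real (X \<omega>)) \<partial>M)"
    by (rule integral_norm_bound)
  also have "\<dots> \<le> (\<integral>\<omega>. b * \<bar>X \<omega>\<bar> \<partial>M)"
    using i bX le by (intro integral_mono) auto
  finally show "norm (\<integral>\<omega>. Z \<omega> * of_real (X \<omega>) \<partial>M) \<le> b * (\<integral>\<omega>. \<bar>X \<omega>\<bar> \<partial>M)" by simp
qed

lemma complex_transition:
  fixes Z :: "'w \<Rightarrow> complex" and g :: "'w \<Rightarrow> 'a \<Rightarrow> real"
  assumes Z [measurable]: "Z \<in> borel_measurable (F n)" and bd: "\<And>\<omega>. norm (Z \<omega>) \<le> b"
    and g [measurable]: "(\<lambda>(\<omega>, y). g \<omega> y) \<in> borel_measurable (F n \<Otimes>\<^sub>M borel)"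
    and int: "integrable M (\<lambda>\<omega>. g \<omega> (Y (Suc n) \<omega>))"
    and intP: "\<And>\<omega>. \<omega> \<in> space M \<Longrightarrow> integrable (P (Y n \<omega>)) (g \<omega>)"
  shows "(\<integral>\<omega>. Z \<omega> * of_real (g \<omega> (Y (Suc n) \<omega>)) \<partial>M) = (\<integral>\<omega>. Z \<omega> * of_real (\<integral>y. g \<omega> y \<partial>P (Y n \<omega>)) \<partial>M)"
proof -
  have ZM [measurable]: "Z \<in> borel_measurable M" by (rule measurable_F_M[OF Z])
  note i1 = integrable_bounded_mult(1)[OF ZM bd int]
  note i2 = integrable_bounded_mult(1)[OF ZM bd expectation_transition(1)[OF g int intP]]
  have real: "(\<integral>\<omega>. z (Z \<omega>) * g \<omega> (Y (Suc n) \<omega>) \<partial>M) = (\<integral>\<omega>. z (Z \<omega>) * (\<integral>y. g \<omega> y \<partial>P (Y n \<omega>)) \<partial>M)"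
    if [measurable]: "z \<in> borel_measurable borel"
      and i: "integrable M (\<lambda>\<omega>. z (Z \<omega>) * g \<omega> (Y (Suc n) \<omega>))" for z :: "complex \<Rightarrow> real"
  proof -
    have "(\<integral>\<omega>. z (Z \<omega>) * g \<omega> (Y (Suc n) \<omega>) \<partial>M) = (\<integral>\<omega>. (\<integral>y. z (Z \<omega>) * g \<omega> y \<partial>P (Y n \<omega>)) \<partial>M)"
    proof (rule expectation_transition(2)[where g="\<lambda>\<omega> y. z (Z \<omega>) * g \<omega> y"])
      show "(\<lambda>(\<omega>, y). z (Z \<omega>) * g \<omega> y) \<in> borel_measurable (F n \<Otimes>\<^sub>M borel)" by measurable
      show "integrable (P (Y n \<omega>)) (\<lambda>y. z (Z \<omega>) * g \<omega> y)" if "\<omega> \<in> space M" for \<omega>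
        using intP[OF that] by simp
    qed (rule i)
    then show ?thesis by simp
  qed
  show ?thesis
  proof (rule complex_eqI)
    have "integrable M (\<lambda>\<omega>. Re (Z \<omega> * of_real (g \<omega> (Y (Suc n) \<omega>))))" using i1 by (rule integrable_Re)
    then have "(\<integral>\<omega>. Re (Z \<omega>) * g \<omega> (Y (Suc n) \<omega>) \<partial>M) = (\<integral>\<omega>. Re (Z \<omega>) * (\<integral>y. g \<omega> y \<partial>P (Y n \<omega>)) \<partial>M)"
      by (intro real) simp_all
    then show "Re (\<integral>\<omega>. Z \<omega> * of_real (g \<omega> (Y (Suc n) \<omega>)) \<partial>M) = Re (\<integral>\<omega>. Z \<omega> * of_real (\<integral>y. g \<omega> y \<partial>P (Y n \<omega>)) \<partial>M)"
      using integral_Re[OF i1] integral_Re[OF i2] by simp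
    have "integrable M (\<lambda>\<omega>. Im (Z \<omega> * of_real (g \<omega> (Y (Suc n) \<omega>))))" using i1 by (rule integrable_Im)
    then have "(\<integral>\<omega>. Im (Z \<omega>) * g \<omega> (Y (Suc n) \<omega>) \<partial>M) = (\<integral>\<omega>. Im (Z \<omega>) * (\<integral>y. g \<omega> y \<partial>P (Y n \<omega>)) \<partial>M)"
      by (intro real) simp_all
    then show "Im (\<integral>\<omega>. Z \<omega> * of_real (g \<omega> (Y (Suc n) \<omega>)) \<partial>M) = Im (\<integral>\<omega>. Z \<omega> * of_real (\<integral>y. g \<omega> y \<partial>P (Y n \<omega>)) \<partial>M)"
      using integral_Im[OF i1] integral_Im[OF i2] by simp
  qed
qed

text \<open>Up to constants this dominates the increment of the Poisson martingale from time k to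
  \<open>Suc k\<close>, its square, and the solution of the second Poisson equation at time
  \<open>Suc k\<close>, so that one Lindeberg quantity serves for all error terms.\<close>

definition kernel_weight :: "nat \<Rightarrow> 'w \<Rightarrow> real" where
  "kernel_weight k \<omega> = (1 + V (Y k \<omega>)) + (1 + V (Y (Suc k) \<omega>))"

lemma kernel_weight_pos: "0 < kernel_weight k \<omega>" using V_nonneg by (simp add: kernel_weight_def add_pos_nonneg)

lemma kernel_weight_measurable [measurable]: "kernel_weight k \<in> borel_measurable M"
  unfolding kernel_weight_def[abs_def] by measurable

lemma kernel_weight_integrable: "integrable M (kernel_weight k)"
  unfolding kernel_weight_def[abs_def] using V_Y_integrable by simp

lemma kernel_weight_min_integrable: "0 \<le> \<delta> \<Longrightarrow> integrable M (\<lambda>\<omega>. kernel_weight k \<omega> * min 1 (\<delta> * kernel_weight k \<omega>))"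
  by (rule Bochner_Integration.integrable_bound[OF kernel_weight_integrable[of k]])
     (use kernel_weight_pos[of k, THEN less_imp_le] in \<open>auto simp: abs_mult mult_left_le\<close>)

text \<open>A Lindeberg condition that uses only first moments of \<open>V\<close>. The truncated
  weight splits into functions of single states, whose averages are compared with an integral under
  \<open>mu\<close>; that integral tends to 0 by dominated convergence with majorant
  \<open>1 + V\<close>.\<close>

lemma cesaro_qk_min_tendsto:
  assumes \<delta>: "\<delta> \<longlonglongrightarrow> 0" "\<And>N. 0 \<le> \<delta> N"
  shows "(\<lambda>N. (\<Sum>k<N. \<integral>\<omega>. kernel_weight k \<omega> * min 1 (\<delta> N * kernel_weight k \<omega>) \<partial>M) / real N) \<longlonglongrightarrow> 0"
proof -
  define \<psi> where "\<psi> d x = (1 + V x) * min 1 (d * (1 + V x))" for d x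
  have \<psi>0: "0 \<le> \<psi> d x" "\<psi> d x \<le> 1 + V x" if "0 \<le> d" for d x
    using that V_nonneg[of x] by (auto simp: \<psi>_def mult_left_le)
  have [measurable]: "\<psi> d \<in> borel_measurable borel" for d unfolding \<psi>_def[abs_def] by measurable
  have \<psi>b: "V.wbdd 1 (\<psi> d)" if "0 \<le> d" for d
    using \<psi>0[OF that] by (auto simp: V.wbdd_def)
  obtain B where B: "0 \<le> B" and sum_le: "\<And>f c N. V.wbdd c f \<Longrightarrow>
    (\<Sum>k<N. expectation (\<lambda>\<omega>. f (Y k \<omega>))) \<le> real N * (\<integral>x. f x \<partial>mu) + B * c"
    using sum_expectation_le by metis
  have lim: "(\<lambda>N. \<integral>x. \<psi> (\<delta> N) x \<partial>mu) \<longlonglongrightarrow> (\<integral>x. 0 \<partial>mu)"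
  proof (rule integral_dominated_convergence[where w="\<lambda>x. 1 + V x" and f="\<lambda>_. 0" and s="\<lambda>N. \<psi> (\<delta> N)"])
    have "(\<lambda>N. \<psi> (\<delta> N) x) \<longlonglongrightarrow> (1 + V x) * min 1 (0 * (1 + V x))" for x
      unfolding \<psi>_def by (intro tendsto_mult tendsto_const tendsto_min \<delta>)
    then show "AE x in mu. (\<lambda>N. \<psi> (\<delta> N) x) \<longlonglongrightarrow> 0" by simp
    show "AE x in mu. norm (\<psi> (\<delta> N) x) \<le> 1 + V x" for N
      using \<psi>0[OF \<delta>(2)] by (intro AE_I2) simp
    show "integrable mu (\<lambda>x. 1 + V x)" using V.W_integrable_mu by simp
  qed measurable
  \<comment> \<open>Doubling the argument of \<open>t * min 1 (d * t)\<close> multiplies its value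
    by at most 4, and \<open>a + b\<close> is at most twice the larger of the two.\<close>
  have q: "(a + b) * min 1 (d * (a + b)) \<le> 4 * (a * min 1 (d * a) + b * min 1 (d * b))"
    if "0 \<le> a" "0 \<le> b" "0 \<le> d" for a b d :: real
  proof -
    have *: "(a + b) * min 1 (d * (a + b)) \<le> 4 * (b * min 1 (d * b))" if "a \<le> b" "0 \<le> a" "0 \<le> b" for a b
    proof -
      have "(a + b) * min 1 (d * (a + b)) \<le> (2 * b) * (2 * min 1 (d * b))"
      proof (rule mult_mono)
        have "d * (a + b) \<le> d * (2 * b)" using that \<open>0 \<le> d\<close> by (intro mult_left_mono) auto
        then show "min 1 (d * (a + b)) \<le> 2 * min 1 (d * b)" by (auto simp: min_def)
      qed (use that \<open>0 \<le> d\<close> in auto)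
      then show ?thesis by (simp add: mult_ac)
    qed
    have nn: "0 \<le> a * min 1 (d * a)" "0 \<le> b * min 1 (d * b)" using that by auto
    show ?thesis
    proof (cases "a \<le> b")
      case True then show ?thesis using *[OF True that(1,2)] nn by argo
    next
      case False
      then have "b \<le> a" by simp
      from *[OF this that(2,1)] show ?thesis using nn by (simp only: add.commute[of b a]) argo
    qed
  qed
  let ?x = "\<lambda>N. (\<Sum>k<N. \<integral>\<omega>. kernel_weight k \<omega> * min 1 (\<delta> N * kernel_weight k \<omega>) \<partial>M) / real N"
  have le: "?x N \<le> 8 * ((real N + 1) * (\<integral>x. \<psi> (\<delta> N) x \<partial>mu) + B) / real N" for N
  proof -
    note \<psi>N = \<psi>b[OF \<delta>(2)[of N]]
    have i: "integrable M (\<lambda>\<omega>. \<psi> (\<delta> N) (Y k \<omega>))" for k by (rule wbdd_Y_integrable[OF \<psi>N])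
    let ?e = "\<lambda>k. expectation (\<lambda>\<omega>. \<psi> (\<delta> N) (Y k \<omega>))"
    have e0: "0 \<le> ?e k" for k using \<psi>0[OF \<delta>(2)[of N]] by simp
    have pw: "kernel_weight k \<omega> * min 1 (\<delta> N * kernel_weight k \<omega>) \<le> 4 * (\<psi> (\<delta> N) (Y k \<omega>) + \<psi> (\<delta> N) (Y (Suc k) \<omega>))" for k \<omega>
      unfolding kernel_weight_def \<psi>_def using V_nonneg \<delta>(2) by (intro q) (simp_all add: add_nonneg_nonneg)
    have "(\<integral>\<omega>. kernel_weight k \<omega> * min 1 (\<delta> N * kernel_weight k \<omega>) \<partial>M) \<le> 4 * (?e k + ?e (Suc k))" for k
    proof -
      have "(\<integral>\<omega>. kernel_weight k \<omega> * min 1 (\<delta> N * kernel_weight k \<omega>) \<partial>M) \<le> (\<integral>\<omega>. 4 * (\<psi> (\<delta> N) (Y k \<omega>) + \<psi> (\<delta> N) (Y (Suc k) \<omega>)) \<partial>M)"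
        using i kernel_weight_min_integrable[OF \<delta>(2)] pw by (intro integral_mono) simp_all
      also have "\<dots> = 4 * (?e k + ?e (Suc k))" using i by simp
      finally show ?thesis .
    qed
    then have "(\<Sum>k<N. \<integral>\<omega>. kernel_weight k \<omega> * min 1 (\<delta> N * kernel_weight k \<omega>) \<partial>M) \<le> (\<Sum>k<N. 4 * (?e k + ?e (Suc k)))"
      by (intro sum_mono)
    also have "\<dots> = 4 * ((\<Sum>k<N. ?e k) + (\<Sum>k<N. ?e (Suc k)))" by (simp add: sum.distrib sum_distrib_left)
    also have "\<dots> \<le> 4 * ((\<Sum>k<Suc N. ?e k) + (\<Sum>k<Suc N. ?e k))"
    proof (intro mult_left_mono add_mono)
      show "(\<Sum>k<N. ?e k) \<le> (\<Sum>k<Suc N. ?e k)" using e0[of N] by simp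
      show "(\<Sum>k<N. ?e (Suc k)) \<le> (\<Sum>k<Suc N. ?e k)"
        using e0[of 0] by (simp add: sum.lessThan_Suc_shift del: sum.lessThan_Suc)
    qed simp
    also have "\<dots> \<le> 8 * ((real N + 1) * (\<integral>x. \<psi> (\<delta> N) x \<partial>mu) + B)"
      using sum_le[OF \<psi>N, of "Suc N"] by (simp add: algebra_simps)
    finally show ?thesis by (intro divide_right_mono) auto
  qed
  have "(\<lambda>N. 8 * ((real N + 1) * (\<integral>x. \<psi> (\<delta> N) x \<partial>mu) + B) / real N) \<longlonglongrightarrow> 8 * (1 * 0) + 0"
  proof (rule Lim_transform_eventually)
    have "(\<lambda>N. 8 * ((1 + 1 / real N) * (\<integral>x. \<psi> (\<delta> N) x \<partial>mu)) + 8 * B / real N) \<longlonglongrightarrow> 8 * ((1 + 0) * 0) + 0"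
      using lim by (intro tendsto_add tendsto_mult tendsto_const lim_const_over_n) simp
    then show "(\<lambda>N. 8 * ((1 + 1 / real N) * (\<integral>x. \<psi> (\<delta> N) x \<partial>mu)) + 8 * B / real N) \<longlonglongrightarrow> 8 * (1 * 0) + 0" by simp
    show "\<forall>\<^sub>F N in sequentially. 8 * ((1 + 1 / real N) * (\<integral>x. \<psi> (\<delta> N) x \<partial>mu)) + 8 * B / real N
        = 8 * ((real N + 1) * (\<integral>x. \<psi> (\<delta> N) x \<partial>mu) + B) / real N"
      using eventually_gt_at_top[of 0] by eventually_elim (simp add: field_simps)
  qed
  then have lim2: "(\<lambda>N. 8 * ((real N + 1) * (\<integral>x. \<psi> (\<delta> N) x \<partial>mu) + B) / real N) \<longlonglongrightarrow> 0" by simp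
  show ?thesis
  proof (rule tendsto_sandwich[OF _ _ tendsto_const lim2])
    show "\<forall>\<^sub>F N in sequentially. 0 \<le> ?x N"
      using kernel_weight_pos[THEN less_imp_le] \<delta>(2)
      by (intro always_eventually allI divide_nonneg_nonneg sum_nonneg integral_nonneg_AE AE_I2) auto
  qed (use le in auto)
qed

end

text \<open>The cubic error bound serves for small x and the quadratic one for large x; the minimum
  never costs more than a second moment.\<close>

lemma norm_iexp_taylor2_le:
  "norm (iexp x - (1 + \<i> * of_real x - of_real (x\<^sup>2 / 2))) \<le> x\<^sup>2 * min 1 \<bar>x\<bar>"
proof -
  have e: "(\<Sum>k\<le>2. (\<i> * of_real x)^k / fact k) = 1 + \<i> * of_real x - of_real (x\<^sup>2 / 2)"
    by (simp add: numeral_2_eq_2 power_mult_distrib)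
  have 1: "norm (iexp x - (1 + \<i> * of_real x - of_real (x\<^sup>2 / 2))) \<le> \<bar>x\<bar> ^ 3"
  proof -
    have "norm (iexp x - (1 + \<i> * of_real x - of_real (x\<^sup>2 / 2))) \<le> \<bar>x\<bar> ^ 3 / 6"
      using iexp_approx1[of x 2] unfolding e by (simp add: numeral_3_eq_3 fact_numeral)
    also have "\<dots> \<le> \<bar>x\<bar> ^ 3" by simp
    finally show ?thesis .
  qed
  have 2: "norm (iexp x - (1 + \<i> * of_real x - of_real (x\<^sup>2 / 2))) \<le> x\<^sup>2"
    using iexp_approx2[of x 2] unfolding e by (simp add: fact_numeral)
  have "\<bar>x\<bar> ^ 3 = x\<^sup>2 * \<bar>x\<bar>" by (simp add: power3_eq_cube power2_eq_square)
  with 1 2 show ?thesis by (auto simp: min_def)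
qed

lemma norm_iexp_minus_1_le: "norm (iexp x - 1) \<le> 2 * min 1 \<bar>x\<bar>"
  using iexp_approx1[of x 0] iexp_approx2[of x 0] by (auto simp: min_def)

context ergodic_chain
begin

definition pois_mart :: "('a \<Rightarrow> real) \<Rightarrow> nat \<Rightarrow> 'w \<Rightarrow> real" where
  "pois_mart G k \<omega> = G (Y (Suc k) \<omega>) - kernel_op P G (Y k \<omega>)"

lemma pois_mart_eq: "pois_mart G = mart_diff (\<lambda>_ _. G)"
  by (intro ext) (simp add: pois_mart_def mart_diff_def kernel_op_def)

definition cond_var :: "('a \<Rightarrow> real) \<Rightarrow> 'a \<Rightarrow> real" where
  "cond_var G x = kernel_op P (\<lambda>y. (G y)\<^sup>2) x - (kernel_op P G x)\<^sup>2"

lemma cond_var_wbdd: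
  assumes "S.wbdd c G" shows "\<exists>c'. V.wbdd c' (cond_var G)"
  unfolding cond_var_def[abs_def]
  using V.wbdd_diff[OF V.wbdd_kernel_op[OF S_wbdd_power2[OF assms]] S_wbdd_power2[OF S.wbdd_kernel_op[OF assms]]]
  by blast

lemma S_integrable_kernel:
  assumes "S.wbdd c G" shows "integrable (P x) G" "integrable (P x) (\<lambda>y. (G y)\<^sup>2)"
  using S.wbdd_integrable[OF assms] V.wbdd_integrable[OF S_wbdd_power2[OF assms]] by auto

lemma cond_var_eq:
  assumes "S.wbdd c G"
  shows "(\<integral>y. (G y - kernel_op P G x)\<^sup>2 \<partial>P x) = cond_var G x"
    and "integrable (P x) (\<lambda>y. (G y - kernel_op P G x)\<^sup>2)"
proof -
  have eq: "(G y - kernel_op P G x)\<^sup>2 = (G y)\<^sup>2 - 2 * kernel_op P G x * G y + (kernel_op P G x)\<^sup>2" for y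
    by (simp add: power2_diff algebra_simps)
  show "integrable (P x) (\<lambda>y. (G y - kernel_op P G x)\<^sup>2)"
    unfolding eq using S_integrable_kernel[OF assms, of x] by simp
  have "(\<integral>y. (G y - kernel_op P G x)\<^sup>2 \<partial>P x)
      = (\<integral>y. (G y)\<^sup>2 \<partial>P x) - 2 * kernel_op P G x * (\<integral>y. G y \<partial>P x) + (kernel_op P G x)\<^sup>2"
    unfolding eq using S_integrable_kernel[OF assms, of x] by simp
  then show "(\<integral>y. (G y - kernel_op P G x)\<^sup>2 \<partial>P x) = cond_var G x"
    by (simp add: cond_var_def kernel_op_def power2_eq_square)
qed

lemma cond_var_nonneg:
  assumes "S.wbdd c G" shows "0 \<le> cond_var G x"
proof -
  have "0 \<le> (\<integral>y. (G y - kernel_op P G x)\<^sup>2 \<partial>P x)" by simp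
  then show ?thesis by (simp only: cond_var_eq(1)[OF assms])
qed

lemma mean_cond_var:
  assumes G: "S.wbdd c G"
  shows "(\<integral>x. cond_var G x \<partial>mu) = (\<integral>x. (G x)\<^sup>2 \<partial>mu) - (\<integral>x. (kernel_op P G x)\<^sup>2 \<partial>mu)"
  using V.wbdd_integrable_mu[OF V.wbdd_kernel_op[OF S_wbdd_power2[OF G]]]
    V.wbdd_integrable_mu[OF S_wbdd_power2[OF S.wbdd_kernel_op[OF G]]]
    V.integral_mu_kernel_op[OF S_wbdd_power2[OF G]]
  by (simp add: cond_var_def)

text \<open>Summation by parts: \<open>B k\<close> is a perturbation of \<open>A (Suc k)\<close>, so
  the sum telescopes up to two end values and the perturbations.\<close>

lemma sum_shift_bound:
  fixes A B :: "nat \<Rightarrow> complex"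
  assumes "\<And>k. k \<le> N \<Longrightarrow> norm (A k) \<le> a" and "\<And>k. k < N \<Longrightarrow> norm (A (Suc k) - B k) \<le> b k"
  shows "norm (\<Sum>k<N. A k - B k) \<le> 2 * a + (\<Sum>k<N. b k)"
proof -
  have "(\<Sum>k<N. A k - B k) = (\<Sum>k<N. A k - A (Suc k)) + (\<Sum>k<N. A (Suc k) - B k)"
    by (simp flip: sum.distrib)
  also have "\<dots> = A 0 - A N + (\<Sum>k<N. A (Suc k) - B k)" by (simp only: sum_lessThan_telescope')
  also have "norm \<dots> \<le> norm (A 0) + norm (A N) + norm (\<Sum>k<N. A (Suc k) - B k)"
    by (rule order_trans[OF norm_triangle_ineq]) (simp add: norm_triangle_ineq4)
  also have "\<dots> \<le> a + a + (\<Sum>k<N. b k)"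
    using assms by (intro add_mono order_trans[OF norm_sum] sum_mono) auto
  finally show ?thesis by simp
qed

text \<open>Telescoping \<open>exp (a k) * E (exp (\<i> \<theta> S\<^sub>k))\<close> with \<open>a = \<theta>\<^sup>2 \<sigma>\<^sup>2 / 2\<close>: the second order terms
  leave \<open>cond_var G (Y k) - \<sigma>\<^sup>2 = H (Y k) - P H (Y k)\<close>, which is summed by parts.\<close>

lemma char_martingale_bound:
  assumes G: "S.wbdd c G"
  defines "\<sigma>2 \<equiv> (\<integral>x. (G x)\<^sup>2 \<partial>mu) - (\<integral>x. (kernel_op P G x)\<^sup>2 \<partial>mu)"
  obtains C where "0 \<le> C" "0 \<le> \<sigma>2"
    "\<And>\<theta> a N. a = \<theta>\<^sup>2 * \<sigma>2 / 2 \<Longrightarrow>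
      norm (of_real (exp (a * real N)) * (\<integral>\<omega>. iexp (\<theta> * (\<Sum>k<N. pois_mart G k \<omega>)) \<partial>M) - 1)
      \<le> exp (a * (real N + 1)) * (C * \<theta>\<^sup>2 * (1 + real N * (exp a - 1) +
          (\<Sum>k<N. \<integral>\<omega>. kernel_weight k \<omega> * min 1 (C * \<bar>\<theta>\<bar> * kernel_weight k \<omega>) \<partial>M)) + real N * a\<^sup>2)"
proof -
  have c: "0 \<le> c" using G by (rule S.wbdd_nonneg)
  let ?d = "pois_mart G"
  let ?h = "cond_var G"
  obtain c' where h: "V.wbdd c' ?h" using cond_var_wbdd[OF G] by blast
  have muh: "(\<integral>x. ?h x \<partial>mu) = \<sigma>2" unfolding \<sigma>2_def by (rule mean_cond_var[OF G])
  have \<sigma>2: "0 \<le> \<sigma>2" unfolding muh[symmetric] using cond_var_nonneg[OF G] by simp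
  \<comment> \<open>The conditional variance is controlled only at weight \<open>V\<close>, so this
    second Poisson equation is solved in the \<open>V\<close> instance of the ergodic
    theory.\<close>
  obtain D where D: "V.wbdd (D * c') (V.poisson_sol ?h)"
    and Heq: "\<And>x. V.poisson_sol ?h x - kernel_op P (V.poisson_sol ?h) x = ?h x - \<sigma>2"
    using V.poisson_sol h muh by metis
  define H where "H = V.poisson_sol ?h"
  define b where "b = D * c'"
  have H: "V.wbdd b H" using D by (simp add: H_def b_def)
  have b: "0 \<le> b" using H by (rule V.wbdd_nonneg)
  have Hm [measurable]: "H \<in> borel_measurable borel" using H by (rule V.wbdd_measurable)
  have hm [measurable]: "?h \<in> borel_measurable borel" using h by (rule V.wbdd_measurable)
  have Gm [measurable]: "G \<in> borel_measurable borel" using G by (rule S.wbdd_measurable)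
  have gm: "(\<lambda>(\<omega>::'w, y). G y) \<in> borel_measurable (F j \<Otimes>\<^sub>M borel)" for j by measurable
  define k1 where "k1 = 2 * c * (1 + sqrt K)"
  define k2 where "k2 = 4 * c\<^sup>2 * (1 + sqrt K)\<^sup>2"
  have kk: "0 \<le> k1" "0 \<le> k2" "c \<le> c * (1 + sqrt K)" "c\<^sup>2 \<le> c\<^sup>2 * (1 + sqrt K)\<^sup>2"
    using c K_nonneg by (auto simp: k1_def k2_def mult_le_cancel_left1 one_le_power)
  have d1: "\<bar>?d k \<omega>\<bar> \<le> k1 * kernel_weight k \<omega>" for k \<omega>
  proof -
    have s: "1 + sqrt (V x) \<le> 2 * (1 + V x)" "0 \<le> 1 + sqrt (V x)" for x
      using sqrt_V_le[of x] V_nonneg[of x] by (argo, simp)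
    have "\<bar>?d k \<omega>\<bar> \<le> c * (1 + sqrt (V (Y (Suc k) \<omega>))) + c * (1 + sqrt K) * (1 + sqrt (V (Y k \<omega>)))"
      unfolding pois_mart_eq using mart_diff_abs_le[of c "\<lambda>_ _. G" k \<omega>] G by simp
    also have "\<dots> \<le> c * (1 + sqrt K) * (2 * (1 + V (Y (Suc k) \<omega>))) + c * (1 + sqrt K) * (2 * (1 + V (Y k \<omega>)))"
      using kk(3) c K_nonneg s by (intro add_mono mult_mono) auto
    also have "\<dots> = k1 * kernel_weight k \<omega>" by (simp add: k1_def kernel_weight_def algebra_simps)
    finally show ?thesis .
  qed
  have d2: "(?d k \<omega>)\<^sup>2 \<le> k2 * kernel_weight k \<omega>" for k \<omega>
  proof -
    have "(?d k \<omega>)\<^sup>2 \<le> 4 * c\<^sup>2 * (1 + V (Y (Suc k) \<omega>)) + 4 * c\<^sup>2 * (1 + sqrt K)\<^sup>2 * (1 + V (Y k \<omega>))"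
      unfolding pois_mart_eq using mart_diff_power2_le[of c "\<lambda>_ _. G" k \<omega>] G by simp
    also have "\<dots> \<le> k2 * (1 + V (Y (Suc k) \<omega>)) + k2 * (1 + V (Y k \<omega>))"
      using kk(4) V_nonneg by (intro add_mono mult_right_mono) (auto simp: k2_def)
    finally show ?thesis by (simp add: kernel_weight_def algebra_simps)
  qed
  have dm [measurable]: "?d k \<in> borel_measurable (F (Suc k))" for k
    unfolding pois_mart_eq by (rule mart_diff_measurable[where g="\<lambda>_ _. G", OF gm])
  have dM [measurable]: "?d k \<in> borel_measurable M" for k by (rule measurable_F_M[OF dm])
  have d2int: "integrable M (\<lambda>\<omega>. (?d k \<omega>)\<^sup>2)" for k
    unfolding pois_mart_eq by (rule mart_diff_power2(1)[where g="\<lambda>_ _. G", OF gm G])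
  have dint: "integrable M (?d k)" for k
    by (rule square_integrable_imp_integrable[OF dM d2int])
  \<comment> \<open>One constant for all error terms. It also appears inside the minimum, where it
    has to dominate \<open>k1\<close>, the constant of the increments.\<close>
  define C where "C = 2 * (b * (1 + vbar) + b + k1 + k2 + 1)"
  have C: "0 \<le> C" "b * (1 + vbar) * 2 \<le> C" "b * 2 + k2 \<le> C" "k1 \<le> C"
    using b kk vbar_nonneg by (auto simp: C_def)
  have "norm (of_real (exp (a * real N)) * (\<integral>\<omega>. iexp (\<theta> * (\<Sum>k<N. ?d k \<omega>)) \<partial>M) - 1)
      \<le> exp (a * (real N + 1)) * (C * \<theta>\<^sup>2 * (1 + real N * (exp a - 1) +
          (\<Sum>k<N. \<integral>\<omega>. kernel_weight k \<omega> * min 1 (C * \<bar>\<theta>\<bar> * kernel_weight k \<omega>) \<partial>M)) + real N * a\<^sup>2)"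
    if a: "a = \<theta>\<^sup>2 * \<sigma>2 / 2" for a \<theta> N
  proof -
    have a0: "0 \<le> a" unfolding a using \<sigma>2 by simp
    define e where "e k \<omega> = iexp (\<theta> * (\<Sum>j<k. ?d j \<omega>))" for k \<omega>
    define w where "w k = exp (a * real k)" for k
    define W where "W = exp (a * (real N + 1))"
    have w: "0 < w k" "w (Suc k) = w k * exp a" for k by (auto simp: w_def algebra_simps exp_add)
    have wW: "w k \<le> W" if "k \<le> Suc N" for k using that a0 by (auto simp: w_def W_def intro!: mult_left_mono)
    have W: "0 < W" by (simp add: W_def)
    have en: "norm (e k \<omega>) = 1" for k \<omega> by (simp add: e_def)
    have em [measurable]: "e k \<in> borel_measurable (F k)" for k
    proof -
      have "(\<lambda>\<omega>. \<Sum>j<k. ?d j \<omega>) \<in> borel_measurable (F k)"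
        by (intro borel_measurable_sum measurable_F_mono[OF dm]) auto
      then show ?thesis unfolding e_def[abs_def] by measurable
    qed
    have eM [measurable]: "e k \<in> borel_measurable M" for k by (rule measurable_F_M[OF em])
    have eint: "integrable M (e k)" for k
      by (rule integrable_const_bound[where B=1]) (simp_all add: en)
    have eS: "e (Suc k) \<omega> = e k \<omega> * iexp (\<theta> * ?d k \<omega>)" for k \<omega>
      by (simp add: e_def ring_distribs exp_add)
    define q where "q k \<omega> = kernel_weight k \<omega> * min 1 (C * \<bar>\<theta>\<bar> * kernel_weight k \<omega>)" for k \<omega>
    have qint: "integrable M (q k)" for k
      unfolding q_def[abs_def] using C by (intro kernel_weight_min_integrable) simp
    have q0: "0 \<le> q k \<omega>" for k \<omega> unfolding q_def using kernel_weight_pos[of k \<omega>] C by simp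
    have td: "min 1 \<bar>\<theta> * ?d k \<omega>\<bar> \<le> min 1 (C * \<bar>\<theta>\<bar> * kernel_weight k \<omega>)" for k \<omega>
    proof -
      have "\<bar>\<theta> * ?d k \<omega>\<bar> \<le> \<bar>\<theta>\<bar> * (C * kernel_weight k \<omega>)"
        unfolding abs_mult using C(4) kernel_weight_pos[of k \<omega>] d1[of k \<omega>]
        by (intro mult_left_mono order_trans[OF d1] mult_right_mono) auto
      then show ?thesis by (auto simp: mult_ac min_def)
    qed
    define rr where "rr k \<omega> = iexp (\<theta> * ?d k \<omega>) - (1 + \<i> * of_real (\<theta> * ?d k \<omega>) - of_real ((\<theta> * ?d k \<omega>)\<^sup>2 / 2))" for k \<omega>
    have rrm [measurable]: "rr k \<in> borel_measurable M" for k unfolding rr_def[abs_def] by measurable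
    have rrle: "norm (rr k \<omega>) \<le> \<theta>\<^sup>2 * k2 * q k \<omega>" for k \<omega>
    proof -
      have "norm (rr k \<omega>) \<le> (\<theta> * ?d k \<omega>)\<^sup>2 * min 1 \<bar>\<theta> * ?d k \<omega>\<bar>"
        unfolding rr_def by (rule norm_iexp_taylor2_le)
      also have "\<dots> \<le> (\<theta>\<^sup>2 * (k2 * kernel_weight k \<omega>)) * min 1 (C * \<bar>\<theta>\<bar> * kernel_weight k \<omega>)"
        using d2[of k \<omega>] td[of k \<omega>] kernel_weight_pos[of k \<omega>] kk unfolding power_mult_distrib
        by (intro mult_mono mult_left_mono) auto
      finally show ?thesis by (simp add: q_def mult_ac)
    qed
    have rrint: "integrable M (\<lambda>\<omega>. e k \<omega> * rr k \<omega>)" for k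
      by (rule Bochner_Integration.integrable_bound[where f="\<lambda>\<omega>. \<theta>\<^sup>2 * k2 * q k \<omega>"])
         (use rrle qint kk q0 in \<open>auto simp: norm_mult en\<close>)
    have rrE: "norm (\<integral>\<omega>. e k \<omega> * rr k \<omega> \<partial>M) \<le> \<theta>\<^sup>2 * k2 * (\<integral>\<omega>. q k \<omega> \<partial>M)" for k
    proof -
      have "norm (\<integral>\<omega>. e k \<omega> * rr k \<omega> \<partial>M) \<le> (\<integral>\<omega>. \<theta>\<^sup>2 * k2 * q k \<omega> \<partial>M)"
      proof -
        have "norm (\<integral>\<omega>. e k \<omega> * rr k \<omega> \<partial>M) \<le> (\<integral>\<omega>. norm (e k \<omega> * rr k \<omega>) \<partial>M)"
          by (rule integral_norm_bound)
        also have "\<dots> \<le> (\<integral>\<omega>. \<theta>\<^sup>2 * k2 * q k \<omega> \<partial>M)"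
          using integrable_norm[OF rrint[of k]] qint rrle by (intro integral_mono) (simp_all add: norm_mult en)
        finally show ?thesis .
      qed
      then show ?thesis by simp
    qed
    have m1: "(\<integral>\<omega>. e k \<omega> * of_real (?d k \<omega>) \<partial>M) = 0" for k
    proof -
      have "(\<integral>\<omega>. e k \<omega> * of_real (?d k \<omega>) \<partial>M) = (\<integral>\<omega>. e k \<omega> * of_real (\<integral>y. G y - kernel_op P G (Y k \<omega>) \<partial>P (Y k \<omega>)) \<partial>M)"
        unfolding pois_mart_def
      proof (rule complex_transition[where g="\<lambda>\<omega> y. G y - kernel_op P G (Y k \<omega>)" and b=1])
        show "(\<lambda>(\<omega>, y). G y - kernel_op P G (Y k \<omega>)) \<in> borel_measurable (F k \<Otimes>\<^sub>M borel)" by measurable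
        show "integrable M (\<lambda>\<omega>. G (Y (Suc k) \<omega>) - kernel_op P G (Y k \<omega>))"
          using dint[of k] by (simp add: pois_mart_def[abs_def])
      qed (use S_integrable_kernel[OF G] en in auto)
      then show ?thesis using S_integrable_kernel[OF G] by (simp add: kernel_op_def)
    qed
    have m2: "(\<integral>\<omega>. e k \<omega> * of_real ((?d k \<omega>)\<^sup>2) \<partial>M) = (\<integral>\<omega>. e k \<omega> * of_real (?h (Y k \<omega>)) \<partial>M)" for k
    proof -
      have "(\<integral>\<omega>. e k \<omega> * of_real ((?d k \<omega>)\<^sup>2) \<partial>M) = (\<integral>\<omega>. e k \<omega> * of_real (\<integral>y. (G y - kernel_op P G (Y k \<omega>))\<^sup>2 \<partial>P (Y k \<omega>)) \<partial>M)"
        unfolding pois_mart_def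
      proof (rule complex_transition[where g="\<lambda>\<omega> y. (G y - kernel_op P G (Y k \<omega>))\<^sup>2" and b=1])
        show "(\<lambda>(\<omega>, y). (G y - kernel_op P G (Y k \<omega>))\<^sup>2) \<in> borel_measurable (F k \<Otimes>\<^sub>M borel)" by measurable
        show "integrable M (\<lambda>\<omega>. (G (Y (Suc k) \<omega>) - kernel_op P G (Y k \<omega>))\<^sup>2)"
          using d2int[of k] by (simp add: pois_mart_def[abs_def])
      qed (use cond_var_eq[OF G] en in auto)
      then show ?thesis by (simp add: cond_var_eq[OF G])
    qed
    define Ak where "Ak k = (\<integral>\<omega>. e k \<omega> * of_real (H (Y k \<omega>)) \<partial>M)" for k
    define Bk where "Bk k = (\<integral>\<omega>. e k \<omega> * of_real (H (Y (Suc k) \<omega>)) \<partial>M)" for k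
    have m3: "(\<integral>\<omega>. e k \<omega> * of_real (?h (Y k \<omega>) - \<sigma>2) \<partial>M) = Ak k - Bk k" for k
    proof -
      have i: "integrable M (\<lambda>\<omega>. e k \<omega> * of_real (f (Y j \<omega>)))" if "V.wbdd b' f" for f b' j
        using wbdd_Y_integrable[OF that] by (intro integrable_bounded_mult[where b=1]) (auto simp: en)
      have "Bk k = (\<integral>\<omega>. e k \<omega> * of_real (\<integral>y. H y \<partial>P (Y k \<omega>)) \<partial>M)"
        unfolding Bk_def
        by (rule complex_transition[where g="\<lambda>\<omega> y. H y" and b=1])
           (use en wbdd_Y_integrable[OF H] V.wbdd_integrable[OF H] in auto)
      then have "Ak k - Bk k = (\<integral>\<omega>. e k \<omega> * of_real (H (Y k \<omega>)) - e k \<omega> * of_real (kernel_op P H (Y k \<omega>)) \<partial>M)"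
        unfolding Ak_def kernel_op_def[symmetric] using i[OF H] i[OF V.wbdd_kernel_op[OF H]] by simp
      then show ?thesis
        unfolding Heq[folded H_def, symmetric] by (simp add: right_diff_distrib)
    qed
    \<comment> \<open>Since \<open>a = \<theta>\<^sup>2 * \<sigma>2 / 2\<close>, the mean part of
      the conditional variance cancels to first order. What remains is its fluctuation, written
      through H, the Taylor remainder, and \<open>1 - a - exp (- a)\<close>, which is of order
      \<open>a\<^sup>2\<close>.\<close>
    have inc: "of_real (w (Suc k)) * (\<integral>\<omega>. e (Suc k) \<omega> \<partial>M) - of_real (w k) * (\<integral>\<omega>. e k \<omega> \<partial>M) =
        of_real (w (Suc k)) * (- of_real (\<theta>\<^sup>2 / 2) * (Ak k - Bk k) + (\<integral>\<omega>. e k \<omega> * rr k \<omega> \<partial>M)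
          + of_real (1 - a - exp (- a)) * (\<integral>\<omega>. e k \<omega> \<partial>M))" for k
    proof -
      have ih: "integrable M (\<lambda>\<omega>. e k \<omega> * of_real (?h (Y k \<omega>)))"
        using wbdd_Y_integrable[OF h] by (intro integrable_bounded_mult[where b=1]) (auto simp: en)
      have i1: "integrable M (\<lambda>\<omega>. e k \<omega> * of_real (?d k \<omega>))"
        using dint by (intro integrable_bounded_mult[where b=1]) (auto simp: en)
      have i2: "integrable M (\<lambda>\<omega>. e k \<omega> * of_real ((?d k \<omega>)\<^sup>2))"
        using d2int by (intro integrable_bounded_mult[where b=1]) (auto simp: en)
      have "e (Suc k) \<omega> = e k \<omega> + \<i> * of_real \<theta> * (e k \<omega> * of_real (?d k \<omega>))
          - of_real (\<theta>\<^sup>2 / 2) * (e k \<omega> * of_real ((?d k \<omega>)\<^sup>2)) + e k \<omega> * rr k \<omega>" for \<omega>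
        unfolding eS rr_def by (simp add: algebra_simps power_mult_distrib)
      then have "(\<integral>\<omega>. e (Suc k) \<omega> \<partial>M) = (\<integral>\<omega>. e k \<omega> + \<i> * of_real \<theta> * (e k \<omega> * of_real (?d k \<omega>))
          - of_real (\<theta>\<^sup>2 / 2) * (e k \<omega> * of_real ((?d k \<omega>)\<^sup>2)) + e k \<omega> * rr k \<omega> \<partial>M)" by simp
      also have "\<dots> = (\<integral>\<omega>. e k \<omega> \<partial>M) + \<i> * of_real \<theta> * (\<integral>\<omega>. e k \<omega> * of_real (?d k \<omega>) \<partial>M)
          - of_real (\<theta>\<^sup>2 / 2) * (\<integral>\<omega>. e k \<omega> * of_real ((?d k \<omega>)\<^sup>2) \<partial>M) + (\<integral>\<omega>. e k \<omega> * rr k \<omega> \<partial>M)"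
        using eint[of k] i1 i2 rrint[of k] by (simp del: of_real_power)
      also have "\<dots> = (\<integral>\<omega>. e k \<omega> \<partial>M) - of_real (\<theta>\<^sup>2 / 2) * (\<integral>\<omega>. e k \<omega> * of_real (?h (Y k \<omega>)) \<partial>M) + (\<integral>\<omega>. e k \<omega> * rr k \<omega> \<partial>M)"
        unfolding m1 m2 by simp
      finally have 1: "(\<integral>\<omega>. e (Suc k) \<omega> \<partial>M) = (\<integral>\<omega>. e k \<omega> \<partial>M) - of_real (\<theta>\<^sup>2 / 2) * (\<integral>\<omega>. e k \<omega> * of_real (?h (Y k \<omega>)) \<partial>M) + (\<integral>\<omega>. e k \<omega> * rr k \<omega> \<partial>M)" .
      have 2: "Ak k - Bk k = (\<integral>\<omega>. e k \<omega> * of_real (?h (Y k \<omega>)) \<partial>M) - of_real \<sigma>2 * (\<integral>\<omega>. e k \<omega> \<partial>M)"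
        unfolding m3[symmetric] using ih eint[of k] by (simp add: right_diff_distrib mult.commute)
      have 3: "of_real (w k) = of_real (w (Suc k)) * (of_real (exp (- a)) :: complex)"
      proof -
        have "w k = w (Suc k) * exp (- a)" unfolding w(2) by (simp add: exp_minus)
        from arg_cong[OF this, of of_real] show ?thesis by (simp only: of_real_mult)
      qed
      have 4: "of_real a = (of_real (\<theta>\<^sup>2 / 2) * of_real \<sigma>2 :: complex)"
      proof -
        have "a = \<theta>\<^sup>2 / 2 * \<sigma>2" unfolding a by simp
        from arg_cong[OF this, of of_real] show ?thesis by (simp only: of_real_mult)
      qed
      show ?thesis
        unfolding 1 2 3 of_real_diff 4 by (simp add: algebra_simps del: of_real_power of_real_divide)
    qed
    have sab: "\<bar>1 - a - exp (- a)\<bar> \<le> a\<^sup>2"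
    proof -
      have l: "1 - a \<le> exp (- a)" using exp_ge_add_one_self[of "- a"] by simp
      have u: "exp (- a) \<le> 1 - a + a\<^sup>2"
      proof -
        have "exp (- a) = 1 / exp a" by (simp add: exp_minus field_simps)
        also have "\<dots> \<le> 1 / (1 + a)" using a0 exp_ge_add_one_self[of a] by (intro divide_left_mono) auto
        also have "\<dots> \<le> 1 - a + a\<^sup>2"
        proof -
          have "1 \<le> (1 - a + a\<^sup>2) * (1 + a)" using a0 by (simp add: power2_eq_square algebra_simps)
          then show ?thesis using a0 by (simp add: divide_le_eq)
        qed
        finally show ?thesis .
      qed
      show ?thesis using l u by simp
    qed
    have eE: "norm (\<integral>\<omega>. e k \<omega> \<partial>M) \<le> 1" for k
    proof -
      have "norm (\<integral>\<omega>. e k \<omega> \<partial>M) \<le> (\<integral>\<omega>. norm (e k \<omega>) \<partial>M)" by (rule integral_norm_bound)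
      then show ?thesis by (simp add: en prob_space)
    qed
    define hz :: complex where "hz = of_real (\<theta>\<^sup>2 / 2)"
    let ?Q = "\<Sum>k<N. \<integral>\<omega>. q k \<omega> \<partial>M"
    have HY: "(\<integral>\<omega>. \<bar>H (Y k \<omega>)\<bar> \<partial>M) \<le> b * (1 + vbar)" for k by (rule expectation_abs_wbdd_Y_le[OF H])
    have AB: "norm (\<Sum>k<N. of_real (w (Suc k)) * Ak k - of_real (w (Suc k)) * Bk k) \<le>
       2 * (W * (b * (1 + vbar))) + (\<Sum>k<N. W * (exp a - 1) * (b * (1 + vbar)) + W * (2 * b) * (\<integral>\<omega>. q k \<omega> \<partial>M))"
    proof (rule sum_shift_bound)
      fix k assume k: "k \<le> N"
      have "norm (Ak k) \<le> 1 * (\<integral>\<omega>. \<bar>H (Y k \<omega>)\<bar> \<partial>M)"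
        unfolding Ak_def using wbdd_Y_integrable[OF H] by (intro integrable_bounded_mult(2)) (auto simp: en)
      then show "norm (of_real (w (Suc k)) * Ak k) \<le> W * (b * (1 + vbar))"
        using HY[of k] w(1)[of "Suc k"] wW[of "Suc k"] k unfolding norm_mult
        by (intro mult_mono) auto
    next
      fix k assume k: "k < N"
      let ?z = "\<lambda>\<omega>. of_real (w (Suc (Suc k))) * e (Suc k) \<omega> - of_real (w (Suc k)) * e k \<omega>"
      \<comment> \<open>The prefactor of \<open>H (Y (Suc k))\<close> changes for two reasons: the
        deterministic weight grows by the factor \<open>exp a\<close>, and the exponential acquires
        one more increment.\<close>
      have z: "norm (?z \<omega>) \<le> W * (exp a - 1) + W * (2 * min 1 (C * \<bar>\<theta>\<bar> * kernel_weight k \<omega>))" for \<omega>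
      proof -
        have "?z \<omega> = of_real (w (Suc k)) * (of_real (exp a - 1) * e (Suc k) \<omega> + e k \<omega> * (iexp (\<theta> * ?d k \<omega>) - 1))"
          unfolding w(2)[of "Suc k"] eS by (simp add: algebra_simps)
        also have "norm \<dots> \<le> w (Suc k) * ((exp a - 1) * 1 + 1 * (2 * min 1 \<bar>\<theta> * ?d k \<omega>\<bar>))"
        proof -
          have "norm (of_real (exp a - 1) * e (Suc k) \<omega> + e k \<omega> * (iexp (\<theta> * ?d k \<omega>) - 1)) \<le>
              norm (of_real (exp a - 1) * e (Suc k) \<omega>) + norm (e k \<omega> * (iexp (\<theta> * ?d k \<omega>) - 1))"
            by (rule norm_triangle_ineq)
          also have "\<dots> \<le> (exp a - 1) * 1 + 1 * (2 * min 1 \<bar>\<theta> * ?d k \<omega>\<bar>)"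
          proof (rule add_mono)
            have "norm (of_real (exp a - 1) :: complex) = exp a - 1" using a0 by (simp only: norm_of_real; simp)
            then show "norm (of_real (exp a - 1) * e (Suc k) \<omega>) \<le> (exp a - 1) * 1"
              by (simp only: norm_mult en; simp)
            show "norm (e k \<omega> * (iexp (\<theta> * ?d k \<omega>) - 1)) \<le> 1 * (2 * min 1 \<bar>\<theta> * ?d k \<omega>\<bar>)"
              using norm_iexp_minus_1_le[of "\<theta> * ?d k \<omega>"] by (simp only: norm_mult en; simp)
          qed
          finally show ?thesis using w(1)[of "Suc k"] by (simp only: norm_mult norm_of_real; simp)
        qed
        also have "\<dots> \<le> W * ((exp a - 1) * 1 + 1 * (2 * min 1 (C * \<bar>\<theta>\<bar> * kernel_weight k \<omega>)))"
          using td[of k \<omega>] wW[of "Suc k"] w(1)[of "Suc k"] k a0 W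
          by (intro mult_mono add_mono) auto
        finally show ?thesis by (simp add: algebra_simps)
      qed
      have i: "integrable M (\<lambda>\<omega>. e j \<omega> * of_real (H (Y i \<omega>)))" for i j
        using wbdd_Y_integrable[OF H] by (intro integrable_bounded_mult[where b=1]) (auto simp: en)
      have "of_real (w (Suc (Suc k))) * Ak (Suc k) - of_real (w (Suc k)) * Bk k = (\<integral>\<omega>. ?z \<omega> * of_real (H (Y (Suc k) \<omega>)) \<partial>M)"
        unfolding Ak_def Bk_def using i by (simp add: left_diff_distrib mult.assoc)
      also have "norm \<dots> \<le> (\<integral>\<omega>. W * (exp a - 1) * \<bar>H (Y (Suc k) \<omega>)\<bar> + W * (2 * b) * q k \<omega> \<partial>M)"
      proof (rule order_trans[OF integral_norm_bound integral_mono])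
        show "integrable M (\<lambda>\<omega>. norm (?z \<omega> * of_real (H (Y (Suc k) \<omega>))))"
          using i by (intro integrable_norm) (simp add: left_diff_distrib mult.assoc)
        show "integrable M (\<lambda>\<omega>. W * (exp a - 1) * \<bar>H (Y (Suc k) \<omega>)\<bar> + W * (2 * b) * q k \<omega>)"
          using qint wbdd_Y_integrable[OF H] by simp
        fix \<omega>
        have Hq: "\<bar>H (Y (Suc k) \<omega>)\<bar> \<le> b * kernel_weight k \<omega>"
        proof -
          have "\<bar>H (Y (Suc k) \<omega>)\<bar> \<le> b * (1 + V (Y (Suc k) \<omega>))" using H by (rule V.wbdd_bound)
          also have "\<dots> \<le> b * kernel_weight k \<omega>" using b V_nonneg by (intro mult_left_mono) (simp_all add: kernel_weight_def)
          finally show ?thesis .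
        qed
        have "norm (?z \<omega> * of_real (H (Y (Suc k) \<omega>))) \<le> (W * (exp a - 1) + W * (2 * min 1 (C * \<bar>\<theta>\<bar> * kernel_weight k \<omega>))) * \<bar>H (Y (Suc k) \<omega>)\<bar>"
          unfolding norm_mult norm_of_real using z by (intro mult_right_mono) auto
        also have "\<dots> = W * (exp a - 1) * \<bar>H (Y (Suc k) \<omega>)\<bar> + W * (2 * min 1 (C * \<bar>\<theta>\<bar> * kernel_weight k \<omega>)) * \<bar>H (Y (Suc k) \<omega>)\<bar>"
          by (simp add: algebra_simps)
        also have "\<dots> \<le> W * (exp a - 1) * \<bar>H (Y (Suc k) \<omega>)\<bar> + W * (2 * min 1 (C * \<bar>\<theta>\<bar> * kernel_weight k \<omega>)) * (b * kernel_weight k \<omega>)"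
          using Hq W C kernel_weight_pos[of k \<omega>] by (intro add_left_mono mult_left_mono) auto
        finally show "norm (?z \<omega> * of_real (H (Y (Suc k) \<omega>))) \<le> W * (exp a - 1) * \<bar>H (Y (Suc k) \<omega>)\<bar> + W * (2 * b) * q k \<omega>"
          by (simp add: q_def mult_ac)
      qed
      also have "\<dots> = W * (exp a - 1) * (\<integral>\<omega>. \<bar>H (Y (Suc k) \<omega>)\<bar> \<partial>M) + W * (2 * b) * (\<integral>\<omega>. q k \<omega> \<partial>M)"
        using qint wbdd_Y_integrable[OF H] by simp
      also have "\<dots> \<le> W * (exp a - 1) * (b * (1 + vbar)) + W * (2 * b) * (\<integral>\<omega>. q k \<omega> \<partial>M)"
        using HY W a0 by (intro add_right_mono mult_left_mono) auto
      finally show "norm (of_real (w (Suc (Suc k))) * Ak (Suc k) - of_real (w (Suc k)) * Bk k) \<le>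
        W * (exp a - 1) * (b * (1 + vbar)) + W * (2 * b) * (\<integral>\<omega>. q k \<omega> \<partial>M)" .
    qed
    have "of_real (exp (a * real N)) * (\<integral>\<omega>. iexp (\<theta> * (\<Sum>k<N. ?d k \<omega>)) \<partial>M) - 1 =
        of_real (w N) * (\<integral>\<omega>. e N \<omega> \<partial>M) - of_real (w 0) * (\<integral>\<omega>. e 0 \<omega> \<partial>M)"
      by (simp add: w_def e_def prob_space)
    also have "\<dots> = (\<Sum>k<N. of_real (w (Suc k)) * (\<integral>\<omega>. e (Suc k) \<omega> \<partial>M) - of_real (w k) * (\<integral>\<omega>. e k \<omega> \<partial>M))"
      by (rule sum_lessThan_telescope[symmetric])
    also have "\<dots> = - of_real (\<theta>\<^sup>2 / 2) * (\<Sum>k<N. of_real (w (Suc k)) * Ak k - of_real (w (Suc k)) * Bk k)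
        + (\<Sum>k<N. of_real (w (Suc k)) * ((\<integral>\<omega>. e k \<omega> * rr k \<omega> \<partial>M) + of_real (1 - a - exp (- a)) * (\<integral>\<omega>. e k \<omega> \<partial>M)))"
      unfolding inc sum_distrib_left sum.distrib[symmetric] hz_def[symmetric]
      by (intro sum.cong refl) (simp add: algebra_simps)
    finally have eqn: "of_real (exp (a * real N)) * (\<integral>\<omega>. iexp (\<theta> * (\<Sum>k<N. ?d k \<omega>)) \<partial>M) - 1 =
       - of_real (\<theta>\<^sup>2 / 2) * (\<Sum>k<N. of_real (w (Suc k)) * Ak k - of_real (w (Suc k)) * Bk k)
        + (\<Sum>k<N. of_real (w (Suc k)) * ((\<integral>\<omega>. e k \<omega> * rr k \<omega> \<partial>M) + of_real (1 - a - exp (- a)) * (\<integral>\<omega>. e k \<omega> \<partial>M)))" .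
    have "norm (of_real (exp (a * real N)) * (\<integral>\<omega>. iexp (\<theta> * (\<Sum>k<N. ?d k \<omega>)) \<partial>M) - 1) \<le> \<theta>\<^sup>2 / 2 * (2 * (W * (b * (1 + vbar))) + (\<Sum>k<N. W * (exp a - 1) * (b * (1 + vbar)) + W * (2 * b) * (\<integral>\<omega>. q k \<omega> \<partial>M)))
        + (\<Sum>k<N. W * (\<theta>\<^sup>2 * k2 * (\<integral>\<omega>. q k \<omega> \<partial>M) + a\<^sup>2))"
      unfolding eqn
    proof (rule order_trans[OF norm_triangle_ineq add_mono])
      have "norm (- of_real (\<theta>\<^sup>2 / 2) :: complex) = \<theta>\<^sup>2 / 2" by (simp only: norm_minus_cancel norm_of_real; simp)
      then show "norm (- of_real (\<theta>\<^sup>2 / 2) * (\<Sum>k<N. of_real (w (Suc k)) * Ak k - of_real (w (Suc k)) * Bk k)) \<le>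
        \<theta>\<^sup>2 / 2 * (2 * (W * (b * (1 + vbar))) + (\<Sum>k<N. W * (exp a - 1) * (b * (1 + vbar)) + W * (2 * b) * (\<integral>\<omega>. q k \<omega> \<partial>M)))"
        using AB by (simp only: norm_mult) (intro mult_left_mono; simp)
      show "norm (\<Sum>k<N. of_real (w (Suc k)) * ((\<integral>\<omega>. e k \<omega> * rr k \<omega> \<partial>M) + of_real (1 - a - exp (- a)) * (\<integral>\<omega>. e k \<omega> \<partial>M)))
        \<le> (\<Sum>k<N. W * (\<theta>\<^sup>2 * k2 * (\<integral>\<omega>. q k \<omega> \<partial>M) + a\<^sup>2))"
      proof (rule order_trans[OF norm_sum sum_mono])
        fix k assume k: "k \<in> {..<N}"
        have "norm (of_real (1 - a - exp (- a)) * (\<integral>\<omega>. e k \<omega> \<partial>M)) \<le> a\<^sup>2 * 1"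
          unfolding norm_mult norm_of_real using sab eE by (intro mult_mono) auto
        then have "norm ((\<integral>\<omega>. e k \<omega> * rr k \<omega> \<partial>M) + of_real (1 - a - exp (- a)) * (\<integral>\<omega>. e k \<omega> \<partial>M)) \<le> \<theta>\<^sup>2 * k2 * (\<integral>\<omega>. q k \<omega> \<partial>M) + a\<^sup>2"
          using rrE[of k] by (intro order_trans[OF norm_triangle_ineq add_mono]) auto
        then show "norm (of_real (w (Suc k)) * ((\<integral>\<omega>. e k \<omega> * rr k \<omega> \<partial>M) + of_real (1 - a - exp (- a)) * (\<integral>\<omega>. e k \<omega> \<partial>M))) \<le>
          W * (\<theta>\<^sup>2 * k2 * (\<integral>\<omega>. q k \<omega> \<partial>M) + a\<^sup>2)"
          unfolding norm_mult[of "of_real _"] norm_of_real using wW[of "Suc k"] w(1)[of "Suc k"] k W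
          by (intro mult_mono) auto
      qed
    qed
    also have "\<dots> = W * (\<theta>\<^sup>2 * (b * (1 + vbar)) + \<theta>\<^sup>2 / 2 * (b * (1 + vbar)) * (real N * (exp a - 1)) + \<theta>\<^sup>2 * (b + k2) * ?Q + real N * a\<^sup>2)"
    proof -
      define \<beta> where "\<beta> = b * (1 + vbar)"
      define Q where "Q = ?Q"
      have 1: "(\<Sum>k<N. W * (exp a - 1) * \<beta> + W * (2 * b) * (\<integral>\<omega>. q k \<omega> \<partial>M)) = real N * (W * (exp a - 1) * \<beta>) + W * (2 * b) * Q"
        unfolding Q_def sum.distrib sum_distrib_left[symmetric] by simp
      have 2: "(\<Sum>k<N. W * (\<theta>\<^sup>2 * k2 * (\<integral>\<omega>. q k \<omega> \<partial>M) + a\<^sup>2)) = W * (\<theta>\<^sup>2 * k2 * Q + real N * a\<^sup>2)"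
        unfolding Q_def sum_distrib_left[symmetric] sum.distrib by simp
      show ?thesis
        unfolding \<beta>_def[symmetric] 1 2 Q_def[symmetric] by (simp add: field_simps)
    qed
    also have "\<dots> \<le> W * (\<theta>\<^sup>2 * C + \<theta>\<^sup>2 * C * (real N * (exp a - 1)) + \<theta>\<^sup>2 * C * ?Q + real N * a\<^sup>2)"
    proof (intro mult_left_mono add_mono mult_right_mono order_refl)
      have "0 \<le> b * (1 + vbar)" using b vbar_nonneg by simp
      then show "b * (1 + vbar) \<le> C" "\<theta>\<^sup>2 / 2 * (b * (1 + vbar)) \<le> \<theta>\<^sup>2 * C"
        using C(2) mult_left_mono[of "b * (1 + vbar)" "2 * C" "\<theta>\<^sup>2 / 2"] by auto
      show "b + k2 \<le> C" using C(3) b by simp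
      show "0 \<le> ?Q" using q0 by (intro sum_nonneg integral_nonneg_AE AE_I2)
    qed (use W a0 in auto)
    finally have fin: "norm (of_real (exp (a * real N)) * (\<integral>\<omega>. iexp (\<theta> * (\<Sum>k<N. ?d k \<omega>)) \<partial>M) - 1)
      \<le> W * (\<theta>\<^sup>2 * C + \<theta>\<^sup>2 * C * (real N * (exp a - 1)) + \<theta>\<^sup>2 * C * ?Q + real N * a\<^sup>2)" .
    have eq: "\<theta>\<^sup>2 * C + \<theta>\<^sup>2 * C * x + \<theta>\<^sup>2 * C * y + z = C * \<theta>\<^sup>2 * (1 + x + y) + z" for x y z :: real
      by (simp add: algebra_simps)
    show ?thesis
      using fin unfolding eq W_def[symmetric] q_def[symmetric] .
  qed
  then show ?thesis using that C(1) \<sigma>2 by blast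
qed

text \<open>With \<open>\<theta> = t / sqrt N\<close> the total exponent \<open>a * N\<close> is the
  constant \<open>s\<close>, so the exponential prefactor stays bounded. The error terms are of
  order \<open>1 / N\<close> or are multiples of the Lindeberg average \<open>\<xi>\<close>.\<close>

theorem martingale_clt:
  assumes G: "S.wbdd c G"
  shows "(\<lambda>N. \<integral>\<omega>. iexp (t * ((\<Sum>k<N. pois_mart G k \<omega>) / sqrt (real N))) \<partial>M)
    \<longlonglongrightarrow> of_real (exp (- (t\<^sup>2 * ((\<integral>x. (G x)\<^sup>2 \<partial>mu) - (\<integral>x. (kernel_op P G x)\<^sup>2 \<partial>mu)) / 2)))"
proof -
  define \<sigma>2 where "\<sigma>2 = (\<integral>x. (G x)\<^sup>2 \<partial>mu) - (\<integral>x. (kernel_op P G x)\<^sup>2 \<partial>mu)"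
  obtain C where C: "0 \<le> C" and \<sigma>2: "0 \<le> \<sigma>2" and bound: "\<And>\<theta> a N. a = \<theta>\<^sup>2 * \<sigma>2 / 2 \<Longrightarrow>
      norm (of_real (exp (a * real N)) * (\<integral>\<omega>. iexp (\<theta> * (\<Sum>k<N. pois_mart G k \<omega>)) \<partial>M) - 1)
      \<le> exp (a * (real N + 1)) * (C * \<theta>\<^sup>2 * (1 + real N * (exp a - 1) +
          (\<Sum>k<N. \<integral>\<omega>. kernel_weight k \<omega> * min 1 (C * \<bar>\<theta>\<bar> * kernel_weight k \<omega>) \<partial>M)) + real N * a\<^sup>2)"
    by (rule char_martingale_bound[OF G, folded \<sigma>2_def]) (rule that)
  define \<theta> where "\<theta> N = t / sqrt (real N)" for N
  define s where "s = t\<^sup>2 * \<sigma>2 / 2"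
  define ch where "ch N = (\<integral>\<omega>. iexp (t * ((\<Sum>k<N. pois_mart G k \<omega>) / sqrt (real N))) \<partial>M)" for N
  define \<xi> where "\<xi> N = (\<Sum>k<N. \<integral>\<omega>. kernel_weight k \<omega> * min 1 (C * \<bar>\<theta> N\<bar> * kernel_weight k \<omega>) \<partial>M) / real N" for N
  have "(\<lambda>N. C * \<bar>\<theta> N\<bar>) \<longlonglongrightarrow> 0"
  proof -
    have "(\<lambda>N. 1 / sqrt (real N)) \<longlonglongrightarrow> 0" by real_asymp
    then have "(\<lambda>N. C * \<bar>t * (1 / sqrt (real N))\<bar>) \<longlonglongrightarrow> C * \<bar>t * 0\<bar>"
      by (intro tendsto_intros)
    then show ?thesis by (simp add: \<theta>_def)
  qed
  then have \<xi>: "\<xi> \<longlonglongrightarrow> 0"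
    unfolding \<xi>_def[abs_def] using C by (intro cesaro_qk_min_tendsto) auto
  let ?r = "\<lambda>N. exp (s * (1 + 1 / real N)) * (C * t\<^sup>2 * (1 / real N + (exp (s / real N) - 1) + \<xi> N) + s\<^sup>2 / real N)"
  have le: "norm (of_real (exp s) * ch N - 1) \<le> ?r N" if N: "0 < N" for N
  proof -
    have \<theta>2: "(\<theta> N)\<^sup>2 = t\<^sup>2 / real N" using N by (simp add: \<theta>_def power_divide)
    have ch: "ch N = (\<integral>\<omega>. iexp (\<theta> N * (\<Sum>k<N. pois_mart G k \<omega>)) \<partial>M)"
      by (simp add: ch_def \<theta>_def)
    have a: "s / real N = (\<theta> N)\<^sup>2 * \<sigma>2 / 2" by (simp add: \<theta>2 s_def)
    have \<xi>N: "(\<Sum>k<N. \<integral>\<omega>. kernel_weight k \<omega> * min 1 (C * \<bar>\<theta> N\<bar> * kernel_weight k \<omega>) \<partial>M) = real N * \<xi> N"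
      using N by (simp add: \<xi>_def)
    show ?thesis
      using bound[OF a, of N] N unfolding \<xi>N \<theta>2 ch by (simp add: field_simps power2_eq_square)
  qed
  have "?r \<longlonglongrightarrow> exp (s * (1 + 0)) * (C * t\<^sup>2 * (0 + (exp 0 - 1) + 0) + 0)"
    by (intro tendsto_intros \<xi> lim_const_over_n) 
  then have "?r \<longlonglongrightarrow> 0" by simp
  then have "(\<lambda>N. of_real (exp s) * ch N - 1) \<longlonglongrightarrow> 0"
    by (rule Lim_null_comparison[rotated]) (use le in \<open>auto intro!: eventually_mono[OF eventually_gt_at_top[of 0]]\<close>)
  then have lim: "(\<lambda>N. of_real (exp (- s)) * (of_real (exp s) * ch N - 1 + 1)) \<longlonglongrightarrow> of_real (exp (- s)) * (0 + 1)"
    by (intro tendsto_intros)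
  have eq: "of_real (exp (- s)) * (of_real (exp s) * ch N - 1 + 1) = ch N" for N
  proof -
    have "exp (- s) * exp s = 1" by (simp flip: exp_add)
    then have "(of_real (exp (- s)) * of_real (exp s) :: complex) = 1" by (metis of_real_1 of_real_mult)
    then show ?thesis by (simp flip: mult.assoc)
  qed
  have "ch \<longlonglongrightarrow> of_real (exp (- s))" using lim unfolding eq by simp
  then show ?thesis unfolding ch_def[abs_def] s_def \<sigma>2_def .
qed

end

section \<open>Wasserstein neighbourhoods\<close>

lemma integral_product_fn:
  fixes f g :: "'a \<Rightarrow> real"
  assumes "prob_space m" "prob_space m'" and f: "integrable m f" and g: "integrable m' g"
  shows "integrable (m \<Otimes>\<^sub>M m') (\<lambda>z. f (fst z) * g (snd z))"
    and "(\<integral>z. f (fst z) * g (snd z) \<partial>(m \<Otimes>\<^sub>M m')) = (\<integral>x. f x \<partial>m) * (\<integral>y. g y \<partial>m')"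
proof -
  interpret m: prob_space m by fact
  interpret m': prob_space m' by fact
  interpret pair_sigma_finite m m' ..
  have [measurable]: "f \<in> borel_measurable m" "g \<in> borel_measurable m'" using f g by auto
  show i: "integrable (m \<Otimes>\<^sub>M m') (\<lambda>z. f (fst z) * g (snd z))"
    by (rule Fubini_integrable) (use f g in \<open>auto simp: abs_mult\<close>)
  show "(\<integral>z. f (fst z) * g (snd z) \<partial>(m \<Otimes>\<^sub>M m')) = (\<integral>x. f x \<partial>m) * (\<integral>y. g y \<partial>m')"
    using integral_fst'[OF i] by simp
qed

lemma real_simple_sum:
  fixes k :: "'a \<Rightarrow> nat" and G :: "nat \<Rightarrow> real"
  assumes "k x \<le> n"
  shows "G (k x) = (\<Sum>i\<le>n. G i * indicator {x. k x = i} x)"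
proof -
  have "(\<Sum>i\<le>n. G i * indicator {x. k x = i} x) = (\<Sum>i\<in>{k x}. G i * indicator {x. k x = i} x)"
    using assms by (intro sum.mono_neutral_right) auto
  then show ?thesis by simp
qed

text \<open>A density that depends only on the cell numbers of both coordinates reduces integrals of
  products to finite double sums. This makes the marginals and the cost of the coupling below
  computable.\<close>

lemma integral_simple_product:
  fixes f g :: "'a::euclidean_space \<Rightarrow> real" and k :: "'a \<Rightarrow> nat"
  assumes P: "prob_space m" "prob_space m'" and s: "sets m = sets borel" "sets m' = sets borel"
    and f: "integrable m f" and g: "integrable m' g"
    and km: "k \<in> borel \<rightarrow>\<^sub>M count_space UNIV" and kn: "\<And>x. k x \<le> n"
  shows "integrable (m \<Otimes>\<^sub>M m') (\<lambda>z. G (k (fst z)) (k (snd z)) * (f (fst z) * g (snd z)))"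
    and "(\<integral>z. G (k (fst z)) (k (snd z)) * (f (fst z) * g (snd z)) \<partial>(m \<Otimes>\<^sub>M m')) =
      (\<Sum>i\<le>n. \<Sum>j\<le>n. G i j * ((\<integral>x. indicator {x. k x = i} x * f x \<partial>m) * (\<integral>y. indicator {x. k x = j} y * g y \<partial>m')))"
proof -
  have E: "{x. k x = i} \<in> sets borel" for i
    using measurable_sets[OF km, of "{i}"] by (simp add: vimage_def)
  have f': "integrable m (\<lambda>x. indicator {x. k x = i} x * f x)" for i
    using integrable_mult_indicator[OF _ f, of "{x. k x = i}"] E s by simp
  have g': "integrable m' (\<lambda>x. indicator {x. k x = i} x * g x)" for i
    using integrable_mult_indicator[OF _ g, of "{x. k x = i}"] E s by simp
  define I :: "nat \<Rightarrow> 'a \<Rightarrow> real" where "I i = indicator {x. k x = i}" for i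
  have eq: "G (k x) (k y) * (f x * g y) = (\<Sum>i\<le>n. \<Sum>j\<le>n. G i j * ((I i x * f x) * (I j y * g y)))" for x y
  proof -
    have "G (k x) (k y) = (\<Sum>i\<le>n. (\<Sum>j\<le>n. G i j * I j y) * I i x)"
      unfolding I_def real_simple_sum[of k y n "G _", OF kn, symmetric]
      by (rule real_simple_sum[of k x n "\<lambda>i. G i (k y)", OF kn])
    then show ?thesis by (simp add: sum_distrib_left sum_distrib_right mult_ac)
  qed
  note ip = integral_product_fn[OF P f'[folded I_def] g'[folded I_def]]
  show "integrable (m \<Otimes>\<^sub>M m') (\<lambda>z. G (k (fst z)) (k (snd z)) * (f (fst z) * g (snd z)))"
    unfolding eq using ip(1) by (intro Bochner_Integration.integrable_sum integrable_mult_right) auto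
  show "(\<integral>z. G (k (fst z)) (k (snd z)) * (f (fst z) * g (snd z)) \<partial>(m \<Otimes>\<^sub>M m')) =
      (\<Sum>i\<le>n. \<Sum>j\<le>n. G i j * ((\<integral>x. indicator {x. k x = i} x * f x \<partial>m) * (\<integral>y. indicator {x. k x = j} y * g y \<partial>m')))"
    unfolding eq I_def[symmetric] using ip
    by (subst Bochner_Integration.integral_sum; (intro Bochner_Integration.integrable_sum integrable_mult_right)?; simp?)+
qed

lemma sum_cell_measure:
  fixes f :: "'a::euclidean_space \<Rightarrow> real" and k :: "'a \<Rightarrow> nat"
  assumes s: "sets m = sets borel" and f: "integrable m f"
    and km: "k \<in> borel \<rightarrow>\<^sub>M count_space UNIV" and kn: "\<And>x. k x \<le> n"
  shows "(\<Sum>i\<le>n. \<integral>x. indicator {x. k x = i} x * f x \<partial>m) = (\<integral>x. f x \<partial>m)"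
proof -
  have E: "{x. k x = i} \<in> sets borel" for i
    using measurable_sets[OF km, of "{i}"] by (simp add: vimage_def)
  have f': "integrable m (\<lambda>x. indicator {x. k x = i} x * f x)" for i
    using integrable_mult_indicator[OF _ f, of "{x. k x = i}"] E s by simp
  define I :: "nat \<Rightarrow> 'a \<Rightarrow> real" where "I i = indicator {x. k x = i}" for i
  have eq: "f x = (\<Sum>i\<le>n. I i x * f x)" for x
    using real_simple_sum[of k x n "\<lambda>_. f x", OF kn] by (simp add: I_def mult.commute del: sum_mult_indicator)
  have "(\<integral>x. f x \<partial>m) = (\<integral>x. (\<Sum>i\<le>n. I i x * f x) \<partial>m)"
    by (intro Bochner_Integration.integral_cong refl eq)
  also have "\<dots> = (\<Sum>i\<le>n. \<integral>x. I i x * f x \<partial>m)"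
    by (rule Bochner_Integration.integral_sum) (rule f'[folded I_def])
  finally show ?thesis by (simp only: I_def)
qed

text \<open>Optimal coupling of the cell masses, spread inside the cells proportionally to the two
  measures; the density with respect to the product measure is constant on products of cells.\<close>

lemma cell_coupling:
  fixes m m' :: "'a::euclidean_space measure" and k :: "'a \<Rightarrow> nat" and cost :: "'a \<times> 'a \<Rightarrow> real"
    and \<phi> :: "'a \<Rightarrow> real"
  assumes P: "prob_space m" "prob_space m'" and s: "sets m = sets borel" "sets m' = sets borel"
    and km: "k \<in> borel \<rightarrow>\<^sub>M count_space UNIV" and kn: "\<And>x. k x \<le> n"
    and cm: "cost \<in> borel_measurable (borel \<Otimes>\<^sub>M borel)" and c0: "\<And>z. 0 \<le> cost z"
    and cnear: "\<And>x y. k x = k y \<Longrightarrow> k x \<noteq> 0 \<Longrightarrow> cost (x, y) \<le> \<epsilon>"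
    and cfar: "\<And>x y. cost (x, y) \<le> \<phi> x + \<phi> y"
    and \<phi>: "integrable m \<phi>" "integrable m' \<phi>" "\<And>x. 0 \<le> \<phi> x" and \<phi>R: "\<And>x. k x \<noteq> 0 \<Longrightarrow> \<phi> x \<le> r"
    and \<epsilon>: "0 \<le> \<epsilon>" and r: "0 \<le> r"
  shows "\<exists>c\<in>couplings m m'. (\<integral>z. cost z \<partial>c) \<le> \<epsilon> + (\<integral>x. indicator {x. k x = 0} x * \<phi> x \<partial>m)
     + (\<integral>x. indicator {x. k x = 0} x * \<phi> x \<partial>m')
     + 2 * r * (\<Sum>i\<le>n. \<bar>measure m {x. k x = i} - measure m' {x. k x = i}\<bar>)"
proof -
  interpret m: prob_space m by (rule P)
  interpret m': prob_space m' by (rule P)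
  interpret pair_sigma_finite m m' ..
  note s [measurable_cong] km [measurable] cm [measurable]
  have sp: "space m = UNIV" "space m' = UNIV" using sets_eq_imp_space_eq[OF s(1)] sets_eq_imp_space_eq[OF s(2)] by simp_all
  define E where "E i = {x. k x = i}" for i
  have E [measurable]: "E i \<in> sets borel" for i
    using measurable_sets[OF km, of "{i}"] by (simp add: vimage_def E_def)
  define a where "a i = measure m (E i)" for i
  define b where "b i = measure m' (E i)" for i
  define c where "c i = min (a i) (b i)" for i
  define t where "t = (\<Sum>i\<le>n. c i)"
  have a0: "0 \<le> a i" and b0: "0 \<le> b i" and ca: "0 \<le> c i" "c i \<le> a i" "c i \<le> b i" for i
    by (auto simp: a_def b_def c_def)
  have aE: "(\<integral>x. indicator (E i) x * 1 \<partial>m) = a i" and bE: "(\<integral>x. indicator (E i) x * 1 \<partial>m') = b i" for i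
    using sp by (simp_all add: a_def b_def)
  have sa: "(\<Sum>i\<le>n. a i) = 1" and sb: "(\<Sum>i\<le>n. b i) = 1"
    using sum_cell_measure[OF s(1) _ km kn, of "\<lambda>_. 1"] sum_cell_measure[OF s(2) _ km kn, of "\<lambda>_. 1"]
      aE bE m.prob_space m'.prob_space by (simp_all add: E_def)
  \<comment> \<open>The unmatched masses are paired by the product of the two excesses, normalised
    by their common total \<open>1 - t\<close>. For \<open>t = 1\<close> all excesses vanish, in
    agreement with the value 0 of the quotient.\<close>
  define q2 where "q2 i j = (a i - c i) * (b j - c j) / (1 - t)" for i j
  have sac: "(\<Sum>i\<le>n. a i - c i) = 1 - t" "(\<Sum>i\<le>n. b i - c i) = 1 - t"
    by (simp_all add: sum_subtractf sa sb t_def)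
  have t1: "t \<le> 1" 
  proof -
    have "0 \<le> (\<Sum>i\<le>n. a i - c i)" using ca by (intro sum_nonneg) simp
    then show ?thesis using sac(1) by simp
  qed
  have q20: "0 \<le> q2 i j" for i j using ca t1 by (simp add: q2_def)
  have t1z: "a i - c i = 0" "b i - c i = 0" if "t = 1" "i \<le> n" for i
  proof -
    have "\<forall>i\<in>{..n}. a i - c i = 0" 
      using sum_nonneg_eq_0_iff[of "{..n}" "\<lambda>i. a i - c i"] sac(1) ca that by simp
    moreover have "\<forall>i\<in>{..n}. b i - c i = 0" 
      using sum_nonneg_eq_0_iff[of "{..n}" "\<lambda>i. b i - c i"] sac(2) ca that by simp
    ultimately show "a i - c i = 0" "b i - c i = 0" using that by auto
  qed
  have sq2a: "(\<Sum>j\<le>n. q2 i j) = a i - c i" if "i \<le> n" for i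
  proof (cases "t = 1")
    case False
    then show ?thesis by (simp add: q2_def sac flip: sum_distrib_left sum_divide_distrib)
  qed (simp add: q2_def t1z that)
  have sq2b: "(\<Sum>i\<le>n. q2 i j) = b j - c j" if "j \<le> n" for j
  proof (cases "t = 1")
    case False
    then show ?thesis by (simp add: q2_def sac flip: sum_distrib_right sum_divide_distrib)
  qed (simp add: q2_def t1z that)
  define q where "q i j = (if i = j then c i else 0) + q2 i j" for i j
  \<comment> \<open>The mass that is not guaranteed to travel only a short way. Cell 0 is the far
    region and has no small diameter, so its diagonal mass is included.\<close>
  define u where "u i j = (if i = j \<and> i = 0 then c i else 0) + q2 i j" for i j
  have q0: "0 \<le> q i j" and u0: "0 \<le> u i j" for i j using q20 ca by (auto simp: q_def u_def)
  have sqa: "(\<Sum>j\<le>n. q i j) = a i" if "i \<le> n" for i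
    using that by (simp add: q_def sum.distrib sq2a)
  have sqb: "(\<Sum>i\<le>n. q i j) = b j" if "j \<le> n" for j
    using that by (simp add: q_def sum.distrib sq2b)
  have sua: "(\<Sum>j\<le>n. u i j) = (if i = 0 then a i else a i - c i)" if "i \<le> n" for i
    using that by (simp add: u_def sum.distrib sq2a)
  have sub: "(\<Sum>i\<le>n. u i j) = (if j = 0 then b j else b j - c j)" if "j \<le> n" for j
  proof -
    have "(\<Sum>i\<le>n. if i = j \<and> i = 0 then c i else 0) = (if j = 0 then c j else 0)"
      using that by (cases "j = 0") (auto intro!: sum.neutral)
    then show ?thesis using that by (simp add: u_def sum.distrib sq2b)
  qed
  have qz: "q i j = 0" "u i j = 0" if "a i = 0 \<or> b j = 0" for i j
  proof -
    have "(a i - c i) * (b j - c j) = 0" "i = j \<Longrightarrow> c i = 0"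
      using that ca[of i] ca[of j] by auto
    then show "q i j = 0" "u i j = 0" by (auto simp: q_def u_def q2_def)
  qed
  \<comment> \<open>On a null cell the quotient is 0 by convention, which is consistent because
    \<open>q\<close> and \<open>u\<close> vanish there as well.\<close>
  define Q where "Q i j = q i j / (a i * b j)" for i j
  define U where "U i j = u i j / (a i * b j)" for i j
  have Q0: "0 \<le> Q i j" and U0: "0 \<le> U i j" for i j
    using q0 u0 a0 b0 by (simp_all add: Q_def U_def)
  have rowQ: "(\<Sum>j\<le>n. Q i j * (x * b j)) = x" if "i \<le> n" "a i = 0 \<Longrightarrow> x = 0" for i x
  proof (cases "a i = 0")
    case False
    have "(\<Sum>j\<le>n. Q i j * (x * b j)) = (\<Sum>j\<le>n. q i j) * (x / a i)"
      unfolding sum_distrib_right using qz by (intro sum.cong) (auto simp: Q_def)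
    then show ?thesis using False sqa[OF that(1)] by simp
  qed (simp add: that)
  have colQ: "(\<Sum>i\<le>n. Q i j * (a i * x)) = x" if "j \<le> n" "b j = 0 \<Longrightarrow> x = 0" for j x
  proof (cases "b j = 0")
    case False
    have "(\<Sum>i\<le>n. Q i j * (a i * x)) = (\<Sum>i\<le>n. q i j) * (x / b j)"
      unfolding sum_distrib_right using qz by (intro sum.cong) (auto simp: Q_def)
    then show ?thesis using False sqb[OF that(1)] by simp
  qed (simp add: that)
  \<comment> \<open>Here x stands for the integral of \<phi> over cell i. In the far cell it is paid
    in full; in a near cell only the excess mass pays, at a rate of at most r.\<close>
  have rowU: "(\<Sum>j\<le>n. U i j * (x * b j)) \<le> (if i = 0 then x else r * \<bar>a i - b i\<bar>)"
    if "i \<le> n" "0 \<le> x" "i \<noteq> 0 \<Longrightarrow> x \<le> r * a i" for i x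
  proof (cases "a i = 0")
    case True
    then show ?thesis using that r by (simp add: U_def)
  next
    case False
    then have ai: "0 < a i" using a0[of i] by simp
    have e: "(\<Sum>j\<le>n. U i j * (x * b j)) = (\<Sum>j\<le>n. u i j) * (x / a i)"
      unfolding sum_distrib_right using qz by (intro sum.cong) (auto simp: U_def)
    show ?thesis
    proof (cases "i = 0")
      case True
      then show ?thesis unfolding e sua[OF that(1)] using ai by simp
    next
      case i0: False
      have "(a i - c i) * (x / a i) \<le> (a i - c i) * r"
        using that(3)[OF i0] ai ca[of i] by (intro mult_left_mono) (auto simp: divide_le_eq mult.commute)
      also have "\<dots> \<le> \<bar>a i - b i\<bar> * r" using r by (intro mult_right_mono) (auto simp: c_def)
      finally show ?thesis unfolding e sua[OF that(1)] using i0 by (simp add: mult.commute)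
    qed
  qed
  have colU: "(\<Sum>i\<le>n. U i j * (a i * x)) \<le> (if j = 0 then x else r * \<bar>a j - b j\<bar>)"
    if "j \<le> n" "0 \<le> x" "j \<noteq> 0 \<Longrightarrow> x \<le> r * b j" for j x
  proof (cases "b j = 0")
    case True
    then show ?thesis using that r by (simp add: U_def)
  next
    case False
    then have bj: "0 < b j" using b0[of j] by simp
    have e: "(\<Sum>i\<le>n. U i j * (a i * x)) = (\<Sum>i\<le>n. u i j) * (x / b j)"
      unfolding sum_distrib_right using qz by (intro sum.cong) (auto simp: U_def)
    show ?thesis
    proof (cases "j = 0")
      case True
      then show ?thesis unfolding e sub[OF that(1)] using bj by simp
    next
      case j0: False
      have "(b j - c j) * (x / b j) \<le> (b j - c j) * r"
        using that(3)[OF j0] bj ca[of j] by (intro mult_left_mono) (auto simp: divide_le_eq mult.commute)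
      also have "\<dots> \<le> \<bar>a j - b j\<bar> * r" using r by (intro mult_right_mono) (auto simp: c_def)
      finally show ?thesis unfolding e sub[OF that(1)] using j0 by (simp add: mult.commute)
    qed
  qed
  let ?M = "m \<Otimes>\<^sub>M m'"
  let ?w = "\<lambda>z. Q (k (fst z)) (k (snd z))"
  have wm: "(\<lambda>z. G (k (fst z)) (k (snd z))) \<in> borel_measurable ?M" for G :: "nat \<Rightarrow> nat \<Rightarrow> real"
    using borel_measurable_integrable[OF integral_simple_product(1)[OF P s _ _ km kn, of "\<lambda>_. 1" "\<lambda>_. 1" G]] by simp
  note wm[of Q, measurable]
  define cc where "cc = density ?M (\<lambda>z. ennreal (?w z))"
  have scc: "sets cc = sets (borel \<Otimes>\<^sub>M borel)"
    unfolding cc_def sets_density by (rule sets_pair_measure_cong[OF s])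
  note isp = integral_simple_product[OF P s _ _ km kn]
  have iind: "integrable m (indicator A :: 'a \<Rightarrow> real)" "integrable m' (indicator B :: 'a \<Rightarrow> real)"
    if [measurable]: "A \<in> sets borel" "B \<in> sets borel" for A B
    by (rule m.integrable_const_bound[where B=1], auto split: split_indicator)
       (rule m'.integrable_const_bound[where B=1], auto split: split_indicator)
  have em: "emeasure cc {z. fst z \<in> A \<and> snd z \<in> B} =
      ennreal (\<Sum>i\<le>n. \<Sum>j\<le>n. Q i j * (measure m (E i \<inter> A) * measure m' (E j \<inter> B)))"
    if [measurable]: "A \<in> sets borel" "B \<in> sets borel" for A B
  proof -
    note iA = iind[OF that(1) that(2)]
    have AB: "{z. fst z \<in> A \<and> snd z \<in> B} \<in> sets ?M"
    proof -
      have "{z. fst z \<in> A \<and> snd z \<in> B} = A \<times> B" by auto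
      then show ?thesis using that s by simp
    qed
    have "emeasure cc {z. fst z \<in> A \<and> snd z \<in> B} = (\<integral>\<^sup>+z. ennreal (?w z) * indicator {z. fst z \<in> A \<and> snd z \<in> B} z \<partial>?M)"
      unfolding cc_def by (rule emeasure_density) (use AB in auto)
    also have "\<dots> = (\<integral>\<^sup>+z. ennreal (?w z * (indicator A (fst z) * indicator B (snd z))) \<partial>?M)"
      by (intro nn_integral_cong) (auto simp: indicator_def)
    also have "\<dots> = ennreal (\<integral>z. ?w z * (indicator A (fst z) * indicator B (snd z)) \<partial>?M)"
      by (intro nn_integral_eq_integral isp(1)[OF iA] AE_I2) (simp add: Q0)
    also have "(\<integral>z. ?w z * (indicator A (fst z) * indicator B (snd z)) \<partial>?M) =
        (\<Sum>i\<le>n. \<Sum>j\<le>n. Q i j * (measure m (E i \<inter> A) * measure m' (E j \<inter> B)))"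
      unfolding isp(2)[OF iA] E_def[symmetric] by (simp add: sp flip: indicator_inter_arith)
    finally show ?thesis .
  qed
  have marg1: "emeasure cc {z. fst z \<in> A \<and> snd z \<in> UNIV} = emeasure m A" if [measurable]: "A \<in> sets borel" for A
  proof -
    have "(\<Sum>i\<le>n. \<Sum>j\<le>n. Q i j * (measure m (E i \<inter> A) * measure m' (E j \<inter> UNIV))) = (\<Sum>i\<le>n. measure m (E i \<inter> A))"
    proof (intro sum.cong refl)
      fix i assume "i \<in> {..n}"
      moreover have "measure m (E i \<inter> A) \<le> a i" unfolding a_def by (intro m.finite_measure_mono) auto
      ultimately show "(\<Sum>j\<le>n. Q i j * (measure m (E i \<inter> A) * measure m' (E j \<inter> UNIV))) = measure m (E i \<inter> A)"
        using rowQ[of i "measure m (E i \<inter> A)"] measure_nonneg[of m "E i \<inter> A"] by (simp add: b_def[symmetric])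
    qed
    also have "\<dots> = measure m A"
      using sum_cell_measure[OF s(1) iind(1)[OF that that] km kn] by (simp add: sp E_def flip: indicator_inter_arith)
    finally show ?thesis using em[of A UNIV] by (simp add: m.emeasure_eq_measure)
  qed
  have marg2: "emeasure cc {z. fst z \<in> UNIV \<and> snd z \<in> B} = emeasure m' B" if [measurable]: "B \<in> sets borel" for B
  proof -
    have "(\<Sum>i\<le>n. \<Sum>j\<le>n. Q i j * (measure m (E i \<inter> UNIV) * measure m' (E j \<inter> B))) =
      (\<Sum>j\<le>n. \<Sum>i\<le>n. Q i j * (measure m (E i \<inter> UNIV) * measure m' (E j \<inter> B)))" by (rule sum.swap)
    also have "\<dots> = (\<Sum>j\<le>n. measure m' (E j \<inter> B))"
    proof (intro sum.cong refl)
      fix j assume "j \<in> {..n}"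
      moreover have "measure m' (E j \<inter> B) \<le> b j" unfolding b_def by (intro m'.finite_measure_mono) auto
      ultimately show "(\<Sum>i\<le>n. Q i j * (measure m (E i \<inter> UNIV) * measure m' (E j \<inter> B))) = measure m' (E j \<inter> B)"
        using colQ[of j "measure m' (E j \<inter> B)"] measure_nonneg[of m' "E j \<inter> B"] by (simp add: a_def[symmetric])
    qed
    also have "\<dots> = measure m' B"
      using sum_cell_measure[OF s(2) iind(2)[OF that that] km kn] by (simp add: sp E_def flip: indicator_inter_arith)
    finally show ?thesis using em[of UNIV B] by (simp add: m'.emeasure_eq_measure)
  qed
  have spc: "space cc = UNIV" using sets_eq_imp_space_eq[OF scc] by (simp add: space_pair_measure)
  have coup: "cc \<in> couplings m m'"
    unfolding couplings_def mem_Collect_eq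
  proof (intro conjI)
    have "emeasure cc (space cc) = 1"
      using marg1[of UNIV] m.emeasure_space_1 by (simp add: spc sp)
    then show "cc \<in> space (prob_algebra (borel \<Otimes>\<^sub>M borel))"
      using scc by (auto simp: space_prob_algebra intro: prob_spaceI)
    show "distr cc borel fst = m"
    proof (rule measure_eqI)
      show "sets (distr cc borel fst) = sets m" using s by simp
      fix A assume "A \<in> sets (distr cc borel fst)"
      then have A: "A \<in> sets borel" by simp
      have "fst \<in> cc \<rightarrow>\<^sub>M borel" unfolding measurable_cong_sets[OF scc refl] by measurable
      then show "emeasure (distr cc borel fst) A = emeasure m A"
        using marg1[OF A] A by (simp add: emeasure_distr spc vimage_def)
    qed
    show "distr cc borel snd = m'"
    proof (rule measure_eqI)
      show "sets (distr cc borel snd) = sets m'" using s by simp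
      fix A assume "A \<in> sets (distr cc borel snd)"
      then have A: "A \<in> sets borel" by simp
      have "snd \<in> cc \<rightarrow>\<^sub>M borel" unfolding measurable_cong_sets[OF scc refl] by measurable
      then show "emeasure (distr cc borel snd) A = emeasure m' A"
        using marg2[OF A] A by (simp add: emeasure_distr spc vimage_def)
    qed
  qed
  have one: "integrable m (\<lambda>_. 1::real)" "integrable m' (\<lambda>_. 1::real)" by auto
  have cM [measurable]: "cost \<in> borel_measurable ?M"
    using cm unfolding measurable_cong_sets[OF sets_pair_measure_cong[OF s] refl] .
  let ?b = "\<lambda>z. \<epsilon> * (Q (k (fst z)) (k (snd z)) * (1 * 1)) + U (k (fst z)) (k (snd z)) * (\<phi> (fst z) * 1)
      + U (k (fst z)) (k (snd z)) * (1 * \<phi> (snd z))"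
  \<comment> \<open>The matched mass of a near cell pays at most \<epsilon>; the rest, counted by
    \<open>U\<close>, pays the crude bound \<open>\<phi> x + \<phi> y\<close>.\<close>
  have le: "?w z * cost z \<le> ?b z" for z
  proof -
    obtain x y where z: "z = (x, y)" by (cases z)
    define D where "D = a (k x) * b (k y)"
    have D: "0 \<le> D" using a0 b0 by (simp add: D_def)
    have "q (k x) (k y) * cost z \<le> \<epsilon> * q (k x) (k y) + u (k x) (k y) * (\<phi> x + \<phi> y)"
    proof (cases "k x = k y \<and> k x \<noteq> 0")
      case True
      then have e: "q (k x) (k y) = c (k x) + q2 (k x) (k y)" "u (k x) (k y) = q2 (k x) (k y)"
        by (auto simp: q_def u_def)
      have "c (k x) * cost z \<le> c (k x) * \<epsilon>" using cnear[of x y] True ca by (intro mult_left_mono) (auto simp: z)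
      moreover have "q2 (k x) (k y) * cost z \<le> q2 (k x) (k y) * (\<phi> x + \<phi> y)"
        using cfar[of x y] q20 by (intro mult_left_mono) (auto simp: z)
      moreover have "0 \<le> \<epsilon> * q2 (k x) (k y)" using \<epsilon> q20 by simp
      ultimately show ?thesis unfolding e by (simp add: algebra_simps)
    next
      case False
      then have e: "q (k x) (k y) = u (k x) (k y)" by (auto simp: q_def u_def)
      have "u (k x) (k y) * cost z \<le> u (k x) (k y) * (\<phi> x + \<phi> y)"
        using cfar[of x y] u0 by (intro mult_left_mono) (auto simp: z)
      then show ?thesis unfolding e using \<epsilon> u0 by (intro add_increasing) auto
    qed
    then have "q (k x) (k y) * cost z / D \<le> (\<epsilon> * q (k x) (k y) + u (k x) (k y) * (\<phi> x + \<phi> y)) / D"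
      using D by (intro divide_right_mono)
    then show ?thesis unfolding z fst_conv snd_conv Q_def U_def D_def[symmetric]
      by (simp add: add_divide_distrib distrib_left)
  qed
  have ib: "integrable ?M ?b"
    using isp(1)[OF one, of Q] isp(1)[OF \<phi>(1) one(2), of U] isp(1)[OF one(1) \<phi>(2), of U] by simp
  have wc0: "0 \<le> ?w z * cost z" for z using Q0 c0 by simp
  have ic: "integrable ?M (\<lambda>z. ?w z * cost z)"
    by (rule Bochner_Integration.integrable_bound[OF ib])
       (use le wc0 in \<open>auto intro!: AE_I2 order_trans[OF _ abs_ge_self] simp: abs_of_nonneg[OF wc0]\<close>)
  have Phi: "0 \<le> (\<integral>x. indicator (E i) x * \<phi> x \<partial>m)" "0 \<le> (\<integral>x. indicator (E i) x * \<phi> x \<partial>m')" for i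
    using \<phi>(3) by (auto intro!: integral_nonneg_AE AE_I2)
  have PhiR: "(\<integral>x. indicator (E i) x * \<phi> x \<partial>m) \<le> r * a i" "(\<integral>x. indicator (E i) x * \<phi> x \<partial>m') \<le> r * b i" if "i \<noteq> 0" for i
  proof -
    have p: "indicator (E i) x * \<phi> x \<le> r * (indicator (E i) x * 1)" for x
      using \<phi>R[of x] that by (auto simp: indicator_def E_def)
    have ie: "integrable m (\<lambda>x. indicator (E i) x * \<phi> x)" "integrable m' (\<lambda>x. indicator (E i) x * \<phi> x)"
      using integrable_mult_indicator[OF _ \<phi>(1), of "E i"] integrable_mult_indicator[OF _ \<phi>(2), of "E i"] by simp_all
    have "(\<integral>x. indicator (E i) x * \<phi> x \<partial>m) \<le> (\<integral>x. r * (indicator (E i) x * 1) \<partial>m)"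
      using ie p iind[OF E E] by (intro integral_mono) auto
    then show "(\<integral>x. indicator (E i) x * \<phi> x \<partial>m) \<le> r * a i" using aE by simp
    have "(\<integral>x. indicator (E i) x * \<phi> x \<partial>m') \<le> (\<integral>x. r * (indicator (E i) x * 1) \<partial>m')"
      using ie p iind[OF E E] by (intro integral_mono) auto
    then show "(\<integral>x. indicator (E i) x * \<phi> x \<partial>m') \<le> r * b i" using bE by simp
  qed
  let ?S = "\<Sum>i\<le>n. \<bar>a i - b i\<bar>"
  have sumif: "(\<Sum>i\<le>n. if i = 0 then X i else r * \<bar>a i - b i\<bar>) \<le> X 0 + r * ?S" for X :: "nat \<Rightarrow> real"
  proof -
    have "(\<Sum>i\<le>n. if i = 0 then X i else r * \<bar>a i - b i\<bar>) \<le> (\<Sum>i\<le>n. (if i = 0 then X i else 0) + r * \<bar>a i - b i\<bar>)"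
      using r by (intro sum_mono) auto
    then show ?thesis by (simp add: sum.distrib sum_distrib_left)
  qed
  have "(\<integral>z. cost z \<partial>cc) = (\<integral>z. ?w z * cost z \<partial>?M)"
    unfolding cc_def using Q0 by (subst integral_density) auto
  also have "\<dots> \<le> (\<integral>z. ?b z \<partial>?M)" using ic ib le by (intro integral_mono) auto
  also have "\<dots> = \<epsilon> * (\<integral>z. Q (k (fst z)) (k (snd z)) * (1 * 1) \<partial>?M)
     + (\<integral>z. U (k (fst z)) (k (snd z)) * (\<phi> (fst z) * 1) \<partial>?M) + (\<integral>z. U (k (fst z)) (k (snd z)) * (1 * \<phi> (snd z)) \<partial>?M)"
    using isp(1)[OF one, of Q] isp(1)[OF \<phi>(1) one(2), of U] isp(1)[OF one(1) \<phi>(2), of U] by simp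
  also have "\<dots> \<le> \<epsilon> * 1 + ((\<integral>x. indicator (E 0) x * \<phi> x \<partial>m) + r * ?S) + ((\<integral>x. indicator (E 0) x * \<phi> x \<partial>m') + r * ?S)"
  proof (intro add_mono mult_left_mono \<epsilon>)
    have "(\<integral>z. Q (k (fst z)) (k (snd z)) * (1 * 1) \<partial>?M) = (\<Sum>i\<le>n. \<Sum>j\<le>n. Q i j * (a i * b j))"
      unfolding isp(2)[OF one] E_def[symmetric] aE bE ..
    also have "\<dots> = (\<Sum>i\<le>n. a i)" by (intro sum.cong refl rowQ) auto
    finally show "(\<integral>z. Q (k (fst z)) (k (snd z)) * (1 * 1) \<partial>?M) \<le> 1" using sa by simp
    have "(\<integral>z. U (k (fst z)) (k (snd z)) * (\<phi> (fst z) * 1) \<partial>?M) = (\<Sum>i\<le>n. \<Sum>j\<le>n. U i j * ((\<integral>x. indicator (E i) x * \<phi> x \<partial>m) * b j))"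
      unfolding isp(2)[OF \<phi>(1) one(2)] E_def[symmetric] bE ..
    also have "\<dots> \<le> (\<Sum>i\<le>n. if i = 0 then (\<integral>x. indicator (E i) x * \<phi> x \<partial>m) else r * \<bar>a i - b i\<bar>)"
      using Phi PhiR by (intro sum_mono rowU) auto
    also have "\<dots> \<le> (\<integral>x. indicator (E 0) x * \<phi> x \<partial>m) + r * ?S" by (rule sumif)
    finally show "(\<integral>z. U (k (fst z)) (k (snd z)) * (\<phi> (fst z) * 1) \<partial>?M) \<le> (\<integral>x. indicator (E 0) x * \<phi> x \<partial>m) + r * ?S" .
    have "(\<integral>z. U (k (fst z)) (k (snd z)) * (1 * \<phi> (snd z)) \<partial>?M) = (\<Sum>i\<le>n. \<Sum>j\<le>n. U i j * (a i * (\<integral>x. indicator (E j) x * \<phi> x \<partial>m')))"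
      unfolding isp(2)[OF one(1) \<phi>(2)] E_def[symmetric] aE ..
    also have "\<dots> = (\<Sum>j\<le>n. \<Sum>i\<le>n. U i j * (a i * (\<integral>x. indicator (E j) x * \<phi> x \<partial>m')))" by (rule sum.swap)
    also have "\<dots> \<le> (\<Sum>i\<le>n. if i = 0 then (\<integral>x. indicator (E i) x * \<phi> x \<partial>m') else r * \<bar>a i - b i\<bar>)"
      using Phi PhiR by (intro sum_mono colU) auto
    also have "\<dots> \<le> (\<integral>x. indicator (E 0) x * \<phi> x \<partial>m') + r * ?S" by (rule sumif)
    finally show "(\<integral>z. U (k (fst z)) (k (snd z)) * (1 * \<phi> (snd z)) \<partial>?M) \<le> (\<integral>x. indicator (E 0) x * \<phi> x \<partial>m') + r * ?S" .
  qed
  finally have "(\<integral>z. cost z \<partial>cc) \<le> \<epsilon> + (\<integral>x. indicator (E 0) x * \<phi> x \<partial>m) + (\<integral>x. indicator (E 0) x * \<phi> x \<partial>m') + 2 * r * ?S"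
    by simp
  then show ?thesis using coup unfolding E_def a_def b_def by blast
qed

section \<open>Moments and Wasserstein balls\<close>

lemma npow_nonneg [simp]: "0 \<le> npow p x"
  by (simp add: npow_def)

lemma npow_measurable [measurable]: "npow p \<in> borel_measurable borel"
  unfolding npow_def[abs_def] by measurable

lemma Pspace_D:
  assumes "m \<in> Pspace l"
  shows "prob_space m" "sets m = sets borel" "integrable m (npow l)"
proof -
  show "prob_space m" and s: "sets m = sets borel"
    using assms by (auto simp: Pspace_def space_prob_algebra)
  have "npow l \<in> borel_measurable m"
    unfolding measurable_cong_sets[OF s refl] by measurable
  then show "integrable m (npow l)"
    using assms by (intro integrableI_bounded) (auto simp: Pspace_def)
qed

lemma far_npow_tendsto:
  assumes "m \<in> Pspace l"
  shows "(\<lambda>A. \<integral>x. indicator {x. real A < norm x} x * npow l x \<partial>m) \<longlonglongrightarrow> 0"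
proof -
  note m = Pspace_D[OF assms]
  note m(2)[measurable_cong]
  have "(\<lambda>A. \<integral>x. indicator {x. real A < norm x} x * npow l x \<partial>m) \<longlonglongrightarrow> (\<integral>x. 0 \<partial>m)"
  proof (rule integral_dominated_convergence[where w="npow l" and f="\<lambda>_. 0" and s="\<lambda>A x. indicator {x. real A < norm x} x * npow l x"])
    show "AE x in m. (\<lambda>A. indicator {x. real A < norm x} x * npow l x) \<longlonglongrightarrow> 0"
    proof (rule AE_I2)
      fix x :: 'a
      obtain A0 where A0: "norm x \<le> real A0" using real_arch_simple by blast
      have "\<forall>\<^sub>F A in sequentially. indicator {x. real A < norm x} x * npow l x = 0"
        using eventually_ge_at_top[of A0] by eventually_elim (use A0 in auto)
      then show "(\<lambda>A. indicator {x. real A < norm x} x * npow l x) \<longlonglongrightarrow> 0"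
        by (rule tendsto_eventually)
    qed
    show "AE x in m. norm (indicator {x. real A < norm x} x * npow l x) \<le> npow l x" for A
      by (intro AE_I2) (simp add: indicator_def)
  qed (use m(3) in measurable)
  then show ?thesis by simp
qed

lemma norm_diff_powr_le:
  fixes x y :: "'a::euclidean_space"
  assumes l: "0 < l"
  shows "norm (x - y) powr l \<le> 2 powr l * npow l x + 2 powr l * npow l y"
proof -
  define M where "M = max (norm x) (norm y)"
  have "norm (x - y) powr l \<le> (2 * M) powr l"
    using l norm_triangle_ineq4[of x y] by (intro powr_mono2) (auto simp: M_def)
  also have "\<dots> = 2 powr l * M powr l" by (rule powr_mult)
  also have "M powr l \<le> npow l x + npow l y"
    using l by (auto simp: M_def npow_def max_def)
  finally show ?thesis by (simp add: distrib_left)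
qed

text \<open>Closeness in the Wasserstein metric is reduced to finitely many cell masses and one tail
  integral. The factor e, prescribed in advance, asks the tail of \<open>mu\<close> itself to be a
  small fraction of the allowed level f; Markov's inequality will turn e into a probability.\<close>

theorem Wdist_lt_of_cells:
  fixes mu :: "'a::euclidean_space measure"
  assumes l: "0 \<le> l" and mu: "mu \<in> Pspace l" and \<delta>: "0 < \<delta>" and e: "0 < e" "e \<le> 1"
  obtains k :: "'a \<Rightarrow> nat" and n :: nat and f g :: real
  where "k \<in> borel \<rightarrow>\<^sub>M count_space UNIV" "\<And>x. k x \<le> n" "0 < f" "0 < g"
    "(\<integral>x. indicator {x. k x = 0} x * npow l x \<partial>mu) \<le> e * f"
    "\<And>m. m \<in> Pspace l \<Longrightarrow> (\<And>i. i \<le> n \<Longrightarrow> \<bar>measure m {x. k x = i} - measure mu {x. k x = i}\<bar> \<le> g) \<Longrightarrow>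
      (\<integral>x. indicator {x. k x = 0} x * npow l x \<partial>m) \<le> f \<Longrightarrow> Wdist l m mu < \<delta>"
proof -
  \<comment> \<open>The level for the transport cost: its power \<open>1 / max l 1\<close> is
    \<delta> / 2, strictly below \<delta>. The budget is \<open>d / 4\<close> for near pairs,
    \<open>d / 8\<close> for each of the two tails and \<open>d / 4\<close> for the mismatch of the
    cell masses.\<close>
  define d where "d = (\<delta> / 2) powr (max l 1)"
  have d: "0 < d" "d powr (1 / max l 1) = \<delta> / 2"
    using \<delta> by (auto simp: d_def powr_powr)
  define cl where "cl = 2 powr l"
  have cl: "1 \<le> cl" using l by (simp add: cl_def ge_one_powr_ge_zero)
  define f where "f = d / (8 * cl)"
  have f: "0 < f" "cl * f = d / 8" using d cl by (auto simp: f_def)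
  have "0 < e * f" using e f by simp
  from order_tendstoD(2)[OF far_npow_tendsto[OF mu] this]
  obtain A :: nat where A: "(\<integral>x. indicator {x. real A < norm x} x * npow l x \<partial>mu) \<le> e * f"
    by (metis (mono_tags, lifting) eventually_sequentially less_imp_le order_refl)
  define cost :: "'a \<times> 'a \<Rightarrow> real" where
    "cost z = (if l = 0 then min 1 (norm (fst z - snd z)) else norm (fst z - snd z) powr l)" for z
  \<comment> \<open>A distance within which the cost is at most \<open>d / 4\<close>; the cells come
    from a net of half that radius.\<close>
  define e0 where "e0 = (if l = 0 then d / 4 else (d / 4) powr (1 / l))"
  have e0: "0 < e0" using d by (simp add: e0_def)
  have near: "cost (x, y) \<le> d / 4" if "dist x y \<le> e0" for x y
  proof (cases "l = 0")
    case True then show ?thesis using that by (simp add: cost_def e0_def dist_norm)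
  next
    case False
    then have "norm (x - y) powr l \<le> ((d / 4) powr (1 / l)) powr l"
      using that l by (intro powr_mono2) (auto simp: e0_def dist_norm)
    then show ?thesis using False d by (simp add: cost_def powr_powr)
  qed
  obtain C where C: "finite C" "cball (0::'a) (real A) \<subseteq> (\<Union>x\<in>C. ball x (e0 / 2))"
    using compact_cball[of "0::'a" "real A"] e0 unfolding compact_eq_totally_bounded
    by (meson half_gt_zero)
  obtain xs where xs: "set xs = C" using finite_list[OF C(1)] by blast
  \<comment> \<open>Cell 0 is the complement of the ball of radius A. Inside, the first net point
    within \<open>e0 / 2\<close> decides, which makes the cells disjoint and Borel.\<close>
  define k where "k x = (if real A < norm x then 0 else Suc (LEAST i. i < length xs \<and> dist (xs ! i) x < e0 / 2))" for x :: 'a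
  have km: "k \<in> borel \<rightarrow>\<^sub>M count_space UNIV"
    unfolding k_def[abs_def] by measurable
  have ex: "\<exists>i. i < length xs \<and> dist (xs ! i) x < e0 / 2" if "norm x \<le> real A" for x
  proof -
    have "x \<in> cball 0 (real A)" using that by simp
    then obtain c where "c \<in> C" "x \<in> ball c (e0 / 2)" using C(2) by blast
    then show ?thesis using xs by (auto simp: in_set_conv_nth)
  qed
  have cell: "k x \<noteq> 0 \<Longrightarrow> norm x \<le> real A \<and> k x - 1 < length xs \<and> dist (xs ! (k x - 1)) x < e0 / 2" for x
    using LeastI_ex[OF ex[of x]] by (auto simp: k_def not_less split: if_splits)
  have kn: "k x \<le> length xs" for x
    using cell[of x] by (cases "k x = 0") auto
  have k0: "{x. k x = 0} = {x. real A < norm x}" by (auto simp: k_def)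
  define r where "r = cl * (1 + real A powr l)"
  have r: "0 \<le> r" using cl by (simp add: r_def)
  have npr: "cl * npow l x \<le> r" if "k x \<noteq> 0" for x
  proof -
    have "npow l x \<le> 1 + real A powr l"
      using cell[OF that] l by (auto simp: npow_def intro: order_trans[OF powr_mono2])
    then show ?thesis using cl by (simp add: r_def)
  qed
  define g where "g = d / (8 * (r + 1) * (real (length xs) + 1))"
  have g: "0 < g" using d r by (simp add: g_def)
  have main: "Wdist l m mu < \<delta>"
    if m: "m \<in> Pspace l" and near_m: "\<And>i. i \<le> length xs \<Longrightarrow> \<bar>measure m {x. k x = i} - measure mu {x. k x = i}\<bar> \<le> g"
      and far: "(\<integral>x. indicator {x. k x = 0} x * npow l x \<partial>m) \<le> f" for m
  proof -
    have "\<exists>c\<in>couplings m mu. (\<integral>z. cost z \<partial>c) \<le> d / 4 + (\<integral>x. indicator {x. k x = 0} x * (cl * npow l x) \<partial>m)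
     + (\<integral>x. indicator {x. k x = 0} x * (cl * npow l x) \<partial>mu)
     + 2 * r * (\<Sum>i\<le>length xs. \<bar>measure m {x. k x = i} - measure mu {x. k x = i}\<bar>)"
    proof (rule cell_coupling[where k=k])
      show "cost \<in> borel_measurable (borel \<Otimes>\<^sub>M borel)" unfolding cost_def[abs_def] by measurable
      show "0 \<le> cost z" for z by (simp add: cost_def)
      show "cost (x, y) \<le> d / 4" if "k x = k y" "k x \<noteq> 0" for x y
      proof (rule near)
        show "dist x y \<le> e0"
          using cell[of x] cell[of y] that dist_triangle_half_r[of "xs ! (k x - 1)" x e0 y] by auto
      qed
      show "cost (x, y) \<le> cl * npow l x + cl * npow l y" for x y
      proof (cases "l = 0")
        case True then show ?thesis by (simp add: cost_def npow_def cl_def)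
      next
        case False then show ?thesis using norm_diff_powr_le[of l x y] l by (simp add: cost_def cl_def)
      qed
    qed (use Pspace_D[OF m] Pspace_D[OF mu] km kn cl npr d r in auto)
    then obtain c where c: "c \<in> couplings m mu" and ci: "(\<integral>z. cost z \<partial>c) \<le> d / 4 + cl * (\<integral>x. indicator {x. k x = 0} x * npow l x \<partial>m)
     + cl * (\<integral>x. indicator {x. k x = 0} x * npow l x \<partial>mu)
     + 2 * r * (\<Sum>i\<le>length xs. \<bar>measure m {x. k x = i} - measure mu {x. k x = i}\<bar>)"
      by (auto simp: mult.left_commute[of _ cl])
    have b1: "cl * (\<integral>x. indicator {x. k x = 0} x * npow l x \<partial>m) \<le> d / 8"
      using mult_left_mono[OF far, of cl] cl f by simp
    have b2: "cl * (\<integral>x. indicator {x. k x = 0} x * npow l x \<partial>mu) \<le> d / 8"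
    proof -
      have "(\<integral>x. indicator {x. k x = 0} x * npow l x \<partial>mu) \<le> 1 * f"
        unfolding k0 using e f by (intro order_trans[OF A] mult_right_mono) auto
      from mult_left_mono[OF this, of cl] show ?thesis using cl f by simp
    qed
    have b3: "2 * r * (\<Sum>i\<le>length xs. \<bar>measure m {x. k x = i} - measure mu {x. k x = i}\<bar>) \<le> d / 4"
    proof -
      have "2 * r * (\<Sum>i\<le>length xs. \<bar>measure m {x. k x = i} - measure mu {x. k x = i}\<bar>) \<le> 2 * (r + 1) * (\<Sum>i\<le>length xs. g)"
        using near_m r by (intro mult_mono sum_mono) (auto intro!: sum_nonneg)
      also have "\<dots> = d / 4"
      proof -
        define a b where "a = r + 1" and "b = real (length xs) + 1"
        have "a \<noteq> 0" "b \<noteq> 0" using r by (auto simp: a_def b_def)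
        then have "2 * a * (b * (d / (8 * a * b))) = d / 4" by (simp add: field_simps)
        then show ?thesis by (simp add: g_def a_def b_def add.commute)
      qed
      finally show ?thesis .
    qed
    have cd: "(\<integral>z. cost z \<partial>c) \<le> d" using ci b1 b2 b3 d by linarith
    have c0: "0 \<le> (\<integral>z. cost z \<partial>c')" for c' by (simp add: cost_def)
    have "Wdist l m mu \<le> (\<integral>z. cost z \<partial>c) powr (1 / max l 1)"
    proof (cases "l = 0")
      case True
      then show ?thesis using c0[of c] c0
        by (auto simp: Wdist_def cost_def intro!: cINF_lower c bdd_belowI2[where m=0])
    next
      case False
      then show ?thesis
        by (auto simp: Wdist_def cost_def intro!: cINF_lower c bdd_belowI2[where m=0])
    qed
    also have "\<dots> \<le> d powr (1 / max l 1)"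
      using cd c0[of c] l by (intro powr_mono2) auto
    also have "\<dots> < \<delta>" using d \<delta> by simp
    finally show ?thesis .
  qed
  show ?thesis
    by (rule that[OF km kn f(1) g]) (use A k0 main in auto)
qed

section \<open>Mixtures and linear functional derivatives\<close>

lemma mixture_sets [simp, measurable_cong]: "sets (mixture e m nu) = sets (borel :: 'a::euclidean_space measure)"
  using sets.sigma_sets_eq[of "borel :: 'a measure"] by (simp add: mixture_def)

lemma mixture_space [simp]: "space (mixture e m nu) = UNIV"
  by (simp add: mixture_def)

lemma emeasure_mixture:
  assumes s: "sets m = sets borel" "sets nu = sets borel" and A: "A \<in> sets borel"
  shows "emeasure (mixture e m nu) A = ennreal (1 - e) * emeasure m A + ennreal e * emeasure nu A"
  unfolding mixture_def
proof (rule emeasure_measure_of_sigma)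
  show "sigma_algebra UNIV (sets (borel :: 'a measure))"
    using sets.sigma_algebra_axioms[of "borel :: 'a measure"] by simp
  show "positive (sets borel) (\<lambda>A. ennreal (1 - e) * emeasure m A + ennreal e * emeasure nu A)"
    by (simp add: positive_def)
  show "countably_additive (sets borel) (\<lambda>A. ennreal (1 - e) * emeasure m A + ennreal e * emeasure nu A)"
  proof (rule countably_additiveI)
    fix B :: "nat \<Rightarrow> 'a set" assume B: "range B \<subseteq> sets borel" "disjoint_family B"
    have "(\<Sum>i. ennreal (1 - e) * emeasure m (B i) + ennreal e * emeasure nu (B i)) =
        (\<Sum>i. ennreal (1 - e) * emeasure m (B i)) + (\<Sum>i. ennreal e * emeasure nu (B i))"
      by (rule suminf_add[symmetric]) auto
    also have "\<dots> = ennreal (1 - e) * emeasure m (\<Union>i. B i) + ennreal e * emeasure nu (\<Union>i. B i)"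
      using B s by (simp add: suminf_emeasure)
    finally show "(\<Sum>i. ennreal (1 - e) * emeasure m (B i) + ennreal e * emeasure nu (B i)) =
        ennreal (1 - e) * emeasure m (\<Union>i. B i) + ennreal e * emeasure nu (\<Union>i. B i)" .
  qed
qed (rule A)

lemma nn_integral_mixture:
  assumes s: "sets m = sets borel" "sets nu = sets borel" and f: "f \<in> borel_measurable borel"
  shows "(\<integral>\<^sup>+x. f x \<partial>mixture e m nu) = ennreal (1 - e) * (\<integral>\<^sup>+x. f x \<partial>m) + ennreal e * (\<integral>\<^sup>+x. f x \<partial>nu)"
  using f
proof induction
  case (cong f g)
  then have "f = g" by auto
  then show ?case using cong by simp
next
  case (set A)
  then show ?case using s by (simp add: emeasure_mixture)
next
  case (mult u c)
  note s[measurable_cong] and mult(2)[measurable]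
  have "(\<integral>\<^sup>+x. c * u x \<partial>mixture e m nu) = c * (\<integral>\<^sup>+x. u x \<partial>mixture e m nu)"
    "(\<integral>\<^sup>+x. c * u x \<partial>m) = c * (\<integral>\<^sup>+x. u x \<partial>m)" "(\<integral>\<^sup>+x. c * u x \<partial>nu) = c * (\<integral>\<^sup>+x. u x \<partial>nu)"
    by (rule nn_integral_cmult; measurable)+
  then show ?case using mult(4) by (simp add: distrib_left mult_ac)
next
  case (add u v)
  note s[measurable_cong] and add.hyps(1)[measurable] add.hyps(3)[measurable]
  have "(\<integral>\<^sup>+x. v x + u x \<partial>mixture e m nu) = (\<integral>\<^sup>+x. v x \<partial>mixture e m nu) + (\<integral>\<^sup>+x. u x \<partial>mixture e m nu)"
    "(\<integral>\<^sup>+x. v x + u x \<partial>m) = (\<integral>\<^sup>+x. v x \<partial>m) + (\<integral>\<^sup>+x. u x \<partial>m)"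
    "(\<integral>\<^sup>+x. v x + u x \<partial>nu) = (\<integral>\<^sup>+x. v x \<partial>nu) + (\<integral>\<^sup>+x. u x \<partial>nu)"
    by (rule nn_integral_add; measurable)+
  then show ?case using add.IH by (simp add: distrib_left add_ac)
next
  case (seq U)
  note s[measurable_cong] and seq.hyps(1)[measurable]
  have U: "incseq U" by (rule seq)
  have sup: "(\<integral>\<^sup>+x. (SUP i. U i) x \<partial>M) = (SUP i. \<integral>\<^sup>+x. U i x \<partial>M)" if [measurable_cong]: "sets M = sets borel" for M
    unfolding SUP_apply using U by (intro nn_integral_monotone_convergence_SUP) auto
  have inc: "incseq (\<lambda>i. ennreal c * (\<integral>\<^sup>+x. U i x \<partial>M))" for c M
    using U by (auto simp: incseq_def le_fun_def intro!: mult_left_mono nn_integral_mono)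
  show ?case
    unfolding sup[OF s(1)] sup[OF s(2)] sup[OF mixture_sets] seq.IH
    by (simp add: ennreal_SUP_add[OF inc inc] SUP_mult_left_ennreal)
qed

lemma integral_mixture:
  fixes f :: "'a::euclidean_space \<Rightarrow> real"
  assumes s: "sets m = sets borel" "sets nu = sets borel" and e: "0 \<le> e" "e \<le> 1"
    and f: "integrable m f" "integrable nu f"
  shows "integrable (mixture e m nu) f"
    and "(\<integral>x. f x \<partial>mixture e m nu) = (1 - e) * (\<integral>x. f x \<partial>m) + e * (\<integral>x. f x \<partial>nu)"
proof -
  note s[measurable_cong]
  have [measurable]: "f \<in> borel_measurable borel"
    using borel_measurable_integrable[OF f(1)] s by (simp cong: measurable_cong_sets)
  have *: "integrable (mixture e m nu) g \<and> (\<integral>x. g x \<partial>mixture e m nu) = (1 - e) * (\<integral>x. g x \<partial>m) + e * (\<integral>x. g x \<partial>nu)"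
    if g: "integrable m g" "integrable nu g" "g \<in> borel_measurable borel" "\<And>x. 0 \<le> g x" for g :: "'a \<Rightarrow> real"
  proof -
    have [measurable]: "g \<in> borel_measurable borel" by (rule g)
    have nn: "0 \<le> (\<integral>x. g x \<partial>m)" "0 \<le> (\<integral>x. g x \<partial>nu)" using g by auto
    have "(\<integral>\<^sup>+x. ennreal (g x) \<partial>mixture e m nu) = ennreal (1 - e) * (\<integral>\<^sup>+x. ennreal (g x) \<partial>m) + ennreal e * (\<integral>\<^sup>+x. ennreal (g x) \<partial>nu)"
      by (rule nn_integral_mixture[OF s]) measurable
    also have "\<dots> = ennreal (1 - e) * ennreal (\<integral>x. g x \<partial>m) + ennreal e * ennreal (\<integral>x. g x \<partial>nu)"
      using g by (simp add: nn_integral_eq_integral)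
    also have "\<dots> = ennreal ((1 - e) * (\<integral>x. g x \<partial>m) + e * (\<integral>x. g x \<partial>nu))"
      using e nn by (simp add: ennreal_mult)
    finally have eq: "(\<integral>\<^sup>+x. ennreal (g x) \<partial>mixture e m nu) = ennreal ((1 - e) * (\<integral>x. g x \<partial>m) + e * (\<integral>x. g x \<partial>nu))" .
    have gm: "g \<in> borel_measurable (mixture e m nu)" by measurable
    have "integrable (mixture e m nu) g"
      using g eq gm by (intro integrableI_nonneg) auto
    moreover have "(\<integral>x. g x \<partial>mixture e m nu) = (1 - e) * (\<integral>x. g x \<partial>m) + e * (\<integral>x. g x \<partial>nu)"
    proof -
      have "(\<integral>x. g x \<partial>mixture e m nu) = enn2real (\<integral>\<^sup>+x. ennreal (g x) \<partial>mixture e m nu)"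
        using g by (intro integral_eq_nn_integral[OF gm]) simp
      also have "\<dots> = (1 - e) * (\<integral>x. g x \<partial>m) + e * (\<integral>x. g x \<partial>nu)"
        unfolding eq using e nn by (intro enn2real_ennreal) simp
      finally show ?thesis .
    qed
    ultimately show ?thesis by simp
  qed
  have p: "integrable m (\<lambda>x. max 0 (f x))" "integrable nu (\<lambda>x. max 0 (f x))"
      "integrable m (\<lambda>x. max 0 (- f x))" "integrable nu (\<lambda>x. max 0 (- f x))"
    using f by auto
  note P = *[OF p(1,2)] and N = *[OF p(3,4)]
  have eq: "max 0 (f x) - max 0 (- f x) = f x" for x by (simp add: max_def)
  have diff: "(\<integral>x. f x \<partial>M) = (\<integral>x. max 0 (f x) \<partial>M) - (\<integral>x. max 0 (- f x) \<partial>M)"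
    if "integrable M (\<lambda>x. max 0 (f x))" "integrable M (\<lambda>x. max 0 (- f x))" for M
    using Bochner_Integration.integral_diff[OF that] by (simp only: eq)
  have "integrable (mixture e m nu) (\<lambda>x. max 0 (f x) - max 0 (- f x))"
    using P N by (intro Bochner_Integration.integrable_diff) auto
  then show "integrable (mixture e m nu) f" by (simp only: eq)
  show "(\<integral>x. f x \<partial>mixture e m nu) = (1 - e) * (\<integral>x. f x \<partial>m) + e * (\<integral>x. f x \<partial>nu)"
  proof -
    have "(\<integral>x. f x \<partial>mixture e m nu) = (\<integral>x. max 0 (f x) \<partial>mixture e m nu) - (\<integral>x. max 0 (- f x) \<partial>mixture e m nu)"
      using P N by (intro diff) auto
    then show ?thesis
      using P N unfolding diff[OF p(1,3)] diff[OF p(2,4)] by (simp add: algebra_simps)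
  qed
qed

lemma prob_space_mixture:
  assumes "prob_space m" "prob_space nu" "sets m = sets borel" "sets nu = sets borel" "0 \<le> e" "e \<le> 1"
  shows "prob_space (mixture e m nu)"
proof (rule prob_spaceI)
  have "space m = UNIV" "space nu = UNIV"
    using sets_eq_imp_space_eq[OF assms(3)] sets_eq_imp_space_eq[OF assms(4)] by simp_all
  then have "emeasure m UNIV = 1" "emeasure nu UNIV = 1"
    using prob_space.emeasure_space_1[OF assms(1)] prob_space.emeasure_space_1[OF assms(2)] by simp_all
  then show "emeasure (mixture e m nu) (space (mixture e m nu)) = 1"
    using assms by (simp add: emeasure_mixture flip: ennreal_plus)
qed

lemma measure_mixture:
  assumes "prob_space m" "prob_space nu" "sets m = sets borel" "sets nu = sets borel" "0 \<le> e" "e \<le> 1"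
    and A: "A \<in> sets borel"
  shows "measure (mixture e m nu) A = (1 - e) * measure m A + e * measure nu A"
proof -
  interpret m: prob_space m by fact
  interpret nu: prob_space nu by fact
  have "emeasure (mixture e m nu) A = ennreal ((1 - e) * measure m A + e * measure nu A)"
    using assms by (simp add: emeasure_mixture m.emeasure_eq_measure nu.emeasure_eq_measure ennreal_mult)
  then show ?thesis using assms by (intro measure_eq_emeasure_eq_ennreal) simp_all
qed

lemma Pspace_mixture:
  assumes m: "m \<in> Pspace l" and nu: "nu \<in> Pspace l" and e: "0 \<le> e" "e \<le> 1"
  shows "mixture e m nu \<in> Pspace l"
proof -
  note M = Pspace_D[OF m] and N = Pspace_D[OF nu]
  have "(\<integral>\<^sup>+x. ennreal (npow l x) \<partial>mixture e m nu) =
    ennreal (1 - e) * (\<integral>\<^sup>+x. ennreal (npow l x) \<partial>m) + ennreal e * (\<integral>\<^sup>+x. ennreal (npow l x) \<partial>nu)"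
    by (rule nn_integral_mixture[OF M(2) N(2)]) measurable
  also have "\<dots> < \<infinity>"
    using m nu by (auto simp: Pspace_def ennreal_mult_less_top)
  finally show ?thesis
    using prob_space_mixture[OF M(1) N(1) M(2) N(2) e] by (simp add: Pspace_def space_prob_algebra)
qed

text \<open>Moving from a point of the segment towards an end point stays on the segment, and the
  parameter advances by e times the remaining length. One-sided derivatives at inner points thus
  become derivatives along the original segment.\<close>

lemma mixture_mixture_right:
  assumes s: "sets m = sets borel" "sets nu = sets borel" and e: "0 \<le> e" "e \<le> 1" "0 \<le> t" "t \<le> 1"
  shows "mixture e (mixture t m nu) nu = mixture (t + e * (1 - t)) m nu"
proof (rule measure_eqI)
  fix A assume "A \<in> sets (mixture e (mixture t m nu) nu)"
  then have A: "A \<in> sets borel" by simp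
  have "1 - (t + e * (1 - t)) = (1 - e) * (1 - t)" "t + e * (1 - t) = (1 - e) * t + e" by (auto simp: algebra_simps)
  then have h: "ennreal (1 - (t + e * (1 - t))) = ennreal (1 - e) * ennreal (1 - t)"
      "ennreal (t + e * (1 - t)) = ennreal (1 - e) * ennreal t + ennreal e"
    using e by (simp_all only: ennreal_mult ennreal_plus mult_nonneg_nonneg diff_ge_0_iff_ge)
  show "emeasure (mixture e (mixture t m nu) nu) A = emeasure (mixture (t + e * (1 - t)) m nu) A"
    using e unfolding emeasure_mixture[OF mixture_sets s(2) A] emeasure_mixture[OF s A] h
    by (simp add: distrib_left distrib_right add.assoc mult.assoc)
qed simp

lemma mixture_mixture_left:
  assumes s: "sets m = sets borel" "sets nu = sets borel" and e: "0 \<le> e" "e \<le> 1" "0 \<le> t" "t \<le> 1"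
  shows "mixture e (mixture t m nu) m = mixture (t - e * t) m nu"
proof (rule measure_eqI)
  fix A assume "A \<in> sets (mixture e (mixture t m nu) m)"
  then have A: "A \<in> sets borel" by simp
  have "1 - (t - e * t) = (1 - e) * (1 - t) + e" "t - e * t = (1 - e) * t" by (auto simp: algebra_simps)
  then have h: "ennreal (1 - (t - e * t)) = ennreal (1 - e) * ennreal (1 - t) + ennreal e"
      "ennreal (t - e * t) = ennreal (1 - e) * ennreal t"
    using e by (simp_all only: ennreal_mult ennreal_plus mult_nonneg_nonneg diff_ge_0_iff_ge)
  show "emeasure (mixture e (mixture t m nu) m) A = emeasure (mixture (t - e * t) m nu) A"
    using e unfolding emeasure_mixture[OF mixture_sets s(1) A] emeasure_mixture[OF s A] h
    by (simp add: distrib_left distrib_right add_ac mult.assoc)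
qed simp

lemma mixture_0: "sets m = sets borel \<Longrightarrow> sets nu = sets borel \<Longrightarrow> mixture 0 m nu = m"
  by (rule measure_eqI) (simp_all add: emeasure_mixture)

lemma mixture_1: "sets m = sets borel \<Longrightarrow> sets nu = sets borel \<Longrightarrow> mixture 1 m nu = nu"
  by (rule measure_eqI) (simp_all add: emeasure_mixture)

text \<open>The sign of c selects the side: c is the signed distance from s to the end point towards
  which the one-sided derivative is taken.\<close>

lemma difference_quotient_rescale:
  fixes h u :: "real \<Rightarrow> real"
  assumes h: "(h has_real_derivative D) (at_right 0)" and c: "c \<noteq> 0"
    and S: "\<And>t. t \<in> S \<Longrightarrow> u t = h ((t - s) / c)" "\<And>t. t \<in> S \<Longrightarrow> 0 < (t - s) / c" "u s = h 0"
  shows "((\<lambda>t. (u t - u s) / (t - s)) \<longlongrightarrow> D / c) (at s within S)"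
proof -
  have ev: "\<forall>\<^sub>F t in at s within S. t \<in> S" by (simp add: eventually_at_filter)
  have "((\<lambda>t. (t - s) / c) \<longlongrightarrow> (s - s) / c) (at s within S)"
    using c by (intro tendsto_intros)
  then have "filterlim (\<lambda>t. (t - s) / c) (at_right 0) (at s within S)"
    using ev S(2) S(2)[of s] by (auto simp: filterlim_at elim!: eventually_mono)
  moreover have "((\<lambda>e. (h e - h 0) / e) \<longlongrightarrow> D) (at_right 0)"
    using h by (simp add: has_field_derivative_iff)
  ultimately have "((\<lambda>t. (h ((t - s) / c) - h 0) / ((t - s) / c)) \<longlongrightarrow> D) (at s within S)"
    by (rule filterlim_compose[rotated])
  then have "((\<lambda>t. (h ((t - s) / c) - h 0) / ((t - s) / c) / c) \<longlongrightarrow> D / c) (at s within S)"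
    using c by (intro tendsto_intros)
  then show ?thesis
  proof (rule Lim_transform_eventually)
    show "\<forall>\<^sub>F t in at s within S. (h ((t - s) / c) - h 0) / ((t - s) / c) / c = (u t - u s) / (t - s)"
      using ev
    proof eventually_elim
      fix t assume t: "t \<in> S"
      have "y / ((t - s) / c) / c = y / (t - s)" for y using c by simp
      then show "(h ((t - s) / c) - h 0) / ((t - s) / c) / c = (u t - u s) / (t - s)"
        by (simp only: S(1)[OF t] S(3))
    qed
  qed
qed

lemma lin_fun_deriv_integrable:
  assumes g: "has_lin_fun_deriv l U m' g" and m: "m \<in> Pspace l"
  shows "integrable m g"
proof -
  note M = Pspace_D[OF m]
  interpret prob_space m by (rule M)
  obtain B where B: "\<And>y. \<bar>g y\<bar> / (1 + npow l y) \<le> B"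
    using g unfolding has_lin_fun_deriv_def bdd_above_def by auto
  have le: "\<bar>g y\<bar> \<le> B * (1 + npow l y)" for y
  proof -
    have "0 < 1 + npow l y" using npow_nonneg[of l y] by linarith
    then show ?thesis using B[of y] by (simp add: divide_le_eq)
  qed
  have gm: "g \<in> borel_measurable m"
    using g unfolding has_lin_fun_deriv_def measurable_cong_sets[OF M(2) refl] by simp
  show ?thesis
    by (rule Bochner_Integration.integrable_bound[where f="\<lambda>y. B * (1 + npow l y)"])
       (use M(3) gm le in \<open>auto intro!: AE_I2 intro: order_trans[OF _ abs_ge_self]\<close>)
qed

text \<open>One-sided derivatives towards both end points combine to a two-sided derivative along the
  segment, so the mean value theorem applies.\<close>

lemma lin_fun_deriv_mean_value:
  assumes m: "m \<in> Pspace l" and nu: "nu \<in> Pspace l"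
    and d: "\<And>s. 0 \<le> s \<Longrightarrow> s \<le> 1 \<Longrightarrow> has_lin_fun_deriv l U (mixture s m nu) (f s)"
  obtains s where "0 \<le> s" "s \<le> 1" "U nu - U m = (\<integral>x. f s x \<partial>nu) - (\<integral>x. f s x \<partial>m)"
proof -
  note M = Pspace_D[OF m] and N = Pspace_D[OF nu]
  define u where "u s = U (mixture s m nu)" for s
  define D where "D s = (\<integral>x. f s x \<partial>nu) - (\<integral>x. f s x \<partial>m)" for s
  have der: "(u has_real_derivative D s) (at s within {0..1})" if s: "0 \<le> s" "s \<le> 1" for s
  proof -
    note ds = d[OF s]
    note i = lin_fun_deriv_integrable[OF ds]
    have im: "(\<integral>x. f s x \<partial>mixture s m nu) = (1 - s) * (\<integral>x. f s x \<partial>m) + s * (\<integral>x. f s x \<partial>nu)"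
      by (rule integral_mixture(2)[OF M(2) N(2) s i[OF m] i[OF nu]])
    \<comment> \<open>At parameter s the direction towards \<open>nu\<close> is \<open>1 - s\<close>
      times \<open>nu - m\<close>, and the direction towards \<open>m\<close> is \<open>- s\<close>
      times it; the rescaling cancels these factors.\<close>
    have dr: "((\<lambda>e. U (mixture e (mixture s m nu) nu)) has_real_derivative (1 - s) * D s) (at_right 0)"
      using ds nu unfolding has_lin_fun_deriv_def by (auto simp: im D_def algebra_simps)
    have dl: "((\<lambda>e. U (mixture e (mixture s m nu) m)) has_real_derivative (- s) * D s) (at_right 0)"
      using ds m unfolding has_lin_fun_deriv_def by (auto simp: im D_def algebra_simps)
    have us: "mixture 0 (mixture s m nu) nu = mixture s m nu" "mixture 0 (mixture s m nu) m = mixture s m nu"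
      using M N by (auto intro: mixture_0)
    \<comment> \<open>At an end point of the unit interval one of the two one-sided filters is
      trivial, and the limit along it holds vacuously.\<close>
    have 1: "((\<lambda>t. (u t - u s) / (t - s)) \<longlongrightarrow> D s) (at s within {s<..1})"
    proof (cases "s < 1")
      case True
      have "((\<lambda>t. (u t - u s) / (t - s)) \<longlongrightarrow> (1 - s) * D s / (1 - s)) (at s within {s<..1})"
      proof (rule difference_quotient_rescale[OF dr])
        fix t assume t: "t \<in> {s<..1}"
        have "mixture ((t - s) / (1 - s)) (mixture s m nu) nu = mixture (s + (t - s) / (1 - s) * (1 - s)) m nu"
          using True t s by (intro mixture_mixture_right M N) (auto simp: field_simps)
        then show "u t = U (mixture ((t - s) / (1 - s)) (mixture s m nu) nu)"
          using True by (simp add: u_def)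
      qed (use True us in \<open>auto simp: u_def\<close>)
      then show ?thesis using True by simp
    qed simp
    have 2: "((\<lambda>t. (u t - u s) / (t - s)) \<longlongrightarrow> D s) (at s within {0..<s})"
    proof (cases "0 < s")
      case True
      have "((\<lambda>t. (u t - u s) / (t - s)) \<longlongrightarrow> (- s) * D s / (- s)) (at s within {0..<s})"
      proof (rule difference_quotient_rescale[OF dl])
        fix t assume t: "t \<in> {0..<s}"
        have "mixture ((t - s) / (- s)) (mixture s m nu) m = mixture (s - (t - s) / (- s) * s) m nu"
          using True t s by (intro mixture_mixture_left M N) (auto simp: field_simps)
        then show "u t = U (mixture ((t - s) / (- s)) (mixture s m nu) m)"
          using True by (simp add: u_def)
        show "0 < (t - s) / - s" using True t by (intro divide_neg_neg) auto
      qed (use True us in \<open>auto simp: u_def\<close>)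
      then show ?thesis using True by simp
    qed simp
    have "((\<lambda>t. (u t - u s) / (t - s)) \<longlongrightarrow> D s) (at s within ({0..<s} \<union> {s<..1}))"
      unfolding at_within_union by (rule filterlim_sup[OF 2 1])
    moreover have "at s within ({0..<s} \<union> {s<..1}) = at s within {0..1}"
    proof -
      have "{0..<s} \<union> {s<..1} - {s} = {0..1} - {s}" using s by auto
      then show ?thesis unfolding at_within_def by simp
    qed
    ultimately show ?thesis by (simp add: has_field_derivative_iff)
  qed
  have "\<exists>s\<in>{0<..<1}. u 1 - u 0 = (\<lambda>h. h * D s) (1 - 0)"
  proof (rule mvt_simple)
    show "(u has_derivative (\<lambda>h. h * D x)) (at x within {0..1})" if "0 \<le> x" "x \<le> 1" for x
      using der[OF that] by (simp add: has_field_derivative_def mult.commute[of _ "D x"])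
  qed simp
  then obtain s where s: "s \<in> {0<..<1}" "u 1 - u 0 = D s" by auto
  show ?thesis
    using that[of s] s M N by (simp add: u_def mixture_0 mixture_1 D_def)
qed

text \<open>Domination on single sets passes to all finite partitions because \<open>nu\<close> is
  additive. By \<open>emeasure_measure_of_conv\<close> the value of \<open>tv_diff\<close> is the
  supremum over partitions or the default 0, and both lie below the dominating measure.\<close>

lemma nn_integral_tv_diff_le:
  fixes m1 m2 nu :: "'a::euclidean_space measure"
  assumes nu: "sets nu = sets borel" "prob_space nu" and c: "0 \<le> c"
    and f: "f \<in> borel_measurable borel"
    and le: "\<And>B. B \<in> sets borel \<Longrightarrow> \<bar>measure m2 B - measure m1 B\<bar> \<le> c * measure nu B"
  shows "(\<integral>\<^sup>+x. f x \<partial>tv_diff m2 m1) \<le> ennreal c * (\<integral>\<^sup>+x. f x \<partial>nu)"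
proof -
  interpret nu: prob_space nu by (rule nu)
  let ?\<mu> = "\<lambda>A. SUP \<B>\<in>{\<B>. finite \<B> \<and> disjoint \<B> \<and> \<B> \<subseteq> sets borel \<and> \<Union>\<B> = A}.
            \<Sum>B\<in>\<B>. ennreal \<bar>measure m2 B - measure m1 B\<bar>"
  have st: "sets (tv_diff m2 m1) = sets (scale_measure (ennreal c) nu)"
    using nu sets.sigma_sets_eq[of "borel :: 'a measure"] by (simp add: tv_diff_def)
  have SUP: "?\<mu> A \<le> ennreal c * emeasure nu A" if A: "A \<in> sets borel" for A
  proof (rule SUP_least)
    fix \<B> assume "\<B> \<in> {\<B>. finite \<B> \<and> disjoint \<B> \<and> \<B> \<subseteq> sets borel \<and> \<Union>\<B> = A}"
    then have B: "finite \<B>" "disjoint \<B>" "\<B> \<subseteq> sets borel" "\<Union>\<B> = A" by auto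
    have "(\<Sum>B\<in>\<B>. ennreal \<bar>measure m2 B - measure m1 B\<bar>) \<le> (\<Sum>B\<in>\<B>. ennreal c * emeasure nu B)"
    proof (rule sum_mono)
      fix X assume "X \<in> \<B>"
      then have "\<bar>measure m2 X - measure m1 X\<bar> \<le> c * measure nu X" using le B(3) by blast
      then have "ennreal \<bar>measure m2 X - measure m1 X\<bar> \<le> ennreal (c * measure nu X)" by (rule ennreal_leI)
      then show "ennreal \<bar>measure m2 X - measure m1 X\<bar> \<le> ennreal c * emeasure nu X"
        using c by (simp add: nu.emeasure_eq_measure ennreal_mult)
    qed
    also have "\<dots> = ennreal c * (\<Sum>B\<in>\<B>. emeasure nu B)" by (simp add: sum_distrib_left)
    also have "(\<Sum>B\<in>\<B>. emeasure nu B) = emeasure nu (\<Union>\<B>)"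
    proof -
      have "disjoint_family_on (\<lambda>X. X) \<B>" using B(2) by (auto simp: disjoint_family_on_def disjoint_def)
      then show ?thesis using sum_emeasure[of "\<lambda>X. X" \<B> nu] B nu by simp
    qed
    finally show "(\<Sum>B\<in>\<B>. ennreal \<bar>measure m2 B - measure m1 B\<bar>) \<le> ennreal c * emeasure nu A" using B by simp
  qed
  have "tv_diff m2 m1 \<le> scale_measure (ennreal c) nu"
    unfolding le_measure[OF st]
  proof
    fix A assume "A \<in> sets (tv_diff m2 m1)"
    then have A: "A \<in> sets borel" using st nu by simp
    have "emeasure (tv_diff m2 m1) A \<le> ?\<mu> A"
      unfolding tv_diff_def emeasure_measure_of_conv by simp
    also have "\<dots> \<le> ennreal c * emeasure nu A" by (rule SUP[OF A])
    finally show "emeasure (tv_diff m2 m1) A \<le> emeasure (scale_measure (ennreal c) nu) A" by simp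
  qed
  then have "(\<integral>\<^sup>+x. f x \<partial>tv_diff m2 m1) \<le> (\<integral>\<^sup>+x. f x \<partial>scale_measure (ennreal c) nu)"
    by (rule nn_integral_mono_measure[OF st])
  also have "\<dots> = ennreal c * (\<integral>\<^sup>+x. f x \<partial>nu)"
    using f nu by (intro nn_integral_scale_measure) (simp cong: measurable_cong_sets)
  finally show ?thesis .
qed

section \<open>Empirical measures and their interpolation with the invariant measure\<close>

lemma empirical_sets [simp, measurable_cong]: "sets (empirical N x) = sets borel"
  by (simp add: empirical_def)

lemma empirical_count_measurable: "x \<in> uniform_count_measure {1..N} \<rightarrow>\<^sub>M borel"
  unfolding measurable_cong_sets[OF sets_uniform_count_measure_count_space refl] by simp

lemma prob_space_empirical: "1 \<le> N \<Longrightarrow> prob_space (empirical N x)"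
  unfolding empirical_def
  by (intro prob_space.prob_space_distr prob_space_uniform_count_measure empirical_count_measurable) auto

lemma integral_empirical:
  fixes f :: "'a::euclidean_space \<Rightarrow> real"
  assumes f [measurable]: "f \<in> borel_measurable borel"
  shows "(\<integral>y. f y \<partial>empirical N x) = (\<Sum>i=1..N. f (x i)) / real N"
  unfolding empirical_def
  by (subst integral_distr[OF empirical_count_measurable f]) (simp add: integral_uniform_count_measure)

lemma nn_integral_empirical_finite:
  assumes "f \<in> borel_measurable borel" "\<And>y. f y < \<infinity>"
  shows "(\<integral>\<^sup>+y. f y \<partial>empirical N x) < \<infinity>"
proof -
  have "(\<integral>\<^sup>+y. f y \<partial>empirical N x) = (\<integral>\<^sup>+i. f (x i) \<partial>uniform_count_measure {1..N})"
    unfolding empirical_def by (rule nn_integral_distr[OF empirical_count_measurable]) (use assms in simp)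
  also have "\<dots> = (\<Sum>i\<in>{1..N}. ennreal (1 / real (card {1..N})) * f (x i))"
    unfolding uniform_count_measure_def by (rule nn_integral_point_measure_finite) simp
  also have "\<dots> < \<infinity>"
    using assms(2) by (auto simp: ennreal_mult_less_top)
  finally show ?thesis .
qed

lemma empirical_Pspace: "1 \<le> N \<Longrightarrow> empirical N x \<in> Pspace l"
  using prob_space_empirical[of N x] nn_integral_empirical_finite[of "\<lambda>y. ennreal (npow l y)" N x]
  by (simp add: Pspace_def space_prob_algebra)

lemma sum_shift_nat: "(\<Sum>i=1..n. f (i - 1)) = (\<Sum>i<n. f i)" for f :: "nat \<Rightarrow> real"
  by (rule sum.reindex_bij_witness[of _ "\<lambda>i. i + 1" "\<lambda>i. i - 1"]) auto

text \<open>Interpolates between \<open>mu\<close> (\<open>i = 0\<close>) and the empirical measure (\<open>i = N\<close>) by replacing the mass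
  \<open>i / N\<close> of \<open>mu\<close> by the first \<open>i\<close> sample points.\<close>

definition interp :: "nat \<Rightarrow> 'a::euclidean_space measure \<Rightarrow> nat \<Rightarrow> (nat \<Rightarrow> 'a) \<Rightarrow> 'a measure" where
  "interp N mu i y = mixture (real i / real N) mu (empirical i (\<lambda>j. y (j - 1)))"

lemma interp_sets [simp, measurable_cong]: "sets (interp N mu i y) = sets borel"
  by (simp add: interp_def)

lemma interp_space [simp]: "space (interp N mu i y) = UNIV"
  by (simp add: interp_def)

text \<open>The empirical measure of no points is not a probability measure; at \<open>i = 0\<close>
  the weight 0 removes it. This is why \<open>i = 0\<close> is a separate case in the facts
  below.\<close>

lemma interp_0: "sets mu = sets borel \<Longrightarrow> interp N mu 0 y = mu"
  by (simp add: interp_def mixture_0)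

lemma interp_last: "sets mu = sets borel \<Longrightarrow> 1 \<le> N \<Longrightarrow> interp N mu N y = empirical N (\<lambda>j. y (j - 1))"
  by (simp add: interp_def mixture_1)

context
  fixes mu :: "'a::euclidean_space measure" and N i :: nat
  assumes mu: "prob_space mu" "sets mu = sets borel" and iN: "i \<le> N" "1 \<le> N"
begin

lemma interp_fraction: "0 \<le> real i / real N" "real i / real N \<le> 1"
  using iN by auto

lemma prob_space_interp: "prob_space (interp N mu i y)"
proof (cases "i = 0")
  case True then show ?thesis using mu by (simp add: interp_0)
next
  case False
  then show ?thesis
    unfolding interp_def using mu interp_fraction by (intro prob_space_mixture prob_space_empirical) auto
qed

lemma interp_Pspace: "mu \<in> Pspace l \<Longrightarrow> interp N mu i y \<in> Pspace l"
proof (cases "i = 0")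
  case True
  assume "mu \<in> Pspace l"
  then show ?thesis using True mu by (simp add: interp_0)
next
  case False
  assume "mu \<in> Pspace l"
  then show ?thesis
    unfolding interp_def using interp_fraction False by (intro Pspace_mixture empirical_Pspace) auto
qed

lemma integral_interp:
  fixes f :: "'a \<Rightarrow> real"
  assumes f: "integrable mu f"
  shows "integrable (interp N mu i y) f"
    and "(\<integral>x. f x \<partial>interp N mu i y) = (1 - real i / real N) * (\<integral>x. f x \<partial>mu) + (\<Sum>j<i. f (y j)) / real N"
proof -
  have fm: "f \<in> borel_measurable borel"
    using borel_measurable_integrable[OF f] unfolding measurable_cong_sets[OF mu(2) refl] .
  have ie: "integrable (empirical i (\<lambda>j. y (j - 1))) f"
  proof (rule integrableI_bounded)
    show "f \<in> borel_measurable (empirical i (\<lambda>j. y (j - 1)))"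
      using fm unfolding measurable_cong_sets[OF empirical_sets refl] .
    show "(\<integral>\<^sup>+x. ennreal (norm (f x)) \<partial>empirical i (\<lambda>j. y (j - 1))) < \<infinity>"
      by (rule nn_integral_empirical_finite) (use fm in auto)
  qed
  note m = integral_mixture[OF mu(2) empirical_sets interp_fraction f ie]
  show "integrable (interp N mu i y) f" using m(1) by (simp add: interp_def)
  show "(\<integral>x. f x \<partial>interp N mu i y) = (1 - real i / real N) * (\<integral>x. f x \<partial>mu) + (\<Sum>j<i. f (y j)) / real N"
  proof (cases "i = 0")
    case True then show ?thesis using mu by (simp add: interp_0)
  next
    case False
    then show ?thesis
      using m(2) integral_empirical[OF fm, of i "\<lambda>j. y (j - 1)"] sum_shift_nat[of "\<lambda>j. f (y j)" i]
      by (simp add: interp_def)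
  qed
qed

lemma measure_interp:
  assumes A: "A \<in> sets borel"
  shows "measure (interp N mu i y) A = (1 - real i / real N) * measure mu A + (\<Sum>j<i. indicator A (y j)) / real N"
proof -
  interpret mu: prob_space mu by (rule mu)
  have sp: "space mu = UNIV" using sets_eq_imp_space_eq[OF mu(2)] by simp
  have "integrable mu (indicator A :: 'a \<Rightarrow> real)"
    by (rule mu.integrable_const_bound[where B=1], auto split: split_indicator)
       (use A mu in \<open>simp cong: measurable_cong_sets\<close>)
  from integral_interp(2)[OF this, of y] show ?thesis by (simp add: sp)
qed

end

lemma interp_measurable:
  assumes mu: "prob_space mu" "sets mu = sets borel" and iN: "i \<le> N" "1 \<le> N"
    and y: "\<And>j. j < i \<Longrightarrow> y j \<in> S \<rightarrow>\<^sub>M borel"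
  shows "(\<lambda>\<omega>. interp N mu i (\<lambda>j. y j \<omega>)) \<in> S \<rightarrow>\<^sub>M prob_algebra borel"
proof (rule measurable_prob_algebraI)
  fix \<omega>
  show "prob_space (interp N mu i (\<lambda>j. y j \<omega>))" by (rule prob_space_interp[OF mu iN])
next
  show "(\<lambda>\<omega>. interp N mu i (\<lambda>j. y j \<omega>)) \<in> S \<rightarrow>\<^sub>M subprob_algebra borel"
  proof (rule measurable_subprob_algebra)
    fix A :: "'a set" assume A [measurable]: "A \<in> sets borel"
    have "emeasure (interp N mu i (\<lambda>j. y j \<omega>)) A =
        ennreal ((1 - real i / real N) * measure mu A + (\<Sum>j<i. indicator A (y j \<omega>)) / real N)" for \<omega>
      using measure_interp[OF mu iN A]
        finite_measure.emeasure_eq_measure[OF prob_space.finite_measure[OF prob_space_interp[OF mu iN]]] by metis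
    moreover have "(\<lambda>\<omega>. ennreal ((1 - real i / real N) * measure mu A + (\<Sum>j<i. indicator A (y j \<omega>)) / real N)) \<in> borel_measurable S"
      using y by (intro measurable_compose[OF _ measurable_ennreal] borel_measurable_add borel_measurable_const
        borel_measurable_divide borel_measurable_sum measurable_compose[OF _ borel_measurable_indicator[OF A]]) auto
    ultimately show "(\<lambda>\<omega>. emeasure (interp N mu i (\<lambda>j. y j \<omega>)) A) \<in> borel_measurable S" by simp
  next
    fix \<omega>
    show "subprob_space (interp N mu i (\<lambda>j. y j \<omega>))"
      by (rule prob_space_imp_subprob_space[OF prob_space_interp[OF mu iN]])
    show "sets (interp N mu i (\<lambda>j. y j \<omega>)) = sets borel" by simp
  qed
qed

section \<open>Functionals with a linear derivative near the invariant measure\<close>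

locale smooth_functional = weak_harris_kernel P V K \<gamma> R \<rho> mu
  for P :: "'a::euclidean_space \<Rightarrow> 'a measure" and V :: "'a \<Rightarrow> real" and K \<gamma> R \<rho> :: real
    and mu :: "'a measure" +
  fixes l :: real and U :: "'a measure \<Rightarrow> real" and dU :: "'a measure \<Rightarrow> 'a \<Rightarrow> real"
    and r Cb Cd \<alpha> :: real
  assumes l: "0 \<le> l"
    and L3: "bdd_above (range (\<lambda>x. npow l x / (1 + V x)))"
    and U_measurable: "U \<in> borel_measurable (restrict_space (prob_algebra borel) (Pspace l))"
    and r: "0 < r"
    and dU: "\<And>m. m \<in> Wball l mu r \<Longrightarrow> has_lin_fun_deriv l U m (dU m)"
    and dU_bound: "\<And>m x. m \<in> Wball l mu r \<Longrightarrow> \<bar>dU m x\<bar> \<le> Cb * (1 + npow (l / 2) x)"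
    and dU_cont: "\<And>\<epsilon>. 0 < \<epsilon> \<Longrightarrow> \<exists>\<delta>>0. \<forall>m\<in>Wball l mu r. Wdist l m mu < \<delta> \<longrightarrow>
      (SUP x. \<bar>dU m x - dU mu x\<bar> / (1 + npow (l / 2) x)) < \<epsilon>"
    and alpha: "1 / 2 < \<alpha>" "\<alpha> \<le> 1"
    and dU_hoelder: "\<And>m1 m2. m1 \<in> Wball l mu r \<Longrightarrow> m2 \<in> Wball l mu r \<Longrightarrow>
        (SUP x. \<bar>dU m2 x - dU m1 x\<bar> / (1 + npow (l / 2) x))
          \<le> Cd * (\<integral>y. 1 + npow (l / (2 * \<alpha>)) y \<partial>tv_diff m2 m1) powr \<alpha>"
begin

definition moment_const :: real where "moment_const = max 1 (SUP x. npow l x / (1 + V x))"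

lemma moment_const: "1 \<le> moment_const" "npow l x \<le> moment_const * (1 + V x)"
proof -
  show "1 \<le> moment_const" by (simp add: moment_const_def)
  have "npow l x / (1 + V x) \<le> moment_const"
    unfolding moment_const_def by (rule max.coboundedI2) (rule cSUP_upper[OF UNIV_I L3])
  then show "npow l x \<le> moment_const * (1 + V x)"
    using V_nonneg[of x] by (simp add: divide_le_eq)
qed

abbreviation W2 :: "'a \<Rightarrow> real" where "W2 x \<equiv> 1 + npow (l / 2) x"

definition weight_const :: real where "weight_const = 1 + sqrt moment_const"

lemma weight_const: "1 \<le> weight_const" using moment_const(1) by (simp add: weight_const_def)

lemma W2_ge_1: "1 \<le> W2 x" by simp

text \<open>The square of the power l / 2 of the norm is the power l, hence at most a multiple of
  \<open>1 + V\<close>. Taking roots puts the derivative at weight \<open>sqrt V\<close>.\<close>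

lemma W2_le: "W2 x \<le> weight_const * (1 + sqrt (V x))"
proof -
  have "(npow (l / 2) x)\<^sup>2 = npow l x"
    by (auto simp: npow_def power2_eq_square simp flip: powr_add)
  also have "\<dots> \<le> moment_const * (1 + sqrt (V x))\<^sup>2"
  proof -
    have "1 + V x \<le> (1 + sqrt (V x))\<^sup>2" using V_nonneg[of x] by (simp add: power2_sum)
    then have "moment_const * (1 + V x) \<le> moment_const * (1 + sqrt (V x))\<^sup>2" using moment_const(1) by (intro mult_left_mono) auto
    with moment_const(2)[of x] show ?thesis by (rule order_trans)
  qed
  also have "\<dots> = (sqrt moment_const * (1 + sqrt (V x)))\<^sup>2" using moment_const(1) by (simp add: power_mult_distrib)
  finally have sq: "(npow (l / 2) x)\<^sup>2 \<le> (sqrt moment_const * (1 + sqrt (V x)))\<^sup>2" .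
  have "0 \<le> sqrt moment_const * (1 + sqrt (V x))" using moment_const(1) V_nonneg[of x] by simp
  with sq have 1: "npow (l / 2) x \<le> sqrt moment_const * (1 + sqrt (V x))" by (rule power2_le_imp_le)
  have 2: "1 \<le> 1 + sqrt (V x)" using V_nonneg[of x] by simp
  show ?thesis using add_mono[OF 2 1] by (simp only: weight_const_def distrib_right mult_1)
qed

lemma W2_wbdd: "S.wbdd weight_const W2"
  unfolding S.wbdd_def using W2_le by (auto simp: abs_of_nonneg[OF add_nonneg_nonneg])

lemma npow_wbdd: "V.wbdd moment_const (npow l)"
  unfolding V.wbdd_def using moment_const by auto

lemma mu_Pspace: "mu \<in> Pspace l"
proof -
  have "integrable mu (npow l)" by (rule V.wbdd_integrable_mu[OF npow_wbdd])
  then show ?thesis using mu(1) by (auto simp: Pspace_def integrable_iff_bounded)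
qed

text \<open>The criterion by cells holds for \<open>mu\<close> itself: the cell masses agree, and
  its tail is below the level.\<close>

lemma mu_Wball: "mu \<in> Wball l mu r"
proof -
  have "Wdist l mu mu < r"
  proof (rule Wdist_lt_of_cells[OF l mu_Pspace r zero_less_one order_refl])
    fix k :: "'a \<Rightarrow> nat" and n :: nat and f g :: real
    assume f: "0 < f" "0 < g" "(\<integral>x. indicator {x. k x = 0} x * npow l x \<partial>mu) \<le> 1 * f" and
    *: "\<And>m. m \<in> Pspace l \<Longrightarrow> (\<And>i. i \<le> n \<Longrightarrow> \<bar>measure m {x. k x = i} - measure mu {x. k x = i}\<bar> \<le> g) \<Longrightarrow>
      (\<integral>x. indicator {x. k x = 0} x * npow l x \<partial>m) \<le> f \<Longrightarrow> Wdist l m mu < r"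
    show "Wdist l mu mu < r" by (rule *[OF mu_Pspace]) (use f in auto)
  qed
  then show ?thesis using mu_Pspace by (simp add: Wball_def)
qed

lemma Cb_nonneg: "0 \<le> Cb"
proof -
  have "0 \<le> Cb * W2 0" using dU_bound[OF mu_Wball, of 0] abs_ge_zero order_trans by blast
  then show ?thesis using W2_ge_1[of 0] by (simp add: zero_le_mult_iff)
qed

lemma dU_measurable: "m \<in> Wball l mu r \<Longrightarrow> dU m \<in> borel_measurable borel"
  using dU[of m] by (simp add: has_lin_fun_deriv_def)

lemma dU_wbdd:
  assumes "m \<in> Wball l mu r" shows "S.wbdd (Cb * weight_const) (dU m)"
proof -
  have "\<bar>dU m x\<bar> \<le> Cb * weight_const * (1 + sqrt (V x))" for x
    using order_trans[OF dU_bound[OF assms, of x] mult_left_mono[OF W2_le Cb_nonneg]] by (simp add: mult.assoc)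
  then show ?thesis using dU_measurable[OF assms] by (simp add: S.wbdd_def)
qed

text \<open>A real supremum is informative only for a bounded family; the growth condition on the
  derivative bounds it by \<open>2 * Cb\<close>.\<close>

lemma dU_diff_le_SUP:
  assumes "m1 \<in> Wball l mu r" "m2 \<in> Wball l mu r"
  shows "\<bar>dU m2 x - dU m1 x\<bar> \<le> (SUP x. \<bar>dU m2 x - dU m1 x\<bar> / W2 x) * W2 x"
proof -
  have pos: "0 < W2 x" for x using W2_ge_1[of x] by linarith
  have bd: "bdd_above (range (\<lambda>x. \<bar>dU m2 x - dU m1 x\<bar> / W2 x))"
  proof (rule bdd_aboveI2)
    fix x
    have "\<bar>dU m2 x - dU m1 x\<bar> \<le> 2 * Cb * W2 x"
      using dU_bound[OF assms(1), of x] dU_bound[OF assms(2), of x] by linarith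
    then show "\<bar>dU m2 x - dU m1 x\<bar> / W2 x \<le> 2 * Cb" using pos[of x] by (simp add: divide_le_eq)
  qed
  have "\<bar>dU m2 x - dU m1 x\<bar> / W2 x \<le> (SUP x. \<bar>dU m2 x - dU m1 x\<bar> / W2 x)"
    by (rule cSUP_upper[OF UNIV_I bd])
  then show ?thesis using pos[of x] by (simp add: divide_le_eq)
qed

lemma dU_cont_pointwise:
  assumes "0 < \<epsilon>"
  obtains \<delta> where "0 < \<delta>" "\<And>m. m \<in> Pspace l \<Longrightarrow> Wdist l m mu < \<delta> \<Longrightarrow>
    m \<in> Wball l mu r \<and> (\<forall>x. \<bar>dU m x - dU mu x\<bar> \<le> \<epsilon> * W2 x)"
proof -
  obtain \<delta> where \<delta>: "0 < \<delta>" "\<forall>m\<in>Wball l mu r. Wdist l m mu < \<delta> \<longrightarrow>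
      (SUP x. \<bar>dU m x - dU mu x\<bar> / W2 x) < \<epsilon>"
    using dU_cont[OF assms] by blast
  show ?thesis
  proof (rule that[of "min \<delta> r"])
    show "0 < min \<delta> r" using \<delta> r by simp
    fix m assume m: "m \<in> Pspace l" "Wdist l m mu < min \<delta> r"
    then have mean_weight: "m \<in> Wball l mu r" by (simp add: Wball_def)
    have "\<bar>dU m x - dU mu x\<bar> \<le> \<epsilon> * W2 x" for x
    proof -
      have "(SUP x. \<bar>dU m x - dU mu x\<bar> / W2 x) * W2 x \<le> \<epsilon> * W2 x"
        using \<delta>(2) mean_weight m(2) W2_ge_1[of x] by (intro mult_right_mono) auto
      then show ?thesis using dU_diff_le_SUP[OF mu_Wball mean_weight, of x] by linarith
    qed
    then show "m \<in> Wball l mu r \<and> (\<forall>x. \<bar>dU m x - dU mu x\<bar> \<le> \<epsilon> * W2 x)" using mean_weight by blast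
  qed
qed

definition mean_weight :: real where "mean_weight = (\<integral>x. W2 x \<partial>mu)"

lemma mean_weight_nonneg: "0 \<le> mean_weight" by (simp add: mean_weight_def)

lemma W2_integrable_mu: "integrable mu W2"
  by (rule S.wbdd_integrable_mu[OF W2_wbdd])

definition centred_const :: real where "centred_const = weight_const + mean_weight"

lemma centred_const: "0 \<le> centred_const" "W2 x + mean_weight \<le> centred_const * (1 + sqrt (V x))"
proof -
  show "0 \<le> centred_const" using weight_const mean_weight_nonneg by (simp add: centred_const_def)
  have "mean_weight * 1 \<le> mean_weight * (1 + sqrt (V x))" using mean_weight_nonneg V_nonneg[of x] by (intro mult_left_mono) auto
  then show "W2 x + mean_weight \<le> centred_const * (1 + sqrt (V x))" using W2_le[of x] by (simp add: centred_const_def distrib_right)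
qed

text \<open>This is the derivative at m tested against a Dirac mass at x minus \<open>mu\<close>,
  the direction of every interpolation step. At \<open>m = mu\<close> it is the right-hand side of
  the Poisson equation.\<close>

definition Hc :: "'a measure \<Rightarrow> 'a \<Rightarrow> real" where
  "Hc m x = dU m x - (\<integral>y. dU m y \<partial>mu)"

lemma dU_integrable_mu: "m \<in> Wball l mu r \<Longrightarrow> integrable mu (dU m)"
  by (rule S.wbdd_integrable_mu[OF dU_wbdd])

lemma Hc_diff_le:
  assumes m: "m1 \<in> Wball l mu r" "m2 \<in> Wball l mu r" and \<epsilon>: "0 \<le> \<epsilon>"
    and le: "\<And>x. \<bar>dU m2 x - dU m1 x\<bar> \<le> \<epsilon> * W2 x"
  shows "\<bar>Hc m2 x - Hc m1 x\<bar> \<le> \<epsilon> * centred_const * (1 + sqrt (V x))"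
proof -
  have "\<bar>\<integral>y. dU m2 y - dU m1 y \<partial>mu\<bar> \<le> (\<integral>y. \<epsilon> * W2 y \<partial>mu)"
    using dU_integrable_mu[OF m(1)] dU_integrable_mu[OF m(2)] W2_integrable_mu le
    by (intro integral_abs_bound_integral) auto
  also have "\<dots> = \<epsilon> * mean_weight" by (simp add: mean_weight_def)
  finally have "\<bar>(\<integral>y. dU m2 y \<partial>mu) - (\<integral>y. dU m1 y \<partial>mu)\<bar> \<le> \<epsilon> * mean_weight"
    using dU_integrable_mu[OF m(1)] dU_integrable_mu[OF m(2)] by simp
  then have "\<bar>Hc m2 x - Hc m1 x\<bar> \<le> \<epsilon> * (W2 x + mean_weight)"
    using le[of x] unfolding Hc_def distrib_left by linarith
  also have "\<dots> \<le> \<epsilon> * (centred_const * (1 + sqrt (V x)))" using centred_const \<epsilon> by (intro mult_left_mono)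
  finally show ?thesis by (simp add: mult.assoc)
qed

lemma Hc_wbdd:
  assumes "m \<in> Wball l mu r" shows "\<exists>c. S.wbdd c (Hc m)"
  unfolding Hc_def[abs_def] using S.wbdd_diff[OF dU_wbdd[OF assms] S.wbdd_const] by blast

lemma integral_Hc: "m \<in> Wball l mu r \<Longrightarrow> (\<integral>x. Hc m x \<partial>mu) = 0"
  using dU_integrable_mu by (simp add: Hc_def)

abbreviation "pow_d \<equiv> l / (2 * \<alpha>)"

text \<open>Because \<open>\<alpha> > 1 / 2\<close>, the exponent \<open>l / (2 * \<alpha>)\<close>
  is at most l, so the weight in the Hoelder condition is integrable under
  \<open>mu\<close>.\<close>

lemma npow_d_le: "npow pow_d x \<le> 1 + npow l x"
proof (cases "l = 0 \<or> x = 0")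
  case True then show ?thesis using alpha by (auto simp: npow_def)
next
  case False
  then have n: "0 < norm x" "0 < l" "0 < pow_d" "pow_d \<le> l" using alpha l by (auto simp: field_simps)
  have e: "npow pow_d x = norm x powr pow_d" "npow l x = norm x powr l"
    using n alpha by (auto simp: npow_def)
  show ?thesis
  proof (cases "norm x \<le> 1")
    case True
    then have "norm x powr pow_d \<le> 1" using n powr_mono2[of pow_d "norm x" 1] by simp
    then show ?thesis unfolding e by (rule order_trans) simp
  next
    case False
    then have "norm x powr pow_d \<le> norm x powr l" using n by (intro powr_mono) auto
    then show ?thesis unfolding e by (rule order_trans) simp
  qed
qed

lemma npow_d_integrable: "integrable mu (npow pow_d)"
  by (rule Bochner_Integration.integrable_bound[where f="\<lambda>x. 1 + npow l x"])
     (use V.wbdd_integrable_mu[OF npow_wbdd] npow_d_le in \<open>auto intro!: AE_I2\<close>)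

text \<open>A Dirac mass plus \<open>mu\<close> has weighted mass \<open>jump_const\<close> plus a
  power of the norm of the point; the leading 1 is the constant part of the weight at that
  point.\<close>

definition jump_const :: real where "jump_const = 1 + (\<integral>x. 1 + npow pow_d x \<partial>mu)"

lemma jump_const_nonneg: "0 \<le> jump_const" by (simp add: jump_const_def)

definition step_const :: real where "step_const = \<bar>Cd\<bar> * (2 * (jump_const powr \<alpha> + 1) * weight_const)"

lemma step_const_nonneg: "0 \<le> step_const" using weight_const by (simp add: step_const_def)

lemma interp_step_measure:
  assumes iN: "Suc i \<le> N" and B: "B \<in> sets borel"
  shows "measure (interp N mu (Suc i) y) B - measure (interp N mu i y) B
    = (indicator B (y i) - measure mu B) / real N"
  using measure_interp[OF V.prob_space_mu V.sets_mu iN _ B, of y] measure_interp[OF V.prob_space_mu V.sets_mu _ _ B, of i N y] iN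
  by (simp add: add_divide_distrib diff_divide_distrib algebra_simps)

lemma interp_step_integral:
  fixes f :: "'a \<Rightarrow> real"
  assumes iN: "Suc i \<le> N" and f: "integrable mu f"
  shows "(\<integral>x. f x \<partial>interp N mu (Suc i) y) - (\<integral>x. f x \<partial>interp N mu i y)
    = (f (y i) - (\<integral>x. f x \<partial>mu)) / real N"
  using integral_interp(2)[OF V.prob_space_mu V.sets_mu iN _ f, of y] integral_interp(2)[OF V.prob_space_mu V.sets_mu _ _ f, of i N y] iN
  by (simp add: add_divide_distrib diff_divide_distrib algebra_simps)

text \<open>One step changes the measure by \<open>1 / N\<close> times a Dirac mass minus
  \<open>mu\<close>. The Hoelder condition turns this into \<open>N powr (- \<alpha>)\<close>, and
  the exponent \<open>l / (2 * \<alpha>)\<close> raised to the power \<alpha> becomes l / 2, which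
  is again weight \<open>sqrt V\<close> at the new point.\<close>

lemma dU_step_le:
  assumes iN: "Suc i \<le> N" and s: "0 \<le> s" "s \<le> 1"
    and m: "interp N mu i y \<in> Wball l mu r"
    and ms: "mixture s (interp N mu i y) (interp N mu (Suc i) y) \<in> Wball l mu r"
  shows "\<bar>dU (mixture s (interp N mu i y) (interp N mu (Suc i) y)) x - dU (interp N mu i y) x\<bar>
    \<le> step_const * real N powr (- \<alpha>) * (1 + sqrt (V (y i))) * W2 x"
proof -
  let ?m0 = "interp N mu i y" and ?m1 = "interp N mu (Suc i) y"
  let ?ms = "mixture s ?m0 ?m1"
  have N0: "0 < real N" using iN by simp
  have iN': "i \<le> N" "1 \<le> N" "1 \<le> N" using iN by auto
  note pm = V.prob_space_mu V.sets_mu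
  \<comment> \<open>The variation of one step is dominated by the Dirac mass plus \<open>mu\<close>,
    divided by N. Half of that sum is a probability measure, hence the factor \<open>2 / N\<close>
    below.\<close>
  define nu where "nu = mixture (1 / 2) (return borel (y i)) mu"
  have ret: "prob_space (return borel (y i))" by (rule prob_space_return) simp
  have pnu: "prob_space nu" unfolding nu_def by (intro prob_space_mixture ret pm) auto
  have snu: "sets nu = sets borel" by (simp add: nu_def)
  have "(\<integral>\<^sup>+x. ennreal (1 + npow pow_d x) \<partial>tv_diff ?ms ?m0) \<le> ennreal (2 / real N) * (\<integral>\<^sup>+x. ennreal (1 + npow pow_d x) \<partial>nu)"
  proof (rule nn_integral_tv_diff_le[OF snu pnu])
    fix B :: "'a set" assume B: "B \<in> sets borel"
    have "measure ?ms B = (1 - s) * measure ?m0 B + s * measure ?m1 B"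
      by (intro measure_mixture prob_space_interp pm iN iN' s B) auto
    then have "measure ?ms B - measure ?m0 B = s * (measure ?m1 B - measure ?m0 B)" by (simp add: algebra_simps)
    also have "\<dots> = s * ((indicator B (y i) - measure mu B) / real N)"
      by (simp only: interp_step_measure[OF iN B])
    also have "\<bar>\<dots>\<bar> \<le> 1 * ((indicator B (y i) + measure mu B) / real N)"
    proof -
      have "\<bar>indicator B (y i) - measure mu B\<bar> \<le> indicator B (y i) + measure mu B"
        using measure_nonneg[of mu B] by (auto simp: indicator_def abs_le_iff)
      then show ?thesis
        unfolding abs_mult abs_divide using s N0 by (intro mult_mono) (auto intro!: divide_right_mono)
    qed
    also have "\<dots> = 2 / real N * ((1 - 1 / 2) * measure (return borel (y i)) B + 1 / 2 * measure mu B)"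
      using B N0 by (simp add: measure_return field_simps)
    also have "\<dots> = 2 / real N * measure nu B"
      unfolding nu_def by (subst measure_mixture[OF ret pm(1) _ pm(2) _ _ B]) auto
    finally show "\<bar>measure ?ms B - measure ?m0 B\<bar> \<le> 2 / real N * measure nu B" .
  qed (use N0 in auto)
  also have "(\<integral>\<^sup>+x. ennreal (1 + npow pow_d x) \<partial>nu) =
      ennreal (1 - 1 / 2) * ennreal (1 + npow pow_d (y i)) + ennreal (1 / 2) * ennreal (\<integral>x. 1 + npow pow_d x \<partial>mu)"
  proof -
    have "(\<integral>\<^sup>+x. ennreal (1 + npow pow_d x) \<partial>mu) = ennreal (\<integral>x. 1 + npow pow_d x \<partial>mu)"
      using npow_d_integrable by (intro nn_integral_eq_integral) auto
    moreover have "(\<integral>\<^sup>+x. ennreal (1 + npow pow_d x) \<partial>return borel (y i)) = ennreal (1 + npow pow_d (y i))"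
      by (rule nn_integral_return) auto
    ultimately show ?thesis
      unfolding nu_def by (subst nn_integral_mixture) (auto simp: pm)
  qed
  also have "ennreal (2 / real N) * \<dots> = ennreal ((jump_const + npow pow_d (y i)) / real N)"
  proof -
    have "ennreal (1 - 1 / 2) * ennreal (1 + npow pow_d (y i)) + ennreal (1 / 2) * ennreal (\<integral>x. 1 + npow pow_d x \<partial>mu)
      = ennreal ((1 - 1 / 2) * (1 + npow pow_d (y i)) + 1 / 2 * (\<integral>x. 1 + npow pow_d x \<partial>mu))"
    proof -
      have "ennreal h * ennreal a + ennreal k * ennreal b = ennreal (h * a + k * b)"
        if "0 \<le> h" "0 \<le> k" "0 \<le> a" "0 \<le> b" for h k a b :: real
        using that by (simp add: ennreal_mult)
      note combine = this
      show ?thesis by (rule combine) auto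
    qed
    also have "ennreal (2 / real N) * \<dots> = ennreal (2 / real N * ((1 - 1 / 2) * (1 + npow pow_d (y i)) + 1 / 2 * (\<integral>x. 1 + npow pow_d x \<partial>mu)))"
      using N0 by (intro ennreal_mult[symmetric]) (auto intro!: add_nonneg_nonneg mult_nonneg_nonneg)
    also have "2 / real N * ((1 - 1 / 2) * (1 + npow pow_d (y i)) + 1 / 2 * (\<integral>x. 1 + npow pow_d x \<partial>mu)) = (jump_const + npow pow_d (y i)) / real N"
      using N0 by (simp add: jump_const_def field_simps)
    finally show ?thesis .
  qed
  finally have tv: "(\<integral>y. 1 + npow pow_d y \<partial>tv_diff ?ms ?m0) \<le> (jump_const + npow pow_d (y i)) / real N"
    using N0 jump_const_nonneg by (intro integral_real_bounded) auto
  have z: "npow pow_d x powr \<alpha> = npow (l / 2) x" for x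
    using alpha by (auto simp: npow_def powr_powr)
  have "(\<integral>y. 1 + npow pow_d y \<partial>tv_diff ?ms ?m0) powr \<alpha> \<le> ((jump_const + npow pow_d (y i)) / real N) powr \<alpha>"
    using tv alpha by (intro powr_mono2) auto
  also have "\<dots> = (jump_const + npow pow_d (y i)) powr \<alpha> * real N powr (- \<alpha>)"
    using N0 jump_const_nonneg by (simp add: powr_divide powr_minus field_simps)
  also have "\<dots> \<le> (2 * (jump_const powr \<alpha> + npow (l / 2) (y i))) * real N powr (- \<alpha>)"
  proof (intro mult_right_mono)
    define Mx where "Mx = max jump_const (npow pow_d (y i))"
    have "(jump_const + npow pow_d (y i)) powr \<alpha> \<le> (2 * Mx) powr \<alpha>"
      using alpha jump_const_nonneg by (intro powr_mono2) (auto simp: Mx_def)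
    also have "\<dots> = 2 powr \<alpha> * Mx powr \<alpha>" by (rule powr_mult)
    also have "\<dots> \<le> 2 * (jump_const powr \<alpha> + npow (l / 2) (y i))"
    proof (rule mult_mono)
      show "2 powr \<alpha> \<le> (2::real)" using alpha powr_mono[of \<alpha> 1 2] by simp
      show "Mx powr \<alpha> \<le> jump_const powr \<alpha> + npow (l / 2) (y i)"
        unfolding Mx_def max_def by (simp add: z)
    qed auto
    finally show "(jump_const + npow pow_d (y i)) powr \<alpha> \<le> 2 * (jump_const powr \<alpha> + npow (l / 2) (y i))" .
  qed auto
  also have "\<dots> \<le> (2 * ((jump_const powr \<alpha> + 1) * (weight_const * (1 + sqrt (V (y i)))))) * real N powr (- \<alpha>)"
  proof (intro mult_right_mono mult_left_mono)
    have "jump_const powr \<alpha> + npow (l / 2) (y i) \<le> (jump_const powr \<alpha> + 1) * W2 (y i)"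
      by (simp add: distrib_left distrib_right)
    also have "\<dots> \<le> (jump_const powr \<alpha> + 1) * (weight_const * (1 + sqrt (V (y i))))"
      by (intro mult_left_mono W2_le) simp
    finally show "jump_const powr \<alpha> + npow (l / 2) (y i) \<le> (jump_const powr \<alpha> + 1) * (weight_const * (1 + sqrt (V (y i))))" .
  qed auto
  finally have p: "(\<integral>y. 1 + npow pow_d y \<partial>tv_diff ?ms ?m0) powr \<alpha> \<le> (2 * ((jump_const powr \<alpha> + 1) * (weight_const * (1 + sqrt (V (y i)))))) * real N powr (- \<alpha>)" .
  have "(SUP x. \<bar>dU ?ms x - dU ?m0 x\<bar> / W2 x) \<le> Cd * (\<integral>y. 1 + npow pow_d y \<partial>tv_diff ?ms ?m0) powr \<alpha>"
    by (rule dU_hoelder[OF m ms])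
  also have "\<dots> \<le> \<bar>Cd\<bar> * (\<integral>y. 1 + npow pow_d y \<partial>tv_diff ?ms ?m0) powr \<alpha>"
    by (intro mult_right_mono) auto
  also have "\<dots> \<le> \<bar>Cd\<bar> * ((2 * ((jump_const powr \<alpha> + 1) * (weight_const * (1 + sqrt (V (y i)))))) * real N powr (- \<alpha>))"
    by (intro mult_left_mono p) auto
  also have "\<dots> = step_const * real N powr (- \<alpha>) * (1 + sqrt (V (y i)))" by (simp add: step_const_def mult_ac)
  finally have "(SUP x. \<bar>dU ?ms x - dU ?m0 x\<bar> / W2 x) * W2 x \<le> step_const * real N powr (- \<alpha>) * (1 + sqrt (V (y i))) * W2 x"
    using W2_ge_1[of x] by (intro mult_right_mono) auto
  then show ?thesis using dU_diff_le_SUP[OF m ms, of x] by linarith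
qed

text \<open>The mean value theorem evaluates the increment with the derivative at an intermediate
  measure. Going back to the left end point costs one factor \<open>1 + sqrt V\<close> from the size
  of the jump and one from the argument of the derivative, both at the new point; their product is
  at weight \<open>V\<close>.\<close>

lemma U_step_le:
  assumes iN: "Suc i \<le> N"
    and seg: "\<And>s. 0 \<le> s \<Longrightarrow> s \<le> 1 \<Longrightarrow> mixture s (interp N mu i y) (interp N mu (Suc i) y) \<in> Wball l mu r"
  shows "\<bar>U (interp N mu (Suc i) y) - U (interp N mu i y) - Hc (interp N mu i y) (y i) / real N\<bar>
    \<le> 2 * step_const * centred_const * real N powr (- 1 - \<alpha>) * (1 + V (y i))"
proof -
  let ?m0 = "interp N mu i y" and ?m1 = "interp N mu (Suc i) y"
  let ?ms = "\<lambda>s. mixture s ?m0 ?m1"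
  have N0: "0 < real N" using iN by simp
  have iN': "i \<le> N" "1 \<le> N" "1 \<le> N" using iN by auto
  note pm = V.prob_space_mu V.sets_mu
  have P0: "?m0 \<in> Pspace l" and P1: "?m1 \<in> Pspace l"
    by (intro interp_Pspace pm iN iN' mu_Pspace)+
  have m0: "?m0 \<in> Wball l mu r" using seg[of 0] by (simp add: mixture_0)
  obtain s where s: "0 \<le> s" "s \<le> 1" and eq: "U ?m1 - U ?m0 = (\<integral>x. dU (?ms s) x \<partial>?m1) - (\<integral>x. dU (?ms s) x \<partial>?m0)"
    by (rule lin_fun_deriv_mean_value[OF P0 P1, of U "\<lambda>s. dU (?ms s)"]) (use seg dU in blast, rule that)
  note ms = seg[OF s]
  have "(\<integral>x. dU (?ms s) x \<partial>?m1) - (\<integral>x. dU (?ms s) x \<partial>?m0) = Hc (?ms s) (y i) / real N"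
    by (simp only: interp_step_integral[OF iN dU_integrable_mu[OF ms]] Hc_def)
  then have "U ?m1 - U ?m0 - Hc ?m0 (y i) / real N = (Hc (?ms s) (y i) - Hc ?m0 (y i)) / real N"
    unfolding eq by (simp add: diff_divide_distrib)
  also have "\<bar>\<dots>\<bar> \<le> (step_const * real N powr (- \<alpha>) * (1 + sqrt (V (y i))) * centred_const * (1 + sqrt (V (y i)))) / real N"
    unfolding abs_divide using N0
  proof (simp, intro divide_right_mono)
    show "\<bar>Hc (?ms s) (y i) - Hc ?m0 (y i)\<bar> \<le> step_const * real N powr (- \<alpha>) * (1 + sqrt (V (y i))) * centred_const * (1 + sqrt (V (y i)))"
      using step_const_nonneg V_nonneg[of "y i"]
      by (intro Hc_diff_le[OF m0 ms _ dU_step_le[OF iN s m0 ms]]) simp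
  qed simp
  also have "\<dots> = step_const * centred_const * real N powr (- 1 - \<alpha>) * (1 + sqrt (V (y i)))\<^sup>2"
  proof -
    have "real N powr (- 1 - \<alpha>) = real N powr (- \<alpha>) / real N"
      using N0 by (simp add: powr_diff powr_minus field_simps)
    then show ?thesis by (simp add: power2_eq_square)
  qed
  also have "\<dots> \<le> step_const * centred_const * real N powr (- 1 - \<alpha>) * (2 * (1 + V (y i)))"
    using step_const_nonneg centred_const by (intro mult_left_mono one_plus_sqrt_squared_le) auto
  also have "\<dots> = 2 * step_const * centred_const * real N powr (- 1 - \<alpha>) * (1 + V (y i))"
    by (simp add: algebra_simps)
  finally show ?thesis .
qed

lemma U_compose_measurable:
  assumes "mm \<in> S \<rightarrow>\<^sub>M prob_algebra borel" "\<And>\<omega>. \<omega> \<in> space S \<Longrightarrow> mm \<omega> \<in> Pspace l"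
  shows "(\<lambda>\<omega>. U (mm \<omega>)) \<in> borel_measurable S"
  by (rule measurable_compose[OF measurable_restrict_space2 U_measurable]) (use assms in auto)

text \<open>Joint measurability of \<open>(m, y) \<mapsto> Hc m y\<close> is inherited from \<open>U\<close>, through the difference quotients of
  \<open>U\<close> in the directions of Dirac masses.\<close>

lemma Hc_jointly_measurable:
  assumes mm: "mm \<in> S \<rightarrow>\<^sub>M prob_algebra borel" and mP: "\<And>\<omega>. \<omega> \<in> space S \<Longrightarrow> mm \<omega> \<in> Pspace l"
    and A: "A \<in> sets S" and AW: "\<And>\<omega>. \<omega> \<in> A \<Longrightarrow> mm \<omega> \<in> Wball l mu r"
  shows "(\<lambda>(\<omega>, y). indicator A \<omega> * Hc (mm \<omega>) y) \<in> borel_measurable (S \<Otimes>\<^sub>M borel)"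
proof -
  note A[measurable]
  have mms: "mm \<in> S \<rightarrow>\<^sub>M subprob_algebra borel" by (rule measurable_prob_algebraD[OF mm])
  define e where "e n = 1 / real (Suc n)" for n
  have e: "0 < e n" "e n \<le> 1" for n by (auto simp: e_def)
  define mix where "mix n z = mixture (e n) (mm (fst z)) (return borel (snd z))" for n and z :: "_ \<times> 'a"
  have ret: "return borel y \<in> Pspace l" for y :: 'a
    by (auto simp: Pspace_def space_prob_algebra nn_integral_return intro: prob_space_return)
  have mixP: "mix n z \<in> Pspace l" if "z \<in> space (S \<Otimes>\<^sub>M borel)" for n z
    unfolding mix_def using that e[of n] by (intro Pspace_mixture ret mP) (auto simp: space_pair_measure)
  have mixm: "mix n \<in> S \<Otimes>\<^sub>M borel \<rightarrow>\<^sub>M prob_algebra borel" for n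
  proof (rule measurable_prob_algebraI)
    show "prob_space (mix n z)" if "z \<in> space (S \<Otimes>\<^sub>M borel)" for z by (rule Pspace_D(1)[OF mixP[OF that]])
    show "mix n \<in> S \<Otimes>\<^sub>M borel \<rightarrow>\<^sub>M subprob_algebra borel"
    proof (rule measurable_subprob_algebra)
      show "subprob_space (mix n z)" if "z \<in> space (S \<Otimes>\<^sub>M borel)" for z
        by (rule prob_space_imp_subprob_space[OF Pspace_D(1)[OF mixP[OF that]]])
      show "sets (mix n z) = sets borel" if "z \<in> space (S \<Otimes>\<^sub>M borel)" for z by (simp add: mix_def)
      fix B :: "'a set" assume B [measurable]: "B \<in> sets borel"
      have eq: "emeasure (mix n z) B = ennreal (1 - e n) * emeasure (mm (fst z)) B + ennreal (e n) * indicator B (snd z)"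
        if "z \<in> space (S \<Otimes>\<^sub>M borel)" for z
        unfolding mix_def using that Pspace_D(2)[OF mP, of "fst z"] B
        by (subst emeasure_mixture) (auto simp: space_pair_measure)
      have [measurable]: "(\<lambda>\<omega>. emeasure (mm \<omega>) B) \<in> borel_measurable S"
        by (rule measurable_compose[OF mms]) measurable
      have "(\<lambda>z. ennreal (1 - e n) * emeasure (mm (fst z)) B + ennreal (e n) * indicator B (snd z)) \<in> borel_measurable (S \<Otimes>\<^sub>M borel)"
        by measurable
      then show "(\<lambda>z. emeasure (mix n z) B) \<in> borel_measurable (S \<Otimes>\<^sub>M borel)"
        by (subst measurable_cong[OF eq])
    qed
  qed
  have [measurable]: "(\<lambda>z. U (mix n z)) \<in> borel_measurable (S \<Otimes>\<^sub>M borel)" for n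
    by (rule U_compose_measurable[OF mixm mixP])
  have [measurable]: "(\<lambda>\<omega>. U (mm \<omega>)) \<in> borel_measurable S" by (rule U_compose_measurable[OF mm mP])
  define D where "D n z = indicator A (fst z) * ((U (mix n z) - U (mm (fst z))) / e n)" for n and z :: "_ \<times> 'a"
  have Dm: "D n \<in> borel_measurable (S \<Otimes>\<^sub>M borel)" for n unfolding D_def[abs_def] by measurable
  \<comment> \<open>Difference quotients towards Dirac masses yield the derivative centred under the
    measure itself. The centring is changed at the end by subtracting the integral of
    \<open>L\<close> over its second argument under \<open>mu\<close>. The indicator of A confines
    everything to measures at which the derivative is assumed.\<close>
  define L where "L z = indicator A (fst z) * (dU (mm (fst z)) (snd z) - (\<integral>y. dU (mm (fst z)) y \<partial>mm (fst z)))" for z :: "_ \<times> 'a"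
  have lim: "(\<lambda>n. D n z) \<longlonglongrightarrow> L z" for z
  proof (cases "fst z \<in> A")
    case False then show ?thesis by (simp add: D_def L_def)
  next
    case True
    let ?m = "mm (fst z)"
    have sm: "fst z \<in> space S" using True sets.sets_into_space[OF A] by auto
    have h: "has_lin_fun_deriv l U ?m (dU ?m)" by (rule dU[OF AW[OF True]])
    have "((\<lambda>e. U (mixture e ?m (return borel (snd z)))) has_real_derivative
        (\<integral>y. dU ?m y \<partial>return borel (snd z)) - (\<integral>y. dU ?m y \<partial>?m)) (at_right 0)"
      using h ret unfolding has_lin_fun_deriv_def by blast
    moreover have "(\<integral>y. dU ?m y \<partial>return borel (snd z)) = dU ?m (snd z)"
      by (rule integral_return) (use dU_measurable[OF AW[OF True]] in auto)
    moreover have "mixture 0 ?m (return borel (snd z)) = ?m"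
      using Pspace_D(2)[OF mP[OF sm]] by (intro mixture_0) auto
    ultimately have t: "((\<lambda>e. (U (mixture e ?m (return borel (snd z))) - U ?m) / e) \<longlongrightarrow>
        dU ?m (snd z) - (\<integral>y. dU ?m y \<partial>?m)) (at_right 0)"
      by (simp add: has_field_derivative_iff)
    have "filterlim e (at_right 0) sequentially"
      unfolding filterlim_at e_def using LIMSEQ_inverse_real_of_nat by (auto simp: inverse_eq_divide)
    from filterlim_compose[OF t this] show ?thesis
      using True by (simp add: D_def L_def mix_def)
  qed
  have Lm: "L \<in> borel_measurable (S \<Otimes>\<^sub>M borel)"
    by (rule borel_measurable_LIMSEQ_real[OF lim Dm])
  interpret mu: prob_space mu by (rule V.prob_space_mu)
  have Lm2: "case_prod (\<lambda>\<omega> y. L (\<omega>, y)) \<in> borel_measurable (S \<Otimes>\<^sub>M mu)"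
    using Lm unfolding measurable_cong_sets[OF sets_pair_measure_cong[OF refl V.sets_mu] refl] by (simp add: case_prod_beta')
  have [measurable]: "(\<lambda>\<omega>. \<integral>y. L (\<omega>, y) \<partial>mu) \<in> borel_measurable S"
    by (rule mu.borel_measurable_lebesgue_integral[OF Lm2])
  note Lm[measurable]
  have "(\<lambda>z. L z - (\<integral>y. L (fst z, y) \<partial>mu)) \<in> borel_measurable (S \<Otimes>\<^sub>M borel)" by measurable
  moreover have "L z - (\<integral>y. L (fst z, y) \<partial>mu) = (case z of (\<omega>, y) \<Rightarrow> indicator A \<omega> * Hc (mm \<omega>) y)" for z
  proof (cases "fst z \<in> A")
    case True
    then show ?thesis using dU_integrable_mu[OF AW[OF True]]
      by (cases z) (simp add: L_def Hc_def)
  qed (simp add: L_def case_prod_beta)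
  ultimately show ?thesis by simp
qed

end

section \<open>The remainder\<close>

text \<open>The right-hand sides of interest depend on the past of the chain. Joint measurability
  passes through the iterates and the series, and makes the solution an admissible integrand for
  \<open>mart_diff\<close>.\<close>

lemma (in drift_kernel) poisson_sol_jointly_measurable:
  assumes f: "(\<lambda>(\<omega>, y). f \<omega> y) \<in> borel_measurable (S \<Otimes>\<^sub>M borel)"
  shows "(\<lambda>(\<omega>, y). poisson_sol (f \<omega>) y) \<in> borel_measurable (S \<Otimes>\<^sub>M borel)"
proof -
  have it: "(\<lambda>(\<omega>, y). (kernel_op P ^^ n) (f \<omega>) y) \<in> borel_measurable (S \<Otimes>\<^sub>M borel)" for n
  proof (induction n)
    case (Suc n)
    note Suc[measurable]
    \<comment> \<open>The starting point of the kernel is made part of the parameter z, so that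
      \<open>integral_kernel_measurable2\<close> applies with \<open>snd\<close> selecting
      it.\<close>
    have "(\<lambda>(z, y). (kernel_op P ^^ n) (f (fst z)) y) \<in> borel_measurable ((S \<Otimes>\<^sub>M borel) \<Otimes>\<^sub>M borel)"
    proof -
      have "(\<lambda>p. (fst (fst p), snd p)) \<in> (S \<Otimes>\<^sub>M borel) \<Otimes>\<^sub>M borel \<rightarrow>\<^sub>M S \<Otimes>\<^sub>M borel" by measurable
      from measurable_compose[OF this Suc] show ?thesis by (simp add: case_prod_beta')
    qed
    from integral_kernel_measurable2[OF this, of snd] show ?case
      by (simp add: kernel_op_def[abs_def] case_prod_beta')
  qed (use f in simp)
  interpret mu: prob_space mu by (rule prob_space_mu)
  have f2: "case_prod f \<in> borel_measurable (S \<Otimes>\<^sub>M mu)"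
    using f unfolding measurable_cong_sets[OF sets_pair_measure_cong[OF refl sets_mu] refl] .
  note mu.borel_measurable_lebesgue_integral[OF f2, measurable]
  have [measurable]: "(\<lambda>z. (kernel_op P ^^ n) (f (fst z)) (snd z)) \<in> borel_measurable (S \<Otimes>\<^sub>M borel)" for n
    using it[of n] by (simp add: case_prod_beta')
  have "(\<lambda>z. \<Sum>n. (kernel_op P ^^ n) (f (fst z)) (snd z) - (\<integral>y. f (fst z) y \<partial>mu)) \<in> borel_measurable (S \<Otimes>\<^sub>M borel)"
    by measurable
  then show ?thesis by (simp add: poisson_sol_def case_prod_beta')
qed

lemma (in smooth_functional) U_empirical_measurable:
  assumes Y: "\<And>j. Y j \<in> borel_measurable M"
  shows "(\<lambda>\<omega>. sqrt (real N) * (U (empirical N (\<lambda>j. Y (j - 1) \<omega>)) - U mu)) \<in> borel_measurable M"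
proof (cases "N = 0")
  case False
  then have N: "1 \<le> N" by simp
  have "(\<lambda>\<omega>. U (interp N mu N (\<lambda>j. Y j \<omega>))) \<in> borel_measurable M"
    by (rule U_compose_measurable[OF interp_measurable[OF V.prob_space_mu V.sets_mu order_refl N Y]])
       (rule interp_Pspace[OF V.prob_space_mu V.sets_mu order_refl N mu_Pspace])
  then have [measurable]: "(\<lambda>\<omega>. U (empirical N (\<lambda>j. Y (j - 1) \<omega>))) \<in> borel_measurable M"
    by (simp add: interp_last[OF V.sets_mu N])
  show ?thesis by measurable
qed simp

locale clt_setting = smooth_functional P V K \<gamma> R \<rho> mu l U dU r Cb Cd \<alpha> + ergodic_chain P V K \<gamma> R \<rho> mu M F Y
  for P :: "'a::euclidean_space \<Rightarrow> 'a measure" and V :: "'a \<Rightarrow> real" and K \<gamma> R \<rho> :: real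
    and mu :: "'a measure" and l :: real and U :: "'a measure \<Rightarrow> real" and dU :: "'a measure \<Rightarrow> 'a \<Rightarrow> real"
    and r Cb Cd \<alpha> :: real and M :: "'w measure" and F :: "nat \<Rightarrow> 'w measure" and Y :: "nat \<Rightarrow> 'w \<Rightarrow> 'a"
begin

abbreviation pm :: "nat \<Rightarrow> nat \<Rightarrow> 'w \<Rightarrow> 'a measure" where
  "pm N i \<omega> \<equiv> interp N mu i (\<lambda>j. Y j \<omega>)"

lemma pm_measurable: "i \<le> N \<Longrightarrow> 1 \<le> N \<Longrightarrow> i \<le> Suc j \<Longrightarrow> pm N i \<in> F j \<rightarrow>\<^sub>M prob_algebra borel"
  by (rule interp_measurable[OF V.prob_space_mu V.sets_mu], simp, simp)
     (rule measurable_F_mono[OF adapted], simp)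

lemma pm_Pspace: "i \<le> N \<Longrightarrow> 1 \<le> N \<Longrightarrow> pm N i \<omega> \<in> Pspace l"
  by (rule interp_Pspace[OF V.prob_space_mu V.sets_mu _ _ mu_Pspace])

text \<open>Finitely many inequalities that are convex in the measure replace the Wasserstein ball.
  Whole segments therefore stay in the set, and membership of the i-th interpolated measure is an
  event of the first i states, hence of \<open>F j\<close> for \<open>i \<le> Suc j\<close>.\<close>

lemma good_measures:
  assumes \<delta>: "0 < \<delta>" and \<epsilon>: "0 < \<epsilon>"
  obtains good :: "'a measure \<Rightarrow> bool" where
    "\<And>m. m \<in> Pspace l \<Longrightarrow> good m \<Longrightarrow> Wdist l m mu < \<delta>"
    "\<And>m m' s. m \<in> Pspace l \<Longrightarrow> m' \<in> Pspace l \<Longrightarrow> good m \<Longrightarrow> good m' \<Longrightarrow> 0 \<le> s \<Longrightarrow> s \<le> 1 \<Longrightarrow> good (mixture s m m')"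
    "\<And>N i j. i \<le> N \<Longrightarrow> 1 \<le> N \<Longrightarrow> i \<le> Suc j \<Longrightarrow> {\<omega>\<in>space M. good (pm N i \<omega>)} \<in> sets (F j)"
    "\<forall>\<^sub>F N in sequentially. prob {\<omega>\<in>space M. \<exists>i\<le>N. \<not> good (pm N i \<omega>)} \<le> \<epsilon>"
proof -
  \<comment> \<open>Markov's inequality for the tail average gives a probability close to
    \<open>2 * e\<close>, which is at most \<open>\<epsilon> / 4\<close>; the bound 1 / 2 keeps the
    tail of \<open>mu\<close> below half of the level f.\<close>
  define e where "e = min (1 / 2) (\<epsilon> / 8)"
  have e: "0 < e" "e \<le> 1" "e \<le> 1 / 2" "e \<le> \<epsilon> / 8" using \<epsilon> by (auto simp: e_def)
  show ?thesis
  proof (rule Wdist_lt_of_cells[OF l mu_Pspace \<delta> e(1,2)])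
    fix k :: "'a \<Rightarrow> nat" and n :: nat and f g :: real
    assume km [measurable]: "k \<in> borel \<rightarrow>\<^sub>M count_space UNIV" and f: "0 < f" and g: "0 < g"
      and far: "(\<integral>x. indicator {x. k x = 0} x * npow l x \<partial>mu) \<le> e * f"
      and W: "\<And>m. m \<in> Pspace l \<Longrightarrow> (\<And>i. i \<le> n \<Longrightarrow> \<bar>measure m {x. k x = i} - measure mu {x. k x = i}\<bar> \<le> g) \<Longrightarrow>
        (\<integral>x. indicator {x. k x = 0} x * npow l x \<partial>m) \<le> f \<Longrightarrow> Wdist l m mu < \<delta>"
    define E where "E q = {x. k x = q}" for q
    have E [measurable]: "E q \<in> sets borel" for q
      using measurable_sets[OF km, of "{q}"] by (simp add: vimage_def E_def)
    define \<phi> where "\<phi> x = indicator (E 0) x * npow l x" for x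
    have \<phi>m [measurable]: "\<phi> \<in> borel_measurable borel" unfolding \<phi>_def[abs_def] by measurable
    have \<phi>0: "0 \<le> \<phi> x" for x by (simp add: \<phi>_def)
    have \<phi>b: "V.wbdd moment_const \<phi>"
      unfolding V.wbdd_def
    proof (intro conjI allI)
      fix x
      have "\<bar>\<phi> x\<bar> \<le> npow l x" by (simp add: \<phi>_def indicator_def)
      then show "\<bar>\<phi> x\<bar> \<le> moment_const * (1 + V x)" using moment_const(2)[of x] by (rule order_trans)
    qed simp
    define good where "good m \<longleftrightarrow> (\<forall>q\<le>n. \<bar>measure m (E q) - measure mu (E q)\<bar> \<le> g) \<and> (\<integral>x. \<phi> x \<partial>m) \<le> f" for m
    have \<phi>int: "integrable m \<phi>" if m: "m \<in> Pspace l" for m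
    proof -
      note Pspace_D(2)[OF m, measurable_cong]
      show ?thesis
        by (rule Bochner_Integration.integrable_bound[OF Pspace_D(3)[OF m]])
           (auto simp: \<phi>_def indicator_def)
    qed
    note pmu = V.prob_space_mu V.sets_mu
    have 1: "Wdist l m mu < \<delta>" if "m \<in> Pspace l" "good m" for m
      by (rule W[OF that(1)]) (use that(2) in \<open>auto simp: good_def E_def \<phi>_def[abs_def]\<close>)
    have 2: "good (mixture s m m')" if m: "m \<in> Pspace l" "m' \<in> Pspace l" "good m" "good m'" and s: "0 \<le> s" "s \<le> 1" for m m' s
      unfolding good_def
    proof (intro conjI allI impI)
      note mD = Pspace_D[OF m(1)] and m'D = Pspace_D[OF m(2)]
      have "(\<integral>x. \<phi> x \<partial>mixture s m m') = (1 - s) * (\<integral>x. \<phi> x \<partial>m) + s * (\<integral>x. \<phi> x \<partial>m')"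
        by (rule integral_mixture(2)[OF mD(2) m'D(2) s \<phi>int[OF m(1)] \<phi>int[OF m(2)]])
      also have "\<dots> \<le> (1 - s) * f + s * f"
        using m(3,4) s by (intro add_mono mult_left_mono) (auto simp: good_def)
      finally show "(\<integral>x. \<phi> x \<partial>mixture s m m') \<le> f" by (simp add: algebra_simps)
      fix q assume q: "q \<le> n"
      have "measure (mixture s m m') (E q) = (1 - s) * measure m (E q) + s * measure m' (E q)"
        by (rule measure_mixture[OF mD(1) m'D(1) mD(2) m'D(2) s E])
      then have "measure (mixture s m m') (E q) - measure mu (E q) =
          (1 - s) * (measure m (E q) - measure mu (E q)) + s * (measure m' (E q) - measure mu (E q))"
        by (simp add: algebra_simps)
      also have "\<bar>\<dots>\<bar> \<le> (1 - s) * \<bar>measure m (E q) - measure mu (E q)\<bar> + s * \<bar>measure m' (E q) - measure mu (E q)\<bar>"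
        using s by (intro order_trans[OF abs_triangle_ineq]) (simp add: abs_mult)
      also have "\<dots> \<le> (1 - s) * g + s * g"
        using m(3,4) s q by (intro add_mono mult_left_mono) (auto simp: good_def)
      finally show "\<bar>measure (mixture s m m') (E q) - measure mu (E q)\<bar> \<le> g" by (simp add: algebra_simps)
    qed
    have mpm: "measure (pm N i \<omega>) (E q) = (1 - real i / real N) * measure mu (E q) + (\<Sum>j<i. indicator (E q) (Y j \<omega>)) / real N"
      if "i \<le> N" "1 \<le> N" for N i q \<omega>
      by (rule measure_interp[OF pmu that E])
    have ipm: "(\<integral>x. \<phi> x \<partial>pm N i \<omega>) = (1 - real i / real N) * (\<integral>x. \<phi> x \<partial>mu) + (\<Sum>j<i. \<phi> (Y j \<omega>)) / real N"
      if "i \<le> N" "1 \<le> N" for N i \<omega>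
      by (rule integral_interp(2)[OF pmu that \<phi>int[OF mu_Pspace]])
    have 3: "{\<omega>\<in>space M. good (pm N i \<omega>)} \<in> sets (F j)" if i: "i \<le> N" "1 \<le> N" "i \<le> Suc j" for N i j
    proof -
      have Yj: "Y t \<in> F j \<rightarrow>\<^sub>M borel" if "t < i" for t
        by (rule measurable_F_mono[OF adapted]) (use that i in auto)
      define s1 where "s1 q \<omega> = (\<Sum>t<i. indicator (E q) (Y t \<omega>) :: real)" for q \<omega>
      define s2 where "s2 \<omega> = (\<Sum>t<i. \<phi> (Y t \<omega>))" for \<omega>
      have s1m [measurable]: "s1 q \<in> borel_measurable (F j)" for q
        unfolding s1_def[abs_def]
        by (intro borel_measurable_sum measurable_compose[OF Yj borel_measurable_indicator[OF E]]) auto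
      have s2m [measurable]: "s2 \<in> borel_measurable (F j)"
        unfolding s2_def[abs_def]
        by (intro borel_measurable_sum measurable_compose[OF Yj \<phi>m]) auto
      have "{\<omega>\<in>space (F j). good (pm N i \<omega>)} \<in> sets (F j)"
        unfolding good_def mpm[OF i(1,2)] ipm[OF i(1,2)] s1_def[symmetric] s2_def[symmetric] by measurable
      then show ?thesis by simp
    qed
    have 4: "\<forall>\<^sub>F N in sequentially. prob {\<omega>\<in>space M. \<exists>i\<le>N. \<not> good (pm N i \<omega>)} \<le> \<epsilon>"
    proof -
      obtain B where B: "0 \<le> B" and sum_le: "\<And>f c N. V.wbdd c f \<Longrightarrow>
        (\<Sum>k<N. expectation (\<lambda>\<omega>. f (Y k \<omega>))) \<le> real N * (\<integral>x. f x \<partial>mu) + B * c"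
        using sum_expectation_le by metis
      have sp: "space mu = UNIV" by simp
      have ind: "(\<integral>x. indicator (E q) x \<partial>mu) = measure mu (E q)" for q by simp
      let ?p = "\<lambda>q N. prob {\<omega>\<in>space M. \<exists>i\<le>N. g * real N < \<bar>\<Sum>j<i. indicator (E q) (Y j \<omega>) - (\<integral>x. indicator (E q) x \<partial>mu)\<bar>}"
      have p0: "?p q \<longlonglongrightarrow> 0" for q
        by (rule max_sum_centred_tendsto) (use g in \<open>auto split: split_indicator\<close>)
      have le: "prob {\<omega>\<in>space M. \<exists>i\<le>N. \<not> good (pm N i \<omega>)} \<le> (\<Sum>q\<le>n. ?p q N) + (\<epsilon> / 4 + 2 * (B * moment_const) / f / real N)"
        if N: "1 \<le> N" for N
      proof -
        have N0: "0 < real N" using N by simp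
        let ?A = "\<lambda>q. {\<omega>\<in>space M. \<exists>i\<le>N. g * real N < \<bar>\<Sum>j<i. indicator (E q) (Y j \<omega>) - (\<integral>x. indicator (E q) x \<partial>mu)\<bar>}"
        \<comment> \<open>The tail function is nonnegative, so its sum up to N bounds all partial
          sums and one event covers every i. The centred cell indicators have no sign and go through
          the maximal estimate.\<close>
        let ?B = "{\<omega>\<in>space M. real N * f / 2 \<le> (\<Sum>j<N. \<phi> (Y j \<omega>))}"
        have "{\<omega>\<in>space M. \<exists>i\<le>N. \<not> good (pm N i \<omega>)} \<subseteq> (\<Union>q\<in>{..n}. ?A q) \<union> ?B"
        proof
          fix \<omega> assume "\<omega> \<in> {\<omega>\<in>space M. \<exists>i\<le>N. \<not> good (pm N i \<omega>)}"
          then obtain i where \<omega>: "\<omega> \<in> space M" and i: "i \<le> N" and ng: "\<not> good (pm N i \<omega>)" by auto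
          show "\<omega> \<in> (\<Union>q\<in>{..n}. ?A q) \<union> ?B"
          proof (rule ccontr)
            assume "\<omega> \<notin> (\<Union>q\<in>{..n}. ?A q) \<union> ?B"
            then have nA: "\<bar>\<Sum>j<i. indicator (E q) (Y j \<omega>) - measure mu (E q)\<bar> \<le> g * real N" if "q \<le> n" for q
              using \<omega> i that by (auto simp: ind not_less)
            have nB: "(\<Sum>j<N. \<phi> (Y j \<omega>)) \<le> real N * f / 2"
              using \<open>\<omega> \<notin> _\<close> \<omega> by auto
            have "\<bar>measure (pm N i \<omega>) (E q) - measure mu (E q)\<bar> \<le> g" if q: "q \<le> n" for q
            proof -
              have "measure (pm N i \<omega>) (E q) - measure mu (E q) = (\<Sum>j<i. indicator (E q) (Y j \<omega>) - measure mu (E q)) / real N"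
                unfolding mpm[OF i N] by (simp add: sum_subtractf add_divide_distrib diff_divide_distrib algebra_simps)
              also have "\<bar>\<dots>\<bar> \<le> g * real N / real N"
                unfolding abs_divide using nA[OF q] N0 by (simp add: divide_le_eq)
              finally show ?thesis using N0 by simp
            qed
            moreover have "(\<integral>x. \<phi> x \<partial>pm N i \<omega>) \<le> f"
            proof -
              have mf0: "0 \<le> (\<integral>x. \<phi> x \<partial>mu)" using \<phi>0 by simp
              have mf: "(\<integral>x. \<phi> x \<partial>mu) \<le> f / 2"
              proof -
                have "(\<integral>x. \<phi> x \<partial>mu) \<le> e * f" using far by (simp add: \<phi>_def[abs_def] E_def)
                also have "\<dots> \<le> 1 / 2 * f" using e f by (intro mult_right_mono) auto
                finally show ?thesis by simp
              qed
              have "(1 - real i / real N) * (\<integral>x. \<phi> x \<partial>mu) \<le> 1 * (\<integral>x. \<phi> x \<partial>mu)"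
                using mf0 N0 by (intro mult_right_mono) auto
              moreover have "(\<Sum>j<i. \<phi> (Y j \<omega>)) / real N \<le> (real N * f / 2) / real N"
              proof (intro divide_right_mono)
                have "(\<Sum>j<i. \<phi> (Y j \<omega>)) \<le> (\<Sum>j<N. \<phi> (Y j \<omega>))"
                  using i \<phi>0 by (intro sum_mono2) auto
                then show "(\<Sum>j<i. \<phi> (Y j \<omega>)) \<le> real N * f / 2" using nB by linarith
              qed simp
              ultimately have "(\<integral>x. \<phi> x \<partial>pm N i \<omega>) \<le> 1 * (\<integral>x. \<phi> x \<partial>mu) + (real N * f / 2) / real N"
                unfolding ipm[OF i N] by (rule add_mono)
              then show ?thesis using mf N0 by simp
            qed
            ultimately show False using ng by (simp add: good_def)
          qed
        qed
        then have "prob {\<omega>\<in>space M. \<exists>i\<le>N. \<not> good (pm N i \<omega>)} \<le> prob ((\<Union>q\<in>{..n}. ?A q) \<union> ?B)"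
          by (intro finite_measure_mono) auto
        also have "\<dots> \<le> prob (\<Union>q\<in>{..n}. ?A q) + prob ?B"
          by (intro measure_Un_le) auto
        also have "\<dots> \<le> (\<Sum>q\<le>n. ?p q N) + (\<epsilon> / 4 + 2 * (B * moment_const) / f / real N)"
        proof (rule add_mono)
          show "prob (\<Union>q\<in>{..n}. ?A q) \<le> (\<Sum>q\<le>n. ?p q N)"
            by (intro finite_measure_subadditive_finite) auto
          have i\<phi>: "integrable M (\<lambda>\<omega>. \<phi> (Y j \<omega>))" for j by (rule wbdd_Y_integrable[OF \<phi>b])
          have "prob ?B \<le> expectation (\<lambda>\<omega>. \<Sum>j<N. \<phi> (Y j \<omega>)) / (real N * f / 2)"
            using i\<phi> \<phi>0 N0 f by (intro integral_Markov_inequality_measure[where A="{}"]) (auto intro!: sum_nonneg)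
          also have "\<dots> \<le> (real N * (e * f) + B * moment_const) / (real N * f / 2)"
          proof (intro divide_right_mono)
            have "expectation (\<lambda>\<omega>. \<Sum>j<N. \<phi> (Y j \<omega>)) = (\<Sum>j<N. expectation (\<lambda>\<omega>. \<phi> (Y j \<omega>)))"
              using i\<phi> by simp
            also have "\<dots> \<le> real N * (\<integral>x. \<phi> x \<partial>mu) + B * moment_const" by (rule sum_le[OF \<phi>b])
            also have "\<dots> \<le> real N * (e * f) + B * moment_const"
              using far by (intro add_right_mono mult_left_mono) (auto simp: \<phi>_def[abs_def] E_def)
            finally show "expectation (\<lambda>\<omega>. \<Sum>j<N. \<phi> (Y j \<omega>)) \<le> real N * (e * f) + B * moment_const" .
          qed (use N0 f in auto)
          also have "\<dots> = 2 * e + 2 * (B * moment_const) / f / real N" using N0 f by (simp add: field_simps)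
          also have "\<dots> \<le> \<epsilon> / 4 + 2 * (B * moment_const) / f / real N" using e by simp
          finally show "prob ?B \<le> \<epsilon> / 4 + 2 * (B * moment_const) / f / real N" .
        qed
        finally show ?thesis .
      qed
      have "(\<lambda>N. (\<Sum>q\<le>n. ?p q N) + (\<epsilon> / 4 + 2 * (B * moment_const) / f / real N)) \<longlonglongrightarrow> (\<Sum>q\<le>n. 0) + (\<epsilon> / 4 + 0)"
        by (intro tendsto_add tendsto_sum p0 tendsto_const lim_const_over_n)
      then have "(\<lambda>N. (\<Sum>q\<le>n. ?p q N) + (\<epsilon> / 4 + 2 * (B * moment_const) / f / real N)) \<longlonglongrightarrow> \<epsilon> / 4" by simp
      then have "\<forall>\<^sub>F N in sequentially. (\<Sum>q\<le>n. ?p q N) + (\<epsilon> / 4 + 2 * (B * moment_const) / f / real N) < \<epsilon>"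
        by (rule order_tendstoD) (use \<epsilon> in simp)
      then show ?thesis
        using eventually_ge_at_top[of 1]
      proof eventually_elim
        case (elim N)
        then show ?case using le[of N] by linarith
      qed
    qed
    show thesis by (rule that[of good, OF 1 2 3 4])
  qed
qed

definition Rem :: "('a \<Rightarrow> real) \<Rightarrow> nat \<Rightarrow> 'w \<Rightarrow> real" where
  "Rem G N \<omega> = sqrt (real N) * (U (empirical N (\<lambda>j. Y (j - 1) \<omega>)) - U mu) - (\<Sum>k<N. pois_mart G k \<omega>) / sqrt (real N)"

lemma pois_mart_measurable:
  assumes "G \<in> borel_measurable borel" shows "pois_mart G k \<in> borel_measurable M"
proof -
  note assms[measurable]
  show ?thesis unfolding pois_mart_def[abs_def] by measurable
qed

lemma Rem_measurable: "G \<in> borel_measurable borel \<Longrightarrow> Rem G N \<in> borel_measurable M"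
  unfolding Rem_def[abs_def]
  by (intro borel_measurable_diff U_empirical_measurable measurable_F_M[OF adapted] borel_measurable_divide borel_measurable_sum
      pois_mart_measurable borel_measurable_const)

text \<open>On the event that all interpolated measures are good, the remainder is a martingale with small
  increments plus summation by parts terms.\<close>

lemma Rem_le:
  assumes G: "S.wbdd c G" and Geq: "\<And>x. G x - kernel_op P G x = Hc mu x"
    and N: "1 \<le> N" and \<epsilon>: "0 \<le> \<epsilon>" and D: "0 \<le> D"
    and sol: "\<And>f c. S.wbdd c f \<Longrightarrow> S.wbdd (D * c) (S.poisson_sol f)"
      "\<And>f c x. S.wbdd c f \<Longrightarrow> S.poisson_sol f x - kernel_op P (S.poisson_sol f) x = f x - (\<integral>y. f y \<partial>mu)"
      "\<And>f g c c'. S.wbdd c f \<Longrightarrow> S.wbdd c' g \<Longrightarrow>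
       S.poisson_sol (\<lambda>x. f x - g x) = (\<lambda>x. S.poisson_sol f x - S.poisson_sol g x)"
    and g: "\<And>i. i \<le> N \<Longrightarrow> g i = (\<lambda>x. Hc (pm N i \<omega>) x - Hc mu x)"
    and gb: "\<And>i. i \<le> N \<Longrightarrow> S.wbdd (\<epsilon> * centred_const) (g i)"
    and ball: "\<And>i. i \<le> N \<Longrightarrow> pm N i \<omega> \<in> Wball l mu r"
    and seg: "\<And>i s. Suc i \<le> N \<Longrightarrow> 0 \<le> s \<Longrightarrow> s \<le> 1 \<Longrightarrow> mixture s (pm N i \<omega>) (pm N (Suc i) \<omega>) \<in> Wball l mu r"
  shows "\<bar>Rem G N \<omega>\<bar> \<le> (\<bar>\<Sum>j<N. S.poisson_sol (g (Suc j)) (Y (Suc j) \<omega>) - kernel_op P (S.poisson_sol (g (Suc j))) (Y j \<omega>)\<bar>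
     + (\<bar>G (Y 0 \<omega>)\<bar> + \<bar>G (Y N \<omega>)\<bar> + D * (\<epsilon> * centred_const) * (1 + sqrt (V (Y 0 \<omega>))) + D * (\<epsilon> * centred_const) * (1 + sqrt (V (Y N \<omega>)))
     + (2 * step_const * centred_const + 2 * D * step_const * centred_const * (1 + sqrt K)) * real N powr (- \<alpha>) * (\<Sum>i<N. 1 + V (Y i \<omega>)))) / sqrt (real N)"
proof -
  let ?Y = "\<lambda>j. Y j \<omega>"
  let ?a = "\<lambda>i. pm N i \<omega>"
  define G' where "G' i = S.poisson_sol (g i)" for i
  have N0: "0 < real N" using N by simp
  have sN: "0 < sqrt (real N)" "sqrt (real N) * sqrt (real N) = real N" using N0 by auto
  have G'b: "S.wbdd (D * (\<epsilon> * centred_const)) (G' i)" if "i \<le> N" for i unfolding G'_def by (rule sol(1)[OF gb[OF that]])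
  have G'eq: "G' i x - kernel_op P (G' i) x = Hc (?a i) x - Hc mu x" if i: "i \<le> N" for i x
  proof -
    obtain b b' where "S.wbdd b (Hc (?a i))" "S.wbdd b' (Hc mu)"
      using Hc_wbdd[OF ball[OF i]] Hc_wbdd[OF mu_Wball] by blast
    then have "(\<integral>y. g i y \<partial>mu) = 0"
      unfolding g[OF i] using S.wbdd_integrable_mu integral_Hc[OF ball[OF i]] integral_Hc[OF mu_Wball]
      by (subst Bochner_Integration.integral_diff) auto
    then show ?thesis using sol(2)[OF gb[OF i], of x] by (simp add: G'_def g[OF i])
  qed
  \<comment> \<open>The j-th increment uses the solution of index \<open>Suc j\<close>: the measure
    \<open>pm N (Suc j)\<close> depends on \<open>Y 0\<close> to \<open>Y j\<close> only, so the
    integrand is known before the jump to \<open>Y (Suc j)\<close>. The price is \<open>Dl\<close>,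
    the change from the solution of index j to that of index \<open>Suc j\<close>.\<close>
  define Mt where "Mt = (\<Sum>j<N. G' (Suc j) (?Y (Suc j)) - kernel_op P (G' (Suc j)) (?Y j))"
  define Dl where "Dl = (\<Sum>j<N. kernel_op P (G' (Suc j)) (?Y j) - kernel_op P (G' j) (?Y j))"
  have sumH: "(\<Sum>i<N. Hc (?a i) (?Y i)) = (\<Sum>k<N. pois_mart G k \<omega>) + (G (?Y 0) - G (?Y N)) + (Mt + Dl + (G' 0 (?Y 0) - G' N (?Y N)))"
  proof -
    have "(\<Sum>i<N. Hc (?a i) (?Y i)) = (\<Sum>i<N. (pois_mart G i \<omega> + (G (?Y i) - G (?Y (Suc i)))) +
        ((G' (Suc i) (?Y (Suc i)) - kernel_op P (G' (Suc i)) (?Y i)) + (kernel_op P (G' (Suc i)) (?Y i) - kernel_op P (G' i) (?Y i))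
          + (G' i (?Y i) - G' (Suc i) (?Y (Suc i)))))"
    proof (intro sum.cong refl)
      fix i assume "i \<in> {..<N}"
      then have i: "i \<le> N" by simp
      show "Hc (?a i) (?Y i) = (pois_mart G i \<omega> + (G (?Y i) - G (?Y (Suc i)))) +
        ((G' (Suc i) (?Y (Suc i)) - kernel_op P (G' (Suc i)) (?Y i)) + (kernel_op P (G' (Suc i)) (?Y i) - kernel_op P (G' i) (?Y i))
          + (G' i (?Y i) - G' (Suc i) (?Y (Suc i))))"
        using G'eq[OF i, of "?Y i"] Geq[of "?Y i"] by (simp add: pois_mart_def)
    qed
    also have "\<dots> = (\<Sum>k<N. pois_mart G k \<omega>) + (\<Sum>i<N. G (?Y i) - G (?Y (Suc i))) + (Mt + Dl + (\<Sum>i<N. G' i (?Y i) - G' (Suc i) (?Y (Suc i))))"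
      by (simp only: sum.distrib Mt_def Dl_def)
    also have "(\<Sum>i<N. G (?Y i) - G (?Y (Suc i))) = G (?Y 0) - G (?Y N)"
      by (rule sum_lessThan_telescope')
    also have "(\<Sum>i<N. G' i (?Y i) - G' (Suc i) (?Y (Suc i))) = G' 0 (?Y 0) - G' N (?Y N)"
      by (rule sum_lessThan_telescope')
    finally show ?thesis .
  qed
  define Sv where "Sv = (\<Sum>i<N. 1 + V (?Y i))"
  define er where "er = (\<Sum>i<N. U (?a (Suc i)) - U (?a i) - Hc (?a i) (?Y i) / real N)"
  have er: "\<bar>er\<bar> \<le> 2 * step_const * centred_const * real N powr (- 1 - \<alpha>) * Sv"
  proof -
    have "\<bar>er\<bar> \<le> (\<Sum>i<N. \<bar>U (?a (Suc i)) - U (?a i) - Hc (?a i) (?Y i) / real N\<bar>)"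
      unfolding er_def by (rule sum_abs)
    also have "\<dots> \<le> (\<Sum>i<N. 2 * step_const * centred_const * real N powr (- 1 - \<alpha>) * (1 + V (?Y i)))"
      by (intro sum_mono U_step_le seg) auto
    finally show ?thesis by (simp add: Sv_def sum_distrib_left)
  qed
  have Dl: "\<bar>Dl\<bar> \<le> 2 * D * step_const * centred_const * (1 + sqrt K) * real N powr (- \<alpha>) * Sv"
  proof -
    have "\<bar>kernel_op P (G' (Suc j)) (?Y j) - kernel_op P (G' j) (?Y j)\<bar> \<le> 2 * D * step_const * centred_const * (1 + sqrt K) * real N powr (- \<alpha>) * (1 + V (?Y j))"
      if j: "j < N" for j
    proof -
      have jj: "Suc j \<le> N" "j \<le> N" using j by auto
      define q where "q = step_const * real N powr (- \<alpha>) * (1 + sqrt (V (?Y j)))"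
      have q: "0 \<le> q" using step_const_nonneg V_nonneg by (simp add: q_def)
      have a1: "mixture 1 (?a j) (?a (Suc j)) = ?a (Suc j)" by (simp add: mixture_1)
      have hd: "\<bar>dU (?a (Suc j)) x - dU (?a j) x\<bar> \<le> q * W2 x" for x
        using dU_step_le[OF jj(1), of 1 "\<lambda>j. Y j \<omega>" x] ball[OF jj(1)] ball[OF jj(2)] by (simp add: a1 q_def)
      have gd: "S.wbdd (q * centred_const) (\<lambda>x. g (Suc j) x - g j x)"
        unfolding S.wbdd_def
      proof (intro conjI allI)
        show "(\<lambda>x. g (Suc j) x - g j x) \<in> borel_measurable borel"
          using S.wbdd_measurable[OF gb[OF jj(1)]] S.wbdd_measurable[OF gb[OF jj(2)]] by measurable
        show "\<bar>g (Suc j) x - g j x\<bar> \<le> q * centred_const * (1 + sqrt (V x))" for x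
          using Hc_diff_le[OF ball[OF jj(2)] ball[OF jj(1)] q hd, of x] by (simp add: g[OF jj(1)] g[OF jj(2)])
      qed
      \<comment> \<open>By linearity the difference of two solutions solves the equation for the
        difference of the right-hand sides, which is of order \<open>N powr (- \<alpha>)\<close>.
        The sum of N such terms divided by \<open>sqrt N\<close> is of order
        \<open>N powr (1 / 2 - \<alpha>)\<close> and still vanishes.\<close>
      have "kernel_op P (G' (Suc j)) (?Y j) - kernel_op P (G' j) (?Y j) = kernel_op P (S.poisson_sol (\<lambda>x. g (Suc j) x - g j x)) (?Y j)"
        unfolding sol(3)[OF gb[OF jj(1)] gb[OF jj(2)]] G'_def
        by (rule kernel_op_diff[symmetric]) (rule S.wbdd_integrable[OF sol(1)[OF gb[OF jj(1)]]], rule S.wbdd_integrable[OF sol(1)[OF gb[OF jj(2)]]])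
      also have "\<bar>\<dots>\<bar> \<le> D * (q * centred_const) * (1 + sqrt K) * (1 + sqrt (V (?Y j)))"
        by (rule S.wbdd_bound[OF S.wbdd_kernel_op[OF sol(1)[OF gd]]])
      also have "\<dots> = D * step_const * centred_const * (1 + sqrt K) * real N powr (- \<alpha>) * (1 + sqrt (V (?Y j)))\<^sup>2"
        by (simp add: q_def power2_eq_square mult_ac)
      also have "\<dots> \<le> D * step_const * centred_const * (1 + sqrt K) * real N powr (- \<alpha>) * (2 * (1 + V (?Y j)))"
        using D step_const_nonneg centred_const K_nonneg by (intro mult_left_mono one_plus_sqrt_squared_le) auto
      also have "\<dots> = 2 * D * step_const * centred_const * (1 + sqrt K) * real N powr (- \<alpha>) * (1 + V (?Y j))" by (simp add: algebra_simps)
      finally show ?thesis .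
    qed
    then have "\<bar>Dl\<bar> \<le> (\<Sum>j<N. 2 * D * step_const * centred_const * (1 + sqrt K) * real N powr (- \<alpha>) * (1 + V (?Y j)))"
      unfolding Dl_def by (intro order_trans[OF sum_abs] sum_mono) auto
    then show ?thesis by (simp add: Sv_def sum_distrib_left)
  qed
  have tel: "U (empirical N (\<lambda>j. Y (j - 1) \<omega>)) - U mu = (\<Sum>i<N. U (?a (Suc i)) - U (?a i))"
    using sum_lessThan_telescope[of "\<lambda>i. U (?a i)" N] by (simp add: interp_last[OF V.sets_mu N] interp_0)
  have X: "U (empirical N (\<lambda>j. Y (j - 1) \<omega>)) - U mu = er + (\<Sum>i<N. Hc (?a i) (?Y i)) / real N"
    unfolding tel er_def by (simp add: sum_subtractf sum_divide_distrib)
  have "sqrt (real N) * (U (empirical N (\<lambda>j. Y (j - 1) \<omega>)) - U mu) = (real N * er + (\<Sum>i<N. Hc (?a i) (?Y i))) / sqrt (real N)"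
  proof -
    define H where "H = (\<Sum>i<N. Hc (?a i) (?Y i))"
    have "sqrt (real N) * (er + H / real N) = (sqrt (real N) * sqrt (real N)) * (er + H / real N) / sqrt (real N)"
    proof (subst nonzero_eq_divide_eq)
      show "sqrt (real N) \<noteq> 0" using sN(1) by simp
    qed (simp only: mult_ac)
    also have "\<dots> = (real N * er + H) / sqrt (real N)"
      unfolding sN(2) using N0 by (simp add: distrib_left)
    finally show ?thesis unfolding X H_def .
  qed
  then have "Rem G N \<omega> = (real N * er + ((G (?Y 0) - G (?Y N)) + (Mt + Dl + (G' 0 (?Y 0) - G' N (?Y N))))) / sqrt (real N)"
    unfolding Rem_def sumH by (simp add: diff_divide_distrib add_divide_distrib)
  then have "\<bar>Rem G N \<omega>\<bar> = \<bar>real N * er + ((G (?Y 0) - G (?Y N)) + (Mt + Dl + (G' 0 (?Y 0) - G' N (?Y N))))\<bar> / sqrt (real N)"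
    using sN by (simp add: abs_divide)
  also have "\<dots> \<le> (\<bar>Mt\<bar> + (\<bar>G (?Y 0)\<bar> + \<bar>G (?Y N)\<bar> + D * (\<epsilon> * centred_const) * (1 + sqrt (V (?Y 0))) + D * (\<epsilon> * centred_const) * (1 + sqrt (V (?Y N)))
     + (2 * step_const * centred_const + 2 * D * step_const * centred_const * (1 + sqrt K)) * real N powr (- \<alpha>) * Sv)) / sqrt (real N)"
  proof (rule divide_right_mono)
    have p: "real N * real N powr (- 1 - \<alpha>) = real N powr (- \<alpha>)"
      using N0 by (simp add: powr_diff powr_minus field_simps)
    have "\<bar>real N * er\<bar> \<le> real N * (2 * step_const * centred_const * real N powr (- 1 - \<alpha>) * Sv)"
      unfolding abs_mult using er N0 by (intro mult_mono) auto
    also have "\<dots> = 2 * step_const * centred_const * (real N * real N powr (- 1 - \<alpha>)) * Sv" by (simp only: mult_ac)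
    finally have 1: "\<bar>real N * er\<bar> \<le> 2 * step_const * centred_const * real N powr (- \<alpha>) * Sv" unfolding p .
    have 2: "\<bar>G' 0 (?Y 0)\<bar> \<le> D * (\<epsilon> * centred_const) * (1 + sqrt (V (?Y 0)))" by (rule S.wbdd_bound[OF G'b]) simp
    have 3: "\<bar>G' N (?Y N)\<bar> \<le> D * (\<epsilon> * centred_const) * (1 + sqrt (V (?Y N)))" by (rule S.wbdd_bound[OF G'b]) simp
    show "\<bar>real N * er + ((G (?Y 0) - G (?Y N)) + (Mt + Dl + (G' 0 (?Y 0) - G' N (?Y N))))\<bar> \<le>
      \<bar>Mt\<bar> + (\<bar>G (?Y 0)\<bar> + \<bar>G (?Y N)\<bar> + D * (\<epsilon> * centred_const) * (1 + sqrt (V (?Y 0))) + D * (\<epsilon> * centred_const) * (1 + sqrt (V (?Y N)))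
     + (2 * step_const * centred_const + 2 * D * step_const * centred_const * (1 + sqrt K)) * real N powr (- \<alpha>) * Sv)"
    proof -
      have tri: "\<bar>x1 + ((x2 - x3) + (x4 + x5 + (x6 - x7)))\<bar> \<le> \<bar>x4\<bar> + (\<bar>x2\<bar> + \<bar>x3\<bar> + b6 + b7 + (b1 + b5))"
        if "\<bar>x1\<bar> \<le> b1" "\<bar>x5\<bar> \<le> b5" "\<bar>x6\<bar> \<le> b6" "\<bar>x7\<bar> \<le> b7" for x1 x2 x3 x4 x5 x6 x7 b1 b5 b6 b7 :: real
        using that by linarith
      have dis: "(2 * step_const * centred_const + 2 * D * step_const * centred_const * (1 + sqrt K)) * real N powr (- \<alpha>) * Sv =
        2 * step_const * centred_const * real N powr (- \<alpha>) * Sv + 2 * D * step_const * centred_const * (1 + sqrt K) * real N powr (- \<alpha>) * Sv"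
        by (simp add: distrib_right)
      show ?thesis unfolding dis by (rule tri[OF 1 Dl 2 3])
    qed
  qed (use sN in simp)
  finally show ?thesis by (simp only: Mt_def G'_def Sv_def)
qed

end

section \<open>The remainder vanishes in probability\<close>

context clt_setting
begin

text \<open>First \<epsilon> is fixed so small that Chebyshev's inequality bounds the martingale
  part uniformly in N, and good measures are chosen accordingly. Markov's inequality then bounds the
  other terms by multiples of \<open>1 / sqrt N\<close> and
  \<open>N powr (1 / 2 - \<alpha>)\<close>.\<close>

lemma Rem_tendsto_0:
  assumes G: "S.wbdd c G" and Geq: "\<And>x. G x - kernel_op P G x = Hc mu x" and \<eta>: "0 < \<eta>"
  shows "(\<lambda>N. prob {\<omega>\<in>space M. \<eta> < \<bar>Rem G N \<omega>\<bar>}) \<longlonglongrightarrow> 0"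
proof (rule S.poisson_sol)
  fix D \<kappa> :: real
  assume D: "0 \<le> D"
    and sol: "\<And>f c. S.wbdd c f \<Longrightarrow> S.wbdd (D * c) (S.poisson_sol f)"
      "\<And>f c x. S.wbdd c f \<Longrightarrow> S.poisson_sol f x - kernel_op P (S.poisson_sol f) x = f x - (\<integral>y. f y \<partial>mu)"
      "\<And>f g c c'. S.wbdd c f \<Longrightarrow> S.wbdd c' g \<Longrightarrow>
       S.poisson_sol (\<lambda>x. f x - g x) = (\<lambda>x. S.poisson_sol f x - S.poisson_sol g x)"
  have Gm [measurable]: "G \<in> borel_measurable borel" using G by (rule S.wbdd_measurable)
  have c0: "0 \<le> c" using G by (rule S.wbdd_nonneg)
  have Rm [measurable]: "Rem G N \<in> borel_measurable M" for N by (rule Rem_measurable[OF Gm])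
  show ?thesis
  proof (rule tendstoI)
    fix \<tau> :: real assume \<tau>: "0 < \<tau>"
    \<comment> \<open>Chebyshev's inequality for the martingale part at level
      \<open>\<eta> * sqrt N / 2\<close> gives \<open>X * \<epsilon>\<^sup>2\<close>; N has
      cancelled.\<close>
    define X where "X = 4 * mart_const * (D * centred_const)\<^sup>2 / \<eta>\<^sup>2"
    have X: "0 \<le> X" using mart_const_nonneg \<eta> by (simp add: X_def)
    define \<epsilon> where "\<epsilon> = sqrt (\<tau> / (4 * (X + 1)))"
    have \<epsilon>: "0 < \<epsilon>" using \<tau> X by (simp add: \<epsilon>_def)
    have X\<epsilon>: "X * \<epsilon>\<^sup>2 \<le> \<tau> / 4"
    proof -
      have "X * \<epsilon>\<^sup>2 = X / (X + 1) * (\<tau> / 4)" using \<tau> X by (simp add: \<epsilon>_def)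
      also have "\<dots> \<le> 1 * (\<tau> / 4)" using \<tau> X by (intro mult_right_mono) auto
      finally show ?thesis by simp
    qed
    have \<epsilon>centred_const: "0 \<le> \<epsilon> * centred_const" using \<epsilon> centred_const(1) by simp
    obtain \<delta> where \<delta>: "0 < \<delta>" and near: "\<And>m. m \<in> Pspace l \<Longrightarrow> Wdist l m mu < \<delta> \<Longrightarrow>
      m \<in> Wball l mu r \<and> (\<forall>x. \<bar>dU m x - dU mu x\<bar> \<le> \<epsilon> * W2 x)"
      using dU_cont_pointwise[OF \<epsilon>] by blast
    have "0 < \<tau> / 4" using \<tau> by simp
    show "\<forall>\<^sub>F N in sequentially. dist (prob {\<omega>\<in>space M. \<eta> < \<bar>Rem G N \<omega>\<bar>}) 0 < \<tau>"
    proof (rule good_measures[OF \<delta> \<open>0 < \<tau> / 4\<close>])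
      fix good :: "'a measure \<Rightarrow> bool"
      assume gd: "\<And>m. m \<in> Pspace l \<Longrightarrow> good m \<Longrightarrow> Wdist l m mu < \<delta>"
        and gmix: "\<And>m m' s. m \<in> Pspace l \<Longrightarrow> m' \<in> Pspace l \<Longrightarrow> good m \<Longrightarrow> good m' \<Longrightarrow> 0 \<le> s \<Longrightarrow> s \<le> 1 \<Longrightarrow> good (mixture s m m')"
        and gsets: "\<And>N i j. i \<le> N \<Longrightarrow> 1 \<le> N \<Longrightarrow> i \<le> Suc j \<Longrightarrow> {\<omega>\<in>space M. good (pm N i \<omega>)} \<in> sets (F j)"
        and gprob: "\<forall>\<^sub>F N in sequentially. prob {\<omega>\<in>space M. \<exists>i\<le>N. \<not> good (pm N i \<omega>)} \<le> \<tau> / 4"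
      have gball: "m \<in> Wball l mu r" "\<And>x. \<bar>dU m x - dU mu x\<bar> \<le> \<epsilon> * W2 x" if "m \<in> Pspace l" "good m" for m
        using near[OF that(1) gd[OF that]] by auto
      define A where "A N i = {\<omega>\<in>space M. good (pm N i \<omega>)}" for N i
      \<comment> \<open>Localisation: where the i-th measure is not good the function is 0, so
        bounds and measurability hold for every \<omega>, while on the event that all measures are
        good nothing changes.\<close>
      define g where "g N i \<omega> y = indicator (A N i) \<omega> * Hc (pm N i \<omega>) y - indicator (A N i) \<omega> * Hc mu y" for N i \<omega> y
      obtain bmu where Hmu: "S.wbdd bmu (Hc mu)" using Hc_wbdd[OF mu_Wball] by blast
      have Hmum [measurable]: "Hc mu \<in> borel_measurable borel" by (rule S.wbdd_measurable[OF Hmu])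
      have gb: "S.wbdd (\<epsilon> * centred_const) (g N i \<omega>)" if i: "i \<le> N" "1 \<le> N" for N i \<omega>
      proof (cases "\<omega> \<in> A N i")
        case True
        then have go: "good (pm N i \<omega>)" by (simp add: A_def)
        note b = gball[OF pm_Pspace[OF i] go]
        obtain b' where H': "S.wbdd b' (Hc (pm N i \<omega>))" using Hc_wbdd[OF b(1)] by blast
        have "g N i \<omega> = (\<lambda>y. Hc (pm N i \<omega>) y - Hc mu y)" using True by (simp add: g_def[abs_def])
        then show ?thesis
          using S.wbdd_measurable[OF H'] Hc_diff_le[OF mu_Wball b(1) less_imp_le[OF \<epsilon>] b(2)]
          by (simp add: S.wbdd_def)
      next
        case False
        then have "g N i \<omega> = (\<lambda>y. 0)" by (simp add: g_def[abs_def])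
        then show ?thesis using \<epsilon>centred_const V_nonneg by (simp add: S.wbdd_def)
      qed
      have gm: "(\<lambda>(\<omega>, y). g N i \<omega> y) \<in> borel_measurable (F j \<Otimes>\<^sub>M borel)" if i: "i \<le> N" "1 \<le> N" "i \<le> Suc j" for N i j
      proof -
        have AF: "A N i \<in> sets (F j)" unfolding A_def by (rule gsets[OF i])
        have 1: "(\<lambda>(\<omega>, y). indicator (A N i) \<omega> * Hc (pm N i \<omega>) y) \<in> borel_measurable (F j \<Otimes>\<^sub>M borel)"
        proof (rule Hc_jointly_measurable[OF pm_measurable[OF i] _ AF])
          show "pm N i \<omega> \<in> Pspace l" for \<omega> by (rule pm_Pspace[OF i(1,2)])
          show "pm N i \<omega> \<in> Wball l mu r" if "\<omega> \<in> A N i" for \<omega>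
            using gball(1)[OF pm_Pspace[OF i(1,2)]] that by (simp add: A_def)
        qed
        have 2: "(\<lambda>(\<omega>, y). indicator (A N i) \<omega> * Hc mu y) \<in> borel_measurable (F j \<Otimes>\<^sub>M borel)"
          using AF by measurable
        show ?thesis
          using borel_measurable_diff[OF 1 2] by (simp add: g_def case_prod_beta')
      qed
      define gg where "gg N j \<omega> = S.poisson_sol (g N (Suc j) \<omega>)" for N j \<omega>
      define Mt where "Mt N \<omega> = (\<Sum>j<N. mart_diff (gg N) j \<omega>)" for N \<omega>
      have ggm: "(\<lambda>(\<omega>, y). gg N j \<omega> y) \<in> borel_measurable (F j \<Otimes>\<^sub>M borel)" if "j < N" for N j
        unfolding gg_def by (rule S.poisson_sol_jointly_measurable[OF gm]) (use that in auto)
      have ggb: "S.wbdd (D * (\<epsilon> * centred_const)) (gg N j \<omega>)" if "j < N" for N j \<omega>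
        unfolding gg_def by (rule sol(1)[OF gb]) (use that in auto)
      have Mtm [measurable]: "Mt N \<in> borel_measurable M" for N
        unfolding Mt_def[abs_def] by (rule measurable_F_M[OF sum_mart_diff_measurable[OF ggm]])
      have Mt2: "integrable M (\<lambda>\<omega>. (Mt N \<omega>)\<^sup>2)"
        "expectation (\<lambda>\<omega>. (Mt N \<omega>)\<^sup>2) \<le> real N * (mart_const * (D * (\<epsilon> * centred_const))\<^sup>2)" for N
        unfolding Mt_def by (rule sum_mart_diff_power2[OF ggm ggb]; assumption)+
      define c7 where "c7 = 2 * step_const * centred_const + 2 * D * step_const * centred_const * (1 + sqrt K)"
      have c7: "0 \<le> c7" using step_const_nonneg centred_const(1) D K_nonneg by (simp add: c7_def)
      define BB where "BB N \<omega> = \<bar>G (Y 0 \<omega>)\<bar> + \<bar>G (Y N \<omega>)\<bar> + D * (\<epsilon> * centred_const) * (1 + sqrt (V (Y 0 \<omega>))) + D * (\<epsilon> * centred_const) * (1 + sqrt (V (Y N \<omega>)))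
         + c7 * real N powr (- \<alpha>) * (\<Sum>i<N. 1 + V (Y i \<omega>))" for N \<omega>
      have BB0: "0 \<le> BB N \<omega>" for N \<omega>
        unfolding BB_def using D less_imp_le[OF \<epsilon>] centred_const(1) c7 V_nonneg
        by (intro add_nonneg_nonneg mult_nonneg_nonneg sum_nonneg) auto
      have Gi: "integrable M (\<lambda>\<omega>. \<bar>G (Y n \<omega>)\<bar>)" "expectation (\<lambda>\<omega>. \<bar>G (Y n \<omega>)\<bar>) \<le> 2 * c * (1 + vbar)" for n
        using wbdd_Y_integrable[OF S_wbdd_imp_V_wbdd[OF G]] expectation_abs_wbdd_Y_le[OF S_wbdd_imp_V_wbdd[OF G]] by auto
      have one: "S.wbdd 1 (\<lambda>x. 1 + sqrt (V x))" using V_nonneg by (auto simp: S.wbdd_def abs_le_iff)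
      have onea: "\<bar>1 + sqrt (V x)\<bar> = 1 + sqrt (V x)" for x using V_nonneg[of x] by simp
      have Oi: "integrable M (\<lambda>\<omega>. 1 + sqrt (V (Y n \<omega>)))" "expectation (\<lambda>\<omega>. 1 + sqrt (V (Y n \<omega>))) \<le> 2 * (1 + vbar)" for n
        using wbdd_Y_integrable[OF S_wbdd_imp_V_wbdd[OF one], of n] expectation_abs_wbdd_Y_le[OF S_wbdd_imp_V_wbdd[OF one], of n]
        unfolding onea by simp_all
      have Vi: "integrable M (\<lambda>\<omega>. 1 + V (Y n \<omega>))" "expectation (\<lambda>\<omega>. 1 + V (Y n \<omega>)) \<le> 1 + vbar" for n
        using V_Y_integrable V_Y_le by (auto simp: prob_space)
      have Bi: "integrable M (\<lambda>\<omega>. D * (\<epsilon> * centred_const) * (1 + sqrt (V (Y n \<omega>))))"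
        "integrable M (\<lambda>\<omega>. b * (\<Sum>i<N. 1 + V (Y i \<omega>)))" for n b N
        by (rule integrable_mult_right[OF Oi(1)],
            rule integrable_mult_right[OF Bochner_Integration.integrable_sum[OF Vi(1)]])
      note B4 = Bochner_Integration.integrable_add[OF Bochner_Integration.integrable_add[OF
        Bochner_Integration.integrable_add[OF Gi(1) Gi(1)] Bi(1)] Bi(1)]
      have BBi: "integrable M (BB N)" for N
        unfolding BB_def[abs_def] by (rule Bochner_Integration.integrable_add[OF B4 Bi(2)])
      define C8 where "C8 = (4 * c + 4 * (D * (\<epsilon> * centred_const))) * (1 + vbar)"
      have EBB: "expectation (BB N) \<le> C8 + c7 * real N powr (- \<alpha>) * (real N * (1 + vbar))" for N
      proof -
        have "expectation (BB N) = expectation (\<lambda>\<omega>. \<bar>G (Y 0 \<omega>)\<bar>) + expectation (\<lambda>\<omega>. \<bar>G (Y N \<omega>)\<bar>)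
          + D * (\<epsilon> * centred_const) * expectation (\<lambda>\<omega>. 1 + sqrt (V (Y 0 \<omega>))) + D * (\<epsilon> * centred_const) * expectation (\<lambda>\<omega>. 1 + sqrt (V (Y N \<omega>)))
          + c7 * real N powr (- \<alpha>) * (\<Sum>i<N. expectation (\<lambda>\<omega>. 1 + V (Y i \<omega>)))"
          unfolding BB_def[abs_def]
          by (simp only: Bochner_Integration.integral_add[OF B4 Bi(2)]
              Bochner_Integration.integral_add[OF Bochner_Integration.integrable_add[OF Bochner_Integration.integrable_add[OF Gi(1) Gi(1)] Bi(1)] Bi(1)]
              Bochner_Integration.integral_add[OF Bochner_Integration.integrable_add[OF Gi(1) Gi(1)] Bi(1)]
              Bochner_Integration.integral_add[OF Gi(1) Gi(1)]
              integral_mult_right_zero Bochner_Integration.integral_sum[OF Vi(1)])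
        also have "\<dots> \<le> 2 * c * (1 + vbar) + 2 * c * (1 + vbar) + D * (\<epsilon> * centred_const) * (2 * (1 + vbar)) + D * (\<epsilon> * centred_const) * (2 * (1 + vbar))
          + c7 * real N powr (- \<alpha>) * (\<Sum>i<N. 1 + vbar)"
          using D \<epsilon>centred_const c7 by (intro add_mono mult_left_mono sum_mono Gi(2) Oi(2) Vi(2)) auto
        also have "\<dots> = C8 + c7 * real N powr (- \<alpha>) * (real N * (1 + vbar))"
          by (simp add: C8_def algebra_simps)
        finally show ?thesis .
      qed
      have main: "prob {\<omega>\<in>space M. \<eta> < \<bar>Rem G N \<omega>\<bar>} \<le> prob {\<omega>\<in>space M. \<exists>i\<le>N. \<not> good (pm N i \<omega>)} + \<tau> / 4
          + (2 * C8 / \<eta> * (1 / sqrt (real N)) + 2 * c7 * (1 + vbar) / \<eta> * real N powr (1 / 2 - \<alpha>))"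
        if N: "1 \<le> N" for N
      proof -
        have N0: "0 < real N" using N by simp
        have sN: "0 < sqrt (real N)" "(sqrt (real N))\<^sup>2 = real N" using N0 by auto
        let ?T = "{\<omega>\<in>space M. \<exists>i\<le>N. \<not> good (pm N i \<omega>)}"
        let ?a = "\<eta> * sqrt (real N) / 2"
        let ?A = "{\<omega>\<in>space M. ?a < \<bar>Mt N \<omega>\<bar>}" and ?B = "{\<omega>\<in>space M. ?a \<le> BB N \<omega>}"
        have Tm: "?T \<in> sets M"
        proof -
          have "?T = (\<Union>i\<in>{..N}. space M - A N i)" by (auto simp: A_def)
          moreover have "A N i \<in> sets M" if "i \<le> N" for i
            using gsets[of i N N] subalg[of N] that N by (auto simp: A_def subalgebra_def)
          ultimately show ?thesis by auto
        qed
        have BBm: "BB N \<in> borel_measurable M" using BBi by (rule borel_measurable_integrable)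
        have Am: "?A \<in> sets M" by (intro borel_measurable_less borel_measurable_const borel_measurable_abs Mtm)
        have Bm: "?B \<in> sets M" by (intro borel_measurable_le borel_measurable_const BBm)
        have "{\<omega>\<in>space M. \<eta> < \<bar>Rem G N \<omega>\<bar>} \<subseteq> (?T \<union> ?A) \<union> ?B"
        proof
          fix \<omega> assume w: "\<omega> \<in> {\<omega>\<in>space M. \<eta> < \<bar>Rem G N \<omega>\<bar>}"
          show "\<omega> \<in> (?T \<union> ?A) \<union> ?B"
          proof (rule ccontr)
            assume n: "\<omega> \<notin> (?T \<union> ?A) \<union> ?B"
            with w have go: "good (pm N i \<omega>)" if "i \<le> N" for i using that by auto
            have le: "\<bar>Mt N \<omega>\<bar> \<le> ?a" "BB N \<omega> \<le> ?a" using n w by auto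
            have "\<bar>Rem G N \<omega>\<bar> \<le> (\<bar>\<Sum>j<N. S.poisson_sol (g N (Suc j) \<omega>) (Y (Suc j) \<omega>) - kernel_op P (S.poisson_sol (g N (Suc j) \<omega>)) (Y j \<omega>)\<bar>
              + (\<bar>G (Y 0 \<omega>)\<bar> + \<bar>G (Y N \<omega>)\<bar> + D * (\<epsilon> * centred_const) * (1 + sqrt (V (Y 0 \<omega>))) + D * (\<epsilon> * centred_const) * (1 + sqrt (V (Y N \<omega>)))
              + (2 * step_const * centred_const + 2 * D * step_const * centred_const * (1 + sqrt K)) * real N powr (- \<alpha>) * (\<Sum>i<N. 1 + V (Y i \<omega>)))) / sqrt (real N)"
            proof (rule Rem_le[OF G Geq N less_imp_le[OF \<epsilon>] D sol])
              show "g N i \<omega> = (\<lambda>x. Hc (pm N i \<omega>) x - Hc mu x)" if "i \<le> N" for i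
                using go[OF that] w by (simp add: g_def[abs_def] A_def)
              show "S.wbdd (\<epsilon> * centred_const) (g N i \<omega>)" if "i \<le> N" for i by (rule gb[OF that N])
              show "pm N i \<omega> \<in> Wball l mu r" if "i \<le> N" for i
                by (rule gball(1)[OF pm_Pspace[OF that N] go[OF that]])
              show "mixture s (pm N i \<omega>) (pm N (Suc i) \<omega>) \<in> Wball l mu r" if "Suc i \<le> N" "0 \<le> s" "s \<le> 1" for i s
              proof (rule gball(1))
                have i: "i \<le> N" using that by simp
                show "mixture s (pm N i \<omega>) (pm N (Suc i) \<omega>) \<in> Pspace l"
                  by (intro Pspace_mixture pm_Pspace i N that)
                show "good (mixture s (pm N i \<omega>) (pm N (Suc i) \<omega>))"
                  by (intro gmix pm_Pspace i N that go)
              qed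
            qed
            also have "\<dots> = (\<bar>Mt N \<omega>\<bar> + BB N \<omega>) / sqrt (real N)"
              unfolding Mt_def mart_diff_def gg_def BB_def c7_def kernel_op_def ..
            also have "\<dots> \<le> (?a + ?a) / sqrt (real N)"
              using le sN by (intro divide_right_mono add_mono) auto
            also have "\<dots> = \<eta>" using sN by simp
            finally show False using w by simp
          qed
        qed
        then have "prob {\<omega>\<in>space M. \<eta> < \<bar>Rem G N \<omega>\<bar>} \<le> prob ((?T \<union> ?A) \<union> ?B)"
          by (rule finite_measure_mono[OF _ sets.Un[OF sets.Un[OF Tm Am] Bm]])
        also have "\<dots> \<le> (prob ?T + prob ?A) + prob ?B"
          by (rule order_trans[OF measure_Un_le[OF sets.Un[OF Tm Am] Bm] add_right_mono[OF measure_Un_le[OF Tm Am]]])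
        also have "\<dots> \<le> (prob ?T + \<tau> / 4) + (2 * C8 / \<eta> * (1 / sqrt (real N)) + 2 * c7 * (1 + vbar) / \<eta> * real N powr (1 / 2 - \<alpha>))"
        proof (intro add_mono order_refl)
          have "prob ?A \<le> expectation (\<lambda>\<omega>. (Mt N \<omega>)\<^sup>2) / ?a\<^sup>2"
            using Mt2(1) \<eta> sN by (intro prob_abs_gt_le) auto
          also have "\<dots> \<le> real N * (mart_const * (D * (\<epsilon> * centred_const))\<^sup>2) / ?a\<^sup>2"
            by (intro divide_right_mono Mt2(2)) auto
          also have "\<dots> = X * \<epsilon>\<^sup>2"
            using N0 \<eta> sN(2) by (simp add: X_def power_mult_distrib power_divide field_simps)
          finally show "prob ?A \<le> \<tau> / 4" using X\<epsilon> by linarith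
          have "prob ?B \<le> expectation (BB N) / ?a"
            using BBi BB0 \<eta> sN by (intro integral_Markov_inequality_measure[where A="{}"]) auto
          also have "\<dots> \<le> (C8 + c7 * real N powr (- \<alpha>) * (real N * (1 + vbar))) / ?a"
            using \<eta> sN by (intro divide_right_mono EBB) auto
          also have "\<dots> = 2 * C8 / \<eta> * (1 / sqrt (real N)) + 2 * c7 * (1 + vbar) / \<eta> * (real N powr (- \<alpha>) * real N / sqrt (real N))"
            using \<eta> sN(1) by (simp add: field_simps)
          also have "real N powr (- \<alpha>) * real N / sqrt (real N) = real N powr (1 / 2 - \<alpha>)"
          proof -
            have "real N / sqrt (real N) = sqrt (real N)" using N0 by (simp add: real_div_sqrt)
            moreover have "real N powr (1 / 2 - \<alpha>) = real N powr (- \<alpha>) * real N powr (1 / 2)"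
              by (simp flip: powr_add)
            ultimately show ?thesis using N0 by (simp add: powr_half_sqrt times_divide_eq_right[symmetric] del: times_divide_eq_right)
          qed
          finally show "prob ?B \<le> 2 * C8 / \<eta> * (1 / sqrt (real N)) + 2 * c7 * (1 + vbar) / \<eta> * real N powr (1 / 2 - \<alpha>)" .
        qed
        finally show ?thesis .
      qed
      have l1: "(\<lambda>N. 1 / sqrt (real N)) \<longlonglongrightarrow> 0" by real_asymp
      have l2: "(\<lambda>N. real N powr (1 / 2 - \<alpha>)) \<longlonglongrightarrow> 0"
        using alpha by (intro tendsto_neg_powr filterlim_real_sequentially) auto
      have "(\<lambda>N. 2 * C8 / \<eta> * (1 / sqrt (real N)) + 2 * c7 * (1 + vbar) / \<eta> * real N powr (1 / 2 - \<alpha>)) \<longlonglongrightarrow>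
          2 * C8 / \<eta> * 0 + 2 * c7 * (1 + vbar) / \<eta> * 0"
        by (intro tendsto_add tendsto_mult_left l1 l2)
      then have "(\<lambda>N. 2 * C8 / \<eta> * (1 / sqrt (real N)) + 2 * c7 * (1 + vbar) / \<eta> * real N powr (1 / 2 - \<alpha>)) \<longlonglongrightarrow> 0" by simp
      then have "\<forall>\<^sub>F N in sequentially. 2 * C8 / \<eta> * (1 / sqrt (real N)) + 2 * c7 * (1 + vbar) / \<eta> * real N powr (1 / 2 - \<alpha>) < \<tau> / 4"
        by (rule order_tendstoD) (use \<tau> in simp)
      with gprob eventually_ge_at_top[of 1] show ?thesis
      proof eventually_elim
        case (elim N)
        then show ?case using main[of N] \<tau> by simp
      qed
    qed
  qed
qed

text \<open>Slutsky's argument for characteristic functions: adding the remainder changes them by at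
  most \<open>2 * \<bar>t\<bar> * \<eta>\<close> plus twice the probability that the remainder
  exceeds \<eta>.\<close>

theorem char_clt:
  assumes G: "S.wbdd c G" and Geq: "\<And>x. G x - kernel_op P G x = Hc mu x"
  shows "(\<lambda>N. \<integral>\<omega>. iexp (t * (sqrt (real N) * (U (empirical N (\<lambda>j. Y (j - 1) \<omega>)) - U mu))) \<partial>M)
    \<longlonglongrightarrow> of_real (exp (- (t\<^sup>2 * ((\<integral>x. (G x)\<^sup>2 \<partial>mu) - (\<integral>x. (kernel_op P G x)\<^sup>2 \<partial>mu)) / 2)))"
proof -
  have Gm: "G \<in> borel_measurable borel" using G by (rule S.wbdd_measurable)
  define T where "T N \<omega> = sqrt (real N) * (U (empirical N (\<lambda>j. Y (j - 1) \<omega>)) - U mu)" for N \<omega>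
  define S where "S N \<omega> = (\<Sum>k<N. pois_mart G k \<omega>) / sqrt (real N)" for N \<omega>
  have Tm [measurable]: "T N \<in> borel_measurable M" for N
    unfolding T_def[abs_def] by (rule U_empirical_measurable[OF measurable_F_M[OF adapted]])
  have Sm [measurable]: "S N \<in> borel_measurable M" for N
    unfolding S_def[abs_def] by (intro borel_measurable_divide borel_measurable_sum pois_mart_measurable Gm borel_measurable_const)
  have Rm [measurable]: "Rem G N \<in> borel_measurable M" for N by (rule Rem_measurable[OF Gm])
  have TS: "T N \<omega> = S N \<omega> + Rem G N \<omega>" for N \<omega> by (simp add: T_def S_def Rem_def)
  have int: "integrable M (\<lambda>\<omega>. iexp (t * Z \<omega>))" if [measurable]: "Z \<in> borel_measurable M" for Z
    by (rule integrable_const_bound[where B=1]) auto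
  have le: "norm ((\<integral>\<omega>. iexp (t * T N \<omega>) \<partial>M) - (\<integral>\<omega>. iexp (t * S N \<omega>) \<partial>M))
      \<le> 2 * \<bar>t\<bar> * \<eta> + 2 * prob {\<omega>\<in>space M. \<eta> < \<bar>Rem G N \<omega>\<bar>}" if \<eta>: "0 < \<eta>" for N \<eta>
  proof -
    let ?A = "{\<omega>\<in>space M. \<eta> < \<bar>Rem G N \<omega>\<bar>}"
    have iA: "integrable M (\<lambda>\<omega>. 2 * indicator ?A \<omega> :: real)" "integrable M (\<lambda>\<omega>. 2 * \<bar>t\<bar> * \<eta>)"
      by (intro integrable_mult_right integrable_real_indicator) (auto simp: emeasure_eq_measure)
    have pw: "norm (iexp (t * T N \<omega>) - iexp (t * S N \<omega>)) \<le> 2 * \<bar>t\<bar> * \<eta> + 2 * indicator ?A \<omega>" if "\<omega> \<in> space M" for \<omega>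
    proof -
      have "iexp (t * T N \<omega>) - iexp (t * S N \<omega>) = iexp (t * S N \<omega>) * (iexp (t * Rem G N \<omega>) - 1)"
        by (simp add: TS ring_distribs exp_add)
      then have "norm (iexp (t * T N \<omega>) - iexp (t * S N \<omega>)) = norm (iexp (t * Rem G N \<omega>) - 1)"
        by (simp only: norm_mult norm_exp_i_times mult_1)
      also have "\<dots> \<le> 2 * min 1 \<bar>t * Rem G N \<omega>\<bar>" by (rule norm_iexp_minus_1_le)
      also have "\<dots> \<le> 2 * \<bar>t\<bar> * \<eta> + 2 * indicator ?A \<omega>"
      proof (cases "\<omega> \<in> ?A")
        case True
        have "0 \<le> 2 * \<bar>t\<bar> * \<eta>" using \<eta> by simp
        moreover have "2 * min 1 \<bar>t * Rem G N \<omega>\<bar> \<le> 2" by simp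
        ultimately have "2 * min 1 \<bar>t * Rem G N \<omega>\<bar> \<le> 2 * \<bar>t\<bar> * \<eta> + 2" by linarith
        then show ?thesis using True by simp
      next
        case False
        then have "\<bar>Rem G N \<omega>\<bar> \<le> \<eta>" using that by simp
        then have "\<bar>t\<bar> * \<bar>Rem G N \<omega>\<bar> \<le> \<bar>t\<bar> * \<eta>" by (rule mult_left_mono) simp
        then show ?thesis using False by (simp add: abs_mult)
      qed
      finally show ?thesis .
    qed
    have "norm ((\<integral>\<omega>. iexp (t * T N \<omega>) \<partial>M) - (\<integral>\<omega>. iexp (t * S N \<omega>) \<partial>M)) = norm (\<integral>\<omega>. iexp (t * T N \<omega>) - iexp (t * S N \<omega>) \<partial>M)"
      by (simp only: Bochner_Integration.integral_diff[OF int[OF Tm] int[OF Sm]])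
    also have "\<dots> \<le> (\<integral>\<omega>. norm (iexp (t * T N \<omega>) - iexp (t * S N \<omega>)) \<partial>M)" by (rule integral_norm_bound)
    also have "\<dots> \<le> (\<integral>\<omega>. 2 * \<bar>t\<bar> * \<eta> + 2 * indicator ?A \<omega> \<partial>M)"
    proof (rule integral_mono)
      show "integrable M (\<lambda>\<omega>. norm (iexp (t * T N \<omega>) - iexp (t * S N \<omega>)))"
        by (intro integrable_norm Bochner_Integration.integrable_diff int Tm Sm)
      show "integrable M (\<lambda>\<omega>. 2 * \<bar>t\<bar> * \<eta> + 2 * indicator ?A \<omega>)"
        by (rule Bochner_Integration.integrable_add[OF iA(2,1)])
    qed (rule pw)
    also have "\<dots> = 2 * \<bar>t\<bar> * \<eta> + 2 * prob ?A"
      by (simp only: Bochner_Integration.integral_add[OF iA(2,1)]; simp add: prob_space Int_absorb2)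
    finally show ?thesis .
  qed
  have diff: "(\<lambda>N. (\<integral>\<omega>. iexp (t * T N \<omega>) \<partial>M) - (\<integral>\<omega>. iexp (t * S N \<omega>) \<partial>M)) \<longlonglongrightarrow> 0"
  proof (rule tendstoI)
    fix \<tau> :: real assume \<tau>: "0 < \<tau>"
    define \<eta> where "\<eta> = \<tau> / (4 * (\<bar>t\<bar> + 1))"
    have \<eta>: "0 < \<eta>" using \<tau> by (simp add: \<eta>_def add_nonneg_pos)
    have t\<eta>: "2 * \<bar>t\<bar> * \<eta> \<le> \<tau> / 2"
    proof -
      have "2 * a * (\<tau> / (4 * b)) = a / b * (\<tau> / 2)" for a b by (simp add: ac_simps)
      then have "2 * \<bar>t\<bar> * \<eta> = \<bar>t\<bar> / (\<bar>t\<bar> + 1) * (\<tau> / 2)" unfolding \<eta>_def .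
      also have "\<dots> \<le> 1 * (\<tau> / 2)" using \<tau> by (intro mult_right_mono) auto
      finally show ?thesis by simp
    qed
    have "\<forall>\<^sub>F N in sequentially. prob {\<omega>\<in>space M. \<eta> < \<bar>Rem G N \<omega>\<bar>} < \<tau> / 4"
      by (rule order_tendstoD(2)[OF Rem_tendsto_0[OF G Geq \<eta>]]) (use \<tau> in simp)
    then show "\<forall>\<^sub>F N in sequentially. dist ((\<integral>\<omega>. iexp (t * T N \<omega>) \<partial>M) - (\<integral>\<omega>. iexp (t * S N \<omega>) \<partial>M)) 0 < \<tau>"
    proof eventually_elim
      case (elim N)
      then show ?case using le[OF \<eta>, of N] t\<eta> unfolding dist_norm diff_zero by linarith
    qed
  qed
  show ?thesis
    using tendsto_add[OF diff martingale_clt[OF G, of t, folded S_def]] by (simp add: T_def)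
qed

end

section \<open>Reduction to an integrable initial law\<close>

lemma real_distribution_centred_normal:
  assumes "0 \<le> v" shows "real_distribution (centred_normal v)"
proof (cases "v = 0")
  case True
  then show ?thesis
    by (simp add: centred_normal_def real_distribution_def real_distribution_axioms_def prob_space_return)
next
  case False
  then have "prob_space (density lborel (normal_density 0 (sqrt v)))"
    using assms by (intro prob_space_normal_density) simp
  then show ?thesis
    using False by (simp add: centred_normal_def real_distribution_def real_distribution_axioms_def)
qed

lemma char_centred_normal:
  assumes "0 \<le> v" shows "char (centred_normal v) t = of_real (exp (- (t\<^sup>2 * v / 2)))"
proof (cases "v = 0")
  case True
  have "(\<integral>x. iexp (t * x) \<partial>return borel (0::real)) = iexp (t * 0)"
    by (rule integral_return) auto
  then show ?thesis using True by (simp add: centred_normal_def char_def)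
next
  case False
  then have v: "0 < sqrt v" using assms by simp
  interpret N: real_distribution std_normal_distribution by (rule real_dist_normal_dist)
  have "distributed std_normal_distribution lborel (\<lambda>x. x) std_normal_density"
    by (auto simp: distributed_def distr_id2)
  from N.normal_density_affine[OF this zero_less_one, of "sqrt v" 0]
  have "distributed std_normal_distribution lborel (\<lambda>x. sqrt v * x) (normal_density 0 (sqrt v))"
    using v by simp
  then have d: "distr std_normal_distribution borel (\<lambda>x. sqrt v * x) = centred_normal v"
    using False by (simp add: distributed_def centred_normal_def cong: distr_cong)
  have "char (centred_normal v) t = (\<integral>x. iexp (t * (sqrt v * x)) \<partial>std_normal_distribution)"
    unfolding d[symmetric] char_def by (subst integral_distr) auto
  also have "\<dots> = char std_normal_distribution (t * sqrt v)"
    by (simp add: char_def ac_simps)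
  also have "\<dots> = of_real (exp (- (t\<^sup>2 * v / 2)))"
    using assms by (simp add: char_std_normal_distribution power_mult_distrib)
  finally show ?thesis .
qed

context prob_space
begin

lemma uniform_measure_prob:
  assumes "A \<in> events" "0 < prob A"
  shows "emeasure M A \<noteq> 0" "emeasure M A \<noteq> \<infinity>" "prob_space (uniform_measure M A)"
  using assms by (auto simp: emeasure_eq_measure intro!: prob_space_uniform_measure)

text \<open>The density of the conditioned law differs from 1 by 1 outside A and by
  \<open>1 / prob A - 1\<close> on A; the integral of this difference is
  \<open>2 * (1 - prob A)\<close>.\<close>

lemma norm_integral_uniform_measure_diff_le:
  fixes f :: "'a \<Rightarrow> complex"
  assumes A: "A \<in> events" "0 < prob A" and f [measurable]: "f \<in> borel_measurable M"
    and f1: "\<And>x. norm (f x) \<le> 1"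
  shows "norm ((\<integral>x. f x \<partial>M) - (\<integral>x. f x \<partial>uniform_measure M A)) \<le> 2 * (1 - prob A)"
proof -
  note [measurable] = A(1)
  let ?p = "prob A"
  have p1: "?p \<le> 1" by simp
  have d: "1 / ennreal ?p = ennreal (1 / ?p)" using divide_ennreal[of 1 ?p] A(2) by simp
  have um: "uniform_measure M A = density M (\<lambda>x. ennreal (indicator A x / ?p))"
    unfolding uniform_measure_def using A
    by (intro density_cong) (auto simp: emeasure_eq_measure d split: split_indicator)
  have "(\<integral>x. f x \<partial>uniform_measure M A) = (\<integral>x. (indicator A x / ?p) *\<^sub>R f x \<partial>M)"
    unfolding um by (rule integral_density) auto
  then have "(\<integral>x. f x \<partial>M) - (\<integral>x. f x \<partial>uniform_measure M A) =
      (\<integral>x. f x \<partial>M) - (\<integral>x. (indicator A x / ?p) *\<^sub>R f x \<partial>M)" by simp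
  also have "\<dots> = (\<integral>x. f x - (indicator A x / ?p) *\<^sub>R f x \<partial>M)"
  proof (rule Bochner_Integration.integral_diff[symmetric])
    show "integrable M f" by (rule integrable_const_bound[where B=1]) (use f1 in auto)
    show "integrable M (\<lambda>x. (indicator A x / ?p) *\<^sub>R f x)"
    proof (rule integrable_const_bound[where B="1 / ?p"])
      have "norm ((indicator A x / ?p) *\<^sub>R f x) \<le> 1 / ?p" for x
        using f1[of x] A(2) by (auto simp: divide_right_mono split: split_indicator)
      then show "AE x in M. norm ((indicator A x / ?p) *\<^sub>R f x) \<le> 1 / ?p" by simp
    qed simp
  qed
  finally have eq: "(\<integral>x. f x \<partial>M) - (\<integral>x. f x \<partial>uniform_measure M A) =
    (\<integral>x. f x - (indicator A x / ?p) *\<^sub>R f x \<partial>M)" .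
  let ?g = "\<lambda>x. 1 + (1 / ?p - 2) * indicator A x :: real"
  have "norm (\<integral>x. f x - (indicator A x / ?p) *\<^sub>R f x \<partial>M) \<le> (\<integral>x. ?g x \<partial>M)"
  proof (rule order_trans[OF integral_norm_bound integral_mono])
    fix x
    show "norm (f x - (indicator A x / ?p) *\<^sub>R f x) \<le> ?g x"
    proof (cases "x \<in> A")
      case True
      have "norm (f x - (1 / ?p) *\<^sub>R f x) = \<bar>1 - 1 / ?p\<bar> * norm (f x)"
        by (metis norm_scaleR scaleR_left.diff scaleR_one)
      also have "\<dots> \<le> \<bar>1 - 1 / ?p\<bar> * 1" by (intro mult_left_mono f1) auto
      also have "\<dots> = 1 / ?p - 1"
        using A(2) p1 by (subst abs_of_nonpos) (simp_all add: le_divide_eq)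
      finally show ?thesis using True by simp
    next
      case False
      then show ?thesis using f1[of x] by simp
    qed
  next
    show "integrable M (\<lambda>x. norm (f x - (indicator A x / ?p) *\<^sub>R f x))"
    proof (rule integrable_norm, rule integrable_const_bound[where B="1 + 1 / ?p"])
      have "norm (f x - (indicator A x / ?p) *\<^sub>R f x) \<le> 1 + 1 / ?p" for x
      proof (rule order_trans[OF norm_triangle_ineq4 add_mono[OF f1]])
        show "norm ((indicator A x / ?p) *\<^sub>R f x) \<le> 1 / ?p"
          using f1[of x] A(2) by (auto simp: divide_right_mono split: split_indicator)
      qed
      then show "AE x in M. norm (f x - (indicator A x / ?p) *\<^sub>R f x) \<le> 1 + 1 / ?p" by simp
    qed simp
  qed (simp add: emeasure_eq_measure)
  also have "(\<integral>x. ?g x \<partial>M) = 1 + (1 / ?p - 2) * ?p"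
    using A(1) by (simp add: emeasure_eq_measure prob_space)
  also have "\<dots> = 2 * (1 - ?p)" using A(2) by (simp add: field_simps)
  finally show ?thesis unfolding eq .
qed

end

context kernel_chain
begin

text \<open>Because A belongs to every \<open>F n\<close>, the transition identity for the past
  event \<open>A \<inter> B\<close>, divided by the probability of A, is the identity for B under
  the conditioned law.\<close>

lemma kernel_chain_uniform_measure:
  assumes A: "A \<in> sets (F 0)" "0 < prob A"
  shows "kernel_chain P (uniform_measure M A) F Y"
proof -
  have AF: "A \<in> sets (F n)" for n
    using A(1) sets_F_mono[of 0 n] by auto
  have Am [measurable]: "A \<in> events" using AF[of 0] subalg[of 0] by (auto simp: subalgebra_def)
  note um = uniform_measure_prob[OF Am A(2)]
  interpret A: prob_space "uniform_measure M A" by (rule um(3))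
  show ?thesis
  proof
    show "subalgebra (uniform_measure M A) (F n)" for n
      using subalg[of n] by (simp add: subalgebra_def)
    show "sets (F n) \<subseteq> sets (F (Suc n))" for n by (rule filtration)
    show "Y n \<in> F n \<rightarrow>\<^sub>M borel" for n by (rule adapted)
    fix B n and S :: "'a set" assume B: "B \<in> sets (F n)" and S [measurable]: "S \<in> sets borel"
    have [measurable]: "B \<in> events" using B subalg[of n] by (auto simp: subalgebra_def)
    have [measurable]: "Y k \<in> M \<rightarrow>\<^sub>M borel" for k by (rule measurable_F_M[OF adapted])
    have "emeasure (uniform_measure M A) (B \<inter> {\<omega>\<in>space (uniform_measure M A). Y (Suc n) \<omega> \<in> S}) =
        emeasure M ((A \<inter> B) \<inter> {\<omega>\<in>space M. Y (Suc n) \<omega> \<in> S}) / emeasure M A"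
      by (simp add: Int_assoc)
    also have "emeasure M ((A \<inter> B) \<inter> {\<omega>\<in>space M. Y (Suc n) \<omega> \<in> S}) =
        (\<integral>\<^sup>+\<omega>. indicator (A \<inter> B) \<omega> * emeasure (P (Y n \<omega>)) S \<partial>M)"
      by (rule transition) (use AF B in auto)
    also have "\<dots> = (\<integral>\<^sup>+\<omega>. indicator B \<omega> * emeasure (P (Y n \<omega>)) S * indicator A \<omega> \<partial>M)"
      by (intro nn_integral_cong) (auto split: split_indicator)
    also have "\<dots> / emeasure M A = (\<integral>\<^sup>+\<omega>. indicator B \<omega> * emeasure (P (Y n \<omega>)) S \<partial>uniform_measure M A)"
      by (rule nn_integral_uniform_measure[symmetric]) measurable
    finally show "emeasure (uniform_measure M A) (B \<inter> {\<omega>\<in>space (uniform_measure M A). Y (Suc n) \<omega> \<in> S}) =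
        (\<integral>\<^sup>+\<omega>. indicator B \<omega> * emeasure (P (Y n \<omega>)) S \<partial>uniform_measure M A)" .
  qed
qed

end

text \<open>The time index is shifted, because \<open>markov_chain\<close> starts at time 1.\<close>

lemma kernel_chain_of_markov_chain:
  fixes X :: "nat \<Rightarrow> 'w \<Rightarrow> 'a::euclidean_space"
  assumes kernel: "P \<in> borel \<rightarrow>\<^sub>M prob_algebra borel" and chain: "markov_chain M X nu P"
  shows "kernel_chain P M
    (\<lambda>n. sigma (space M) (\<Union>i\<in>{1..Suc n}. {X i -` B \<inter> space M |B. B \<in> sets borel})) (\<lambda>n. X (Suc n))"
proof -
  interpret markov_kernel P by standard (rule kernel)
  interpret prob_space M using chain by (simp add: markov_chain_def)
  let ?G = "\<lambda>n. \<Union>i\<in>{1..Suc n}. {X i -` B \<inter> space M |B. B \<in> sets borel}"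
  let ?F = "\<lambda>n. sigma (space M) (?G n)"
  have X [measurable]: "X (Suc i) \<in> borel_measurable M" for i using chain by (simp add: markov_chain_def)
  have Gs: "?G n \<subseteq> Pow (space M)" for n by auto
  have GM: "?G n \<subseteq> sets M" for n
  proof -
    have "X i -` B \<inter> space M \<in> sets M" if "1 \<le> i" "B \<in> sets borel" for i and B
      using measurable_sets[OF X[of "i - 1"] that(2)] that(1) by simp
    then show ?thesis by auto
  qed
  have sF: "sets (?F n) = sigma_sets (space M) (?G n)" for n by (rule sets_measure_of[OF Gs])
  have sub: "subalgebra M (?F n)" for n
    unfolding subalgebra_def sF using sets.sigma_sets_subset[OF GM] by (simp add: space_measure_of_conv)
  show ?thesis
  proof
    show "subalgebra M (?F n)" for n by (rule sub)
    show "sets (?F n) \<subseteq> sets (?F (Suc n))" for n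
      unfolding sF by (intro sigma_sets_mono' UN_mono) auto
    show "X (Suc n) \<in> ?F n \<rightarrow>\<^sub>M borel" for n
    proof (rule measurableI)
      fix B :: "'a set" assume "B \<in> sets borel"
      then have "X (Suc n) -` B \<inter> space M \<in> ?G n" by (intro UN_I[of "Suc n"]) auto
      then show "X (Suc n) -` B \<inter> space (?F n) \<in> sets (?F n)"
        unfolding sF by (auto simp: space_measure_of_conv)
    qed simp
    fix A n and B :: "'a set" assume A: "A \<in> sets (?F n)" and B [measurable]: "B \<in> sets borel"
    interpret C: finite_measure_subalgebra M "?F n" by standard (rule sub)
    have [measurable]: "A \<in> events" using A sub by (auto simp: subalgebra_def)
    let ?f = "\<lambda>\<omega>. indicator B (X (Suc (Suc n)) \<omega>) :: real"
    have fi: "integrable M ?f" by (rule integrable_const_bound[where B=1]) auto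
    have AEc: "AE \<omega> in M. real_cond_exp M (?F n) ?f \<omega> = measure (P (X (Suc n) \<omega>)) B"
      using chain[unfolded markov_chain_def, THEN conjunct2, THEN conjunct2, THEN conjunct2, rule_format,
          of "Suc n" B, OF _ B] by simp
    have mm [measurable]: "(\<lambda>\<omega>. measure (P (X (Suc n) \<omega>)) B) \<in> borel_measurable M"
      by measurable
    have le1: "measure (P x) B \<le> 1" for x
      using prob_space.prob_le_1[OF prob_space_kernel] .
    \<comment> \<open>The defining identity of the conditional expectation on the past event A
      removes the exceptional null sets and yields the integrated Markov property.\<close>
    have "measure M (A \<inter> {\<omega>\<in>space M. X (Suc (Suc n)) \<omega> \<in> B}) = (\<integral>\<omega>. indicator (A \<inter> {\<omega>\<in>space M. X (Suc (Suc n)) \<omega> \<in> B}) \<omega> \<partial>M)"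
      unfolding Bochner_Integration.integral_indicator by (rule arg_cong[where f=prob]) auto
    also have "\<dots> = (\<integral>\<omega>\<in>A. ?f \<omega> \<partial>M)"
      unfolding set_lebesgue_integral_def
      by (intro Bochner_Integration.integral_cong) (auto split: split_indicator)
    also have "\<dots> = (\<integral>\<omega>\<in>A. real_cond_exp M (?F n) ?f \<omega> \<partial>M)" by (rule C.real_cond_exp_intA[OF fi A])
    also have "\<dots> = (\<integral>\<omega>. indicator A \<omega> * measure (P (X (Suc n) \<omega>)) B \<partial>M)"
      unfolding set_lebesgue_integral_def using AEc
      by (intro integral_cong_AE) (auto elim: eventually_mono)
    finally have eq: "measure M (A \<inter> {\<omega>\<in>space M. X (Suc (Suc n)) \<omega> \<in> B}) = (\<integral>\<omega>. indicator A \<omega> * measure (P (X (Suc n) \<omega>)) B \<partial>M)" .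
    have "(\<integral>\<^sup>+\<omega>. indicator A \<omega> * emeasure (P (X (Suc n) \<omega>)) B \<partial>M) = (\<integral>\<^sup>+\<omega>. ennreal (indicator A \<omega> * measure (P (X (Suc n) \<omega>)) B) \<partial>M)"
      by (intro nn_integral_cong)
         (auto simp: finite_measure.emeasure_eq_measure[OF prob_space.finite_measure[OF prob_space_kernel]] split: split_indicator)
    also have "\<dots> = ennreal (\<integral>\<omega>. indicator A \<omega> * measure (P (X (Suc n) \<omega>)) B \<partial>M)"
    proof (rule nn_integral_eq_integral)
      show "integrable M (\<lambda>\<omega>. indicator A \<omega> * measure (P (X (Suc n) \<omega>)) B)"
        by (rule integrable_const_bound[where B=1]) (auto simp: le1 split: split_indicator)
    qed simp
    finally show "emeasure M (A \<inter> {\<omega>\<in>space M. X (Suc (Suc n)) \<omega> \<in> B}) =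
        (\<integral>\<^sup>+\<omega>. indicator A \<omega> * emeasure (P (X (Suc n) \<omega>)) B \<partial>M)"
      by (simp add: emeasure_eq_measure eq)
  qed
qed

context smooth_functional
begin

text \<open>Conditioning on \<open>V (Y 0) \<le> a\<close> makes \<open>V (Y 0)\<close> integrable and costs little for large \<open>a\<close>.\<close>

theorem char_clt_any_initial_law:
  assumes kc: "kernel_chain P M F Y"
    and G: "S.wbdd c G" and Geq: "\<And>x. G x - kernel_op P G x = Hc mu x"
  shows "(\<lambda>N. \<integral>\<omega>. iexp (t * (sqrt (real N) * (U (empirical N (\<lambda>j. Y (j - 1) \<omega>)) - U mu))) \<partial>M)
    \<longlonglongrightarrow> of_real (exp (- (t\<^sup>2 * ((\<integral>x. (G x)\<^sup>2 \<partial>mu) - (\<integral>x. (kernel_op P G x)\<^sup>2 \<partial>mu)) / 2)))"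
    (is "?f \<longlonglongrightarrow> ?l")
proof -
  interpret Y: kernel_chain P M F Y by (rule kc)
  have Ym [measurable]: "Y j \<in> borel_measurable M" for j by (rule Y.measurable_F_M[OF Y.adapted])
  let ?T = "\<lambda>N \<omega>. iexp (t * (sqrt (real N) * (U (empirical N (\<lambda>j. Y (j - 1) \<omega>)) - U mu)))"
  have Tm: "?T N \<in> borel_measurable M" for N
    using U_empirical_measurable[OF Ym, of N] by measurable
  define A where "A n = {\<omega>\<in>space M. V (Y 0 \<omega>) \<le> real n}" for n
  have AF: "A n \<in> sets (F 0)" for n
  proof -
    note Y.adapted[of 0, measurable]
    have "{\<omega>\<in>space (F 0). V (Y 0 \<omega>) \<le> real n} \<in> sets (F 0)" by measurable
    then show ?thesis unfolding A_def Y.space_F .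
  qed
  have Am [measurable]: "A n \<in> Y.events" for n
    by (rule subsetD[OF _ AF]) (use Y.subalg[of 0] in \<open>simp add: subalgebra_def\<close>)
  have "(\<lambda>n. Y.prob (A n)) \<longlonglongrightarrow> Y.prob (\<Union>n. A n)"
  proof (rule Y.finite_Lim_measure_incseq)
    show "incseq A" by (auto simp: incseq_def A_def)
  qed auto
  moreover have "(\<Union>n. A n) = space M"
    by (auto simp: A_def intro: real_arch_simple)
  ultimately have lim: "(\<lambda>n. Y.prob (A n)) \<longlonglongrightarrow> 1" by (simp add: Y.prob_space)
  show ?thesis
  proof (rule tendstoI)
    fix \<tau> :: real assume \<tau>: "0 < \<tau>"
    \<comment> \<open>The maximum with 0 guarantees a conditioning event of positive probability
      also when \<tau> is large.\<close>
    have "\<forall>\<^sub>F n in sequentially. max 0 (1 - \<tau> / 4) < Y.prob (A n)"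
      by (rule order_tendstoD(1)[OF lim]) (use \<tau> in simp)
    then obtain n where n: "max 0 (1 - \<tau> / 4) < Y.prob (A n)" by (auto simp: eventually_sequentially)
    then have p: "0 < Y.prob (A n)" and p': "2 * (1 - Y.prob (A n)) < \<tau> / 2" by auto
    let ?M = "uniform_measure M (A n)"
    interpret C: kernel_chain P ?M F Y by (rule Y.kernel_chain_uniform_measure[OF AF p])
    have "integrable ?M (\<lambda>\<omega>. V (Y 0 \<omega>))"
    proof (rule C.integrable_const_bound)
      show "AE \<omega> in ?M. norm (V (Y 0 \<omega>)) \<le> real n"
        using V_nonneg by (intro AE_uniform_measureI) (auto simp: A_def)
    qed simp
    then interpret C: clt_setting P V K \<gamma> R \<rho> mu l U dU r Cb Cd \<alpha> ?M F Y
      by unfold_locales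
    have "\<forall>\<^sub>F N in sequentially. dist (\<integral>\<omega>. ?T N \<omega> \<partial>?M) ?l < \<tau> / 2"
      by (rule tendstoD[OF C.char_clt[OF G Geq]]) (use \<tau> in simp)
    then show "\<forall>\<^sub>F N in sequentially. dist (?f N) ?l < \<tau>"
    proof eventually_elim
      case (elim N)
      have "dist (?f N) (\<integral>\<omega>. ?T N \<omega> \<partial>?M) \<le> 2 * (1 - Y.prob (A n))"
        unfolding dist_norm by (rule Y.norm_integral_uniform_measure_diff_le[OF Am p Tm]) simp
      then show ?case using elim p' dist_triangle[of "?f N" ?l "\<integral>\<omega>. ?T N \<omega> \<partial>?M"] by linarith
    qed
  qed
qed

theorem clt_any_initial_law:
  assumes kc: "kernel_chain P M F Y"
    and G: "S.wbdd c G" and Geq: "\<And>x. G x - kernel_op P G x = Hc mu x"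
  shows "weak_conv_m
         (\<lambda>N. distr M borel (\<lambda>\<omega>. sqrt (real N) * (U (empirical N (\<lambda>j. Y (j - 1) \<omega>)) - U mu)))
         (centred_normal ((\<integral>x. (G x)\<^sup>2 \<partial>mu) - (\<integral>x. (kernel_op P G x)\<^sup>2 \<partial>mu)))"
    (is "weak_conv_m (\<lambda>N. distr M borel (?T N)) (centred_normal ?v)")
proof -
  interpret Y: kernel_chain P M F Y by (rule kc)
  have Tm [measurable]: "?T N \<in> borel_measurable M" for N
    by (rule U_empirical_measurable[OF Y.measurable_F_M[OF Y.adapted]])
  note lim = char_clt_any_initial_law[OF kc G Geq]
  have rd: "real_distribution (distr M borel (?T N))" for N by (rule Y.real_distribution_distr[OF Tm])
  have ch: "char (distr M borel (?T N)) t = (\<integral>\<omega>. iexp (t * ?T N \<omega>) \<partial>M)" for N t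
    unfolding char_def by (subst integral_distr[OF Tm]) auto
  \<comment> \<open>Nonnegativity of the variance is read off from the limit at
    \<open>t = 1\<close>: characteristic functions have modulus at most 1, so
    \<open>exp (- ?v / 2)\<close> is at most 1.\<close>
  have "norm (of_real (exp (- (1\<^sup>2 * ?v / 2))) :: complex) \<le> 1"
  proof (rule Lim_norm_ubound[OF trivial_limit_sequentially lim[of 1]])
    show "\<forall>\<^sub>F N in sequentially. norm (\<integral>\<omega>. iexp (1 * ?T N \<omega>) \<partial>M) \<le> 1"
      unfolding ch[symmetric] using real_distribution.cmod_char_le_1[OF rd] by (simp del: mult_1)
  qed
  then have v: "0 \<le> ?v" by simp
  show ?thesis
  proof (rule levy_continuity[OF rd real_distribution_centred_normal[OF v]])
    show "(\<lambda>N. char (distr M borel (?T N)) t) \<longlonglongrightarrow> char (centred_normal ?v) t" for t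
      unfolding ch char_centred_normal[OF v] by (rule lim)
  qed
qed

end

section \<open>Poisson solutions in the \<open>sqrt V\<close> norm, and the final assembly\<close>

context weak_harris_kernel
begin

lemma sqrtV_norm_le_iff:
  assumes "0 \<le> c"
  shows "sqrtV_norm V f \<le> ennreal c \<longleftrightarrow> (\<forall>x. \<bar>f x\<bar> \<le> c * (1 + sqrt (V x)))"
proof -
  have "0 < 1 + sqrt (V x)" for x using V_nonneg[of x] by (simp add: add_pos_nonneg)
  then have "ennreal (\<bar>f x\<bar> / (1 + sqrt (V x))) \<le> ennreal c \<longleftrightarrow> \<bar>f x\<bar> \<le> c * (1 + sqrt (V x))" for x
    using assms by (simp add: ennreal_le_iff pos_divide_le_eq)
  then show ?thesis by (simp add: sqrtV_norm_def SUP_le_iff)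
qed

lemma sqrtV_norm_finite_imp_wbdd:
  assumes [measurable]: "f \<in> borel_measurable borel" and "sqrtV_norm V f < \<infinity>"
  obtains c where "S.wbdd c f"
proof (rule that)
  have "sqrtV_norm V f \<le> ennreal (enn2real (sqrtV_norm V f))"
    using assms(2) by simp
  then have "\<bar>f x\<bar> \<le> enn2real (sqrtV_norm V f) * (1 + sqrt (V x))" for x
    by (simp only: sqrtV_norm_le_iff[OF enn2real_nonneg])
  then show "S.wbdd (enn2real (sqrtV_norm V f)) f"
    using assms(1) by (simp add: S.wbdd_def)
qed

text \<open>The remainder of the series decays geometrically with a constant that is uniform
  relative to the weight; this gives convergence in norm and not only at every point.\<close>

lemma poisson_solution_poisson_sol:
  assumes f: "S.wbdd c f"
  shows "poisson_solution P V mu f (S.poisson_sol f)"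
    and "poisson_series_sums P V mu f (S.poisson_sol f)"
proof -
  have c0: "0 \<le> c" using f by (rule S.wbdd_nonneg)
  have "poisson_solution P V mu f (S.poisson_sol f) \<and> poisson_series_sums P V mu f (S.poisson_sol f)"
  proof (rule S.poisson_sol)
    fix D \<kappa> :: real
    assume D: "0 \<le> D" and \<kappa>: "0 < \<kappa>" "\<kappa> < 1"
      and sol: "\<And>f c. S.wbdd c f \<Longrightarrow> S.wbdd (D * c) (S.poisson_sol f)"
        "\<And>f c x. S.wbdd c f \<Longrightarrow> S.poisson_sol f x - kernel_op P (S.poisson_sol f) x = f x - (\<integral>y. f y \<partial>mu)"
      and rate: "\<And>f c n x. S.wbdd c f \<Longrightarrow>
       \<bar>(\<Sum>k<n. (kernel_op P ^^ k) f x - (\<integral>y. f y \<partial>mu)) - S.poisson_sol f x\<bar> \<le> D * c * \<kappa> ^ n * (1 + sqrt (V x))"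
    have "sqrtV_norm V (S.poisson_sol f) \<le> ennreal (D * c)"
      using sol(1)[OF f] D c0 by (subst sqrtV_norm_le_iff) (auto simp: S.wbdd_def)
    then have "sqrtV_norm V (S.poisson_sol f) < \<infinity>"
      by (rule order_le_less_trans) simp
    then have 1: "poisson_solution P V mu f (S.poisson_sol f)"
      unfolding poisson_solution_def using sol(2)[OF f] S.wbdd_measurable[OF sol(1)[OF f]] by blast
    have le: "sqrtV_norm V (\<lambda>x. (\<Sum>k<n. (kernel_op P ^^ k) f x - (\<integral>y. f y \<partial>mu)) - S.poisson_sol f x)
        \<le> ennreal (D * c * \<kappa> ^ n)" for n
      using D c0 \<kappa> rate[OF f] by (subst sqrtV_norm_le_iff) auto
    have lim: "(\<lambda>n. ennreal (D * c * \<kappa> ^ n)) \<longlonglongrightarrow> 0"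
    proof -
      have "(\<lambda>n. D * c * \<kappa> ^ n) \<longlonglongrightarrow> D * c * 0"
        using \<kappa> by (intro tendsto_mult_left LIMSEQ_realpow_zero) auto
      then show ?thesis using tendsto_ennrealI by fastforce
    qed
    have 2: "poisson_series_sums P V mu f (S.poisson_sol f)"
      unfolding poisson_series_sums_def
      by (rule tendsto_sandwich[OF _ _ tendsto_const lim]) (simp_all add: le)
    show ?thesis using 1 2 by blast
  qed
  then show "poisson_solution P V mu f (S.poisson_sol f)" "poisson_series_sums P V mu f (S.poisson_sol f)"
    by auto
qed

text \<open>The difference of two solutions is harmonic and at weight \<open>sqrt V\<close>, hence
  constant.\<close>

lemma poisson_solution_unique:
  assumes F: "poisson_solution P V mu f F" and G: "poisson_solution P V mu f G"
  obtains k where "(\<lambda>x. F x - k) = G"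
proof -
  have m: "F \<in> borel_measurable borel" "sqrtV_norm V F < \<infinity>" "G \<in> borel_measurable borel" "sqrtV_norm V G < \<infinity>"
    and eq: "\<And>x. F x - kernel_op P F x = f x - (\<integral>y. f y \<partial>mu)"
      "\<And>x. G x - kernel_op P G x = f x - (\<integral>y. f y \<partial>mu)"
    using F G by (auto simp: poisson_solution_def)
  obtain c where c: "S.wbdd c F" using sqrtV_norm_finite_imp_wbdd[OF m(1,2)] .
  obtain c' where c': "S.wbdd c' G" using sqrtV_norm_finite_imp_wbdd[OF m(3,4)] .
  let ?h = "\<lambda>x. F x - G x"
  have h: "S.wbdd (c + c') ?h" by (rule S.wbdd_diff[OF c c'])
  have "kernel_op P ?h x = ?h x" for x
    using eq(1)[of x] eq(2)[of x] kernel_op_diff[OF S.wbdd_integrable[OF c] S.wbdd_integrable[OF c']]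
    by simp
  then have e: "?h x = (\<integral>y. ?h y \<partial>mu)" for x
    by (rule S.harmonic_wbdd_const[OF h])
  show ?thesis
  proof (rule that)
    have "F x - (\<integral>y. ?h y \<partial>mu) = G x" for x using e[of x] by linarith
    then show "(\<lambda>x. F x - (\<integral>y. ?h y \<partial>mu)) = G" by (rule ext)
  qed
qed

end

lemma empirical_cong:
  assumes "\<And>i. 1 \<le> i \<Longrightarrow> i \<le> N \<Longrightarrow> x i = y i"
  shows "empirical N x = empirical N y"
  unfolding empirical_def using assms
  by (intro distr_cong) (auto simp: space_uniform_count_measure)

theorem theorem6:
  fixes l :: real
    and M :: "'w measure" and X :: "nat \<Rightarrow> 'w \<Rightarrow> 'a::euclidean_space"
    and nu1 mu :: "'a measure" and P :: "'a \<Rightarrow> 'a measure"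
    and V :: "'a \<Rightarrow> real" and K \<gamma> R \<rho> :: real
    and U :: "'a measure \<Rightarrow> real" and dU :: "'a measure \<Rightarrow> 'a \<Rightarrow> real"
    and r C C' \<alpha> :: real
  assumes l: "l \<ge> 0"
    and kernel: "P \<in> borel \<rightarrow>\<^sub>M prob_algebra borel"
    and chain: "markov_chain M X nu1 P"
    and L1: "V \<in> borel_measurable borel" "\<forall>x. V x \<ge> 0" "K \<ge> 0" "0 < \<gamma>" "\<gamma> < 1"
      "\<forall>x. (\<integral>\<^sup>+y. ennreal (V y) \<partial>P x) \<le> ennreal (\<gamma> * V x + K)"
    and L2': "R > 4 * K / (1 - sqrt \<gamma>)\<^sup>2" "0 < \<rho>" "\<rho> \<le> 1"
      "\<forall>x y. V x + V y \<le> R \<longrightarrow> emeasure (inf (P x) (P y)) UNIV \<ge> ennreal \<rho>"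
    and L3: "bdd_above (range (\<lambda>x. npow l x / (1 + V x)))"
    and invariant: "mu \<in> space (prob_algebra borel)" "bind mu P = mu"
    and U_measurable: "U \<in> borel_measurable (restrict_space (prob_algebra borel) (Pspace l))"
    and r: "r > 0"
    and a: "\<forall>m\<in>Wball l mu r. has_lin_fun_deriv l U m (dU m)"
    and b: "\<forall>m\<in>Wball l mu r. \<forall>x. \<bar>dU m x\<bar> \<le> C * (1 + npow (l / 2) x)"
    and c: "\<forall>\<epsilon>>0. \<exists>\<delta>>0. \<forall>m\<in>Wball l mu r. Wdist l m mu < \<delta> \<longrightarrow>
      (SUP x. \<bar>dU m x - dU mu x\<bar> / (1 + npow (l / 2) x)) < \<epsilon>"
    and d: "1 / 2 < \<alpha>" "\<alpha> \<le> 1"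
      "\<forall>m1\<in>Wball l mu r. \<forall>m2\<in>Wball l mu r.
        (SUP x. \<bar>dU m2 x - dU m1 x\<bar> / (1 + npow (l / 2) x))
          \<le> C' * (\<integral>y. 1 + npow (l / (2 * \<alpha>)) y \<partial>tv_diff m2 m1) powr \<alpha>"
  shows "(\<exists>F. poisson_solution P V mu (dU mu) F) \<and>
    (\<forall>F. poisson_solution P V mu (dU mu) F \<longrightarrow>
       (\<exists>k. poisson_series_sums P V mu (dU mu) (\<lambda>x. F x - k)) \<and>
       weak_conv_m
         (\<lambda>N. distr M borel (\<lambda>\<omega>. sqrt (real N) * (U (empirical N (\<lambda>i. X i \<omega>)) - U mu)))
         (centred_normal ((\<integral>x. (F x)\<^sup>2 \<partial>mu) - (\<integral>x. (kernel_op P F x)\<^sup>2 \<partial>mu))))"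
proof -
  interpret weak_harris_kernel P V K \<gamma> R \<rho> mu
    by standard (use kernel L1 L2' invariant in auto)
  interpret smooth_functional P V K \<gamma> R \<rho> mu l U dU r C C' \<alpha>
    by standard (use l L3 U_measurable r a b c d in auto)
  let ?F0 = "S.poisson_sol (dU mu)"
  note f = dU_wbdd[OF mu_Wball]
  note F0 = poisson_solution_poisson_sol[OF f]
  note kc = kernel_chain_of_markov_chain[OF kernel chain]
  \<comment> \<open>The given chain is indexed from 1, the internal one from 0. The truncated
    subtraction is harmless because an empirical measure only uses indices
    \<open>i \<ge> 1\<close>.\<close>
  have emp: "empirical N (\<lambda>i. X i \<omega>) = empirical N (\<lambda>i. X (Suc (i - 1)) \<omega>)" for N \<omega>
    by (rule empirical_cong) simp
  have "(\<exists>k. poisson_series_sums P V mu (dU mu) (\<lambda>x. F x - k)) \<and>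
       weak_conv_m
         (\<lambda>N. distr M borel (\<lambda>\<omega>. sqrt (real N) * (U (empirical N (\<lambda>i. X i \<omega>)) - U mu)))
         (centred_normal ((\<integral>x. (F x)\<^sup>2 \<partial>mu) - (\<integral>x. (kernel_op P F x)\<^sup>2 \<partial>mu)))"
    if F: "poisson_solution P V mu (dU mu) F" for F
  proof
    obtain k where k: "(\<lambda>x. F x - k) = ?F0" using poisson_solution_unique[OF F F0(1)] .
    show "\<exists>k. poisson_series_sums P V mu (dU mu) (\<lambda>x. F x - k)"
      by (rule exI[of _ k]) (simp only: k F0(2))
    have m: "F \<in> borel_measurable borel" "sqrtV_norm V F < \<infinity>"
      and eq: "\<And>x. F x - kernel_op P F x = Hc mu x"
      using F by (auto simp: poisson_solution_def Hc_def)
    obtain c where "S.wbdd c F" using sqrtV_norm_finite_imp_wbdd[OF m] .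
    \<comment> \<open>Applied to the given solution itself, so that the variance appears directly in
      terms of F.\<close>
    from clt_any_initial_law[OF kc this eq]
    show "weak_conv_m
         (\<lambda>N. distr M borel (\<lambda>\<omega>. sqrt (real N) * (U (empirical N (\<lambda>i. X i \<omega>)) - U mu)))
         (centred_normal ((\<integral>x. (F x)\<^sup>2 \<partial>mu) - (\<integral>x. (kernel_op P F x)\<^sup>2 \<partial>mu)))"
      unfolding emp .
  qed
  then show ?thesis using F0(1) by blast
qed

end
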